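(* Let $(X_i)_{i\in\mathbb{Z}}$ be a stationary sequence of centered real random variables adapted to the filtration $(\mathcal{F}_i)_{i\in\mathbb{Z}}$ as described in the context. Assume that $\|X_0\|_\infty<\infty$, $$\sigma^2:=\sum_{k=-\infty}^\infty\mathbb{E}[X_0X_k]>0\qquad\text{and}\qquad\max_{i=1,2}\{\eta_{i,n}\}=O(n^{-\beta}),\quad n\to\infty,$$ for some constant $\beta>1$, where $$\eta_{1,n}=\sup_{k\ge n}\|\mathbb{E}[X_k|\mathcal{F}_0]\|_\infty,\qquad\eta_{2,n}=\sup_{k,l\ge n}\|\mathbb{E}[X_kX_l|\mathcal{F}_0]-\mathbb{E}[X_kX_l]\|_\infty.$$ Let $W_n^\circ$ be the block self-normalized sum with block length $m$ defined in the context. [i] If $\beta\ge3/2$, then with $m=\lfloor n^{2/7}\rfloor$, $$\frac{\mathbb{P}(W_n^\circ\ge x)}{1-\Phi(x)}=1+o(1)$$ uniformly for $0\le x=o(n^{1/14}/\sqrt{\ln n})$ as $n\to\infty$. [ii] If $\beta\in(1,3/2)$, then with $m=\lfloor n^{1/(3\beta-1)}\rfloor$, $$\frac{\mathbb{P}(W_n^\circ\ge x)}{1-\Phi(x)}=1+o(1)$$ uniformly for $0\le x=o(n^{(\beta-1)/(6\beta-2)})$ as $n\to\infty$. [iii] Assume $m=m(n)\to\infty$ and $n^{1/2}/m\to\infty$ as $n\to\infty$. Let $(a_n)_{n\ge1}$ be any sequence of real numbers such that $a_n\to0$ and $a_nn^{1/2}/m\to\infty$ as $n\to\infty$. Then,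 for each Borel set $B\subset\mathbb{R}$, $$-\inf_{x\in B^o}\frac{x^2}{2}\le\liminf_{n\to\infty}a_n^2\ln\mathbb{P}\big(a_nW_n^\circ\in B\big)\le\limsup_{n\to\infty}a_n^2\ln\mathbb{P}\big(a_nW_n^\circ\in B\big)\le-\inf_{x\in\overline{B}}\frac{x^2}{2},$$ where $B^o$ and $\overline{B}$ denote the interior and the closure of $B$, respectively.
   Context: Setting. $(\Omega,\mathcal{F},\mathbb{P})$ is a probability space and $T:\Omega\to\Omega$ is a bijective bimeasurable transformation preserving $\mathbb{P}$. $\mathcal{F}_0\subseteq\mathcal{F}$ is a sub-$\sigma$-field with $\mathcal{F}_0\subseteq T^{-1}(\mathcal{F}_0)$, and $\mathcal{F}_i=T^{-i}(\mathcal{F}_0)$. $X_0$ is an $\mathcal{F}_0$-measurable real random variable with $\mathbb{E}X_0=0$, and $X_i=X_0\circ T^i$, $i\in\mathbb{Z}$. Notation. For an integer $m=m(n)\in[1,n]$: $k=\lfloor n/m\rfloor$, $H_j=\{i:m(j-1)+1\le i\le mj\}$, $S_j^\circ=\sum_{i\in H_j}X_i$ for $1\le j\le k$, $(V_k^\circ)^2=\sum_{j=1}^k(S_j^\circ)^2$, and $W_n^\circ=\big(\sum_{j=1}^kS_j^\circ\big)/V_k^\circ$ (with the convention $W_n^\circ=0$ when $V_k^\circ=0$). $\|\cdot\|_\infty$ is the $\mathbb{L}^\infty$-norm and $\Phi$ is the standard normal distribution function. "Uniformly for $0\le x=o(b_n)$" means: for every sequence $x_n\ge0$ with $x_n=o(b_n)$,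 the convergence is uniform over $0\le x\le x_n$. Conventions: $\inf\emptyset=+\infty$, $\ln0=-\infty$. *)

theory Defs
  imports "HOL-Probability.Probability"
begin

definition automorphism :: "'a measure \<Rightarrow> ('a \<Rightarrow> 'a) \<Rightarrow> bool" where
  "automorphism M T \<longleftrightarrow>
     bij_betw T (space M) (space M) \<and>
     T \<in> measurable M M \<and>
     the_inv_into (space M) T \<in> measurable M M \<and>
     distr M M T = M"

definition iterate :: "'a measure \<Rightarrow> ('a \<Rightarrow> 'a) \<Rightarrow> int \<Rightarrow> 'a \<Rightarrow> 'a" where
  "iterate M T i =
     (if i \<ge> 0 then T ^^ nat i else the_inv_into (space M) T ^^ nat (- i))"

(* sigma-fields are represented as measure spaces of which only space and sets matter;
   F i = T^{-i}(F0) *)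
definition shifted_field ::
  "'a measure \<Rightarrow> ('a \<Rightarrow> 'a) \<Rightarrow> 'a measure \<Rightarrow> int \<Rightarrow> 'a measure" where
  "shifted_field M T F0 i = vimage_algebra (space M) (iterate M T i) F0"

definition shifted_var ::
  "'a measure \<Rightarrow> ('a \<Rightarrow> 'a) \<Rightarrow> ('a \<Rightarrow> real) \<Rightarrow> int \<Rightarrow> 'a \<Rightarrow> real" where
  "shifted_var M T X0 i = X0 \<circ> iterate M T i"

definition Linf_norm :: "'a measure \<Rightarrow> ('a \<Rightarrow> real) \<Rightarrow> ereal" where
  "Linf_norm M f = esssup M (\<lambda>\<omega>. ereal \<bar>f \<omega>\<bar>)"

definition eta1 :: "'a measure \<Rightarrow> 'a measure \<Rightarrow> (int \<Rightarrow> 'a \<Rightarrow> real) \<Rightarrow> nat \<Rightarrow> ereal" where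
  "eta1 M F0 X n = (SUP k\<in>{int n..}. Linf_norm M (real_cond_exp M F0 (X k)))"

definition eta2 :: "'a measure \<Rightarrow> 'a measure \<Rightarrow> (int \<Rightarrow> 'a \<Rightarrow> real) \<Rightarrow> nat \<Rightarrow> ereal" where
  "eta2 M F0 X n =
     (SUP k\<in>{int n..}. SUP l\<in>{int n..}.
        Linf_norm M (\<lambda>\<omega>. real_cond_exp M F0 (\<lambda>\<omega>. X k \<omega> * X l \<omega>) \<omega>
                          - (\<integral>\<omega>. X k \<omega> * X l \<omega> \<partial>M)))"

definition block :: "nat \<Rightarrow> nat \<Rightarrow> nat set" where
  "block m j = {m * (j - 1) + 1..m * j}"

definition block_sum :: "(int \<Rightarrow> 'a \<Rightarrow> real) \<Rightarrow> nat \<Rightarrow> nat \<Rightarrow> 'a \<Rightarrow> real" where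
  "block_sum X m j \<omega> = (\<Sum>i\<in>block m j. X (int i) \<omega>)"

definition block_norm :: "(int \<Rightarrow> 'a \<Rightarrow> real) \<Rightarrow> nat \<Rightarrow> nat \<Rightarrow> 'a \<Rightarrow> real" where
  "block_norm X m n \<omega> = sqrt (\<Sum>j=1..n div m. (block_sum X m j \<omega>)\<^sup>2)"

(* x / 0 = 0 is the wanted convention where the denominator vanishes *)
definition self_norm_sum :: "(int \<Rightarrow> 'a \<Rightarrow> real) \<Rightarrow> nat \<Rightarrow> nat \<Rightarrow> 'a \<Rightarrow> real" where
  "self_norm_sum X m n \<omega> = (\<Sum>j=1..n div m. block_sum X m j \<omega>) / block_norm X m n \<omega>"

(* P(W n >= x) / (1 - Phi(x)) = 1 + o(1) uniformly for 0 <= x = o(b n) *)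
definition normal_tail_uniformly ::
  "'a measure \<Rightarrow> (nat \<Rightarrow> 'a \<Rightarrow> real) \<Rightarrow> (nat \<Rightarrow> real) \<Rightarrow> bool" where
  "normal_tail_uniformly M W b \<longleftrightarrow>
     (\<forall>xs. (\<forall>n. xs n \<ge> 0) \<longrightarrow> xs \<in> o(b) \<longrightarrow>
        (\<forall>\<epsilon>>0. \<forall>\<^sub>F n in sequentially. \<forall>x\<in>{0..xs n}.
           \<bar>\<P>(\<omega> in M. W n \<omega> \<ge> x) / (1 - cdf std_normal_distribution x) - 1\<bar> < \<epsilon>))"

(* the library has ln 0 = 0 on the reals *)
definition ext_ln :: "real \<Rightarrow> ereal" where
  "ext_ln p = (if p = 0 then - \<infinity> else ereal (ln p))"

end

theory Submission
  imports Defs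
begin

text \<open>The martingale \<open>t \<mapsto> E[S\<^sub>N | F\<^sub>t]\<close> stays within a bounded distance of \<open>S\<^sub>t\<close>, so the block sums,
  divided by \<open>\<sigma> \<surd>(k m)\<close>, are martingale differences up to small errors. Let \<open>T\<close> be the sum of these
  differences and \<open>Q\<close> the sum of their squares. The event \<open>T / \<surd>Q \<ge> x\<close> is compared with the event that
  the exponent \<open>U = x T - x\<^sup>2 Q / 2\<close> is at least \<open>x\<^sup>2 / 2\<close>. Since \<open>exp (y - y\<^sup>2 / 2) = 1 + y + O(\<bar>y\<bar>\<^sup>3)\<close>, the
  moments \<open>E[exp (\<lambda> U)]\<close> depend only weakly on the conditional variances, and they are close to the
  Gaussian ones for complex \<open>\<lambda>\<close> with real part \<open>1\<close>. Fourier inversion against a Gaussian window turns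
  this into a local limit theorem for the tilted law of \<open>U\<close>, of precision \<open>o(1 / x)\<close>, which is what the
  ratio of the tails needs for large \<open>x\<close>. Bounded \<open>x\<close> are treated by Levy continuity and Polya's
  argument. Real \<open>\<lambda>\<close> alone yield the exponential tail bounds behind the large deviation statement.\<close>

text \<open>Only conditional second and fourth moments of a block are controlled, the second up to a
  relative error of order m^(1 - \<beta>). The exponent tolerates this: each summand y - y^2 / 2 is
  at most 1/2, and in the expansion of exp (\<lambda> (y - y^2 / 2)) the coefficient (\<lambda>^2 -
  \<lambda>) / 2 of y^2 vanishes at \<lambda> = 1. Hence E[exp U] is close to 1 without any
  normalisation, and under the weight exp U the variable U is nearly normal with mean x^2 / 2 and
  variance x^2. Its density has order 1 / x, so errors must be small compared with 1 / x. Passing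
  from T / sqrt Q to U costs up to x^2 (Q - 1)^2 / 2; this is harmless when |Q - 1| < a / x with a
  small a, and the complementary event has to be negligible against the normal tail. Replacing a
  block sum by its martingale increment changes its square by about the root of the block length.
  This matches the mixing error m^(2 - \<beta>) exactly at \<beta> = 3/2, which is why larger rates
  are lowered to 3/2; there the full range o(n^(1/14)) comes out.\<close>

lemma exp_minus_linear_bound:
  fixes w :: complex
  assumes "Re w \<le> 1"
  shows "norm (exp w - 1 - w) \<le> 5 * (norm w)\<^sup>2"
proof (cases "norm w \<le> 1")
  case True
  have "\<bar>Re w\<bar> \<le> 1"
    using True abs_Re_le_cmod[of w] by linarith
  then have e: "exp \<bar>Re w\<bar> \<le> 3"
    using exp_le exp_le_cancel_iff[of "\<bar>Re w\<bar>" 1] by linarith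
  have "norm (exp w - 1 - w) \<le> exp \<bar>Re w\<bar> * (norm w)\<^sup>2"
    using Taylor_exp[of w 1] by (simp add: diff_diff_add power2_eq_square)
  also have "\<dots> \<le> 3 * (norm w)\<^sup>2"
    by (rule mult_right_mono[OF e]) simp
  finally show ?thesis by (smt (verit) zero_le_power2)
next
  case False
  have "norm (exp w - 1 - w) \<le> norm (exp w) + 1 + norm w"
    by (smt (verit) norm_triangle_ineq4 norm_one)
  also have "norm (exp w) \<le> 3"
    using assms exp_le exp_le_cancel_iff[of "Re w" 1] by (simp add: norm_exp_eq_Re del: exp_le_cancel_iff)
  also have "3 + 1 + norm w \<le> 5 * norm w"
    using False by simp
  also have "\<dots> \<le> 5 * (norm w)\<^sup>2"
    using False mult_left_mono[of 1 "norm w" "norm w"] by (simp add: power2_eq_square)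
  finally show ?thesis by simp
qed

text \<open>Completing the square. The cap bounds \<open>exp (l * U)\<close> in modulus whenever
  \<open>Re l\<close> is nonnegative, so the integrability of exponentials of \<open>U\<close> never
  depends on the tails of the increments.\<close>

lemma self_normalized_exponent_le: "y - y\<^sup>2 / 2 \<le> (1/2 :: real)"
proof -
  have "0 \<le> (y - 1)\<^sup>2" by simp
  then show ?thesis by (simp add: power2_eq_square algebra_simps)
qed

text \<open>The quadratic correction in the exponent removes the need for any control of large \<open>y\<close>.\<close>

lemma self_normalized_exp_expansion:
  fixes l :: complex and y :: real
  assumes "0 \<le> Re l" "Re l \<le> 2"
  shows "norm (exp (l * of_real (y - y\<^sup>2 / 2)) - (1 + l * of_real y + (l\<^sup>2 - l) / 2 * of_real (y\<^sup>2)))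
    \<le> 40 * (1 + norm l) ^ 3 * (\<bar>y\<bar> ^ 3 + y ^ 4)"
proof -
  define L where "L = norm l"
  have L0: "0 \<le> L" by (simp add: L_def)
  have L1: "L \<le> (1 + L) ^ 3" "L\<^sup>2 \<le> (1 + L) ^ 3" "L ^ 3 \<le> (1 + L) ^ 3" "1 \<le> (1 + L) ^ 3"
    using L0 by (auto simp: power3_eq_cube power2_eq_square algebra_simps)
  show ?thesis
  \<comment> \<open>For small \<open>y\<close> a second-order Taylor expansion is used. For large
    \<open>y\<close> nothing cancels: each term on its own is of order
    \<open>\<bar>y\<bar> ^ 3\<close>, the exponential because its real exponent is at most
    1.\<close>
  proof (cases "\<bar>y\<bar> \<le> 1")
    case True
    define u where "u = y - y\<^sup>2 / 2"
    have y2: "y\<^sup>2 \<le> \<bar>y\<bar>"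
      using True by (metis abs_ge_zero mult_left_le power2_abs power2_eq_square)
    have u1: "\<bar>u\<bar> \<le> 3 / 2 * \<bar>y\<bar>"
      unfolding u_def using y2 zero_le_power2[of y] by linarith
    have u2: "\<bar>u\<bar> \<le> 3 / 2" using u1 True by linarith
    define z where "z = l * of_real u"
    have Rez: "\<bar>Re z\<bar> \<le> 3"
    proof -
      have "\<bar>Re z\<bar> = Re l * \<bar>u\<bar>" using assms(1) by (simp add: z_def abs_mult)
      also have "\<dots> \<le> 2 * (3/2)" using assms u2 by (intro mult_mono) auto
      finally show ?thesis by simp
    qed
    have e3: "exp \<bar>Re z\<bar> \<le> 22"
    proof -
      have "exp \<bar>Re z\<bar> \<le> exp 3" using Rez by simp
      also have "exp 3 = (exp 1 :: real) ^ 3" by (simp flip: exp_of_nat_mult)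
      also have "\<dots> \<le> (272/100) ^ 3" using e_less_272 by (intro power_mono) auto
      also have "\<dots> \<le> 22" by (simp add: power3_eq_cube)
      finally show ?thesis .
    qed
    have nz: "norm z \<le> L * (3/2 * \<bar>y\<bar>)"
      using mult_left_mono[OF u1 L0] by (simp add: z_def L_def norm_mult)
    have "norm (exp z - (1 + z + z\<^sup>2 / 2)) \<le> exp \<bar>Re z\<bar> * norm z ^ 3 / 2"
      using Taylor_exp[of z 2] by (simp add: numeral_2_eq_2 power2_eq_square eval_nat_numeral)
    also have "\<dots> \<le> 22 * (L * (3/2 * \<bar>y\<bar>)) ^ 3 / 2"
      using e3 nz by (intro divide_right_mono mult_mono power_mono) auto
    also have "\<dots> = (22 * 27 / 16) * (L ^ 3 * \<bar>y\<bar> ^ 3)"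
      by (simp add: power3_eq_cube)
    finally have t1: "norm (exp z - (1 + z + z\<^sup>2 / 2)) \<le> (22 * 27 / 16) * (L ^ 3 * \<bar>y\<bar> ^ 3)" .
    \<comment> \<open>The terms \<open>z\<close> and \<open>z\<^sup>2 / 2\<close> contribute -l/2
      and l^2/2 to the coefficient of y^2, which accounts for \<open>(l\<^sup>2 - l) / 2\<close>;
      what remains has order 3 and 4 in \<open>y\<close>.\<close>
    have "(1 + z + z\<^sup>2 / 2) - (1 + l * of_real y + (l\<^sup>2 - l) / 2 * of_real (y\<^sup>2))
       = l\<^sup>2 / 2 * of_real (u\<^sup>2 - y\<^sup>2)"
      unfolding z_def u_def by (simp add: power2_eq_square field_simps)
    moreover have "u\<^sup>2 - y\<^sup>2 = - (y ^ 3) + y ^ 4 / 4"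
      unfolding u_def by (simp add: power2_eq_square power3_eq_cube power4_eq_xxxx field_simps)
    ultimately have "norm ((1 + z + z\<^sup>2 / 2) - (1 + l * of_real y + (l\<^sup>2 - l) / 2 * of_real (y\<^sup>2)))
       = L\<^sup>2 / 2 * \<bar>- (y ^ 3) + y ^ 4 / 4\<bar>"
      by (simp only: norm_mult norm_divide norm_power L_def norm_of_real) simp
    also have "\<dots> \<le> L\<^sup>2 / 2 * (\<bar>y\<bar> ^ 3 + y ^ 4)"
      by (intro mult_left_mono order.trans[OF abs_triangle_ineq]) (auto simp: power_abs)
    finally have t2: "norm ((1 + z + z\<^sup>2 / 2) - (1 + l * of_real y + (l\<^sup>2 - l) / 2 * of_real (y\<^sup>2)))
       \<le> L\<^sup>2 / 2 * (\<bar>y\<bar> ^ 3 + y ^ 4)" .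
    have "norm (exp z - (1 + l * of_real y + (l\<^sup>2 - l) / 2 * of_real (y\<^sup>2)))
       \<le> (22 * 27 / 16) * (L ^ 3 * \<bar>y\<bar> ^ 3) + L\<^sup>2 / 2 * (\<bar>y\<bar> ^ 3 + y ^ 4)"
      using norm_triangle_le[OF add_mono[OF t1 t2]] by (simp add: algebra_simps)
    also have "\<dots> \<le> (22 * 27 / 16) * ((1 + L) ^ 3 * (\<bar>y\<bar> ^ 3 + y ^ 4)) + (1 + L) ^ 3 / 2 * (\<bar>y\<bar> ^ 3 + y ^ 4)"
      using L1 L0 by (intro add_mono mult_left_mono mult_mono mult_right_mono) auto
    also have "\<dots> \<le> 40 * (1 + L) ^ 3 * (\<bar>y\<bar> ^ 3 + y ^ 4)"
    proof -
      have "0 \<le> (1 + L) ^ 3 * (\<bar>y\<bar> ^ 3 + y ^ 4)" using L0 by auto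
      then show ?thesis by (simp add: algebra_simps)
    qed
    finally show ?thesis by (simp add: z_def u_def L_def)
  next
    case False
    then have y1: "1 \<le> \<bar>y\<bar>" by simp
    have p3: "1 \<le> \<bar>y\<bar> ^ 3" "\<bar>y\<bar> \<le> \<bar>y\<bar> ^ 3" "y\<^sup>2 \<le> \<bar>y\<bar> ^ 3"
      using y1 power_increasing[of 1 3 "\<bar>y\<bar>"] power_increasing[of 2 3 "\<bar>y\<bar>"] by auto
    have "Re l * (y - y\<^sup>2 / 2) \<le> 1"
    proof -
      have "Re l * (y - y\<^sup>2 / 2) \<le> Re l * (1/2)"
        using assms self_normalized_exponent_le by (intro mult_left_mono) auto
      then show ?thesis using assms by simp
    qed
    then have e1: "norm (exp (l * of_real (y - y\<^sup>2 / 2))) \<le> 3"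
      using exp_le exp_le_cancel_iff[of "Re l * (y - y\<^sup>2 / 2)" 1] unfolding norm_exp_eq_Re
      by (simp del: exp_le_cancel_iff)
    have "norm (l\<^sup>2 - l) \<le> L\<^sup>2 + L"
      unfolding L_def by (metis norm_triangle_ineq4 norm_power)
    then have "norm ((l\<^sup>2 - l) / 2 * of_real (y\<^sup>2)) \<le> (L\<^sup>2 + L) / 2 * y\<^sup>2"
      by (simp add: norm_mult norm_divide norm_power mult_right_mono)
    also have "\<dots> \<le> (1 + L) ^ 3 * \<bar>y\<bar> ^ 3"
      using L1 L0 p3 by (intro mult_mono) auto
    finally have e2: "norm ((l\<^sup>2 - l) / 2 * of_real (y\<^sup>2)) \<le> (1 + L) ^ 3 * \<bar>y\<bar> ^ 3" .
    have "norm (l * of_real y) \<le> (1 + L) ^ 3 * \<bar>y\<bar> ^ 3"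
      unfolding norm_mult L_def[symmetric] norm_of_real using L1 L0 p3 by (intro mult_mono) auto
    moreover have "1 \<le> (1 + L) ^ 3 * \<bar>y\<bar> ^ 3"
      using L1(4) p3(1) by (metis mult_1 mult_mono' zero_le_one)
    moreover have "norm (exp (l * of_real (y - y\<^sup>2 / 2)) - (1 + l * of_real y + (l\<^sup>2 - l) / 2 * of_real (y\<^sup>2)))
       \<le> norm (exp (l * of_real (y - y\<^sup>2 / 2))) + (1 + norm (l * of_real y) + norm ((l\<^sup>2 - l) / 2 * of_real (y\<^sup>2)))"
      by (intro order.trans[OF norm_triangle_ineq4] add_mono order.refl order.trans[OF norm_triangle_ineq]) auto
    ultimately have "norm (exp (l * of_real (y - y\<^sup>2 / 2)) - (1 + l * of_real y + (l\<^sup>2 - l) / 2 * of_real (y\<^sup>2)))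
       \<le> 6 * ((1 + L) ^ 3 * \<bar>y\<bar> ^ 3)"
      using e1 e2 by linarith
    also have "\<dots> \<le> 40 * ((1 + L) ^ 3 * (\<bar>y\<bar> ^ 3 + y ^ 4))"
      using L0 by (intro mult_mono) auto
    finally show ?thesis by (simp add: L_def mult.assoc)
  qed
qed

section \<open>Tilted moments of martingale differences\<close>

text \<open>Statements about conditional expectations are encoded by testing against bounded
  \<open>F j\<close>-measurable functions \<open>G\<close>: \<open>\<delta>\<close> bounds the relative error of the conditional variance.\<close>

locale bounded_mds = prob_space M for M :: "'a measure" +
  fixes F :: "nat \<Rightarrow> 'a measure" and \<xi> :: "nat \<Rightarrow> 'a \<Rightarrow> real"
    and k :: nat and b \<delta> C :: real
  assumes k_pos: "0 < k"
    and subalg: "\<And>j. subalgebra M (F j)"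
    and filtration: "\<And>i j. i \<le> j \<Longrightarrow> sets (F i) \<subseteq> sets (F j)"
    and adapted: "\<And>j. j < k \<Longrightarrow> \<xi> j \<in> borel_measurable (F (Suc j))"
    and bounded: "\<And>j. j < k \<Longrightarrow> AE \<omega> in M. \<bar>\<xi> j \<omega>\<bar> \<le> b"
    and \<delta>_nonneg: "0 \<le> \<delta>" and \<delta>_le: "\<delta> \<le> 1" and C_ge: "1 \<le> C"
    and centered: "\<And>j G c. j < k \<Longrightarrow> G \<in> borel_measurable (F j) \<Longrightarrow> AE \<omega> in M. \<bar>G \<omega>\<bar> \<le> c \<Longrightarrow>
      expectation (\<lambda>\<omega>. G \<omega> * \<xi> j \<omega>) = 0"
    and variance: "\<And>j G c. j < k \<Longrightarrow> G \<in> borel_measurable (F j) \<Longrightarrow> AE \<omega> in M. \<bar>G \<omega>\<bar> \<le> c \<Longrightarrow>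
      \<bar>expectation (\<lambda>\<omega>. G \<omega> * ((\<xi> j \<omega>)\<^sup>2 - 1 / k))\<bar> \<le> \<delta> / k * expectation (\<lambda>\<omega>. \<bar>G \<omega>\<bar>)"
    and fourth: "\<And>j G c. j < k \<Longrightarrow> G \<in> borel_measurable (F j) \<Longrightarrow> AE \<omega> in M. \<bar>G \<omega>\<bar> \<le> c \<Longrightarrow>
      expectation (\<lambda>\<omega>. \<bar>G \<omega>\<bar> * (\<xi> j \<omega>) ^ 4) \<le> C / (real k)\<^sup>2 * expectation (\<lambda>\<omega>. \<bar>G \<omega>\<bar>)"
begin

lemma measurable_F_mono:
  assumes "f \<in> borel_measurable (F i)" "i \<le> j"
  shows "f \<in> borel_measurable (F j)"
proof -
  have "subalgebra (F j) (F i)"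
    using subalg[of i] subalg[of j] filtration[OF assms(2)] unfolding subalgebra_def by simp
  then show ?thesis using assms(1) measurable_from_subalg by blast
qed

lemma measurable_F_M: "f \<in> borel_measurable (F i) \<Longrightarrow> f \<in> borel_measurable M"
  using subalg measurable_from_subalg by blast

lemma \<xi>_measurable_F: "i < j \<Longrightarrow> j \<le> k \<Longrightarrow> \<xi> i \<in> borel_measurable (F j)"
  using measurable_F_mono[OF adapted] by (meson Suc_leI order_less_le_trans)

lemma \<xi>_measurable: "j < k \<Longrightarrow> \<xi> j \<in> borel_measurable M"
  using measurable_F_M adapted by blast

definition part_sum :: "nat \<Rightarrow> 'a \<Rightarrow> real" where
  "part_sum j \<omega> = (\<Sum>i<j. \<xi> i \<omega>)"

definition part_sq :: "nat \<Rightarrow> 'a \<Rightarrow> real" where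
  "part_sq j \<omega> = (\<Sum>i<j. (\<xi> i \<omega>)\<^sup>2)"

definition U :: "real \<Rightarrow> nat \<Rightarrow> 'a \<Rightarrow> real" where
  "U x j \<omega> = (\<Sum>i<j. x * \<xi> i \<omega> - (x * \<xi> i \<omega>)\<^sup>2 / 2)"

lemma U_eq: "U x j \<omega> = x * part_sum j \<omega> - x\<^sup>2 * part_sq j \<omega> / 2"
  by (simp add: U_def part_sum_def part_sq_def sum_subtractf sum_distrib_left power_mult_distrib
      sum_divide_distrib)

lemma U_measurable_F: "j \<le> k \<Longrightarrow> U x j \<in> borel_measurable (F j)"
  unfolding U_def using \<xi>_measurable_F
  by (intro borel_measurable_sum borel_measurable_diff borel_measurable_divide borel_measurable_power
      borel_measurable_times) auto

lemma U_measurable [measurable]: "j \<le> k \<Longrightarrow> U x j \<in> borel_measurable M"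
  using U_measurable_F measurable_F_M by blast

lemma part_measurable [measurable]:
  "part_sum k \<in> borel_measurable M" "part_sq k \<in> borel_measurable M"
  unfolding part_sum_def part_sq_def using \<xi>_measurable
  by (auto intro!: borel_measurable_sum borel_measurable_power)

lemma U_le: "U x j \<omega> \<le> j / 2"
proof -
  have "U x j \<omega> \<le> (\<Sum>i<j. 1/2)"
    unfolding U_def by (intro sum_mono self_normalized_exponent_le)
  then show ?thesis by simp
qed

lemma integrable_AE_bounded:
  fixes f :: "'a \<Rightarrow> 'b::{banach, second_countable_topology}"
  assumes "f \<in> borel_measurable M" "AE \<omega> in M. norm (f \<omega>) \<le> c"
  shows "integrable M f"
  using assms by (intro integrable_const_bound)

lemma norm_exp_U_le: "0 \<le> Re l \<Longrightarrow> norm (exp (l * of_real (U x j \<omega>))) \<le> exp (Re l * (j / 2))"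
  using mult_left_mono[OF U_le[of x j \<omega>], of "Re l"] by (simp add: norm_exp_eq_Re)

text \<open>The third moment is interpolated between the conditional second and fourth moments by
  expanding 0 \<le> y^2 (s |y| - 1)^2 / (2 s). The choice s = sqrt k is the inverse of the typical
  size of an increment, so both resulting terms have the same order.\<close>

lemma abs_moments:
  assumes j: "j < k" and G: "G \<in> borel_measurable (F j)" and Gc: "AE \<omega> in M. \<bar>G \<omega>\<bar> \<le> c"
  shows "expectation (\<lambda>\<omega>. \<bar>G \<omega>\<bar> * \<bar>\<xi> j \<omega>\<bar> ^ 3) \<le> 2 * C / (k * sqrt k) * expectation (\<lambda>\<omega>. \<bar>G \<omega>\<bar>)"
proof -
  have [measurable]: "G \<in> borel_measurable M" "\<xi> j \<in> borel_measurable M"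
    using G j measurable_F_M \<xi>_measurable by auto
  have bd: "AE \<omega> in M. \<bar>G \<omega>\<bar> * \<bar>\<xi> j \<omega>\<bar> ^ p \<le> c * b ^ p" for p
    using Gc bounded[OF j] by eventually_elim (intro mult_mono power_mono, auto)
  have int: "integrable M (\<lambda>\<omega>. \<bar>G \<omega>\<bar> * \<bar>\<xi> j \<omega>\<bar> ^ p)" for p
    by (rule integrable_AE_bounded[where c="c * b ^ p"]) (use bd[of p] in \<open>auto simp: abs_mult\<close>)
  have int2: "integrable M (\<lambda>\<omega>. \<bar>G \<omega>\<bar> * (\<xi> j \<omega>)\<^sup>2)" and int4: "integrable M (\<lambda>\<omega>. \<bar>G \<omega>\<bar> * (\<xi> j \<omega>) ^ 4)"
    using int[of 2] int[of 4] by auto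
  have intG: "integrable M (\<lambda>\<omega>. \<bar>G \<omega>\<bar>)" using int[of 0] by simp
  define s where "s = sqrt (real k)"
  have s: "0 < s" "s * s = k" using k_pos by (auto simp: s_def)
  have E0: "0 \<le> expectation (\<lambda>\<omega>. \<bar>G \<omega>\<bar>)" by simp
  have "expectation (\<lambda>\<omega>. \<bar>G \<omega>\<bar> * (\<xi> j \<omega>)\<^sup>2) - 1 / k * expectation (\<lambda>\<omega>. \<bar>G \<omega>\<bar>)
      = expectation (\<lambda>\<omega>. \<bar>G \<omega>\<bar> * ((\<xi> j \<omega>)\<^sup>2 - 1 / k))"
    using int2 intG by (simp add: right_diff_distrib)
  also have "\<dots> \<le> \<delta> / k * expectation (\<lambda>\<omega>. \<bar>G \<omega>\<bar>)"
    using variance[OF j, of "\<lambda>\<omega>. \<bar>G \<omega>\<bar>" c] G Gc by auto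
  also have "\<dots> \<le> 1 / k * expectation (\<lambda>\<omega>. \<bar>G \<omega>\<bar>)"
    using \<delta>_le E0 by (intro mult_right_mono divide_right_mono) auto
  finally have v: "expectation (\<lambda>\<omega>. \<bar>G \<omega>\<bar> * (\<xi> j \<omega>)\<^sup>2) \<le> 2 / k * expectation (\<lambda>\<omega>. \<bar>G \<omega>\<bar>)"
    by (simp add: field_simps)
  have pw: "\<bar>y\<bar> ^ 3 \<le> y\<^sup>2 / (2 * s) + s * y ^ 4 / 2" for y :: real
  proof -
    have "0 \<le> y\<^sup>2 * (s * \<bar>y\<bar> - 1)\<^sup>2 / (2 * s)" using s by simp
    also have "\<dots> = y\<^sup>2 / (2 * s) + s * y ^ 4 / 2 - \<bar>y\<bar> ^ 3"
      using s by (simp add: power2_diff field_simps power3_eq_cube power2_eq_square power4_eq_xxxx abs_mult_self_eq)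
    finally show ?thesis by simp
  qed
  have "expectation (\<lambda>\<omega>. \<bar>G \<omega>\<bar> * \<bar>\<xi> j \<omega>\<bar> ^ 3)
      \<le> expectation (\<lambda>\<omega>. (1 / (2 * s)) * (\<bar>G \<omega>\<bar> * (\<xi> j \<omega>)\<^sup>2) + (s / 2) * (\<bar>G \<omega>\<bar> * (\<xi> j \<omega>) ^ 4))"
  proof (rule integral_mono[OF int])
    fix \<omega>
    show "\<bar>G \<omega>\<bar> * \<bar>\<xi> j \<omega>\<bar> ^ 3 \<le> (1 / (2 * s)) * (\<bar>G \<omega>\<bar> * (\<xi> j \<omega>)\<^sup>2) + (s / 2) * (\<bar>G \<omega>\<bar> * (\<xi> j \<omega>) ^ 4)"
      using mult_left_mono[OF pw[of "\<xi> j \<omega>"], of "\<bar>G \<omega>\<bar>"] by (simp add: algebra_simps)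
  qed (use int2 int4 in auto)
  also have "\<dots> = (1 / (2 * s)) * expectation (\<lambda>\<omega>. \<bar>G \<omega>\<bar> * (\<xi> j \<omega>)\<^sup>2)
      + (s / 2) * expectation (\<lambda>\<omega>. \<bar>G \<omega>\<bar> * (\<xi> j \<omega>) ^ 4)"
    using int2 int4 by simp
  also have "\<dots> \<le> (1 / (2 * s)) * (2 / k * expectation (\<lambda>\<omega>. \<bar>G \<omega>\<bar>))
      + (s / 2) * (C / (real k)\<^sup>2 * expectation (\<lambda>\<omega>. \<bar>G \<omega>\<bar>))"
    using v fourth[OF j G Gc] s by (intro add_mono mult_left_mono) auto
  also have "\<dots> = (1 + C / 2) / (k * s) * expectation (\<lambda>\<omega>. \<bar>G \<omega>\<bar>)"
  proof -
    have kr: "real k = s * s" by (simp add: s(2))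
    have "(s / 2) * (C / (real k)\<^sup>2) = C / 2 * (1 / (k * s))"
      using s(1) unfolding kr by (simp add: power2_eq_square)
    moreover have "(1 / (2 * s)) * (2 / k) = 1 / (k * s)" by simp
    ultimately have "(1 / (2 * s)) * (2 / k) + (s / 2) * (C / (real k)\<^sup>2) = (1 + C / 2) * (1 / (k * s))"
      by (simp only: distrib_right mult_1)
    then show ?thesis by (simp only: mult.assoc[symmetric] distrib_right[symmetric]) simp
  qed
  also have "\<dots> \<le> 2 * C / (k * s) * expectation (\<lambda>\<omega>. \<bar>G \<omega>\<bar>)"
    using C_ge s E0 by (intro mult_right_mono divide_right_mono) auto
  finally show ?thesis by (simp add: s_def)
qed

text \<open>The hypotheses test with real functions; splitting \<open>G\<close> into real and
  imaginary part costs the factor 2.\<close>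

lemma centered_complex:
  fixes G :: "'a \<Rightarrow> complex"
  assumes j: "j < k" and G: "G \<in> borel_measurable (F j)" and Gc: "AE \<omega> in M. norm (G \<omega>) \<le> c"
  shows "(\<integral>\<omega>. G \<omega> * of_real (\<xi> j \<omega>) \<partial>M) = 0"
    and "norm (\<integral>\<omega>. G \<omega> * of_real ((\<xi> j \<omega>)\<^sup>2 - 1 / k) \<partial>M) \<le> 2 * \<delta> / k * expectation (\<lambda>\<omega>. norm (G \<omega>))"
proof -
  have [measurable]: "G \<in> borel_measurable M" "\<xi> j \<in> borel_measurable M"
    using j \<xi>_measurable measurable_from_subalg[OF subalg G] by auto
  have Re: "(\<lambda>\<omega>. Re (G \<omega>)) \<in> borel_measurable (F j)" and Im: "(\<lambda>\<omega>. Im (G \<omega>)) \<in> borel_measurable (F j)"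
    using G by auto
  have Rec: "AE \<omega> in M. \<bar>Re (G \<omega>)\<bar> \<le> c" and Imc: "AE \<omega> in M. \<bar>Im (G \<omega>)\<bar> \<le> c"
    using Gc abs_Re_le_cmod abs_Im_le_cmod by (auto elim!: eventually_mono intro: order.trans)
  have i1: "integrable M (\<lambda>\<omega>. G \<omega> * of_real (\<xi> j \<omega>))"
  proof (rule integrable_AE_bounded[where c="c * b"])
    show "AE \<omega> in M. norm (G \<omega> * of_real (\<xi> j \<omega>)) \<le> c * b"
      using Gc bounded[OF j] by eventually_elim (auto simp: norm_mult intro!: mult_mono intro: order.trans[OF norm_ge_zero])
  qed simp
  have i2: "integrable M (\<lambda>\<omega>. G \<omega> * of_real ((\<xi> j \<omega>)\<^sup>2 - 1 / k))"
  proof (rule integrable_AE_bounded[where c="c * (b\<^sup>2 + 1 / k)"])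
    show "AE \<omega> in M. norm (G \<omega> * of_real ((\<xi> j \<omega>)\<^sup>2 - 1 / k)) \<le> c * (b\<^sup>2 + 1 / k)"
      using Gc bounded[OF j]
    proof eventually_elim
      case (elim \<omega>)
      have "\<bar>(\<xi> j \<omega>)\<^sup>2 - 1 / k\<bar> \<le> b\<^sup>2 + 1 / k"
        using elim(2) power_mono[OF elim(2), of 2] by (intro order.trans[OF abs_triangle_ineq4] add_mono) auto
      then show ?case unfolding norm_mult norm_of_real
        using elim(1) by (intro mult_mono) (auto intro: order.trans[OF norm_ge_zero])
    qed
  qed simp
  have iG: "integrable M G" by (rule integrable_AE_bounded[OF _ Gc]) simp
  show "(\<integral>\<omega>. G \<omega> * of_real (\<xi> j \<omega>) \<partial>M) = 0"
    using centered[OF j Re Rec] centered[OF j Im Imc] integral_Re[OF i1] integral_Im[OF i1]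
    by (simp add: complex_eq_iff)
  have "norm (\<integral>\<omega>. G \<omega> * of_real ((\<xi> j \<omega>)\<^sup>2 - 1 / k) \<partial>M) \<le>
      \<bar>expectation (\<lambda>\<omega>. Re (G \<omega>) * ((\<xi> j \<omega>)\<^sup>2 - 1 / k))\<bar> + \<bar>expectation (\<lambda>\<omega>. Im (G \<omega>) * ((\<xi> j \<omega>)\<^sup>2 - 1 / k))\<bar>"
    using integral_Re[OF i2] integral_Im[OF i2] cmod_le[of "\<integral>\<omega>. G \<omega> * of_real ((\<xi> j \<omega>)\<^sup>2 - 1 / k) \<partial>M"]
    by simp
  also have "\<dots> \<le> \<delta> / k * expectation (\<lambda>\<omega>. \<bar>Re (G \<omega>)\<bar>) + \<delta> / k * expectation (\<lambda>\<omega>. \<bar>Im (G \<omega>)\<bar>)"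
    by (intro add_mono variance[OF j Re Rec] variance[OF j Im Imc])
  also have "\<dots> \<le> \<delta> / k * expectation (\<lambda>\<omega>. norm (G \<omega>)) + \<delta> / k * expectation (\<lambda>\<omega>. norm (G \<omega>))"
    using \<delta>_nonneg iG
    by (intro add_mono mult_left_mono integral_mono) (auto intro: abs_Re_le_cmod abs_Im_le_cmod)
  finally show "norm (\<integral>\<omega>. G \<omega> * of_real ((\<xi> j \<omega>)\<^sup>2 - 1 / k) \<partial>M) \<le> 2 * \<delta> / k * expectation (\<lambda>\<omega>. norm (G \<omega>))"
    by simp
qed

text \<open>Error of the tilted moments accumulated over all \<open>k\<close> steps: the relative
  variance error weighted by \<open>x\<^sup>2\<close>, and a Lyapunov ratio, because the
  \<open>k\<close> third moments add up to order \<open>C / sqrt k\<close>.\<close>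

definition r0 :: "real \<Rightarrow> real" where
  "r0 x = \<delta> * x\<^sup>2 + 130 * C * x ^ 3 / sqrt k"

text \<open>The constant 130 leaves room for the third and fourth moments of the increment and for the
  error in \<open>exp w = 1 + w + O(w\<^sup>2)\<close>.\<close>

lemma exp_U_step:
  fixes l :: complex
  assumes l: "0 \<le> Re l" "Re l \<le> 2" "Re (l\<^sup>2 - l) \<le> 2" and j: "j < k"
    and x: "0 \<le> x" "x \<le> sqrt k"
  shows "norm ((\<integral>\<omega>. exp (l * of_real (U x (Suc j) \<omega>)) \<partial>M)
      - exp ((l\<^sup>2 - l) / 2 * of_real (x\<^sup>2 / k)) * (\<integral>\<omega>. exp (l * of_real (U x j \<omega>)) \<partial>M))
    \<le> (1 + norm l) ^ 4 * r0 x / k * expectation (\<lambda>\<omega>. exp (Re l * U x j \<omega>))"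
proof -
  define G where "G = (\<lambda>\<omega>. exp (l * of_real (U x j \<omega>)))"
  define L where "L = norm l"
  define q where "q = (l\<^sup>2 - l) / 2"
  define s where "s = sqrt (real k)"
  have L0: "0 \<le> L" by (simp add: L_def)
  have s: "0 < s" "s * s = k" using k_pos by (auto simp: s_def)
  have nq: "norm q \<le> (L\<^sup>2 + L) / 2"
    unfolding q_def L_def norm_divide by (simp add: order.trans[OF norm_triangle_ineq4] norm_power)
  have [measurable]: "U x j \<in> borel_measurable M" "\<xi> j \<in> borel_measurable M"
    using j \<xi>_measurable by auto
  have GF: "G \<in> borel_measurable (F j)"
    using U_measurable_F[of j x] j unfolding G_def by (auto intro!: borel_measurable_times measurable_compose[OF _ borel_measurable_exp])
  have [measurable]: "G \<in> borel_measurable M" unfolding G_def by measurable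
  have Gb: "AE \<omega> in M. norm (G \<omega>) \<le> exp (Re l * (j / 2))"
    unfolding G_def using norm_exp_U_le[OF l(1)] by auto
  have nG: "norm (G \<omega>) = exp (Re l * U x j \<omega>)" for \<omega> unfolding G_def by (simp add: norm_exp_eq_Re)
  define g where "g = expectation (\<lambda>\<omega>. norm (G \<omega>))"
  have g0: "0 \<le> g" unfolding g_def by simp
  have iG: "integrable M G" by (rule integrable_AE_bounded[OF _ Gb]) simp
  have moments: "AE \<omega> in M. norm (G \<omega>) * \<bar>\<xi> j \<omega>\<bar> ^ p \<le> exp (Re l * (j / 2)) * b ^ p" for p
    using Gb bounded[OF j] by eventually_elim (intro mult_mono power_mono, auto)
  have imom: "integrable M (\<lambda>\<omega>. norm (G \<omega>) * \<bar>\<xi> j \<omega>\<bar> ^ p)" for p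
    by (rule integrable_AE_bounded[where c="exp (Re l * (j / 2)) * b ^ p"])
      (use moments[of p] in \<open>auto simp: abs_mult\<close>)
  have icm: "integrable M (\<lambda>\<omega>. G \<omega> * of_real (\<xi> j \<omega> ^ p))" for p
    by (rule integrable_AE_bounded[where c="exp (Re l * (j / 2)) * b ^ p"])
      (use moments[of p] in \<open>auto simp: norm_mult norm_power\<close>)
  define R where "R = (\<lambda>\<omega>. exp (l * of_real (x * \<xi> j \<omega> - (x * \<xi> j \<omega>)\<^sup>2 / 2))
      - (1 + l * of_real (x * \<xi> j \<omega>) + q * of_real ((x * \<xi> j \<omega>)\<^sup>2)))"
  have [measurable]: "R \<in> borel_measurable M" unfolding R_def by measurable
  have Rb: "norm (R \<omega>) \<le> 40 * (1 + L) ^ 3 * (x ^ 3 * \<bar>\<xi> j \<omega>\<bar> ^ 3 + x ^ 4 * \<bar>\<xi> j \<omega>\<bar> ^ 4)" for \<omega>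
    using self_normalized_exp_expansion[OF l(1,2), of "x * \<xi> j \<omega>"] x
    unfolding R_def q_def L_def by (simp add: abs_mult power_mult_distrib)
  have GRb: "norm (G \<omega> * R \<omega>) \<le> 40 * (1 + L) ^ 3 *
       (x ^ 3 * (norm (G \<omega>) * \<bar>\<xi> j \<omega>\<bar> ^ 3) + x ^ 4 * (norm (G \<omega>) * \<bar>\<xi> j \<omega>\<bar> ^ 4))" for \<omega>
    unfolding norm_mult using mult_left_mono[OF Rb[of \<omega>], of "norm (G \<omega>)"] by (simp add: algebra_simps)
  have iB: "integrable M (\<lambda>\<omega>. 40 * (1 + L) ^ 3 *
       (x ^ 3 * (norm (G \<omega>) * \<bar>\<xi> j \<omega>\<bar> ^ 3) + x ^ 4 * (norm (G \<omega>) * \<bar>\<xi> j \<omega>\<bar> ^ 4)))"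
    by (intro integrable_mult_right Bochner_Integration.integrable_add imom)
  have iGR: "integrable M (\<lambda>\<omega>. G \<omega> * R \<omega>)"
    by (rule Bochner_Integration.integrable_bound[OF iB]) (use GRb in \<open>auto intro!: AE_I2 order.trans[OF GRb] abs_ge_self\<close>)
  have "norm (\<integral>\<omega>. G \<omega> * R \<omega> \<partial>M) \<le> expectation (\<lambda>\<omega>. norm (G \<omega> * R \<omega>))"
    by (rule integral_norm_bound)
  also have "\<dots> \<le> expectation (\<lambda>\<omega>. 40 * (1 + L) ^ 3 *
       (x ^ 3 * (norm (G \<omega>) * \<bar>\<xi> j \<omega>\<bar> ^ 3) + x ^ 4 * (norm (G \<omega>) * \<bar>\<xi> j \<omega>\<bar> ^ 4)))"
    using iGR iB GRb by (intro integral_mono) auto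
  also have "\<dots> = 40 * (1 + L) ^ 3 * (x ^ 3 * expectation (\<lambda>\<omega>. norm (G \<omega>) * \<bar>\<xi> j \<omega>\<bar> ^ 3)
       + x ^ 4 * expectation (\<lambda>\<omega>. norm (G \<omega>) * \<bar>\<xi> j \<omega>\<bar> ^ 4))"
    using imom[of 3] imom[of 4] by (simp del: power_abs)
  also have "\<dots> \<le> 40 * (1 + L) ^ 3 * (x ^ 3 * (2 * C / (k * s) * g) + x ^ 3 * (C / (k * s) * g))"
  proof -
    have nGF: "(\<lambda>\<omega>. norm (G \<omega>)) \<in> borel_measurable (F j)" using GF by auto
    have nGb: "AE \<omega> in M. \<bar>norm (G \<omega>)\<bar> \<le> exp (Re l * (j / 2))" using Gb by auto
    have m3: "expectation (\<lambda>\<omega>. norm (G \<omega>) * \<bar>\<xi> j \<omega>\<bar> ^ 3) \<le> 2 * C / (k * s) * g"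
      using abs_moments[OF j nGF nGb] by (simp add: g_def s_def)
    have m4: "expectation (\<lambda>\<omega>. norm (G \<omega>) * \<bar>\<xi> j \<omega>\<bar> ^ 4) \<le> C / (real k)\<^sup>2 * g"
      using fourth[OF j nGF nGb] by (simp add: g_def)
    have "x ^ 4 * expectation (\<lambda>\<omega>. norm (G \<omega>) * \<bar>\<xi> j \<omega>\<bar> ^ 4) \<le> x ^ 4 * (C / (real k)\<^sup>2 * g)"
      using m4 by (intro mult_left_mono) auto
    also have "\<dots> = x ^ 3 * x * (C / (real k)\<^sup>2 * g)" by (simp add: power3_eq_cube power4_eq_xxxx)
    \<comment> \<open>One factor \<open>x\<close> is traded for \<open>sqrt k\<close>, which brings
      the fourth-moment term to the rate of the third-moment term.\<close>
    also have "\<dots> \<le> x ^ 3 * s * (C / (real k)\<^sup>2 * g)"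
      using x g0 C_ge by (intro mult_right_mono mult_left_mono) (auto simp: s_def)
    also have "\<dots> = x ^ 3 * (s * (C / (real k)\<^sup>2 * g))" by (rule mult.assoc)
    also have "s * (C / (real k)\<^sup>2 * g) = C / (k * s) * g"
    proof -
      have kr: "real k = s * s" by (simp add: s(2))
      show ?thesis using s(1) unfolding kr by (simp add: power2_eq_square)
    qed
    finally have "x ^ 4 * expectation (\<lambda>\<omega>. norm (G \<omega>) * \<bar>\<xi> j \<omega>\<bar> ^ 4) \<le> x ^ 3 * (C / (k * s) * g)"
      by (simp only: mult.assoc)
    moreover have "x ^ 3 * expectation (\<lambda>\<omega>. norm (G \<omega>) * \<bar>\<xi> j \<omega>\<bar> ^ 3) \<le> x ^ 3 * (2 * C / (k * s) * g)"
      using m3 x by (intro mult_left_mono) auto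
    ultimately show ?thesis using L0 by (intro mult_left_mono[OF add_mono]) auto
  qed
  also have "\<dots> = (1 + L) ^ 3 * (120 * C * x ^ 3 / s) / k * g"
    using s k_pos by (simp add: field_simps)
  finally have e1: "norm (\<integral>\<omega>. G \<omega> * R \<omega> \<partial>M) \<le> (1 + L) ^ 3 * (120 * C * x ^ 3 / s) / k * g" .
  \<comment> \<open>Given the past, one step multiplies by \<open>1 + w\<close> up to errors: the
    linear term is centered and the quadratic one has mean close to \<open>w\<close>. Passing on to
    \<open>exp w\<close> makes the product of the \<open>k\<close> factors the Gaussian value
    exactly.\<close>
  define w where "w = q * of_real (x\<^sup>2 / k)"
  have dec: "exp (l * of_real (U x (Suc j) \<omega>)) = G \<omega> * (1 + w) + of_real x * l * (G \<omega> * of_real (\<xi> j \<omega>))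
      + of_real (x\<^sup>2) * q * (G \<omega> * of_real ((\<xi> j \<omega>)\<^sup>2 - 1 / k)) + G \<omega> * R \<omega>" for \<omega>
  proof -
    have "exp (l * of_real (U x (Suc j) \<omega>)) = G \<omega> * exp (l * of_real (x * \<xi> j \<omega> - (x * \<xi> j \<omega>)\<^sup>2 / 2))"
      unfolding G_def U_def by (simp add: distrib_left exp_add)
    also have "exp (l * of_real (x * \<xi> j \<omega> - (x * \<xi> j \<omega>)\<^sup>2 / 2))
      = R \<omega> + (1 + l * of_real (x * \<xi> j \<omega>) + q * of_real ((x * \<xi> j \<omega>)\<^sup>2))" by (simp add: R_def)
    finally show ?thesis
      by (simp add: w_def power_mult_distrib algebra_simps)
  qed
  have i1: "integrable M (\<lambda>\<omega>. G \<omega> * of_real (\<xi> j \<omega>))" using icm[of 1] by simp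
  have i2: "integrable M (\<lambda>\<omega>. G \<omega> * of_real ((\<xi> j \<omega>)\<^sup>2 - 1 / k))"
  proof -
    have "integrable M (\<lambda>\<omega>. G \<omega> * of_real ((\<xi> j \<omega>)\<^sup>2) - G \<omega> * of_real (1 / k))"
      using icm[of 2] iG by (intro Bochner_Integration.integrable_diff integrable_mult_left) auto
    then show ?thesis by (simp add: right_diff_distrib)
  qed
  have "(\<integral>\<omega>. exp (l * of_real (U x (Suc j) \<omega>)) \<partial>M) = (\<integral>\<omega>. G \<omega> * (1 + w) + of_real x * l * (G \<omega> * of_real (\<xi> j \<omega>))
      + of_real (x\<^sup>2) * q * (G \<omega> * of_real ((\<xi> j \<omega>)\<^sup>2 - 1 / k)) + G \<omega> * R \<omega> \<partial>M)"
    by (simp only: dec)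
  also have "\<dots> = (\<integral>\<omega>. G \<omega> \<partial>M) * (1 + w) + of_real x * l * (\<integral>\<omega>. G \<omega> * of_real (\<xi> j \<omega>) \<partial>M)
      + of_real (x\<^sup>2) * q * (\<integral>\<omega>. G \<omega> * of_real ((\<xi> j \<omega>)\<^sup>2 - 1 / k) \<partial>M) + (\<integral>\<omega>. G \<omega> * R \<omega> \<partial>M)"
    using iG i1 i2 iGR
    by (simp only: Bochner_Integration.integral_add Bochner_Integration.integrable_add integrable_mult_left
        integrable_mult_right integral_mult_left_zero integral_mult_right_zero)
  finally have "(\<integral>\<omega>. exp (l * of_real (U x (Suc j) \<omega>)) \<partial>M) - exp w * (\<integral>\<omega>. G \<omega> \<partial>M)
      = - ((exp w - 1 - w) * (\<integral>\<omega>. G \<omega> \<partial>M))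
        + of_real (x\<^sup>2) * q * (\<integral>\<omega>. G \<omega> * of_real ((\<xi> j \<omega>)\<^sup>2 - 1 / k) \<partial>M) + (\<integral>\<omega>. G \<omega> * R \<omega> \<partial>M)"
    using centered_complex(1)[OF j GF Gb] by (simp add: algebra_simps)
  then have "norm ((\<integral>\<omega>. exp (l * of_real (U x (Suc j) \<omega>)) \<partial>M) - exp w * (\<integral>\<omega>. G \<omega> \<partial>M))
      \<le> norm (exp w - 1 - w) * norm (\<integral>\<omega>. G \<omega> \<partial>M)
        + x\<^sup>2 * norm q * norm (\<integral>\<omega>. G \<omega> * of_real ((\<xi> j \<omega>)\<^sup>2 - 1 / k) \<partial>M) + norm (\<integral>\<omega>. G \<omega> * R \<omega> \<partial>M)"
    by (simp only: norm_minus_cancel norm_mult norm_of_real abs_power2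
        order.trans[OF norm_triangle_ineq] add_mono order.refl norm_triangle_le)
  also have "\<dots> \<le> 5 * (norm w)\<^sup>2 * g + x\<^sup>2 * ((L\<^sup>2 + L) / 2) * (2 * \<delta> / k * g) + (1 + L) ^ 3 * (120 * C * x ^ 3 / s) / k * g"
  proof -
    have "x\<^sup>2 / k \<le> 1"
      using x k_pos s power_mono[of x s 2] by (simp add: s_def)
    moreover have "Re q \<le> 1" using l(3) by (simp add: q_def)
    moreover have "Re w = Re q * (x\<^sup>2 / k)" by (simp add: w_def)
    moreover have "Re q * (x\<^sup>2 / k) \<le> 1 * (x\<^sup>2 / k)"
      using \<open>Re q \<le> 1\<close> by (intro mult_right_mono) auto
    ultimately have "Re w \<le> 1" by linarith
    then have a: "norm (exp w - 1 - w) \<le> 5 * (norm w)\<^sup>2" by (rule exp_minus_linear_bound)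
    have b: "norm (\<integral>\<omega>. G \<omega> \<partial>M) \<le> g" unfolding g_def by (rule integral_norm_bound)
    have c: "norm (\<integral>\<omega>. G \<omega> * of_real ((\<xi> j \<omega>)\<^sup>2 - 1 / k) \<partial>M) \<le> 2 * \<delta> / k * g"
      unfolding g_def by (rule centered_complex(2)[OF j GF Gb])
    show ?thesis using a b c e1 nq L0 by (intro add_mono mult_mono) auto
  qed
  also have "\<dots> \<le> (1 + L) ^ 4 * r0 x / k * g"
  proof -
    have L4: "(1 + L) ^ 3 \<le> (1 + L) ^ 4" "L\<^sup>2 + L \<le> (1 + L) ^ 4" "(L\<^sup>2 + L)\<^sup>2 \<le> (1 + L) ^ 4"
    proof -
      show "(1 + L) ^ 3 \<le> (1 + L) ^ 4" using L0 by (intro power_increasing) auto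
      have 1: "L\<^sup>2 + L \<le> (1 + L)\<^sup>2" using L0 by (simp add: power2_eq_square algebra_simps)
      also have "\<dots> \<le> (1 + L) ^ 4" using L0 by (intro power_increasing) auto
      finally show "L\<^sup>2 + L \<le> (1 + L) ^ 4" .
      have "(L\<^sup>2 + L)\<^sup>2 \<le> ((1 + L)\<^sup>2)\<^sup>2" using 1 L0 by (intro power_mono) auto
      then show "(L\<^sup>2 + L)\<^sup>2 \<le> (1 + L) ^ 4" by simp
    qed
    have x3: "x ^ 4 / k \<le> x ^ 3 / s"
    proof -
      have "x ^ 4 / k = x ^ 3 / s * (x / s)" using s(1) by (simp flip: s(2) add: power3_eq_cube power4_eq_xxxx)
      also have "\<dots> \<le> x ^ 3 / s * 1" using x s by (intro mult_left_mono) (auto simp: s_def)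
      finally show ?thesis by simp
    qed
    have "norm w \<le> (L\<^sup>2 + L) / 2 * (x\<^sup>2 / k)"
      unfolding w_def norm_mult norm_of_real using nq by (intro mult_mono) (use L0 in auto)
    then have "(norm w)\<^sup>2 \<le> ((L\<^sup>2 + L) / 2 * (x\<^sup>2 / k))\<^sup>2" by (intro power_mono) auto
    also have "\<dots> = (L\<^sup>2 + L)\<^sup>2 * (x ^ 4 / k) / (4 * k)"
      by (simp add: power_mult_distrib power_divide power2_eq_square power4_eq_xxxx mult_ac)
    also have "\<dots> \<le> (1 + L) ^ 4 * (x ^ 3 / s) / (4 * k)"
      using L4(3) x3 L0 x by (intro divide_right_mono mult_mono) auto
    finally have a: "5 * (norm w)\<^sup>2 \<le> (1 + L) ^ 4 * (2 * (x ^ 3 / s)) / k"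
    proof -
      assume *: "(norm w)\<^sup>2 \<le> (1 + L) ^ 4 * (x ^ 3 / s) / (4 * k)"
      have "5 * (norm w)\<^sup>2 \<le> 5 * ((1 + L) ^ 4 * (x ^ 3 / s) / (4 * k))" using * by linarith
      also have "\<dots> = (5 / 4) * ((1 + L) ^ 4 * (x ^ 3 / s) / k)" by simp
      also have "\<dots> \<le> 2 * ((1 + L) ^ 4 * (x ^ 3 / s) / k)"
        using L0 x s by (intro mult_right_mono) auto
      finally show ?thesis by (simp add: mult_ac)
    qed
    have b: "x\<^sup>2 * ((L\<^sup>2 + L) / 2) * (2 * \<delta> / k) \<le> (1 + L) ^ 4 * (\<delta> * x\<^sup>2) / k"
    proof -
      have "x\<^sup>2 * (a / 2) * (2 * \<delta> / k) = a * (\<delta> * x\<^sup>2 / k)" for a :: real by simp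
      then have "x\<^sup>2 * ((L\<^sup>2 + L) / 2) * (2 * \<delta> / k) = (L\<^sup>2 + L) * (\<delta> * x\<^sup>2 / k)" .
      also have "\<dots> \<le> (1 + L) ^ 4 * (\<delta> * x\<^sup>2 / k)"
        using L4(2) \<delta>_nonneg by (intro mult_right_mono) auto
      finally show ?thesis by simp
    qed
    have c: "(1 + L) ^ 3 * (120 * C * x ^ 3 / s) / k \<le> (1 + L) ^ 4 * (120 * C * x ^ 3 / s) / k"
      using L4(1) C_ge x s by (intro divide_right_mono mult_right_mono) auto
    have C1: "x ^ 3 / s \<le> C * x ^ 3 / s"
      using C_ge x s mult_right_mono[of 1 C "x ^ 3"] by (intro divide_right_mono) auto
    have "(5 * (norm w)\<^sup>2 + x\<^sup>2 * ((L\<^sup>2 + L) / 2) * (2 * \<delta> / k) + (1 + L) ^ 3 * (120 * C * x ^ 3 / s) / k) * g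
       \<le> ((1 + L) ^ 4 * (2 * (x ^ 3 / s)) / k + (1 + L) ^ 4 * (\<delta> * x\<^sup>2) / k + (1 + L) ^ 4 * (120 * C * x ^ 3 / s) / k) * g"
      using a b c g0 by (intro mult_right_mono add_mono) auto
    also have "\<dots> = (1 + L) ^ 4 * (2 * (x ^ 3 / s) + \<delta> * x\<^sup>2 + 120 * C * x ^ 3 / s) / k * g"
      by (simp add: add_divide_distrib distrib_left)
    also have "\<dots> \<le> (1 + L) ^ 4 * r0 x / k * g"
    proof -
      have "0 \<le> C * x ^ 3 / s" using C_ge x s by simp
      then have "2 * (x ^ 3 / s) + \<delta> * x\<^sup>2 + 120 * C * x ^ 3 / s \<le> r0 x"
        using C1 unfolding r0_def s_def[symmetric] by (simp add: mult.assoc)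
      then show ?thesis using L0 g0 by (intro mult_right_mono divide_right_mono mult_left_mono) auto
    qed
    finally show ?thesis by (simp add: distrib_right mult.assoc)
  qed
  finally show ?thesis unfolding w_def q_def G_def[symmetric] L_def g_def nG[symmetric] .
qed

end

section \<open>Iteration of the one-step estimate\<close>

lemma linear_recursion_bound:
  fixes a :: "nat \<Rightarrow> complex"
  assumes "a 0 = 1" and "\<And>j. j < k \<Longrightarrow> norm (a (Suc j) - \<phi> * a j) \<le> \<rho>"
  shows "j \<le> k \<Longrightarrow> norm (a j - \<phi> ^ j) \<le> \<rho> * (\<Sum>i<j. norm \<phi> ^ i)"
proof (induction j)
  case 0
  then show ?case using assms by simp
next
  case (Suc j)
  have "a (Suc j) - \<phi> ^ Suc j = (a (Suc j) - \<phi> * a j) + \<phi> * (a j - \<phi> ^ j)"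
    by (simp add: algebra_simps)
  then have "norm (a (Suc j) - \<phi> ^ Suc j) \<le> norm (a (Suc j) - \<phi> * a j) + norm \<phi> * norm (a j - \<phi> ^ j)"
    by (metis norm_mult norm_triangle_ineq)
  also have "\<dots> \<le> \<rho> + norm \<phi> * (\<rho> * (\<Sum>i<j. norm \<phi> ^ i))"
    using Suc assms(2)[of j] by (intro add_mono mult_left_mono) auto
  also have "\<dots> = \<rho> * (\<Sum>i<Suc j. norm \<phi> ^ i)"
    by (simp add: sum.lessThan_Suc_shift sum_distrib_left algebra_simps del: sum.lessThan_Suc)
  finally show ?case .
qed

text \<open>Here z will be t^2 x^2 / 2. Compared with the trivial bound \<open>k\<close> the sum
  gains the factor 1 / (1 + z); integrated over the frequency t, this gain yields the order 1 / x of
  the error. For z > 1 it is the geometric series together with 1 / (1 - exp (- y)) \<le> 1 + 1 /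
  y.\<close>

lemma sum_exp_decay_le:
  fixes z :: real
  assumes "0 \<le> z" "0 < k"
  shows "(\<Sum>i<k. exp (- (z / real k)) ^ i) \<le> 2 * real k / (1 + z) + 1"
proof (cases "z \<le> 1")
  case True
  have "(\<Sum>i<k. exp (- (z / real k)) ^ i) \<le> (\<Sum>i<k. 1)"
    using assms by (intro sum_mono power_le_one) auto
  also have "\<dots> = real k" by simp
  also have "\<dots> \<le> 2 * real k / (1 + z)" using True assms by (simp add: field_simps)
  finally show ?thesis by simp
next
  case False
  define y where "y = z / real k"
  have y: "0 < y" using False assms by (simp add: y_def)
  define q where "q = exp (- y)"
  have q: "0 < q" "q < 1" using y by (auto simp: q_def)
  have "(1 + y) * q \<le> 1"
    using exp_ge_add_one_self[of y] unfolding q_def by (simp add: exp_minus field_simps)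
  then have "y / (1 + y) \<le> 1 - q" using y by (simp add: field_simps)
  then have "1 / (1 - q) \<le> 1 / (y / (1 + y))"
    using y q by (intro divide_left_mono mult_pos_pos) auto
  also have "1 / (y / (1 + y)) = 1 + 1 / y" using y by (simp add: field_simps)
  finally have a: "1 / (1 - q) \<le> 1 + 1 / y" .
  have "(\<Sum>i<k. q ^ i) = (1 - q ^ k) / (1 - q)"
    using q by (simp add: sum_gp_strict)
  also have "\<dots> \<le> 1 / (1 - q)" using q by (intro divide_right_mono) auto
  also note a
  also have "1 / y = real k / z" by (simp add: y_def)
  also have "\<dots> \<le> 2 * real k / (1 + z)"
    using False assms by (simp add: field_simps mult_left_le)
  finally show ?thesis by (simp add: q_def y_def)
qed

text \<open>For negative z = - y the claim says that exp y (1 - y + y^2) is at least 1, and the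
  quadratic Taylor polynomial of exp y already achieves this.\<close>

lemma exp_le_one_plus_sq:
  fixes z :: real
  assumes "z \<le> 1"
  shows "exp z \<le> 1 + z + z\<^sup>2"
proof (cases "0 \<le> z")
  case True
  then show ?thesis using exp_bound[of z] assms by simp
next
  case False
  define y where "y = - z"
  have y: "0 \<le> y" using False by (simp add: y_def)
  have "1 \<le> (1 + y + y\<^sup>2 / 2) * (1 - y + y\<^sup>2)"
  proof -
    have "(1 + y + y\<^sup>2 / 2) * (1 - y + y\<^sup>2) = 1 + (y\<^sup>2 + y ^ 3 + y ^ 4) / 2"
      by (simp add: power2_eq_square power3_eq_cube power4_eq_xxxx field_simps)
    then show ?thesis using y by simp
  qed
  also have "\<dots> \<le> exp y * (1 - y + y\<^sup>2)"
  proof (rule mult_right_mono)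
    show "1 + y + y\<^sup>2 / 2 \<le> exp y" using exp_lower_Taylor_quadratic[OF y] by simp
    show "0 \<le> 1 - y + y\<^sup>2"
      using zero_le_power2[of "y - 1/2"] by (simp add: power2_eq_square algebra_simps)
  qed
  finally have "exp (- y) \<le> 1 - y + y\<^sup>2" by (simp add: exp_minus field_simps)
  then show ?thesis by (simp add: y_def)
qed

context bounded_mds
begin

lemma r0_nonneg: "0 \<le> x \<Longrightarrow> 0 \<le> r0 x"
  using \<delta>_nonneg C_ge unfolding r0_def by simp

lemma real_exp_U_step:
  assumes l: "0 \<le> l" "l \<le> 2" and j: "j < k" and x: "0 \<le> x" "x \<le> sqrt k"
  shows "\<bar>expectation (\<lambda>\<omega>. exp (l * U x (Suc j) \<omega>)) - exp ((l\<^sup>2 - l) / 2 * (x\<^sup>2 / k)) * expectation (\<lambda>\<omega>. exp (l * U x j \<omega>))\<bar>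
    \<le> (1 + l) ^ 4 * r0 x / k * expectation (\<lambda>\<omega>. exp (l * U x j \<omega>))"
proof -
  have l2: "l\<^sup>2 - l \<le> 2"
    using mult_mono[of l 2 "l - 1" 1] l mult_nonneg_nonpos[of l "l - 1"]
    by (cases "l \<le> 1") (auto simp: power2_eq_square algebra_simps)
  have c: "(\<integral>\<omega>. exp (of_real l * of_real (U x i \<omega>)) \<partial>M) = complex_of_real (expectation (\<lambda>\<omega>. exp (l * U x i \<omega>)))" for i
    by (simp flip: integral_complex_of_real exp_of_real)
  have e: "exp (((of_real l)\<^sup>2 - of_real l) / 2 * of_real (x\<^sup>2 / k)) = complex_of_real (exp ((l\<^sup>2 - l) / 2 * (x\<^sup>2 / k)))"
    by (simp flip: exp_of_real)
  have "norm (complex_of_real (expectation (\<lambda>\<omega>. exp (l * U x (Suc j) \<omega>)) - exp ((l\<^sup>2 - l) / 2 * (x\<^sup>2 / k)) * expectation (\<lambda>\<omega>. exp (l * U x j \<omega>))))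
    \<le> (1 + l) ^ 4 * r0 x / k * expectation (\<lambda>\<omega>. exp (l * U x j \<omega>))"
    using exp_U_step[of "of_real l" j x] l j x l2 unfolding c e by simp
  then show ?thesis by (simp only: norm_of_real)
qed

text \<open>At \<open>l = 1\<close> the Gaussian factor is 1, so each step multiplies the moment by
  at most \<open>1 + 16 * r0 x / k\<close>, with 16 = (1 + 1)^4.\<close>

lemma exp_U_le:
  assumes j: "j \<le> k" and x: "0 \<le> x" "x \<le> sqrt k"
  shows "expectation (\<lambda>\<omega>. exp (U x j \<omega>)) \<le> exp (16 * r0 x)"
proof -
  have "expectation (\<lambda>\<omega>. exp (U x j \<omega>)) \<le> (1 + 16 * r0 x / k) ^ j" using j
  proof (induction j)
    case 0
    then show ?case by (simp add: U_def prob_space)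
  next
    case (Suc j)
    have "expectation (\<lambda>\<omega>. exp (U x (Suc j) \<omega>)) \<le> (1 + 16 * r0 x / k) * expectation (\<lambda>\<omega>. exp (U x j \<omega>))"
      using real_exp_U_step[of 1 j x] Suc x by (simp add: abs_le_iff algebra_simps)
    also have "\<dots> \<le> (1 + 16 * r0 x / k) * (1 + 16 * r0 x / k) ^ j"
      using Suc r0_nonneg[OF x(1)] by (intro mult_left_mono) auto
    finally show ?case by simp
  qed
  also have "\<dots> \<le> (1 + 16 * r0 x / k) ^ k"
    using j r0_nonneg[OF x(1)] by (intro power_increasing) auto
  also have "\<dots> \<le> exp (16 * r0 x / k) ^ k"
    using r0_nonneg[OF x(1)] by (intro power_mono exp_ge_add_one_self) auto
  also have "\<dots> = exp (16 * r0 x)" using k_pos by (simp flip: exp_of_nat_mult)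
  finally show ?thesis .
qed

text \<open>For real \<open>l\<close> the error of a step is proportional to the very moment that is
  being followed. The moment is therefore trapped between powers of \<open>\<phi> - \<rho>\<close>
  and \<open>\<phi> + \<rho>\<close>, and the error stays multiplicative even where the moment is
  exponentially large or small. The factor 81 in \<open>\<rho>\<close> is (1 + 2)^4.\<close>

lemma exp_mult_U_bounds:
  assumes l: "0 \<le> l" "l \<le> 2" and x: "0 \<le> x" "x \<le> sqrt k" and small: "400 * r0 x \<le> k"
  shows "expectation (\<lambda>\<omega>. exp (l * U x k \<omega>)) \<le> exp ((l\<^sup>2 - l) / 2 * x\<^sup>2 + 400 * r0 x)"
    and "exp ((l\<^sup>2 - l) / 2 * x\<^sup>2 - 400 * r0 x) \<le> expectation (\<lambda>\<omega>. exp (l * U x k \<omega>))"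
proof -
  define \<phi> where "\<phi> = exp ((l\<^sup>2 - l) / 2 * (x\<^sup>2 / k))"
  define \<rho> where "\<rho> = 81 * r0 x / k"
  have r0: "0 \<le> r0 x" using r0_nonneg[OF x(1)] .
  have \<rho>0: "0 \<le> \<rho>" using r0 by (simp add: \<rho>_def)
  have l81: "(1 + l) ^ 4 \<le> 81" using power_mono[of "1 + l" 3 4] l by simp
  have xk: "x\<^sup>2 / k \<le> 1" using x k_pos power_mono[of x "sqrt k" 2] by simp
  have "- 1/4 \<le> l\<^sup>2 - l" using zero_le_power2[of "l - 1/2"] by (simp add: power2_eq_square algebra_simps)
  then have "- 1/8 * (x\<^sup>2 / k) \<le> (l\<^sup>2 - l) / 2 * (x\<^sup>2 / k)"
    by (intro mult_right_mono) auto
  then have "- 1/4 \<le> (l\<^sup>2 - l) / 2 * (x\<^sup>2 / k)"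
    using xk by linarith
  moreover have "1 + (l\<^sup>2 - l) / 2 * (x\<^sup>2 / k) \<le> \<phi>" unfolding \<phi>_def by (rule exp_ge_add_one_self)
  ultimately have \<phi>: "3/4 \<le> \<phi>" by linarith
  define f where "f = (\<lambda>j. expectation (\<lambda>\<omega>. exp (l * U x j \<omega>)))"
  have f0: "0 \<le> f j" for j by (simp add: f_def)
  have step: "\<bar>f (Suc j) - \<phi> * f j\<bar> \<le> \<rho> * f j" if "j < k" for j
  proof -
    have "\<bar>f (Suc j) - \<phi> * f j\<bar> \<le> (1 + l) ^ 4 * r0 x / k * f j"
      using real_exp_U_step[OF l that x] by (simp add: f_def \<phi>_def)
    also have "\<dots> \<le> \<rho> * f j"
      unfolding \<rho>_def using l81 r0 f0 by (intro mult_right_mono divide_right_mono) auto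
    finally show ?thesis .
  qed
  have "r0 x / k \<le> 1 / 400" using small k_pos by (simp add: divide_le_eq)
  then have \<rho>small: "\<rho> \<le> \<phi> / 2" using \<phi> unfolding \<rho>_def by linarith
  have up: "f j \<le> (\<phi> + \<rho>) ^ j" if "j \<le> k" for j using that
  proof (induction j)
    case 0
    then show ?case by (simp add: f_def U_def prob_space)
  next
    case (Suc j)
    have "f (Suc j) \<le> (\<phi> + \<rho>) * f j" using step[of j] Suc by (simp add: abs_le_iff algebra_simps)
    also have "\<dots> \<le> (\<phi> + \<rho>) * (\<phi> + \<rho>) ^ j" using Suc \<phi> \<rho>0 by (intro mult_left_mono) auto
    finally show ?case by simp
  qed
  have lo: "(\<phi> - \<rho>) ^ j \<le> f j" if "j \<le> k" for j using that
  proof (induction j)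
    case 0
    then show ?case by (simp add: f_def U_def prob_space)
  next
    case (Suc j)
    have "(\<phi> - \<rho>) * (\<phi> - \<rho>) ^ j \<le> (\<phi> - \<rho>) * f j" using Suc \<phi> \<rho>small by (intro mult_left_mono) auto
    also have "\<dots> \<le> f (Suc j)" using step[of j] Suc by (simp add: abs_le_iff algebra_simps)
    finally show ?case by simp
  qed
  have \<phi>k: "\<phi> ^ k = exp ((l\<^sup>2 - l) / 2 * x\<^sup>2)"
    unfolding \<phi>_def using k_pos by (simp flip: exp_of_nat_mult)
  \<comment> \<open>Relative error of one step. The bound \<open>3/4 \<le> \<phi>\<close> turns 81
    into 108, and the doubling in the lower bound still stays below 400.\<close>
  define y where "y = \<rho> / \<phi>"
  have y: "0 \<le> y" "y \<le> 1/2" using \<phi> \<rho>0 \<rho>small by (auto simp: y_def field_simps)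
  have yk: "k * y \<le> 108 * r0 x"
  proof -
    have "y \<le> \<rho> / (3/4)" unfolding y_def using \<phi> \<rho>0 by (intro divide_left_mono) auto
    then have "k * y \<le> k * (\<rho> / (3/4))" by (intro mult_left_mono) auto
    also have "\<dots> = 108 * r0 x" using k_pos by (simp add: \<rho>_def)
    finally show ?thesis .
  qed
  have "f k \<le> (\<phi> * (1 + y)) ^ k" using up[of k] \<phi> by (simp add: y_def distrib_left)
  also have "\<dots> = \<phi> ^ k * (1 + y) ^ k" by (rule power_mult_distrib)
  also have "\<dots> \<le> \<phi> ^ k * exp y ^ k"
    using y \<phi> by (intro mult_left_mono power_mono exp_ge_add_one_self) auto
  also have "\<dots> = exp ((l\<^sup>2 - l) / 2 * x\<^sup>2 + k * y)"
    unfolding \<phi>k by (simp flip: exp_of_nat_mult exp_add)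
  also have "\<dots> \<le> exp ((l\<^sup>2 - l) / 2 * x\<^sup>2 + 400 * r0 x)" using yk r0 by simp
  finally show "expectation (\<lambda>\<omega>. exp (l * U x k \<omega>)) \<le> exp ((l\<^sup>2 - l) / 2 * x\<^sup>2 + 400 * r0 x)"
    by (simp add: f_def)
  have e2: "exp (- (2 * y)) \<le> 1 - y"
  proof -
    have "1 \<le> (1 - y) * (1 + 2 * y)"
      using y mult_nonneg_nonneg[of y "1 - 2 * y"] by (simp add: algebra_simps)
    also have "\<dots> \<le> (1 - y) * exp (2 * y)"
      using y by (intro mult_left_mono exp_ge_add_one_self) auto
    finally show ?thesis by (simp add: exp_minus field_simps)
  qed
  have "- (400 * r0 x) \<le> k * (- (2 * y))" using yk r0 by (simp add: mult.commute[of y])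
  then have "exp ((l\<^sup>2 - l) / 2 * x\<^sup>2 - 400 * r0 x) \<le> exp ((l\<^sup>2 - l) / 2 * x\<^sup>2 + k * (- (2 * y)))"
    unfolding exp_le_cancel_iff by linarith
  also have "\<dots> = \<phi> ^ k * exp (- (2 * y)) ^ k"
    unfolding \<phi>k by (simp flip: exp_of_nat_mult exp_add)
  also have "\<dots> \<le> \<phi> ^ k * (1 - y) ^ k"
    using e2 \<phi> by (intro mult_left_mono power_mono) auto
  also have "\<dots> = (\<phi> * (1 - y)) ^ k" by (simp add: power_mult_distrib)
  also have "\<dots> = (\<phi> - \<rho>) ^ k" using \<phi> by (simp add: y_def right_diff_distrib)
  also have "\<dots> \<le> f k" using lo by simp
  finally show "exp ((l\<^sup>2 - l) / 2 * x\<^sup>2 - 400 * r0 x) \<le> expectation (\<lambda>\<omega>. exp (l * U x k \<omega>))"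
    by (simp add: f_def)
qed

text \<open>Since \<open>Re l = 1\<close>, the moment that multiplies the error of each step is the
  one bounded by \<open>exp_U_le\<close>, uniformly in the step. The modulus of
  \<open>\<phi>\<close> is strictly below 1 for t \<noteq> 0 and x > 0, so early errors are damped
  by later steps; the sum of these damping factors gives the decay in \<open>t\<close>.\<close>

lemma tilted_char_bound:
  assumes x: "0 \<le> x" "x \<le> sqrt k"
  shows "norm ((\<integral>\<omega>. exp ((1 + \<i> * of_real t) * of_real (U x k \<omega>)) \<partial>M) - exp ((\<i> * of_real t - of_real (t\<^sup>2)) / 2 * of_real (x\<^sup>2)))
    \<le> 16 * exp (16 * r0 x) * r0 x * (1 + \<bar>t\<bar>) ^ 4 * (2 / (1 + t\<^sup>2 * x\<^sup>2 / 2) + 1 / k)"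
proof -
  define l where "l = 1 + \<i> * complex_of_real t"
  have Rel: "Re l = 1" by (simp add: l_def)
  have l2: "l\<^sup>2 - l = \<i> * of_real t - of_real (t\<^sup>2)"
    by (simp add: l_def power2_eq_square algebra_simps)
  have nl: "(1 + norm l) ^ 4 \<le> 16 * (1 + \<bar>t\<bar>) ^ 4"
  proof -
    have "norm l \<le> 1 + \<bar>t\<bar>" unfolding l_def by (rule order.trans[OF norm_triangle_ineq]) (simp add: norm_mult)
    then have "(1 + norm l) ^ 4 \<le> (2 * (1 + \<bar>t\<bar>)) ^ 4" by (intro power_mono) auto
    then show ?thesis unfolding power_mult_distrib by simp
  qed
  define \<phi> where "\<phi> = exp ((l\<^sup>2 - l) / 2 * of_real (x\<^sup>2 / k))"
  define z where "z = t\<^sup>2 * x\<^sup>2 / 2"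
  have n\<phi>: "norm \<phi> = exp (- (z / k))"
    unfolding \<phi>_def l2 by (simp add: norm_exp_eq_Re z_def)
  have \<phi>k: "\<phi> ^ k = exp ((\<i> * of_real t - of_real (t\<^sup>2)) / 2 * of_real (x\<^sup>2))"
    unfolding \<phi>_def l2 using k_pos by (simp flip: exp_of_nat_mult)
  define a where "a = (\<lambda>j. \<integral>\<omega>. exp (l * of_real (U x j \<omega>)) \<partial>M)"
  define \<rho> where "\<rho> = 16 * (1 + \<bar>t\<bar>) ^ 4 * r0 x / k * exp (16 * r0 x)"
  have r0: "0 \<le> r0 x" using r0_nonneg[OF x(1)] .
  have "norm (a k - \<phi> ^ k) \<le> \<rho> * (\<Sum>i<k. norm \<phi> ^ i)"
  proof (rule linear_recursion_bound[where k=k])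
    show "a 0 = 1" by (simp add: a_def U_def prob_space)
    fix j assume j: "j < k"
    have "norm (a (Suc j) - \<phi> * a j) \<le> (1 + norm l) ^ 4 * r0 x / k * expectation (\<lambda>\<omega>. exp (Re l * U x j \<omega>))"
      unfolding a_def \<phi>_def
      by (rule exp_U_step) (use x j zero_le_power2[of t] in \<open>auto simp: Rel l2 intro: order.trans[of _ 0]\<close>)
    also have "\<dots> \<le> \<rho>"
      unfolding \<rho>_def Rel using nl r0 exp_U_le[of j x] j x
      by (intro mult_mono divide_right_mono mult_right_mono) auto
    finally show "norm (a (Suc j) - \<phi> * a j) \<le> \<rho>" .
  qed simp
  also have "\<dots> \<le> \<rho> * (2 * real k / (1 + z) + 1)"
  proof (rule mult_left_mono)
    show "(\<Sum>i<k. norm \<phi> ^ i) \<le> 2 * real k / (1 + z) + 1"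
      unfolding n\<phi> by (rule sum_exp_decay_le) (use k_pos in \<open>auto simp: z_def\<close>)
    show "0 \<le> \<rho>" using r0 by (simp add: \<rho>_def)
  qed
  also have "\<dots> = 16 * exp (16 * r0 x) * r0 x * (1 + \<bar>t\<bar>) ^ 4 * (2 / (1 + z) + 1 / k)"
  proof -
    have "(2 * real k / (1 + z) + 1) / k = 2 / (1 + z) + 1 / k"
      using k_pos by (simp add: add_divide_distrib)
    moreover have "\<rho> * Y = 16 * exp (16 * r0 x) * r0 x * (1 + \<bar>t\<bar>) ^ 4 * (Y / k)" for Y
      unfolding \<rho>_def by simp
    ultimately show ?thesis by (simp only:)
  qed
  finally show ?thesis by (simp add: a_def \<phi>k z_def l_def)
qed

text \<open>Without tilting, \<open>Re l = 0\<close> and the moment in the error is 1. Pointwise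
  convergence of characteristic functions is all that bounded \<open>x\<close> require, so the
  damping by \<open>\<phi>\<close> is given away.\<close>

lemma char_U_bound:
  assumes x: "0 \<le> x" "x \<le> sqrt k"
  shows "norm ((\<integral>\<omega>. exp (\<i> * of_real t * of_real (U x k \<omega>)) \<partial>M) - exp ((- of_real (t\<^sup>2) - \<i> * of_real t) / 2 * of_real (x\<^sup>2)))
    \<le> (1 + \<bar>t\<bar>) ^ 4 * r0 x"
proof -
  define l where "l = \<i> * complex_of_real t"
  have Rel: "Re l = 0" by (simp add: l_def)
  have nl: "norm l = \<bar>t\<bar>" by (simp add: l_def norm_mult)
  have l2: "l\<^sup>2 - l = - of_real (t\<^sup>2) - \<i> * of_real t"
    by (simp add: l_def power2_eq_square algebra_simps)
  define \<phi> where "\<phi> = exp ((l\<^sup>2 - l) / 2 * of_real (x\<^sup>2 / k))"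
  have n\<phi>: "norm \<phi> \<le> 1"
    unfolding \<phi>_def l2 by (simp add: norm_exp_eq_Re)
  have \<phi>k: "\<phi> ^ k = exp ((- of_real (t\<^sup>2) - \<i> * of_real t) / 2 * of_real (x\<^sup>2))"
    unfolding \<phi>_def l2 using k_pos by (simp flip: exp_of_nat_mult)
  define a where "a = (\<lambda>j. \<integral>\<omega>. exp (l * of_real (U x j \<omega>)) \<partial>M)"
  define \<rho> where "\<rho> = (1 + \<bar>t\<bar>) ^ 4 * r0 x / k"
  have r0: "0 \<le> r0 x" using r0_nonneg[OF x(1)] .
  have "norm (a k - \<phi> ^ k) \<le> \<rho> * (\<Sum>i<k. norm \<phi> ^ i)"
  proof (rule linear_recursion_bound[where k=k])
    show "a 0 = 1" by (simp add: a_def U_def prob_space)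
    fix j assume j: "j < k"
    have "norm (a (Suc j) - \<phi> * a j) \<le> (1 + norm l) ^ 4 * r0 x / k * expectation (\<lambda>\<omega>. exp (Re l * U x j \<omega>))"
      unfolding a_def \<phi>_def
      by (rule exp_U_step) (use x j zero_le_power2[of t] in \<open>auto simp: Rel l2 intro: order.trans[of _ 0]\<close>)
    also have "\<dots> = \<rho>" unfolding \<rho>_def Rel nl by (simp add: prob_space)
    finally show "norm (a (Suc j) - \<phi> * a j) \<le> \<rho>" .
  qed simp
  also have "\<dots> \<le> \<rho> * (\<Sum>i<k. 1)"
    using n\<phi> r0 by (intro mult_left_mono sum_mono power_le_one) (auto simp: \<rho>_def)
  also have "\<dots> = (1 + \<bar>t\<bar>) ^ 4 * r0 x" using k_pos by (simp add: \<rho>_def)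
  finally show ?thesis by (simp add: a_def \<phi>k l_def)
qed

section \<open>Concentration of the sum of squares\<close>

lemma exp_square_step:
  assumes th: "th * b\<^sup>2 \<le> 1" "\<bar>sg\<bar> = 1" "0 \<le> th" and j: "j \<le> k"
  shows "expectation (\<lambda>\<omega>. exp (sg * th * part_sq j \<omega>)) \<le> exp (j * (sg * th / k + th * \<delta> / k + th\<^sup>2 * C / (real k)\<^sup>2))"
  using j
proof (induction j)
  case 0
  then show ?case by (simp add: part_sq_def prob_space)
next
  case (Suc j)
  then have j: "j < k" by simp
  define G where "G = (\<lambda>\<omega>. exp (sg * th * part_sq j \<omega>))"
  have GF: "G \<in> borel_measurable (F j)"
    unfolding G_def part_sq_def using \<xi>_measurable_F[of _ j] j
    by (intro measurable_compose[OF _ borel_measurable_exp] borel_measurable_times borel_measurable_const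
        borel_measurable_sum borel_measurable_power) auto
  have [measurable]: "G \<in> borel_measurable M" "\<xi> j \<in> borel_measurable M"
    using measurable_F_M[OF GF] \<xi>_measurable[OF j] by auto
  have "AE \<omega> in M. \<forall>i\<in>{..<j}. \<bar>\<xi> i \<omega>\<bar> \<le> b"
    using bounded j by (intro AE_finite_allI) auto
  then have Gb: "AE \<omega> in M. \<bar>G \<omega>\<bar> \<le> exp (th * (j * b\<^sup>2))"
  proof eventually_elim
    case (elim \<omega>)
    have "0 \<le> part_sq j \<omega>" by (simp add: part_sq_def sum_nonneg)
    moreover have "part_sq j \<omega> \<le> (\<Sum>i<j. b\<^sup>2)"
      unfolding part_sq_def
    proof (rule sum_mono)
      fix i assume "i \<in> {..<j}"
      with elim have "\<bar>\<xi> i \<omega>\<bar> \<le> b" by auto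
      then show "(\<xi> i \<omega>)\<^sup>2 \<le> b\<^sup>2" using power_mono[of "\<bar>\<xi> i \<omega>\<bar>" b 2] by simp
    qed
    ultimately have "\<bar>sg * th * part_sq j \<omega>\<bar> \<le> th * (j * b\<^sup>2)"
      using th(2,3) by (simp add: abs_mult mult_left_mono)
    then show ?case by (simp add: G_def)
  qed
  have xb: "AE \<omega> in M. \<bar>G \<omega>\<bar> * \<bar>\<xi> j \<omega>\<bar> ^ p \<le> exp (th * (j * b\<^sup>2)) * b ^ p" for p
    using Gb bounded[OF j] by eventually_elim (intro mult_mono power_mono, auto)
  have int: "integrable M (\<lambda>\<omega>. G \<omega> * \<bar>\<xi> j \<omega>\<bar> ^ p)" for p
    by (rule integrable_AE_bounded[where c="exp (th * (j * b\<^sup>2)) * b ^ p"]) (use xb[of p] in \<open>auto simp: abs_mult\<close>)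
  have iG: "integrable M G" and i2: "integrable M (\<lambda>\<omega>. G \<omega> * (\<xi> j \<omega>)\<^sup>2)" and i4: "integrable M (\<lambda>\<omega>. G \<omega> * (\<xi> j \<omega>) ^ 4)"
    using int[of 0] int[of 2] int[of 4] by auto
  have Gpos: "0 \<le> G \<omega>" for \<omega> by (simp add: G_def)
  have absG2: "\<bar>G \<omega>\<bar> = G \<omega>" for \<omega> by (simp add: G_def)
  define g where "g = expectation G"
  have g0: "0 \<le> g" unfolding g_def using Gpos by simp
  have absG: "expectation (\<lambda>\<omega>. \<bar>G \<omega>\<bar>) = g" unfolding g_def using Gpos by simp
  have "expectation (\<lambda>\<omega>. exp (sg * th * part_sq (Suc j) \<omega>)) = expectation (\<lambda>\<omega>. G \<omega> * exp (sg * th * (\<xi> j \<omega>)\<^sup>2))"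
    by (simp add: G_def part_sq_def distrib_left exp_add)
  \<comment> \<open>The hypothesis \<open>th * b\<^sup>2 \<le> 1\<close> keeps the exponent in the
    range of \<open>exp_le_one_plus_sq\<close>; the quadratic term there is a fourth power of the
    increment, for which a conditional bound is available.\<close>
  also have "\<dots> \<le> expectation (\<lambda>\<omega>. G \<omega> + sg * th * (G \<omega> * (\<xi> j \<omega>)\<^sup>2) + th\<^sup>2 * (G \<omega> * \<xi> j \<omega> ^ 4))"
  proof (rule integral_mono_AE)
    have bnd: "AE \<omega> in M. exp (sg * th * (\<xi> j \<omega>)\<^sup>2) \<le> 1 + sg * th * (\<xi> j \<omega>)\<^sup>2 + th\<^sup>2 * \<xi> j \<omega> ^ 4"
      using bounded[OF j]
    proof eventually_elim
      case (elim \<omega>)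
      have "(\<xi> j \<omega>)\<^sup>2 \<le> b\<^sup>2" using power_mono[OF elim, of 2] by simp
      then have "th * (\<xi> j \<omega>)\<^sup>2 \<le> 1" using th mult_left_mono[of "(\<xi> j \<omega>)\<^sup>2" "b\<^sup>2" th] by linarith
      moreover have "sg * (th * (\<xi> j \<omega>)\<^sup>2) \<le> th * (\<xi> j \<omega>)\<^sup>2"
        using th(2,3) mult_right_mono[of sg 1 "th * (\<xi> j \<omega>)\<^sup>2"] by auto
      ultimately have "sg * th * (\<xi> j \<omega>)\<^sup>2 \<le> 1" by (simp add: mult.assoc)
      moreover have "sg\<^sup>2 = 1" using th(2) by (metis power2_abs one_power2)
      ultimately show ?case
        using exp_le_one_plus_sq[of "sg * th * (\<xi> j \<omega>)\<^sup>2"] by (simp add: power_mult_distrib)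
    qed
    show "AE \<omega> in M. G \<omega> * exp (sg * th * (\<xi> j \<omega>)\<^sup>2) \<le> G \<omega> + sg * th * (G \<omega> * (\<xi> j \<omega>)\<^sup>2) + th\<^sup>2 * (G \<omega> * \<xi> j \<omega> ^ 4)"
      using bnd
    proof eventually_elim
      case (elim \<omega>)
      show ?case using mult_left_mono[OF elim Gpos[of \<omega>]] by (simp add: algebra_simps)
    qed
    show "integrable M (\<lambda>\<omega>. G \<omega> + sg * th * (G \<omega> * (\<xi> j \<omega>)\<^sup>2) + th\<^sup>2 * (G \<omega> * \<xi> j \<omega> ^ 4))"
      using iG i2 i4 by simp
    then show "integrable M (\<lambda>\<omega>. G \<omega> * exp (sg * th * (\<xi> j \<omega>)\<^sup>2))"
    proof (rule Bochner_Integration.integrable_bound)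
      show "AE \<omega> in M. norm (G \<omega> * exp (sg * th * (\<xi> j \<omega>)\<^sup>2)) \<le> norm (G \<omega> + sg * th * (G \<omega> * (\<xi> j \<omega>)\<^sup>2) + th\<^sup>2 * (G \<omega> * \<xi> j \<omega> ^ 4))"
        using bnd
      proof eventually_elim
        case (elim \<omega>)
        have "G \<omega> * exp (sg * th * (\<xi> j \<omega>)\<^sup>2) \<le> G \<omega> + sg * th * (G \<omega> * (\<xi> j \<omega>)\<^sup>2) + th\<^sup>2 * (G \<omega> * \<xi> j \<omega> ^ 4)"
          using mult_left_mono[OF elim Gpos[of \<omega>]] by (simp add: algebra_simps)
        moreover have "norm (G \<omega> * exp (sg * th * (\<xi> j \<omega>)\<^sup>2)) = G \<omega> * exp (sg * th * (\<xi> j \<omega>)\<^sup>2)"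
          using Gpos[of \<omega>] by simp
        ultimately show ?case unfolding real_norm_def by linarith
      qed
    qed simp
  qed
  also have "\<dots> = g + sg * th * expectation (\<lambda>\<omega>. G \<omega> * (\<xi> j \<omega>)\<^sup>2) + th\<^sup>2 * expectation (\<lambda>\<omega>. G \<omega> * \<xi> j \<omega> ^ 4)"
    using iG i2 i4 by (simp add: g_def)
  also have "\<dots> \<le> g + (sg * th / k * g + th * \<delta> / k * g) + th\<^sup>2 * (C / (real k)\<^sup>2 * g)"
  proof -
    have v: "\<bar>expectation (\<lambda>\<omega>. G \<omega> * (\<xi> j \<omega>)\<^sup>2) - g / k\<bar> \<le> \<delta> / k * g"
    proof -
      have "expectation (\<lambda>\<omega>. G \<omega> * ((\<xi> j \<omega>)\<^sup>2 - 1 / k)) = expectation (\<lambda>\<omega>. G \<omega> * (\<xi> j \<omega>)\<^sup>2) - g / k"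
        using i2 iG by (simp add: right_diff_distrib g_def)
      then show ?thesis using variance[OF j GF Gb] by (simp add: absG)
    qed
    have "\<bar>sg * th * (expectation (\<lambda>\<omega>. G \<omega> * (\<xi> j \<omega>)\<^sup>2) - g / k)\<bar> \<le> th * (\<delta> / k * g)"
      using mult_left_mono[OF v th(3)] th(2,3) by (simp add: abs_mult)
    then have "sg * th * expectation (\<lambda>\<omega>. G \<omega> * (\<xi> j \<omega>)\<^sup>2) \<le> sg * th / k * g + th * \<delta> / k * g"
      by (simp add: right_diff_distrib abs_le_iff)
    moreover have "expectation (\<lambda>\<omega>. G \<omega> * \<xi> j \<omega> ^ 4) \<le> C / (real k)\<^sup>2 * g"
      using fourth[OF j GF Gb] unfolding absG2 g_def[symmetric] .
    ultimately show ?thesis by (intro add_mono mult_left_mono) auto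
  qed
  also have "\<dots> = (1 + (sg * th / k + th * \<delta> / k + th\<^sup>2 * C / (real k)\<^sup>2)) * g"
    by (simp add: algebra_simps)
  also have "\<dots> \<le> exp (sg * th / k + th * \<delta> / k + th\<^sup>2 * C / (real k)\<^sup>2) * g"
    using g0 by (intro mult_right_mono exp_ge_add_one_self) auto
  also have "\<dots> \<le> exp (sg * th / k + th * \<delta> / k + th\<^sup>2 * C / (real k)\<^sup>2) * exp (j * (sg * th / k + th * \<delta> / k + th\<^sup>2 * C / (real k)\<^sup>2))"
    using Suc by (intro mult_left_mono) (auto simp: g_def G_def)
  also have "\<dots> = exp (Suc j * (sg * th / k + th * \<delta> / k + th\<^sup>2 * C / (real k)\<^sup>2))"
    by (simp add: exp_add[symmetric] distrib_right)
  finally show ?case .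
qed

text \<open>Markov's inequality for \<open>exp (sg * th * part_sq k \<omega>)\<close> with both
  signs. Of the ideal exponent \<open>th * t\<close> one half is lost to the variance error and one
  quarter to the fourth moments, which leaves a quarter.\<close>

lemma part_sq_deviation:
  assumes t: "0 < t" "2 * \<delta> \<le> t" and th: "th * b\<^sup>2 \<le> 1" "0 < th" "4 * C * th \<le> t * k"
  shows "prob {\<omega> \<in> space M. \<bar>part_sq k \<omega> - 1\<bar> \<ge> t} \<le> 2 * exp (- (th * t / 4))"
proof -
  have int: "integrable M (\<lambda>\<omega>. exp (sg * th * part_sq k \<omega>))" if "\<bar>sg\<bar> = 1" for sg
  proof -
    have "AE \<omega> in M. \<forall>i\<in>{..<k}. \<bar>\<xi> i \<omega>\<bar> \<le> b"
      using bounded by (intro AE_finite_allI) auto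
    then have Gb: "AE \<omega> in M. \<bar>exp (sg * th * part_sq k \<omega>)\<bar> \<le> exp (th * (k * b\<^sup>2))"
    proof eventually_elim
      case (elim \<omega>)
      have "0 \<le> part_sq k \<omega>" by (simp add: part_sq_def sum_nonneg)
      moreover have "part_sq k \<omega> \<le> (\<Sum>i<k. b\<^sup>2)"
        unfolding part_sq_def
      proof (rule sum_mono)
        fix i assume "i \<in> {..<k}"
        with elim have "\<bar>\<xi> i \<omega>\<bar> \<le> b" by auto
        then show "(\<xi> i \<omega>)\<^sup>2 \<le> b\<^sup>2" using power_mono[of "\<bar>\<xi> i \<omega>\<bar>" b 2] by simp
      qed
      ultimately have "\<bar>sg * th * part_sq k \<omega>\<bar> \<le> th * (k * b\<^sup>2)"
        using th that by (simp add: abs_mult mult_left_mono)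
      then show ?case by simp
    qed
    show ?thesis by (rule integrable_AE_bounded) (use Gb in auto)
  qed
  have one_side: "prob {\<omega> \<in> space M. sg * (part_sq k \<omega> - 1) \<ge> t} \<le> exp (- (th * t / 4))" if "\<bar>sg\<bar> = 1" for sg
  proof -
    have "prob {\<omega> \<in> space M. sg * (part_sq k \<omega> - 1) \<ge> t}
      = prob {\<omega> \<in> space M. exp (sg * th * part_sq k \<omega>) \<ge> exp (th * (t + sg))}"
    proof -
      have "sg * (q - 1) \<ge> t \<longleftrightarrow> exp (sg * th * q) \<ge> exp (th * (t + sg))" for q :: real
      proof -
        have "exp (sg * th * q) \<ge> exp (th * (t + sg)) \<longleftrightarrow> th * (t + sg) \<le> th * (sg * q)" by (simp add: mult_ac)
        also have "\<dots> \<longleftrightarrow> t + sg \<le> sg * q" using th(2) by simp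
        finally show ?thesis by (auto simp: algebra_simps)
      qed
      then show ?thesis by simp
    qed
    also have "\<dots> \<le> expectation (\<lambda>\<omega>. exp (sg * th * part_sq k \<omega>)) / exp (th * (t + sg))"
      by (rule integral_Markov_inequality_measure[OF int[OF that], where A="{}"]) auto
    also have "\<dots> \<le> exp (k * (sg * th / k + th * \<delta> / k + th\<^sup>2 * C / (real k)\<^sup>2)) / exp (th * (t + sg))"
      using exp_square_step[of th sg k] th that by (intro divide_right_mono) auto
    also have "\<dots> = exp (k * (sg * th / k + th * \<delta> / k + th\<^sup>2 * C / (real k)\<^sup>2) - th * (t + sg))"
      by (simp add: exp_diff)
    also have "k * (sg * th / k + th * \<delta> / k + th\<^sup>2 * C / (real k)\<^sup>2) - th * (t + sg) = th * (\<delta> + C * th / k - t)"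
      using k_pos by (simp add: field_simps power2_eq_square)
    also have "exp \<dots> \<le> exp (- (th * t / 4))"
    proof -
      have "C * th / k \<le> t / 4" using th(3) k_pos by (simp add: field_simps)
      then have "\<delta> + C * th / k - t \<le> - t / 4" using t by linarith
      then have "th * (\<delta> + C * th / k - t) \<le> th * (- t / 4)" using th(2) by (intro mult_left_mono) auto
      then show ?thesis by simp
    qed
    finally show ?thesis .
  qed
  have "prob {\<omega> \<in> space M. \<bar>part_sq k \<omega> - 1\<bar> \<ge> t}
    \<le> prob ({\<omega> \<in> space M. 1 * (part_sq k \<omega> - 1) \<ge> t} \<union> {\<omega> \<in> space M. -1 * (part_sq k \<omega> - 1) \<ge> t})"
    by (intro finite_measure_mono) (auto simp: abs_real_def)
  also have "\<dots> \<le> prob {\<omega> \<in> space M. 1 * (part_sq k \<omega> - 1) \<ge> t} + prob {\<omega> \<in> space M. -1 * (part_sq k \<omega> - 1) \<ge> t}"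
    by (rule measure_Un_le) auto
  also have "\<dots> \<le> exp (- (th * t / 4)) + exp (- (th * t / 4))"
    by (intro add_mono one_side) auto
  finally show ?thesis by simp
qed

end

section \<open>Smoothed local limit theorem and tail bounds\<close>

lemma integral_std_normal_cexp:
  "integrable lborel (\<lambda>s. of_real (std_normal_density s) * exp (\<i> * of_real (y * s)))"
  "(\<integral>s. of_real (std_normal_density s) * exp (\<i> * of_real (y * s)) \<partial>lborel) = complex_of_real (exp (- y\<^sup>2 / 2))"
proof -
  show "integrable lborel (\<lambda>s. of_real (std_normal_density s) * exp (\<i> * of_real (y * s)))"
    by (rule Bochner_Integration.integrable_bound[OF integrable_normal_density[of 1 0]])
      (auto simp: norm_mult)
  have "(\<integral>s. of_real (std_normal_density s) * exp (\<i> * of_real (y * s)) \<partial>lborel)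
     = (\<integral>s. std_normal_density s *\<^sub>R exp (\<i> * of_real (y * s)) \<partial>lborel)"
    by (simp add: scaleR_conv_of_real)
  also have "\<dots> = (\<integral>s. exp (\<i> * of_real (y * s)) \<partial>std_normal_distribution)"
    by (subst integral_density) auto
  also have "\<dots> = char std_normal_distribution y"
    by (simp add: char_def)
  also have "\<dots> = complex_of_real (exp (- y\<^sup>2 / 2))" by (simp add: char_std_normal_distribution)
  finally show "(\<integral>s. of_real (std_normal_density s) * exp (\<i> * of_real (y * s)) \<partial>lborel) = complex_of_real (exp (- y\<^sup>2 / 2))" .
qed

text \<open>The substitution with scale \<open>sqrt (1 + a)\<close> absorbs the second Gaussian
  factor and reduces the integral to the characteristic function of the standard normal law. This
  evaluates the main term of a window: a normal density convolved with another one.\<close>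

lemma integral_std_normal_cexp_gaussian:
  assumes "0 \<le> a"
  shows "integrable lborel (\<lambda>s. of_real (std_normal_density s) * exp (\<i> * of_real (y * s) - of_real (a * s\<^sup>2 / 2)))"
  "(\<integral>s. of_real (std_normal_density s) * exp (\<i> * of_real (y * s) - of_real (a * s\<^sup>2 / 2)) \<partial>lborel)
     = complex_of_real (exp (- y\<^sup>2 / (2 * (1 + a))) / sqrt (1 + a))"
proof -
  define c where "c = sqrt (1 + a)"
  have c: "0 < c" "c\<^sup>2 = 1 + a" using assms by (auto simp: c_def)
  define f where "f = (\<lambda>s. of_real (std_normal_density s) * exp (\<i> * complex_of_real (y / c * s)))"
  have eq: "f (0 + c * s) = of_real (std_normal_density s) * exp (\<i> * of_real (y * s) - of_real (a * s\<^sup>2 / 2))" for s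
  proof -
    have "std_normal_density (c * s) = std_normal_density s * exp (- (a * s\<^sup>2 / 2))"
      by (simp add: std_normal_density_def power_mult_distrib c exp_add[symmetric] field_simps)
    moreover have "exp (\<i> * of_real (y * s) - of_real (a * s\<^sup>2 / 2))
        = exp (\<i> * of_real (y * s)) * complex_of_real (exp (- (a * s\<^sup>2 / 2)))"
      by (simp only: exp_diff exp_of_real exp_minus divide_inverse of_real_inverse)
    moreover have "y / c * (0 + c * s) = y * s" using c(1) by simp
    then have "f (0 + c * s) = of_real (std_normal_density (c * s)) * exp (\<i> * complex_of_real (y * s))"
      unfolding f_def by (simp only: add_0)
    ultimately show ?thesis by (simp only: of_real_mult mult_ac)
  qed
  have fi: "integrable lborel f" unfolding f_def by (rule integral_std_normal_cexp)
  show "integrable lborel (\<lambda>s. of_real (std_normal_density s) * exp (\<i> * of_real (y * s) - of_real (a * s\<^sup>2 / 2)))"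
    using lborel_integrable_real_affine[OF fi, of c 0] c unfolding eq by simp
  have "complex_of_real (exp (- (y / c)\<^sup>2 / 2)) = integral\<^sup>L lborel f"
    unfolding f_def by (rule integral_std_normal_cexp(2)[symmetric])
  also have "\<dots> = \<bar>c\<bar> *\<^sub>R (\<integral>s. f (0 + c * s) \<partial>lborel)"
    using c by (intro lborel_integral_real_affine) auto
  finally have e: "complex_of_real (exp (- (y / c)\<^sup>2 / 2)) = of_real c * (\<integral>s. f (0 + c * s) \<partial>lborel)"
    using c by (simp add: scaleR_conv_of_real)
  have "(\<integral>s. f (0 + c * s) \<partial>lborel) = of_real (exp (- (y / c)\<^sup>2 / 2)) / of_real c"
    unfolding e using c(1) by simp
  also have "\<dots> = complex_of_real (exp (- y\<^sup>2 / (2 * (1 + a))) / sqrt (1 + a))"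
    using c by (simp add: power_divide mult.commute c_def)
  finally show "(\<integral>s. of_real (std_normal_density s) * exp (\<i> * of_real (y * s) - of_real (a * s\<^sup>2 / 2)) \<partial>lborel)
     = complex_of_real (exp (- y\<^sup>2 / (2 * (1 + a))) / sqrt (1 + a))"
    unfolding eq .
qed

lemma lborel_inverse_1_plus_square:
  assumes "0 < c"
  shows "integrable lborel (\<lambda>s::real. 1 / (1 + (c * s)\<^sup>2))" "(\<integral>s. 1 / (1 + (c * s)\<^sup>2) \<partial>lborel) = pi / c"
proof -
  have i: "integrable lborel (\<lambda>s::real. inverse (1 + s\<^sup>2))"
    using integrable_inverse_1_plus_square by (simp add: set_integrable_def einterval_eq)
  have v: "(\<integral>s. inverse (1 + s\<^sup>2) \<partial>lborel) = pi"
    using LBINT_inverse_1_plus_square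
    by (simp add: interval_lebesgue_integral_def set_lebesgue_integral_def einterval_eq)
  show "integrable lborel (\<lambda>s::real. 1 / (1 + (c * s)\<^sup>2))"
    using lborel_integrable_real_affine[OF i, of c 0] assms by (simp add: inverse_eq_divide)
  have "pi = \<bar>c\<bar> *\<^sub>R (\<integral>s. inverse (1 + (0 + c * s)\<^sup>2) \<partial>lborel)"
    unfolding v[symmetric] using assms by (intro lborel_integral_real_affine) auto
  then show "(\<integral>s. 1 / (1 + (c * s)\<^sup>2) \<partial>lborel) = pi / c"
    using assms by (simp add: inverse_eq_divide field_simps)
qed

text \<open>The Gaussian weight absorbs the growth (1 + |t|)^4 of the error in
  \<open>tilted_char_bound\<close> and still leaves an integrable factor. The constant comes from (y
  / 3)^3 \<le> exp y at y = (1 + s^2) / 2.\<close>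

lemma std_normal_density_poly_bound:
  "std_normal_density s * (1 + \<bar>s\<bar>) ^ 4 \<le> 1800 / (1 + s\<^sup>2)"
proof -
  define y where "y = (1 + s\<^sup>2) / 2"
  have y0: "0 \<le> y" by (simp add: y_def)
  have "(1 + y / 3) ^ 3 \<le> exp (y / 3) ^ 3"
    using y0 by (intro power_mono exp_ge_add_one_self) auto
  also have "exp (y / 3) ^ 3 = exp y" by (simp flip: exp_of_nat_mult)
  finally have "(y / 3) ^ 3 \<le> exp y"
    using power_mono[of "y / 3" "1 + y / 3" 3] y0 by linarith
  then have "(1 + s\<^sup>2) ^ 3 \<le> 216 * exp y"
    by (simp add: y_def power_divide)
  also have "exp y = exp (1/2) * exp (s\<^sup>2 / 2)" by (simp add: y_def add_divide_distrib exp_add)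
  also have "216 * (exp (1/2) * exp (s\<^sup>2 / 2)) \<le> 216 * (2 * exp (s\<^sup>2 / 2))"
  proof -
    have "exp (1/2) \<le> (1::real) + 1/2 + (1/2)\<^sup>2" by (rule exp_bound) auto
    then show ?thesis by (intro mult_left_mono mult_right_mono) (auto simp: power2_eq_square)
  qed
  finally have a: "(1 + s\<^sup>2) ^ 3 \<le> 432 * exp (s\<^sup>2 / 2)" by simp
  have "(1 + \<bar>s\<bar>)\<^sup>2 \<le> 2 * (1 + s\<^sup>2)"
    using zero_le_power2[of "\<bar>s\<bar> - 1"] by (simp add: power2_eq_square algebra_simps)
  then have "((1 + \<bar>s\<bar>)\<^sup>2)\<^sup>2 \<le> (2 * (1 + s\<^sup>2))\<^sup>2" by (intro power_mono) auto
  then have "(1 + \<bar>s\<bar>) ^ 4 \<le> 4 * (1 + s\<^sup>2)\<^sup>2" unfolding power_mult_distrib by simp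
  then have "(1 + \<bar>s\<bar>) ^ 4 * (1 + s\<^sup>2) \<le> 4 * (1 + s\<^sup>2)\<^sup>2 * (1 + s\<^sup>2)" by (intro mult_right_mono) auto
  also have "\<dots> = 4 * (1 + s\<^sup>2) ^ 3" by (simp add: power2_eq_square power3_eq_cube)
  also have "\<dots> \<le> 1800 * exp (s\<^sup>2 / 2)"
    using a exp_gt_zero[of "s\<^sup>2 / 2"] by linarith
  finally have b: "(1 + \<bar>s\<bar>) ^ 4 * (1 + s\<^sup>2) \<le> 1800 * exp (s\<^sup>2 / 2)" .
  have "std_normal_density s \<le> exp (- s\<^sup>2 / 2)"
  proof -
    have "1 / sqrt (2 * pi) \<le> 1" using pi_gt3 by (simp add: real_le_rsqrt)
    then show ?thesis unfolding std_normal_density_def by (intro mult_left_le_one_le) auto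
  qed
  then have "std_normal_density s * ((1 + \<bar>s\<bar>) ^ 4 * (1 + s\<^sup>2)) \<le> exp (- s\<^sup>2 / 2) * (1800 * exp (s\<^sup>2 / 2))"
    by (rule mult_mono[OF _ b]) auto
  also have "\<dots> = 1800" by (simp add: exp_minus)
  finally show ?thesis by (simp add: field_simps add_pos_nonneg)
qed

text \<open>The power of \<open>\<kappa>\<close> stems from the rescaled factor (1 + |s /
  \<kappa>|)^4, and 10^6 is a round bound for 16 * 1800 * 16, the product of constants met in
  \<open>window_approx\<close>.\<close>

definition window_err :: "real \<Rightarrow> real \<Rightarrow> real" where
  "window_err \<kappa> r = 10^6 * exp (16 * r) * r / \<kappa> ^ 4"

context bounded_mds
begin

text \<open>Fourier inversion in a smoothed form: the Gaussian window is itself the Fourier transform of a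
  Gaussian density, so that the tilted measure of a window is an average of tilted characteristic functions.
  The decay factor there turns the error into \<open>O(1 / x)\<close>, the size of the main term.\<close>

definition window :: "real \<Rightarrow> real \<Rightarrow> real \<Rightarrow> real" where
  "window \<kappa> x v = expectation (\<lambda>\<omega>. exp (U x k \<omega>) * exp (- (U x k \<omega> - v)\<^sup>2 / (2 * \<kappa>\<^sup>2)))"

text \<open>Fubini's theorem: the double integrand has modulus
  \<open>std_normal_density s * exp (U x k \<omega>)\<close>, and
  \<open>exp (U x k \<omega>)\<close> is bounded.\<close>

lemma window_fourier:
  assumes \<kappa>: "0 < \<kappa>"
  shows "integrable lborel (\<lambda>s. of_real (std_normal_density s) * exp (- \<i> * of_real (v / \<kappa> * s))
       * (\<integral>\<omega>. exp ((1 + \<i> * of_real (s / \<kappa>)) * of_real (U x k \<omega>)) \<partial>M))" (is ?I)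
    and "complex_of_real (window \<kappa> x v) = (\<integral>s. of_real (std_normal_density s) * exp (- \<i> * of_real (v / \<kappa> * s))
       * (\<integral>\<omega>. exp ((1 + \<i> * of_real (s / \<kappa>)) * of_real (U x k \<omega>)) \<partial>M) \<partial>lborel)" (is ?E)
proof -
  interpret P: pair_sigma_finite M "lborel :: real measure" ..
  have [measurable]: "U x k \<in> borel_measurable M" by simp
  define f where "f = (\<lambda>\<omega> s. of_real (std_normal_density s) * exp (- \<i> * of_real (v / \<kappa> * s))
       * exp ((1 + \<i> * of_real (s / \<kappa>)) * complex_of_real (U x k \<omega>)))"
  have nf: "norm (f \<omega> s) = std_normal_density s * exp (U x k \<omega>)" for \<omega> s
    unfolding f_def by (simp add: norm_mult norm_exp_eq_Re)
  have fm [measurable]: "case_prod f \<in> borel_measurable (M \<Otimes>\<^sub>M lborel)"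
    unfolding f_def split_beta' by measurable
  have int_U: "integrable M (\<lambda>\<omega>. exp (U x k \<omega>))"
    by (rule integrable_AE_bounded[where c="exp (k / 2)"]) (use U_le[of x k] in auto)
  have fi: "integrable (M \<Otimes>\<^sub>M lborel) (case_prod f)"
  proof (rule P.Fubini_integrable)
    show "integrable M (\<lambda>\<omega>. \<integral>s. norm (case_prod f (\<omega>, s)) \<partial>lborel)"
      using int_U by (simp add: nf)
    show "AE \<omega> in M. integrable lborel (\<lambda>s. case_prod f (\<omega>, s))"
    proof (rule AE_I2)
      fix \<omega> assume w[measurable]: "\<omega> \<in> space M"
      have a: "integrable lborel (\<lambda>s. std_normal_density s * exp (U x k \<omega>))" by simp
      have b: "(\<lambda>s. case_prod f (\<omega>, s)) \<in> borel_measurable lborel"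
        unfolding f_def by simp
      have c: "norm (case_prod f (\<omega>, s)) \<le> norm (std_normal_density s * exp (U x k \<omega>))" for s
        by (simp add: nf)
      show "integrable lborel (\<lambda>s. case_prod f (\<omega>, s))"
        by (rule Bochner_Integration.integrable_bound[OF a b AE_I2[OF c]])
    qed
  qed simp
  have in_s: "(\<integral>s. f \<omega> s \<partial>lborel) = complex_of_real (exp (U x k \<omega>) * exp (- (U x k \<omega> - v)\<^sup>2 / (2 * \<kappa>\<^sup>2)))" for \<omega>
  proof -
    define y where "y = (U x k \<omega> - v) / \<kappa>"
    have "f \<omega> s = of_real (exp (U x k \<omega>)) * (of_real (std_normal_density s) * exp (\<i> * of_real (y * s)))" for s
    proof -
      have "y * s = U x k \<omega> * (s / \<kappa>) - v / \<kappa> * s"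
        by (simp add: y_def diff_divide_distrib left_diff_distrib)
      then have "- \<i> * of_real (v / \<kappa> * s) + (1 + \<i> * of_real (s / \<kappa>)) * complex_of_real (U x k \<omega>)
        = of_real (U x k \<omega>) + \<i> * of_real (y * s)"
        by (simp only: of_real_diff of_real_mult) (simp add: algebra_simps)
      then have "exp (- \<i> * of_real (v / \<kappa> * s)) * exp ((1 + \<i> * of_real (s / \<kappa>)) * complex_of_real (U x k \<omega>))
        = of_real (exp (U x k \<omega>)) * exp (\<i> * of_real (y * s))"
        by (simp only: exp_add[symmetric] exp_of_real[symmetric])
      then show ?thesis unfolding f_def by (simp only: mult.assoc mult.left_commute)
    qed
    then show ?thesis using integral_std_normal_cexp(2)[of y] by (simp add: y_def power_divide mult.commute)
  qed
  have in_w: "(\<integral>\<omega>. f \<omega> s \<partial>M) = of_real (std_normal_density s) * exp (- \<i> * of_real (v / \<kappa> * s))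
       * (\<integral>\<omega>. exp ((1 + \<i> * of_real (s / \<kappa>)) * of_real (U x k \<omega>)) \<partial>M)" for s
    unfolding f_def by simp
  show ?I using P.integrable_snd[OF fi] unfolding in_w .
  have "(\<integral>s. (\<integral>\<omega>. f \<omega> s \<partial>M) \<partial>lborel) = (\<integral>\<omega>. (\<integral>s. f \<omega> s \<partial>lborel) \<partial>M)"
    by (rule P.Fubini_integral[OF fi])
  then show ?E unfolding in_w in_s window_def by (simp only: integral_complex_of_real)
qed

text \<open>Inserting the characteristic function of the normal law with mean x^2 / 2 and variance
  x^2 into the Fourier formula gives the main term. The difference is integrated against the
  Gaussian weight; at frequency t = s / \<kappa> the decay factor becomes 1 / (1 + (c s)^2) with c =
  x / (sqrt 2 \<kappa>), whose integral \<pi> / c supplies the factor 1 / x.\<close>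

lemma window_approx:
  assumes \<kappa>: "0 < \<kappa>" "\<kappa> \<le> 1" and x: "0 < x" "x \<le> sqrt k"
  shows "\<bar>window \<kappa> x v - \<kappa> / sqrt (\<kappa>\<^sup>2 + x\<^sup>2) * exp (- (x\<^sup>2 / 2 - v)\<^sup>2 / (2 * (\<kappa>\<^sup>2 + x\<^sup>2)))\<bar> \<le> window_err \<kappa> (r0 x) / x"
proof -
  have x0: "0 \<le> x" using x by simp
  define A where "A = (\<lambda>t. \<integral>\<omega>. exp ((1 + \<i> * of_real t) * of_real (U x k \<omega>)) \<partial>M)"
  define N where "N = (\<lambda>t. exp ((\<i> * of_real t - of_real (t\<^sup>2)) / 2 * complex_of_real (x\<^sup>2)))"
  define g where "g = (\<lambda>s. of_real (std_normal_density s) * exp (- \<i> * complex_of_real (v / \<kappa> * s)))"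
  define y where "y = (x\<^sup>2 / 2 - v) / \<kappa>"
  define a where "a = x\<^sup>2 / \<kappa>\<^sup>2"
  have gN: "g s * N (s / \<kappa>) = of_real (std_normal_density s) * exp (\<i> * of_real (y * s) - of_real (a * s\<^sup>2 / 2))" for s
  proof -
    have "- \<i> * complex_of_real (v / \<kappa> * s) + (\<i> * of_real (s / \<kappa>) - of_real ((s / \<kappa>)\<^sup>2)) / 2 * complex_of_real (x\<^sup>2)
      = \<i> * of_real (y * s) - of_real (a * s\<^sup>2 / 2)"
      using \<kappa> by (simp add: y_def a_def field_simps power_divide)
    then show ?thesis unfolding g_def N_def by (simp only: mult.assoc exp_add[symmetric])
  qed
  have iN: "integrable lborel (\<lambda>s. g s * N (s / \<kappa>))"
    unfolding gN by (rule integral_std_normal_cexp_gaussian) (simp add: a_def)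
  have vN: "(\<integral>s. g s * N (s / \<kappa>) \<partial>lborel) = complex_of_real (\<kappa> / sqrt (\<kappa>\<^sup>2 + x\<^sup>2) * exp (- (x\<^sup>2 / 2 - v)\<^sup>2 / (2 * (\<kappa>\<^sup>2 + x\<^sup>2))))"
  proof -
    have "1 + a = (\<kappa>\<^sup>2 + x\<^sup>2) / \<kappa>\<^sup>2" using \<kappa> by (simp add: a_def field_simps)
    then have "sqrt (1 + a) = sqrt (\<kappa>\<^sup>2 + x\<^sup>2) / \<kappa>" and "y\<^sup>2 / (2 * (1 + a)) = (x\<^sup>2 / 2 - v)\<^sup>2 / (2 * (\<kappa>\<^sup>2 + x\<^sup>2))"
      using \<kappa> by (simp_all add: real_sqrt_divide y_def power_divide)
    then have "exp (- y\<^sup>2 / (2 * (1 + a))) / sqrt (1 + a) = \<kappa> / sqrt (\<kappa>\<^sup>2 + x\<^sup>2) * exp (- (x\<^sup>2 / 2 - v)\<^sup>2 / (2 * (\<kappa>\<^sup>2 + x\<^sup>2)))"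
      by simp
    then show ?thesis
      unfolding gN using integral_std_normal_cexp_gaussian(2)[of a y] by (simp add: a_def)
  qed
  have iA: "integrable lborel (\<lambda>s. g s * A (s / \<kappa>))" and vA: "complex_of_real (window \<kappa> x v) = (\<integral>s. g s * A (s / \<kappa>) \<partial>lborel)"
    unfolding g_def A_def using window_fourier[OF \<kappa>(1), where x=x and v=v] by auto
  define K where "K = 16 * exp (16 * r0 x) * r0 x / \<kappa> ^ 4 * 1800"
  have K0: "0 \<le> K" using \<kappa> r0_nonneg[OF x0] by (simp add: K_def)
  define c where "c = x / (sqrt 2 * \<kappa>)"
  have c0: "0 < c" using x \<kappa> by (simp add: c_def)
  have pw: "norm (g s * A (s / \<kappa>) - g s * N (s / \<kappa>)) \<le> K * (2 * (1 / (1 + (c * s)\<^sup>2)) + 1 / k * (1 / (1 + (1 * s)\<^sup>2)))" for s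
  proof -
    define D where "D = 2 / (1 + (c * s)\<^sup>2) + 1 / k"
    have D0: "0 \<le> D" by (simp add: D_def)
    have cs: "(s / \<kappa>)\<^sup>2 * x\<^sup>2 / 2 = (c * s)\<^sup>2" by (simp add: c_def power_mult_distrib power_divide mult_ac)
    have "norm (A (s / \<kappa>) - N (s / \<kappa>)) \<le> 16 * exp (16 * r0 x) * r0 x * (1 + \<bar>s / \<kappa>\<bar>) ^ 4 * D"
      unfolding A_def N_def D_def cs[symmetric] by (rule tilted_char_bound[OF x0 x(2)])
    also have "\<dots> \<le> 16 * exp (16 * r0 x) * r0 x * ((1 + \<bar>s\<bar>) ^ 4 / \<kappa> ^ 4) * D"
    proof -
      have "1 + \<bar>s / \<kappa>\<bar> \<le> (1 + \<bar>s\<bar>) / \<kappa>" using \<kappa> by (simp add: field_simps)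
      then have "(1 + \<bar>s / \<kappa>\<bar>) ^ 4 \<le> ((1 + \<bar>s\<bar>) / \<kappa>) ^ 4" by (intro power_mono) auto
      then show ?thesis using D0 r0_nonneg[OF x0]
        by (intro mult_right_mono[OF mult_left_mono]) (auto simp: power_divide)
    qed
    finally have d: "norm (A (s / \<kappa>) - N (s / \<kappa>)) \<le> 16 * exp (16 * r0 x) * r0 x * ((1 + \<bar>s\<bar>) ^ 4 / \<kappa> ^ 4) * D" .
    have "norm (g s) = std_normal_density s" unfolding g_def by (simp add: norm_mult)
    then have "norm (g s) * norm (A (s / \<kappa>) - N (s / \<kappa>))
      \<le> std_normal_density s * (16 * exp (16 * r0 x) * r0 x * ((1 + \<bar>s\<bar>) ^ 4 / \<kappa> ^ 4) * D)"
      using mult_left_mono[OF d, of "std_normal_density s"] by (simp only: normal_density_nonneg)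
    also have "\<dots> = 16 * exp (16 * r0 x) * r0 x / \<kappa> ^ 4 * D * (std_normal_density s * (1 + \<bar>s\<bar>) ^ 4)" by simp
    also have "\<dots> \<le> 16 * exp (16 * r0 x) * r0 x / \<kappa> ^ 4 * D * (1800 / (1 + s\<^sup>2))"
      using std_normal_density_poly_bound[of s] D0 r0_nonneg[OF x0] \<kappa> by (intro mult_left_mono) auto
    also have "\<dots> = K * (D / (1 + s\<^sup>2))" by (simp add: K_def)
    \<comment> \<open>The first summand of \<open>D\<close> is integrable by itself and drops the
      extra decay; the constant \<open>1 / k\<close> needs it.\<close>
    also have "D / (1 + s\<^sup>2) \<le> 2 * (1 / (1 + (c * s)\<^sup>2)) + 1 / k * (1 / (1 + (1 * s)\<^sup>2))"
    proof -
      have "2 / (1 + (c * s)\<^sup>2) / (1 + s\<^sup>2) \<le> 2 / (1 + (c * s)\<^sup>2) / 1"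
        by (intro divide_left_mono) (auto simp: add_pos_nonneg)
      then show ?thesis by (simp add: D_def add_divide_distrib)
    qed
    finally show ?thesis using K0 by (simp add: norm_mult mult_left_mono flip: right_diff_distrib)
  qed
  have iB: "integrable lborel (\<lambda>s. K * (2 * (1 / (1 + (c * s)\<^sup>2)) + 1 / k * (1 / (1 + (1 * s)\<^sup>2))))"
    using lborel_inverse_1_plus_square(1)[OF c0] lborel_inverse_1_plus_square(1)[of 1]
    by (intro integrable_mult_right Bochner_Integration.integrable_add) auto
  have "norm (complex_of_real (window \<kappa> x v - \<kappa> / sqrt (\<kappa>\<^sup>2 + x\<^sup>2) * exp (- (x\<^sup>2 / 2 - v)\<^sup>2 / (2 * (\<kappa>\<^sup>2 + x\<^sup>2)))))
     = norm (\<integral>s. g s * A (s / \<kappa>) - g s * N (s / \<kappa>) \<partial>lborel)"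
    using iA iN vA vN by (simp only: of_real_diff Bochner_Integration.integral_diff)
  also have "\<dots> \<le> (\<integral>s. norm (g s * A (s / \<kappa>) - g s * N (s / \<kappa>)) \<partial>lborel)" by (rule integral_norm_bound)
  also have "\<dots> \<le> (\<integral>s. K * (2 * (1 / (1 + (c * s)\<^sup>2)) + 1 / k * (1 / (1 + (1 * s)\<^sup>2))) \<partial>lborel)"
    by (rule integral_mono[OF _ iB]) (use iA iN pw in \<open>auto intro!: integrable_norm\<close>)
  also have "\<dots> = K * (2 * (\<integral>s. 1 / (1 + (c * s)\<^sup>2) \<partial>lborel) + 1 / k * (\<integral>s. 1 / (1 + (1 * s)\<^sup>2) \<partial>lborel))"
    using lborel_inverse_1_plus_square(1)[OF c0] lborel_inverse_1_plus_square(1)[of 1]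
    by (simp only: integral_mult_right_zero Bochner_Integration.integral_add integrable_mult_right zero_less_one)
  also have "\<dots> = K * (2 * (pi / c) + 1 / k * pi)"
    using lborel_inverse_1_plus_square(2)[OF c0] lborel_inverse_1_plus_square(2)[of 1] by simp
  also have "\<dots> \<le> K * (16 / x)"
  proof (rule mult_left_mono[OF _ K0])
    have "pi / c = pi * (sqrt 2 * \<kappa>) / x" by (simp add: c_def)
    also have "\<dots> \<le> 4 * (1.5 * 1) / x"
    proof -
      have "sqrt 2 \<le> (1.5::real)" by (intro real_le_lsqrt) (auto simp: power2_eq_square)
      moreover have "pi \<le> 4" using pi_less_4 by simp
      ultimately show ?thesis using \<kappa> x by (intro divide_right_mono mult_mono) auto
    qed
    finally have 1: "pi / c \<le> 6 / x" by simp
    \<comment> \<open>The contribution of the constant \<open>1 / k\<close> is thus of order 1 / x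
      as well.\<close>
    have "x \<le> k"
    proof -
      have "sqrt k \<le> k" using k_pos by (intro real_le_lsqrt) (auto simp: power2_eq_square)
      then show ?thesis using x by simp
    qed
    then have "1 / k * pi \<le> 1 / x * 4"
      using x k_pos pi_less_4 by (intro mult_mono divide_left_mono) auto
    then have 2: "1 / k * pi \<le> 4 / x" by simp
    have "2 * (pi / c) + 1 / k * pi \<le> (12 + 4) / x"
      using 1 2 by (simp add: add_divide_distrib)
    also have "\<dots> \<le> 16 / x" using x by (intro divide_right_mono) auto
    finally show "2 * (pi / c) + 1 / k * pi \<le> 16 / x" .
  qed
  also have "\<dots> \<le> window_err \<kappa> (r0 x) / x"
    using x \<kappa> r0_nonneg[OF x0] unfolding K_def window_err_def
    by (simp add: divide_right_mono)
  finally show ?thesis by (simp only: norm_of_real)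
qed

end

section \<open>From smoothed windows to tail probabilities\<close>

lemma nn_integral_exp_minus_atLeast:
  "(\<integral>\<^sup>+v. ennreal (exp (- v)) * indicator {a..} v \<partial>lborel) = ennreal (exp (- a))"
proof -
  have "(\<integral>\<^sup>+v. ennreal (exp (- v)) * indicator {a..} v \<partial>lborel) = ennreal (0 - (- exp (- a)))"
  proof (rule nn_integral_FTC_atLeast)
    show "((\<lambda>v::real. - exp (- v)) \<longlongrightarrow> 0) at_top"
      using tendsto_minus[OF filterlim_compose[OF exp_at_bot filterlim_uminus_at_bot_at_top]] by simp
  qed (auto intro!: derivative_eq_intros)
  then show ?thesis by simp
qed

lemma nn_integral_exp_minus_Icc:
  assumes "a \<le> b"
  shows "(\<integral>\<^sup>+v. ennreal (exp (- v)) * indicator {a..b} v \<partial>lborel) = ennreal (exp (- a) - exp (- b))"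
proof -
  have "(\<integral>\<^sup>+v. ennreal (exp (- v)) * indicator {a..b} v \<partial>lborel) = ennreal (- exp (- b) - (- exp (- a)))"
    by (rule nn_integral_FTC_Icc) (use assms in \<open>auto intro!: derivative_eq_intros\<close>)
  then show ?thesis by simp
qed

lemma normal_second_moment:
  "integrable lborel (\<lambda>v. normal_density \<mu> \<kappa> v * (v - \<mu>)\<^sup>2)"
  "0 < \<kappa> \<Longrightarrow> (\<integral>v. normal_density \<mu> \<kappa> v * (v - \<mu>)\<^sup>2 \<partial>lborel) = \<kappa>\<^sup>2"
proof -
  show i: "0 < \<kappa> \<Longrightarrow> (\<integral>v. normal_density \<mu> \<kappa> v * (v - \<mu>)\<^sup>2 \<partial>lborel) = \<kappa>\<^sup>2"
    using integral_normal_moment_even[of \<kappa> \<mu> 1] by (simp add: fact_numeral)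
  show "integrable lborel (\<lambda>v. normal_density \<mu> \<kappa> v * (v - \<mu>)\<^sup>2)"
  proof (cases "0 < \<kappa>")
    case True
    then show ?thesis by (rule integrable_normal_moment)
  next
    case False
    then show ?thesis
    proof (cases "\<kappa> = 0")
      case True
      then show ?thesis by (simp add: normal_density_def)
    next
      case F: False
      have "normal_density \<mu> \<kappa> = normal_density \<mu> (- \<kappa>)" by (simp add: normal_density_def fun_eq_iff)
      then show ?thesis using False F integrable_normal_moment[of "- \<kappa>" \<mu> 2] by simp
    qed
  qed
qed

text \<open>Chebyshev's inequality for the normal law of standard deviation \<open>\<kappa>\<close>:
  all but a fraction \<open>\<kappa>\<close> of its mass lies within \<open>sqrt \<kappa>\<close> of
  \<open>u\<close>, and there the weight is at least \<open>exp (- sqrt \<kappa>)\<close>. The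
  minorant \<open>f\<close> encodes this by 1 - (v - u)^2 / \<kappa>, which is nonpositive outside
  that interval. Integrated over the sample space, the bound leads to an upper estimate of the tail
  of \<open>U\<close>.\<close>

lemma smoothed_tail_lower:
  assumes \<kappa>: "0 < \<kappa>" "\<kappa> \<le> 1" and u: "c \<le> u"
  shows "ennreal (exp (- sqrt \<kappa>) * (1 - \<kappa>))
    \<le> (\<integral>\<^sup>+v. ennreal (exp (u - v) * normal_density u \<kappa> v) * indicator {c - sqrt \<kappa>..} v \<partial>lborel)"
proof -
  define r where "r = sqrt \<kappa>"
  have r: "0 < r" "r\<^sup>2 = \<kappa>" using \<kappa> by (auto simp: r_def)
  define f where "f = (\<lambda>v. exp (- r) * (normal_density u \<kappa> v - normal_density u \<kappa> v * (v - u)\<^sup>2 / \<kappa>))"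
  have fi: "integrable lborel f"
    unfolding f_def using normal_second_moment(1)[where \<mu>=u and \<kappa>=\<kappa>] \<kappa> by auto
  have "integral\<^sup>L lborel f = exp (- r) * (1 - \<kappa>\<^sup>2 / \<kappa>)"
    unfolding f_def using normal_second_moment[where \<mu>=u and \<kappa>=\<kappa>] \<kappa> by simp
  also have "\<dots> = exp (- r) * (1 - \<kappa>)" using \<kappa> by (simp add: power2_eq_square)
  finally have "integral\<^sup>L lborel f = exp (- r) * (1 - \<kappa>)" .
  moreover have "integral\<^sup>L lborel f \<le> (\<integral>v. max 0 (f v) \<partial>lborel)"
    by (rule integral_mono[OF fi]) (use fi in auto)
  ultimately have "exp (- r) * (1 - \<kappa>) \<le> (\<integral>v. max 0 (f v) \<partial>lborel)" by simp
  then have "ennreal (exp (- r) * (1 - \<kappa>)) \<le> ennreal (\<integral>v. max 0 (f v) \<partial>lborel)"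
    by (rule ennreal_leI)
  also have "\<dots> = (\<integral>\<^sup>+v. ennreal (max 0 (f v)) \<partial>lborel)"
    using fi by (intro nn_integral_eq_integral[symmetric]) auto
  also have "\<dots> \<le> (\<integral>\<^sup>+v. ennreal (exp (u - v) * normal_density u \<kappa> v) * indicator {c - r..} v \<partial>lborel)"
  proof (rule nn_integral_mono)
    fix v
    show "ennreal (max 0 (f v)) \<le> ennreal (exp (u - v) * normal_density u \<kappa> v) * indicator {c - r..} v"
    proof (cases "\<bar>v - u\<bar> \<le> r")
      case True
      then have "c - r \<le> v" using u by auto
      have "f v \<le> exp (- r) * normal_density u \<kappa> v"
        unfolding f_def using \<kappa> by (intro mult_left_mono) auto
      also have "\<dots> \<le> exp (u - v) * normal_density u \<kappa> v"
        using True by (intro mult_right_mono) auto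
      finally show ?thesis using \<open>c - r \<le> v\<close> by (auto intro!: ennreal_leI)
    next
      case False
      then have "r\<^sup>2 \<le> \<bar>v - u\<bar>\<^sup>2" using r by (intro power_mono) auto
      then have "1 \<le> (v - u)\<^sup>2 / \<kappa>" using r \<kappa> by simp
      then have "normal_density u \<kappa> v * 1 \<le> normal_density u \<kappa> v * ((v - u)\<^sup>2 / \<kappa>)"
        by (intro mult_left_mono) auto
      then have "f v \<le> 0" unfolding f_def by (intro mult_nonneg_nonpos) auto
      then show ?thesis by (simp add: max_def)
    qed
  qed
  finally show ?thesis by (simp add: r_def)
qed

text \<open>If \<open>c \<le> u\<close>, the full integral is an exponential moment of a normal law.
  If \<open>u < c\<close>, the integration starts \<open>sqrt \<kappa>\<close> above
  \<open>c\<close>, and (v - u)^2 \<ge> (v - c)^2 + (u - c)^2 splits off a Gaussian window around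
  \<open>c\<close>; Chebyshev in the remaining variable gives the factor \<open>\<kappa>\<close>.
  The leakage from below \<open>c\<close> is thus again a window, which \<open>window_approx\<close>
  controls.\<close>

lemma smoothed_tail_upper:
  assumes \<kappa>: "0 < \<kappa>" "\<kappa> \<le> 1"
  shows "(\<integral>\<^sup>+v. ennreal (exp (u - v) * normal_density u \<kappa> v) * indicator {c + sqrt \<kappa>..} v \<partial>lborel)
    \<le> ennreal (exp (\<kappa>\<^sup>2 / 2)) * indicator {c..} u + ennreal (\<kappa> * exp (- c) * (exp u * exp (- (u - c)\<^sup>2 / (2 * \<kappa>\<^sup>2))))"
proof (cases "c \<le> u")
  case True
  have "(\<integral>\<^sup>+v. ennreal (exp (u - v) * normal_density u \<kappa> v) * indicator {c + sqrt \<kappa>..} v \<partial>lborel)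
    \<le> (\<integral>\<^sup>+v. ennreal (exp (\<kappa>\<^sup>2 / 2) * normal_density (u - \<kappa>\<^sup>2) \<kappa> v) \<partial>lborel)"
  proof (rule nn_integral_mono)
    fix v
    \<comment> \<open>Completing the square: the weight shifts the mean by
      \<open>\<kappa>\<^sup>2\<close> and leaves the factor
      \<open>exp (\<kappa>\<^sup>2 / 2)\<close>.\<close>
    have "(u - v) + - (v - u)\<^sup>2 / (2 * \<kappa>\<^sup>2) = \<kappa>\<^sup>2 / 2 + - (v - (u - \<kappa>\<^sup>2))\<^sup>2 / (2 * \<kappa>\<^sup>2)"
      using \<kappa> by (simp add: field_simps power2_eq_square)
    then have "exp (u - v) * exp (- (v - u)\<^sup>2 / (2 * \<kappa>\<^sup>2)) = exp (\<kappa>\<^sup>2 / 2) * exp (- (v - (u - \<kappa>\<^sup>2))\<^sup>2 / (2 * \<kappa>\<^sup>2))"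
      by (simp only: exp_add[symmetric])
    moreover have "p * e = p' * e' \<Longrightarrow> p * (q * e) = p' * (q * e')" for p q e p' e' :: real
      by (simp add: mult.left_commute)
    ultimately have "exp (u - v) * normal_density u \<kappa> v = exp (\<kappa>\<^sup>2 / 2) * normal_density (u - \<kappa>\<^sup>2) \<kappa> v"
      unfolding normal_density_def by blast
    then show "ennreal (exp (u - v) * normal_density u \<kappa> v) * indicator {c + sqrt \<kappa>..} v
        \<le> ennreal (exp (\<kappa>\<^sup>2 / 2) * normal_density (u - \<kappa>\<^sup>2) \<kappa> v)"
      by (auto simp: indicator_def)
  qed
  also have "\<dots> = ennreal (\<integral>v. exp (\<kappa>\<^sup>2 / 2) * normal_density (u - \<kappa>\<^sup>2) \<kappa> v \<partial>lborel)"
    using \<kappa> by (intro nn_integral_eq_integral) auto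
  also have "\<dots> = ennreal (exp (\<kappa>\<^sup>2 / 2))" using \<kappa> by simp
  finally show ?thesis using True by (simp add: add_increasing2)
next
  case False
  define K where "K = exp (u - c) * exp (- (u - c)\<^sup>2 / (2 * \<kappa>\<^sup>2)) / \<kappa>"
  have "(\<integral>\<^sup>+v. ennreal (exp (u - v) * normal_density u \<kappa> v) * indicator {c + sqrt \<kappa>..} v \<partial>lborel)
    \<le> (\<integral>\<^sup>+v. ennreal (K * (normal_density c \<kappa> v * (v - c)\<^sup>2)) \<partial>lborel)"
  proof (rule nn_integral_mono)
    fix v
    show "ennreal (exp (u - v) * normal_density u \<kappa> v) * indicator {c + sqrt \<kappa>..} v
      \<le> ennreal (K * (normal_density c \<kappa> v * (v - c)\<^sup>2))"
    proof (cases "c + sqrt \<kappa> \<le> v")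
      case True
      have "(sqrt \<kappa>)\<^sup>2 \<le> (v - c)\<^sup>2" using True \<kappa> by (intro power_mono) auto
      then have one: "1 \<le> (v - c)\<^sup>2 / \<kappa>" using \<kappa> by simp
      have vc: "0 \<le> v - c" using True \<kappa> by (smt (verit) real_sqrt_ge_zero)
      have "0 \<le> (v - c) * (c - u)" using vc False by (intro mult_nonneg_nonneg) auto
      then have "(v - c)\<^sup>2 + (u - c)\<^sup>2 \<le> (v - u)\<^sup>2" by (simp add: power2_eq_square algebra_simps)
      then have "((v - c)\<^sup>2 + (u - c)\<^sup>2) / (2 * \<kappa>\<^sup>2) \<le> (v - u)\<^sup>2 / (2 * \<kappa>\<^sup>2)"
        using \<kappa> by (intro divide_right_mono) auto
      then have "exp (- (v - u)\<^sup>2 / (2 * \<kappa>\<^sup>2)) \<le> exp (- (u - c)\<^sup>2 / (2 * \<kappa>\<^sup>2) + - (v - c)\<^sup>2 / (2 * \<kappa>\<^sup>2))"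
        by (simp add: add_divide_distrib)
      then have "exp (- (v - u)\<^sup>2 / (2 * \<kappa>\<^sup>2)) \<le> exp (- (u - c)\<^sup>2 / (2 * \<kappa>\<^sup>2)) * exp (- (v - c)\<^sup>2 / (2 * \<kappa>\<^sup>2))"
        by (simp only: exp_add)
      moreover have "e \<le> e1 * e2 \<Longrightarrow> 0 \<le> q \<Longrightarrow> q * e \<le> e1 * (q * e2)" for q e e1 e2 :: real
        using mult_left_mono[of e "e1 * e2" q] mult.left_commute[of q e1 e2] by simp
      moreover have "0 \<le> 1 / sqrt (2 * pi * \<kappa>\<^sup>2)" by simp
      ultimately have n: "normal_density u \<kappa> v \<le> exp (- (u - c)\<^sup>2 / (2 * \<kappa>\<^sup>2)) * normal_density c \<kappa> v"
        unfolding normal_density_def by blast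
      have "exp (u - v) * normal_density u \<kappa> v
        \<le> exp (u - c) * (exp (- (u - c)\<^sup>2 / (2 * \<kappa>\<^sup>2)) * normal_density c \<kappa> v)"
        using n vc by (intro mult_mono) auto
      also have "\<dots> = exp (u - c) * exp (- (u - c)\<^sup>2 / (2 * \<kappa>\<^sup>2)) * normal_density c \<kappa> v * 1" by simp
      also have "\<dots> \<le> exp (u - c) * exp (- (u - c)\<^sup>2 / (2 * \<kappa>\<^sup>2)) * normal_density c \<kappa> v * ((v - c)\<^sup>2 / \<kappa>)"
        using one by (intro mult_left_mono) auto
      also have "\<dots> = K * (normal_density c \<kappa> v * (v - c)\<^sup>2)" by (simp add: K_def)
      finally show ?thesis using True by (simp add: ennreal_leI)
    qed auto
  qed
  also have "\<dots> = ennreal (\<integral>v. K * (normal_density c \<kappa> v * (v - c)\<^sup>2) \<partial>lborel)"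
    using normal_second_moment(1)[where \<mu>=c and \<kappa>=\<kappa>] \<kappa> by (intro nn_integral_eq_integral) (auto simp: K_def)
  also have "(\<integral>v. K * (normal_density c \<kappa> v * (v - c)\<^sup>2) \<partial>lborel) = K * \<kappa>\<^sup>2"
    using normal_second_moment(2)[where \<mu>=c and \<kappa>=\<kappa>] \<kappa> by simp
  also have "K * \<kappa>\<^sup>2 = \<kappa> * exp (- c) * (exp u * exp (- (u - c)\<^sup>2 / (2 * \<kappa>\<^sup>2)))"
    using \<kappa> by (simp add: K_def power2_eq_square exp_diff exp_minus field_simps)
  finally show ?thesis using False by simp
qed

context bounded_mds
begin

lemma window_nonneg: "0 \<le> window \<kappa> x v"
  unfolding window_def by simp

lemma nn_integral_window:
  assumes \<kappa>: "0 < \<kappa>"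
  shows "(\<integral>\<^sup>+\<omega>. ennreal (exp (U x k \<omega> - v) * normal_density (U x k \<omega>) \<kappa> v) \<partial>M)
    = ennreal (window \<kappa> x v / sqrt (2 * pi * \<kappa>\<^sup>2) * exp (- v))"
proof -
  have [measurable]: "U x k \<in> borel_measurable M" by simp
  define K where "K = exp (- v) / sqrt (2 * pi * \<kappa>\<^sup>2)"
  define f where "f = (\<lambda>\<omega>. exp (U x k \<omega>) * exp (- (U x k \<omega> - v)\<^sup>2 / (2 * \<kappa>\<^sup>2)))"
  have [measurable]: "f \<in> borel_measurable M" unfolding f_def by measurable
  have fb: "\<bar>f \<omega>\<bar> \<le> exp (k / 2) * 1" for \<omega>
    unfolding f_def abs_mult using U_le[of x k \<omega>] by (intro mult_mono) auto
  have fi: "integrable M f"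
    by (rule integrable_AE_bounded[where c="exp (k / 2) * 1"]) (use fb in auto)
  have "exp (U x k \<omega> - v) * normal_density (U x k \<omega>) \<kappa> v = K * f \<omega>" for \<omega>
    by (simp add: K_def f_def normal_density_def exp_diff exp_minus power2_commute[of v] field_simps)
  then have "(\<integral>\<^sup>+\<omega>. ennreal (exp (U x k \<omega> - v) * normal_density (U x k \<omega>) \<kappa> v) \<partial>M) = (\<integral>\<^sup>+\<omega>. ennreal (K * f \<omega>) \<partial>M)"
    by simp
  also have "\<dots> = ennreal (expectation (\<lambda>\<omega>. K * f \<omega>))"
    using fi by (intro nn_integral_eq_integral) (auto simp: K_def f_def)
  also have "expectation (\<lambda>\<omega>. K * f \<omega>) = window \<kappa> x v / sqrt (2 * pi * \<kappa>\<^sup>2) * exp (- v)"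
    unfolding window_def f_def K_def by simp
  finally show ?thesis .
qed

lemma nn_integral_smoothed:
  assumes \<kappa>: "0 < \<kappa>" and A: "A \<in> sets borel"
  shows "(\<integral>\<^sup>+\<omega>. (\<integral>\<^sup>+v. ennreal (exp (U x k \<omega> - v) * normal_density (U x k \<omega>) \<kappa> v) * indicator A v \<partial>lborel) \<partial>M)
    = (\<integral>\<^sup>+v. ennreal (window \<kappa> x v / sqrt (2 * pi * \<kappa>\<^sup>2) * exp (- v)) * indicator A v \<partial>lborel)"
proof -
  interpret P: pair_sigma_finite M "lborel :: real measure" ..
  have [measurable]: "U x k \<in> borel_measurable M" by simp
  note A[measurable]
  have "(\<integral>\<^sup>+\<omega>. (\<integral>\<^sup>+v. ennreal (exp (U x k \<omega> - v) * normal_density (U x k \<omega>) \<kappa> v) * indicator A v \<partial>lborel) \<partial>M)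
     = (\<integral>\<^sup>+v. (\<integral>\<^sup>+\<omega>. ennreal (exp (U x k \<omega> - v) * normal_density (U x k \<omega>) \<kappa> v) * indicator A v \<partial>M) \<partial>lborel)"
    by (rule P.Fubini'[symmetric]) (simp add: normal_density_def, measurable)
  also have "\<dots> = (\<integral>\<^sup>+v. ennreal (window \<kappa> x v / sqrt (2 * pi * \<kappa>\<^sup>2) * exp (- v)) * indicator A v \<partial>lborel)"
    by (intro nn_integral_cong) (auto simp: indicator_def nn_integral_window[OF \<kappa>])
  finally show ?thesis .
qed

text \<open>The indicator of the tail is bounded by a smoothed tail starting at
  \<open>c - sqrt \<kappa>\<close>. After Fubini this is the integral of the windows against exp (-
  v), and every window is at most the peak of its Gaussian main term plus the error.\<close>

lemma tail_U_upper:
  assumes \<kappa>: "0 < \<kappa>" "\<kappa> < 1" and x: "0 < x" "x \<le> sqrt k"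
  shows "prob {\<omega> \<in> space M. c \<le> U x k \<omega>} * (exp (- sqrt \<kappa>) * (1 - \<kappa>))
    \<le> (\<kappa> + window_err \<kappa> (r0 x)) / x / sqrt (2 * pi * \<kappa>\<^sup>2) * exp (- (c - sqrt \<kappa>))"
proof -
  have [measurable]: "U x k \<in> borel_measurable M" by simp
  define B where "B = (\<kappa> + window_err \<kappa> (r0 x)) / x / sqrt (2 * pi * \<kappa>\<^sup>2)"
  have "0 \<le> window_err \<kappa> (r0 x)" using \<kappa> x r0_nonneg[of x] by (simp add: window_err_def)
  then have B0: "0 \<le> B" using \<kappa> x unfolding B_def by simp
  have wb: "window \<kappa> x v / sqrt (2 * pi * \<kappa>\<^sup>2) \<le> B" for v
  proof -
    define m where "m = \<kappa> / sqrt (\<kappa>\<^sup>2 + x\<^sup>2) * exp (- (x\<^sup>2 / 2 - v)\<^sup>2 / (2 * (\<kappa>\<^sup>2 + x\<^sup>2)))"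
    have "x \<le> sqrt (\<kappa>\<^sup>2 + x\<^sup>2)" using x by (intro real_le_rsqrt) auto
    then have "m \<le> \<kappa> / x * 1"
      unfolding m_def using x \<kappa> by (intro mult_mono divide_left_mono mult_pos_pos) (auto simp: add_pos_pos)
    moreover have "window \<kappa> x v \<le> m + window_err \<kappa> (r0 x) / x"
      using window_approx[of \<kappa> x v] \<kappa> x unfolding m_def by (simp add: abs_le_iff)
    ultimately have "window \<kappa> x v \<le> (\<kappa> + window_err \<kappa> (r0 x)) / x" by (simp add: add_divide_distrib)
    then show ?thesis unfolding B_def by (intro divide_right_mono) auto
  qed
  define p where "p = exp (- sqrt \<kappa>) * (1 - \<kappa>)"
  have p0: "0 \<le> p" using \<kappa> by (simp add: p_def)
  define S where "S = {\<omega> \<in> space M. c \<le> U x k \<omega>}"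
  have [measurable]: "S \<in> sets M" unfolding S_def by measurable
  have "ennreal (prob S * p) = ennreal p * emeasure M S"
    using p0 by (simp add: emeasure_eq_measure ennreal_mult mult.commute)
  also have "\<dots> = (\<integral>\<^sup>+\<omega>. ennreal p * indicator S \<omega> \<partial>M)"
    by (simp add: nn_integral_cmult_indicator)
  also have "\<dots> \<le> (\<integral>\<^sup>+\<omega>. (\<integral>\<^sup>+v. ennreal (exp (U x k \<omega> - v) * normal_density (U x k \<omega>) \<kappa> v) * indicator {c - sqrt \<kappa>..} v \<partial>lborel) \<partial>M)"
  proof (rule nn_integral_mono)
    fix \<omega> assume "\<omega> \<in> space M"
    show "ennreal p * indicator S \<omega> \<le> (\<integral>\<^sup>+v. ennreal (exp (U x k \<omega> - v) * normal_density (U x k \<omega>) \<kappa> v) * indicator {c - sqrt \<kappa>..} v \<partial>lborel)"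
      using smoothed_tail_lower[of \<kappa> c "U x k \<omega>"] \<kappa> unfolding p_def S_def by (auto simp: indicator_def)
  qed
  also have "\<dots> = (\<integral>\<^sup>+v. ennreal (window \<kappa> x v / sqrt (2 * pi * \<kappa>\<^sup>2) * exp (- v)) * indicator {c - sqrt \<kappa>..} v \<partial>lborel)"
    using \<kappa> by (intro nn_integral_smoothed) auto
  also have "\<dots> \<le> (\<integral>\<^sup>+v. ennreal B * (ennreal (exp (- v)) * indicator {c - sqrt \<kappa>..} v) \<partial>lborel)"
  proof (rule nn_integral_mono)
    fix v
    have "ennreal (window \<kappa> x v / sqrt (2 * pi * \<kappa>\<^sup>2) * exp (- v)) \<le> ennreal (B * exp (- v))"
      using wb[of v] by (intro ennreal_leI mult_right_mono) auto
    then show "ennreal (window \<kappa> x v / sqrt (2 * pi * \<kappa>\<^sup>2) * exp (- v)) * indicator {c - sqrt \<kappa>..} v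
       \<le> ennreal B * (ennreal (exp (- v)) * indicator {c - sqrt \<kappa>..} v)"
      using B0 by (simp add: ennreal_mult indicator_def)
  qed
  also have "\<dots> = ennreal (B * exp (- (c - sqrt \<kappa>)))"
    using B0 by (subst nn_integral_cmult) (auto simp: nn_integral_exp_minus_atLeast ennreal_mult)
  finally have "prob S * p \<le> B * exp (- (c - sqrt \<kappa>))" using B0 by (subst (asm) ennreal_le_iff) auto
  then show ?thesis unfolding S_def p_def B_def .
qed

text \<open>Only windows centered in an interval of length \<open>J\<close> above
  \<open>c + sqrt \<kappa>\<close> are kept. There the Gaussian main term is still close to its peak
  when \<open>x\<close> is much larger than \<open>J\<close>, while the weight exp (- v) has lost
  only the fraction \<open>exp (- J)\<close> of its mass. The last summand on the right is the
  leakage from below \<open>c\<close>.\<close>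

lemma tail_U_lower:
  assumes \<kappa>: "0 < \<kappa>" "\<kappa> < 1" and x: "0 < x" "x \<le> sqrt k" and J: "0 \<le> J" and h: "\<bar>c - x\<^sup>2 / 2\<bar> \<le> 1"
  shows "(\<kappa> / sqrt (\<kappa>\<^sup>2 + x\<^sup>2) * exp (- (J + 2)\<^sup>2 / (2 * x\<^sup>2)) - window_err \<kappa> (r0 x) / x) / sqrt (2 * pi * \<kappa>\<^sup>2)
      * (exp (- (c + sqrt \<kappa>)) * (1 - exp (- J)))
    \<le> exp (\<kappa>\<^sup>2 / 2) * prob {\<omega> \<in> space M. c \<le> U x k \<omega>} + \<kappa> * exp (- c) * ((\<kappa> + window_err \<kappa> (r0 x)) / x)"
  (is "?n / _ * _ \<le> ?R")
proof (cases "0 \<le> ?n")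
  case False
  have "0 \<le> window_err \<kappa> (r0 x)" using \<kappa> x r0_nonneg[of x] by (simp add: window_err_def)
  then have "0 \<le> ?R" using \<kappa> x by simp
  moreover have "?n / sqrt (2 * pi * \<kappa>\<^sup>2) * (exp (- (c + sqrt \<kappa>)) * (1 - exp (- J))) \<le> 0"
    using False J by (intro mult_nonpos_nonneg divide_nonpos_nonneg) auto
  ultimately show ?thesis by linarith
next
  case True
  have [measurable]: "U x k \<in> borel_measurable M" by simp
  define n where "n = ?n"
  define s where "s = sqrt (2 * pi * \<kappa>\<^sup>2)"
  have s: "0 < s" using \<kappa> by (simp add: s_def)
  have ns: "0 \<le> n / s" using True s unfolding n_def by (intro divide_nonneg_nonneg) auto
  define S where "S = {\<omega> \<in> space M. c \<le> U x k \<omega>}"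
  have [measurable]: "S \<in> sets M" unfolding S_def by measurable
  have r: "0 < sqrt \<kappa>" "sqrt \<kappa> \<le> 1" using \<kappa> by auto
  have wl: "n \<le> window \<kappa> x v" if v: "c + sqrt \<kappa> \<le> v" "v \<le> c + sqrt \<kappa> + J" for v
  proof -
    \<comment> \<open>The 2 is the sum of the shift
      \<open>\<bar>c - x\<^sup>2 / 2\<bar> \<le> 1\<close> and of
      \<open>sqrt \<kappa> \<le> 1\<close>.\<close>
    have "\<bar>x\<^sup>2 / 2 - v\<bar> \<le> J + 2" using v abs_le_D1[OF h] abs_le_D2[OF h] r J by (intro abs_leI) linarith+
    then have "(x\<^sup>2 / 2 - v)\<^sup>2 \<le> (J + 2)\<^sup>2" by (metis abs_ge_zero power2_abs power_mono)
    then have "(x\<^sup>2 / 2 - v)\<^sup>2 / (2 * (\<kappa>\<^sup>2 + x\<^sup>2)) \<le> (J + 2)\<^sup>2 / (2 * x\<^sup>2)"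
      using x by (intro frac_le) auto
    then have "\<kappa> / sqrt (\<kappa>\<^sup>2 + x\<^sup>2) * exp (- (J + 2)\<^sup>2 / (2 * x\<^sup>2))
       \<le> \<kappa> / sqrt (\<kappa>\<^sup>2 + x\<^sup>2) * exp (- (x\<^sup>2 / 2 - v)\<^sup>2 / (2 * (\<kappa>\<^sup>2 + x\<^sup>2)))"
      using \<kappa> by (intro mult_left_mono) auto
    then show ?thesis
      using window_approx[of \<kappa> x v] \<kappa> x unfolding n_def by (simp add: abs_le_iff)
  qed
  have "ennreal (n / s * (exp (- (c + sqrt \<kappa>)) * (1 - exp (- J))))
     = ennreal (n / s) * ennreal (exp (- (c + sqrt \<kappa>)) - exp (- (c + sqrt \<kappa> + J)))"
  proof -
    have "exp (- (c + sqrt \<kappa>)) * (1 - exp (- J)) = exp (- (c + sqrt \<kappa>)) - exp (- (c + sqrt \<kappa> + J))"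
      by (simp add: right_diff_distrib exp_add[symmetric] algebra_simps)
    moreover have "0 \<le> exp (- (c + sqrt \<kappa>)) - exp (- (c + sqrt \<kappa> + J))" using J by simp
    ultimately show ?thesis using ns by (simp only: ennreal_mult)
  qed
  also have "\<dots> = (\<integral>\<^sup>+v. ennreal (n / s) * (ennreal (exp (- v)) * indicator {c + sqrt \<kappa>..c + sqrt \<kappa> + J} v) \<partial>lborel)"
    using J by (subst nn_integral_cmult) (auto simp: nn_integral_exp_minus_Icc)
  also have "\<dots> \<le> (\<integral>\<^sup>+v. ennreal (window \<kappa> x v / s * exp (- v)) * indicator {c + sqrt \<kappa>..} v \<partial>lborel)"
  proof (rule nn_integral_mono)
    fix v
    show "ennreal (n / s) * (ennreal (exp (- v)) * indicator {c + sqrt \<kappa>..c + sqrt \<kappa> + J} v)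
       \<le> ennreal (window \<kappa> x v / s * exp (- v)) * indicator {c + sqrt \<kappa>..} v"
    proof (cases "v \<in> {c + sqrt \<kappa>..c + sqrt \<kappa> + J}")
      case True
      then have "n / s * exp (- v) \<le> window \<kappa> x v / s * exp (- v)"
        using wl[of v] s by (intro mult_right_mono divide_right_mono) auto
      then show ?thesis using True ns by (simp add: ennreal_leI flip: ennreal_mult)
    qed auto
  qed
  also have "\<dots> = (\<integral>\<^sup>+\<omega>. (\<integral>\<^sup>+v. ennreal (exp (U x k \<omega> - v) * normal_density (U x k \<omega>) \<kappa> v) * indicator {c + sqrt \<kappa>..} v \<partial>lborel) \<partial>M)"
    unfolding s_def using \<kappa> by (intro nn_integral_smoothed[symmetric]) auto
  also have "\<dots> \<le> (\<integral>\<^sup>+\<omega>. ennreal (exp (\<kappa>\<^sup>2 / 2)) * indicator S \<omega>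
      + ennreal (\<kappa> * exp (- c) * (exp (U x k \<omega>) * exp (- (U x k \<omega> - c)\<^sup>2 / (2 * \<kappa>\<^sup>2)))) \<partial>M)"
  proof (rule nn_integral_mono)
    fix \<omega> assume "\<omega> \<in> space M"
    then have "indicator {c..} (U x k \<omega>) = (indicator S \<omega> :: ennreal)" by (simp add: S_def indicator_def)
    then show "(\<integral>\<^sup>+v. ennreal (exp (U x k \<omega> - v) * normal_density (U x k \<omega>) \<kappa> v) * indicator {c + sqrt \<kappa>..} v \<partial>lborel)
      \<le> ennreal (exp (\<kappa>\<^sup>2 / 2)) * indicator S \<omega>
      + ennreal (\<kappa> * exp (- c) * (exp (U x k \<omega>) * exp (- (U x k \<omega> - c)\<^sup>2 / (2 * \<kappa>\<^sup>2))))"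
      using smoothed_tail_upper[of \<kappa> "U x k \<omega>" c] \<kappa> by simp
  qed
  also have "\<dots> = ennreal (exp (\<kappa>\<^sup>2 / 2)) * emeasure M S
     + (\<integral>\<^sup>+\<omega>. ennreal (\<kappa> * exp (- c) * (exp (U x k \<omega>) * exp (- (U x k \<omega> - c)\<^sup>2 / (2 * \<kappa>\<^sup>2)))) \<partial>M)"
    by (subst nn_integral_add) (auto simp: nn_integral_cmult_indicator)
  also have "(\<integral>\<^sup>+\<omega>. ennreal (\<kappa> * exp (- c) * (exp (U x k \<omega>) * exp (- (U x k \<omega> - c)\<^sup>2 / (2 * \<kappa>\<^sup>2)))) \<partial>M)
     = ennreal (\<kappa> * exp (- c) * window \<kappa> x c)"
  proof -
    define f where "f = (\<lambda>\<omega>. exp (U x k \<omega>) * exp (- (U x k \<omega> - c)\<^sup>2 / (2 * \<kappa>\<^sup>2)))"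
    have [measurable]: "f \<in> borel_measurable M" unfolding f_def by measurable
    have fb: "\<bar>f \<omega>\<bar> \<le> exp (k / 2) * 1" for \<omega>
      unfolding f_def abs_mult using U_le[of x k \<omega>] by (intro mult_mono) auto
    have fi: "integrable M f"
      by (rule integrable_AE_bounded[where c="exp (k / 2) * 1"]) (use fb in auto)
    have "(\<integral>\<^sup>+\<omega>. ennreal (\<kappa> * exp (- c) * f \<omega>) \<partial>M) = ennreal (expectation (\<lambda>\<omega>. \<kappa> * exp (- c) * f \<omega>))"
      using fi \<kappa> by (intro nn_integral_eq_integral) (auto simp: f_def)
    then show ?thesis by (simp add: f_def window_def)
  qed
  also have "ennreal (exp (\<kappa>\<^sup>2 / 2)) * emeasure M S + ennreal (\<kappa> * exp (- c) * window \<kappa> x c)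
     = ennreal (exp (\<kappa>\<^sup>2 / 2) * prob S + \<kappa> * exp (- c) * window \<kappa> x c)"
    using \<kappa> window_nonneg[of \<kappa> x c] by (simp add: emeasure_eq_measure ennreal_mult ennreal_plus)
  finally have "n / s * (exp (- (c + sqrt \<kappa>)) * (1 - exp (- J))) \<le> exp (\<kappa>\<^sup>2 / 2) * prob S + \<kappa> * exp (- c) * window \<kappa> x c"
    using \<kappa> window_nonneg[of \<kappa> x c] by (subst (asm) ennreal_le_iff) auto
  also have "\<dots> \<le> exp (\<kappa>\<^sup>2 / 2) * prob S + \<kappa> * exp (- c) * ((\<kappa> + window_err \<kappa> (r0 x)) / x)"
  proof -
    define m where "m = \<kappa> / sqrt (\<kappa>\<^sup>2 + x\<^sup>2) * exp (- (x\<^sup>2 / 2 - c)\<^sup>2 / (2 * (\<kappa>\<^sup>2 + x\<^sup>2)))"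
    have "x \<le> sqrt (\<kappa>\<^sup>2 + x\<^sup>2)" using x by (intro real_le_rsqrt) auto
    then have "m \<le> \<kappa> / x * 1"
      unfolding m_def using x \<kappa> by (intro mult_mono divide_left_mono mult_pos_pos) (auto simp: add_pos_pos)
    moreover have "window \<kappa> x c \<le> m + window_err \<kappa> (r0 x) / x"
      using window_approx[of \<kappa> x c] \<kappa> x unfolding m_def by (simp add: abs_le_iff)
    ultimately have "window \<kappa> x c \<le> (\<kappa> + window_err \<kappa> (r0 x)) / x" by (simp add: add_divide_distrib)
    then show ?thesis using \<kappa> by (intro add_left_mono mult_left_mono) auto
  qed
  finally show ?thesis unfolding n_def s_def S_def .
qed

end

section \<open>The normal tail and Mills' ratio\<close>

lemma nn_integral_mills:
  assumes "0 < x"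
  shows "(\<integral>\<^sup>+t. ennreal (std_normal_density t * (1 + 1 / t\<^sup>2)) * indicator {x..} t \<partial>lborel)
    = ennreal (std_normal_density x / x)"
proof -
  have d: "(std_normal_density has_real_derivative - t * std_normal_density t) (at t)" for t
  proof -
    have "((\<lambda>t. exp (- t\<^sup>2 / 2)) has_real_derivative - t * exp (- t\<^sup>2 / 2)) (at t)"
      by (auto intro!: derivative_eq_intros)
    from DERIV_cmult[OF this, of "1 / sqrt (2 * pi)"] show ?thesis
      unfolding std_normal_density_def by (simp add: mult_ac)
  qed
  have "(\<integral>\<^sup>+t. ennreal (std_normal_density t * (1 + 1 / t\<^sup>2)) * indicator {x..} t \<partial>lborel)
    = ennreal (0 - (- (std_normal_density x / x)))"
  proof (rule nn_integral_FTC_atLeast)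
    fix t assume "x \<le> t"
    then have t: "0 < t" using assms by simp
    show "((\<lambda>t. - (std_normal_density t / t)) has_real_derivative std_normal_density t * (1 + 1 / t\<^sup>2)) (at t)"
      using t by (auto intro!: derivative_eq_intros d simp: field_simps power2_eq_square)
    show "0 \<le> std_normal_density t * (1 + 1 / t\<^sup>2)" by simp
  next
    have "((\<lambda>t. std_normal_density t / t) \<longlongrightarrow> 0) at_top"
    proof (rule tendsto_sandwich[where f="\<lambda>_. 0" and h="\<lambda>t. 1 / t"])
      have "std_normal_density t \<le> 1" for t
      proof -
        have "1 / sqrt (2 * pi) \<le> 1" using pi_gt3 by (simp add: real_le_rsqrt)
        then have "1 / sqrt (2 * pi) * exp (- t\<^sup>2 / 2) \<le> 1 * 1" by (intro mult_mono) auto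
        then show ?thesis by (simp add: std_normal_density_def)
      qed
      then show "\<forall>\<^sub>F t in at_top. std_normal_density t / t \<le> 1 / t"
        by (auto intro!: eventually_mono[OF eventually_gt_at_top[of 0]] divide_right_mono)
      show "\<forall>\<^sub>F t in at_top. 0 \<le> std_normal_density t / t"
        by (auto intro!: eventually_mono[OF eventually_gt_at_top[of 0]])
      show "((\<lambda>t. 1 / t) \<longlongrightarrow> (0::real)) at_top"
        by (rule tendsto_divide_0[OF tendsto_const filterlim_at_top_imp_at_infinity[OF filterlim_ident]])
    qed simp
    then show "((\<lambda>t. - (std_normal_density t / t)) \<longlongrightarrow> 0) at_top"
      using tendsto_minus by fastforce
  qed simp
  then show ?thesis by simp
qed

definition normal_tail :: "real \<Rightarrow> real" where
  "normal_tail x = 1 - cdf std_normal_distribution x"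

lemma normal_tail_eq:
  "ennreal (normal_tail x) = (\<integral>\<^sup>+t. ennreal (std_normal_density t) * indicator {x..} t \<partial>lborel)"
proof -
  interpret N: real_distribution std_normal_distribution by (rule real_dist_normal_dist)
  have "normal_tail x = measure std_normal_distribution {x<..}"
    unfolding normal_tail_def cdf_def using N.prob_compl[of "{..x}"]
    by (simp add: Compl_eq_Diff_UNIV[symmetric] not_le Compl_atMost)
  then have "ennreal (normal_tail x) = emeasure std_normal_distribution {x<..}"
    by (simp add: N.emeasure_eq_measure)
  also have "\<dots> = (\<integral>\<^sup>+t. ennreal (std_normal_density t) * indicator {x<..} t \<partial>lborel)"
    by (simp add: emeasure_density)
  also have "\<dots> = (\<integral>\<^sup>+t. ennreal (std_normal_density t) * indicator {x..} t \<partial>lborel)"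
    by (rule nn_integral_cong_AE) (use AE_lborel_singleton[of x] in \<open>auto elim!: eventually_mono simp: indicator_def\<close>)
  finally show ?thesis .
qed

lemma normal_tail_nonneg: "0 \<le> normal_tail x"
proof -
  interpret N: real_distribution std_normal_distribution by (rule real_dist_normal_dist)
  show ?thesis unfolding normal_tail_def using N.cdf_bounded_prob[of x] by simp
qed

text \<open>The quotient of the density by its argument has an exactly integrable derivative, up to
  sign the density times 1 + 1 / t^2. On the tail this factor lies between 1 and 1 + 1 / x^2, which
  gives both inequalities.\<close>

lemma mills_ratio:
  assumes x: "0 < x"
  shows "normal_tail x \<le> exp (- x\<^sup>2 / 2) / (x * sqrt (2 * pi))"
    and "exp (- x\<^sup>2 / 2) / (x * sqrt (2 * pi)) \<le> (1 + 1 / x\<^sup>2) * normal_tail x"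
proof -
  have eq: "exp (- x\<^sup>2 / 2) / (x * sqrt (2 * pi)) = std_normal_density x / x"
    by (simp add: std_normal_density_def)
  have "ennreal (normal_tail x) \<le> ennreal (std_normal_density x / x)"
    unfolding normal_tail_eq nn_integral_mills[OF x, symmetric]
    by (intro nn_integral_mono mult_right_mono ennreal_leI) (auto simp: mult_left_le algebra_simps)
  then show "normal_tail x \<le> exp (- x\<^sup>2 / 2) / (x * sqrt (2 * pi))"
    unfolding eq using x by (subst (asm) ennreal_le_iff) auto
  have "ennreal (std_normal_density x / x)
    \<le> (\<integral>\<^sup>+t. ennreal (1 + 1 / x\<^sup>2) * (ennreal (std_normal_density t) * indicator {x..} t) \<partial>lborel)"
    unfolding nn_integral_mills[OF x, symmetric]
  proof (rule nn_integral_mono)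
    fix t
    show "ennreal (std_normal_density t * (1 + 1 / t\<^sup>2)) * indicator {x..} t
      \<le> ennreal (1 + 1 / x\<^sup>2) * (ennreal (std_normal_density t) * indicator {x..} t)"
    proof (cases "x \<le> t")
      case True
      then have "1 / t\<^sup>2 \<le> 1 / x\<^sup>2" using x by (intro divide_left_mono power_mono) auto
      then have "std_normal_density t * (1 + 1 / t\<^sup>2) \<le> (1 + 1 / x\<^sup>2) * std_normal_density t"
        by (subst mult.commute) (intro mult_right_mono, auto)
      then show ?thesis using True by (simp add: ennreal_leI ennreal_mult[symmetric] del: ennreal_plus)
    qed simp
  qed
  also have "\<dots> = ennreal (1 + 1 / x\<^sup>2) * ennreal (normal_tail x)"
    unfolding normal_tail_eq by (intro nn_integral_cmult) auto
  also have "\<dots> = ennreal ((1 + 1 / x\<^sup>2) * normal_tail x)"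
    using normal_tail_nonneg by (intro ennreal_mult[symmetric]) auto
  finally show "exp (- x\<^sup>2 / 2) / (x * sqrt (2 * pi)) \<le> (1 + 1 / x\<^sup>2) * normal_tail x"
    unfolding eq using normal_tail_nonneg[of x] by (subst (asm) ennreal_le_iff) auto
qed

lemma normal_tail_pos: "0 < normal_tail x"
proof -
  interpret N: real_distribution std_normal_distribution by (rule real_dist_normal_dist)
  define y where "y = max 1 x"
  have "0 < exp (- y\<^sup>2 / 2) / (y * sqrt (2 * pi))" by (simp add: y_def max_def)
  also have "\<dots> \<le> (1 + 1 / y\<^sup>2) * normal_tail y" by (rule mills_ratio) (simp add: y_def)
  finally have "0 < normal_tail y"
    by (simp add: zero_less_mult_iff add_pos_nonneg) (smt (verit) divide_nonneg_nonneg zero_le_power2)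
  moreover have "normal_tail y \<le> normal_tail x"
    unfolding normal_tail_def using N.cdf_nondecreasing[of x y] by (simp add: y_def)
  ultimately show ?thesis by simp
qed

text \<open>Bounds for the tail of \<open>U\<close> relative to the normal tail; both tend to \<open>1\<close> when first \<open>A\<close> and then \<open>\<kappa>\<close>
  tends to \<open>0\<close>. The parameter \<open>A\<close> bounds all errors and \<open>\<kappa>\<close> is the width of the smoothing window.\<close>

definition tail_up :: "real \<Rightarrow> real \<Rightarrow> real" where
  "tail_up \<kappa> A = exp (A + 2 * sqrt \<kappa>) * (1 + window_err \<kappa> A / \<kappa>) / (1 - \<kappa>) * (1 + A\<^sup>2)"

definition tail_lo :: "real \<Rightarrow> real \<Rightarrow> real" where
  "tail_lo \<kappa> A = exp (- \<kappa>\<^sup>2 / 2) * (exp (- A) * (exp (- sqrt \<kappa>) * (1 - exp (- (1 / \<kappa>)))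
      * (1 / sqrt (1 + A\<^sup>2) * exp (- (1 / \<kappa> + 2)\<^sup>2 * A\<^sup>2 / 2) - window_err \<kappa> A / \<kappa>)
      - sqrt (2 * pi) * \<kappa> * (\<kappa> + window_err \<kappa> A)))"

text \<open>The window width comes first: \<open>f \<kappa>\<close> and \<open>g \<kappa>\<close>
  are the limits of the two bounds as \<open>A\<close> tends to 0, and they tend to 1 with
  \<open>\<kappa>\<close>. Only for fixed \<open>\<kappa>\<close> does
  \<open>window_err \<kappa> A / \<kappa>\<close> vanish, so \<open>A\<close> has to be chosen
  afterwards.\<close>

lemma ex_tail_constants:
  assumes \<eta>: "0 < \<eta>"
  shows "\<exists>\<kappa> A. 0 < \<kappa> \<and> \<kappa> < 1 \<and> 0 < A \<and> A \<le> 1 \<and> tail_up \<kappa> A < 1 + \<eta> \<and> 1 - \<eta> < tail_lo \<kappa> A"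
proof -
  define f where "f = (\<lambda>\<kappa>::real. exp (2 * sqrt \<kappa>) / (1 - \<kappa>))"
  define g where "g = (\<lambda>\<kappa>::real. exp (- \<kappa>\<^sup>2 / 2) * (exp (- sqrt \<kappa>) * (1 - exp (- (1 / \<kappa>))) - sqrt (2 * pi) * \<kappa> * \<kappa>))"
  have "(f \<longlongrightarrow> exp (2 * sqrt 0) / (1 - 0)) (at_right 0)"
    unfolding f_def by (intro tendsto_intros) auto
  then have f: "(f \<longlongrightarrow> 1) (at_right 0)" by simp
  have e: "((\<lambda>\<kappa>::real. exp (- (1 / \<kappa>))) \<longlongrightarrow> 0) (at_right 0)"
    using filterlim_compose[OF exp_at_bot filterlim_compose[OF filterlim_uminus_at_bot_at_top filterlim_inverse_at_top_right]]
    by (simp add: inverse_eq_divide)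
  have "(g \<longlongrightarrow> exp (- 0\<^sup>2 / 2) * (exp (- sqrt 0) * (1 - 0) - sqrt (2 * pi) * 0 * 0)) (at_right 0)"
    unfolding g_def by (intro tendsto_intros e) auto
  then have g: "(g \<longlongrightarrow> 1) (at_right 0)" by simp
  have "\<forall>\<^sub>F \<kappa> in at_right 0. f \<kappa> < 1 + \<eta>" using order_tendstoD(2)[OF f] \<eta> by simp
  moreover have "\<forall>\<^sub>F \<kappa> in at_right 0. 1 - \<eta> < g \<kappa>" using order_tendstoD(1)[OF g] \<eta> by simp
  moreover have "\<forall>\<^sub>F \<kappa> in at_right 0. \<kappa> \<in> {0<..<1::real}" by (rule eventually_at_right_real) simp
  ultimately have "\<forall>\<^sub>F \<kappa> in at_right 0. f \<kappa> < 1 + \<eta> \<and> 1 - \<eta> < g \<kappa> \<and> \<kappa> \<in> {0<..<1::real}"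
    by eventually_elim auto
  then obtain \<kappa> where \<kappa>: "f \<kappa> < 1 + \<eta>" "1 - \<eta> < g \<kappa>" "0 < \<kappa>" "\<kappa> < 1"
    using eventually_happens[of _ "at_right (0::real)"] by auto
  have w: "(window_err \<kappa> \<longlongrightarrow> 10^6 * exp (16 * 0) * 0 / \<kappa> ^ 4) (at_right 0)"
    unfolding window_err_def[abs_def] using \<kappa> by (intro tendsto_intros) auto
  have "(tail_up \<kappa> \<longlongrightarrow> exp (0 + 2 * sqrt \<kappa>) * (1 + (10^6 * exp (16 * 0) * 0 / \<kappa> ^ 4) / \<kappa>) / (1 - \<kappa>) * (1 + 0\<^sup>2)) (at_right 0)"
    unfolding tail_up_def[abs_def] using \<kappa> by (intro tendsto_intros w) auto
  then have u: "(tail_up \<kappa> \<longlongrightarrow> f \<kappa>) (at_right 0)" by (simp add: f_def)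
  have "(tail_lo \<kappa> \<longlongrightarrow> exp (- \<kappa>\<^sup>2 / 2) * (exp (- 0) * (exp (- sqrt \<kappa>) * (1 - exp (- (1 / \<kappa>)))
      * (1 / sqrt (1 + 0\<^sup>2) * exp (- (1 / \<kappa> + 2)\<^sup>2 * 0\<^sup>2 / 2) - (10^6 * exp (16 * 0) * 0 / \<kappa> ^ 4) / \<kappa>)
      - sqrt (2 * pi) * \<kappa> * (\<kappa> + (10^6 * exp (16 * 0) * 0 / \<kappa> ^ 4))))) (at_right 0)"
    unfolding tail_lo_def[abs_def] using \<kappa> by (intro tendsto_intros w) auto
  then have l: "(tail_lo \<kappa> \<longlongrightarrow> g \<kappa>) (at_right 0)" by (simp add: g_def)
  have "\<forall>\<^sub>F A in at_right 0. tail_up \<kappa> A < 1 + \<eta>" using order_tendstoD(2)[OF u] \<kappa> by simp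
  moreover have "\<forall>\<^sub>F A in at_right 0. 1 - \<eta> < tail_lo \<kappa> A" using order_tendstoD(1)[OF l] \<kappa> by simp
  moreover have "\<forall>\<^sub>F A in at_right 0. A \<in> {0<..<1::real}" by (rule eventually_at_right_real) simp
  ultimately have "\<forall>\<^sub>F A in at_right 0. tail_up \<kappa> A < 1 + \<eta> \<and> 1 - \<eta> < tail_lo \<kappa> A \<and> A \<in> {0<..<1::real}"
    by eventually_elim auto
  then obtain A where "tail_up \<kappa> A < 1 + \<eta> \<and> 1 - \<eta> < tail_lo \<kappa> A \<and> A \<in> {0<..<1::real}"
    using eventually_happens[of _ "at_right (0::real)"] by auto
  then show ?thesis using \<kappa> by (intro exI[of _ \<kappa>] exI[of _ A]) auto
qed

context bounded_mds
begin

text \<open>Both tail estimates are rewritten with \<open>m\<close>, Mills' approximation of the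
  normal tail, which for \<open>x \<ge> 1 / A\<close> is exact up to the factor
  \<open>1 + A\<^sup>2\<close>. The shift \<open>h\<close> leaves room for the discrepancy between
  the martingale and the block sums. The length \<open>1 / \<kappa>\<close> of the interval of
  windows grows as the window narrows.\<close>

lemma tail_U_bounds:
  assumes \<kappa>: "0 < \<kappa>" "\<kappa> < 1" and A: "0 < A" "A \<le> 1" and x: "1 / A \<le> x" "x \<le> sqrt k"
    and r: "r0 x \<le> A" and h: "\<bar>h\<bar> \<le> A"
  shows "prob {\<omega> \<in> space M. x\<^sup>2 / 2 + h \<le> U x k \<omega>} \<le> normal_tail x * tail_up \<kappa> A"
    and "normal_tail x * tail_lo \<kappa> A \<le> prob {\<omega> \<in> space M. x\<^sup>2 / 2 + h \<le> U x k \<omega>}"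
proof -
  have "1 \<le> 1 / A" using A by simp
  then have x1: "1 \<le> x" using x by linarith
  have xA: "1 / x \<le> A" using x x1 A by (simp add: field_simps)
  define P where "P = prob {\<omega> \<in> space M. x\<^sup>2 / 2 + h \<le> U x k \<omega>}"
  have P0: "0 \<le> P" by (simp add: P_def)
  define m where "m = exp (- x\<^sup>2 / 2) / (x * sqrt (2 * pi))"
  have m0: "0 < m" using x1 by (simp add: m_def)
  define e where "e = window_err \<kappa> (r0 x)"
  define e' where "e' = window_err \<kappa> A"
  have r00: "0 \<le> r0 x" using r0_nonneg x1 by simp
  have ee: "0 \<le> e" "e \<le> e'"
    unfolding e_def e'_def window_err_def using \<kappa> r r00
    by (auto intro!: divide_right_mono mult_mono)
  have s: "sqrt (2 * pi * \<kappa>\<^sup>2) = sqrt (2 * pi) * \<kappa>" using \<kappa> by (simp add: real_sqrt_mult)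
  have xx: "1 / x\<^sup>2 \<le> A\<^sup>2" using power_mono[OF xA, of 2] x1 by (simp add: power_divide)
  have mt: "m \<le> (1 + A\<^sup>2) * normal_tail x"
  proof -
    have "m \<le> (1 + 1 / x\<^sup>2) * normal_tail x" unfolding m_def using x1 by (intro mills_ratio) auto
    also have "\<dots> \<le> (1 + A\<^sup>2) * normal_tail x" using xx normal_tail_nonneg by (intro mult_right_mono) auto
    finally show ?thesis .
  qed
  have tm: "normal_tail x \<le> m" unfolding m_def using x1 by (intro mills_ratio) auto
  have "P * (exp (- sqrt \<kappa>) * (1 - \<kappa>)) \<le> (\<kappa> + e) / x / (sqrt (2 * pi) * \<kappa>) * exp (- (x\<^sup>2 / 2 + h - sqrt \<kappa>))"
    using tail_U_upper[OF \<kappa> _ x(2), of "x\<^sup>2 / 2 + h"] x1 unfolding P_def e_def s by simp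
  also have "\<dots> = m * (1 + e / \<kappa>) * exp (sqrt \<kappa> - h)"
  proof -
    have "exp (- (x\<^sup>2 / 2 + h - sqrt \<kappa>)) = exp (- x\<^sup>2 / 2) * exp (sqrt \<kappa> - h)"
      by (simp flip: exp_add)
    then show ?thesis using \<kappa> x1 unfolding m_def by (simp add: field_simps)
  qed
  also have "\<dots> \<le> m * (1 + e' / \<kappa>) * exp (sqrt \<kappa> + A)"
    using m0 ee h \<kappa> by (intro mult_mono add_mono divide_right_mono) auto
  finally have "P * (exp (- sqrt \<kappa>) * (1 - \<kappa>)) \<le> m * (1 + e' / \<kappa>) * exp (sqrt \<kappa> + A)" .
  then have "P * (exp (- sqrt \<kappa>) * (1 - \<kappa>)) * (exp (sqrt \<kappa>) / (1 - \<kappa>)) \<le> m * (1 + e' / \<kappa>) * exp (sqrt \<kappa> + A) * (exp (sqrt \<kappa>) / (1 - \<kappa>))"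
    using \<kappa> by (intro mult_right_mono) auto
  also have "P * (exp (- sqrt \<kappa>) * (1 - \<kappa>)) * (exp (sqrt \<kappa>) / (1 - \<kappa>)) = P"
    using \<kappa> by (simp add: exp_minus field_simps)
  also have "m * (1 + e' / \<kappa>) * exp (sqrt \<kappa> + A) * (exp (sqrt \<kappa>) / (1 - \<kappa>)) = m * (exp (A + 2 * sqrt \<kappa>) * (1 + e' / \<kappa>) / (1 - \<kappa>))"
  proof -
    have "exp (A + 2 * sqrt \<kappa>) = exp (sqrt \<kappa> + A) * exp (sqrt \<kappa>)" by (simp flip: exp_add)
    then show ?thesis by simp
  qed
  also have "\<dots> \<le> ((1 + A\<^sup>2) * normal_tail x) * (exp (A + 2 * sqrt \<kappa>) * (1 + e' / \<kappa>) / (1 - \<kappa>))"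
    using mt ee \<kappa> by (intro mult_right_mono) auto
  finally show "P \<le> normal_tail x * tail_up \<kappa> A" by (simp add: tail_up_def e'_def mult_ac)
  define J where "J = 1 / \<kappa>"
  define B where "B = exp (- sqrt \<kappa>) * (1 - exp (- J)) * (1 / sqrt (1 + A\<^sup>2) * exp (- (J + 2)\<^sup>2 * A\<^sup>2 / 2) - e' / \<kappa>)
      - sqrt (2 * pi) * \<kappa> * (\<kappa> + e')"
  have J0: "0 \<le> J" using \<kappa> by (simp add: J_def)
  have lo: "tail_lo \<kappa> A = exp (- \<kappa>\<^sup>2 / 2) * (exp (- A) * B)" unfolding tail_lo_def B_def J_def e'_def ..
  show "normal_tail x * tail_lo \<kappa> A \<le> P"
  \<comment> \<open>For negative \<open>B\<close> the claim is trivial; otherwise \<open>B\<close>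
    may multiply inequalities.\<close>
  proof (cases "0 \<le> B")
    case False
    then have "tail_lo \<kappa> A \<le> 0" unfolding lo by (intro mult_nonneg_nonpos) auto
    then have "normal_tail x * tail_lo \<kappa> A \<le> 0" using normal_tail_nonneg by (intro mult_nonneg_nonpos)
    then show ?thesis using P0 by linarith
  next
    case True
    define n where "n = \<kappa> / sqrt (\<kappa>\<^sup>2 + x\<^sup>2) * exp (- (J + 2)\<^sup>2 / (2 * x\<^sup>2)) - e / x"
    define E where "E = exp (- (x\<^sup>2 / 2 + h))"
    have Em: "E = m * (x * sqrt (2 * pi)) * exp (- h)"
      using x1 unfolding E_def m_def by (simp flip: exp_add)
    have main: "n / (sqrt (2 * pi) * \<kappa>) * (exp (- (x\<^sup>2 / 2 + h + sqrt \<kappa>)) * (1 - exp (- J)))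
       \<le> exp (\<kappa>\<^sup>2 / 2) * P + \<kappa> * E * ((\<kappa> + e) / x)"
      using tail_U_lower[OF \<kappa> _ x(2) J0, of "x\<^sup>2 / 2 + h"] h A x1 unfolding n_def e_def s P_def E_def by simp
    have n_ge: "\<kappa> / x * (1 / sqrt (1 + A\<^sup>2) * exp (- (J + 2)\<^sup>2 * A\<^sup>2 / 2) - e' / \<kappa>) \<le> n"
    proof -
      have "\<kappa> / x * (1 / sqrt (1 + A\<^sup>2)) \<le> \<kappa> / sqrt (\<kappa>\<^sup>2 + x\<^sup>2)"
      proof -
        have "\<kappa>\<^sup>2 \<le> 1" using \<kappa> by (simp add: power_le_one)
        then have "\<kappa>\<^sup>2 + x\<^sup>2 \<le> x\<^sup>2 * (1 + 1 / x\<^sup>2)" using x1 by (simp add: field_simps)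
        also have "\<dots> \<le> x\<^sup>2 * (1 + A\<^sup>2)" using xx by (intro mult_left_mono) auto
        finally have "sqrt (\<kappa>\<^sup>2 + x\<^sup>2) \<le> sqrt (x\<^sup>2 * (1 + A\<^sup>2))" by (rule real_sqrt_le_mono)
        then have "sqrt (\<kappa>\<^sup>2 + x\<^sup>2) \<le> x * sqrt (1 + A\<^sup>2)"
          using x1 by (simp add: real_sqrt_mult)
        then have "\<kappa> / (x * sqrt (1 + A\<^sup>2)) \<le> \<kappa> / sqrt (\<kappa>\<^sup>2 + x\<^sup>2)"
          using \<kappa> x1 by (intro divide_left_mono mult_pos_pos) (auto simp: add_pos_pos add_pos_nonneg)
        then show ?thesis by simp
      qed
      moreover have "exp (- (J + 2)\<^sup>2 * A\<^sup>2 / 2) \<le> exp (- (J + 2)\<^sup>2 / (2 * x\<^sup>2))"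
        using mult_left_mono[OF xx, of "(J + 2)\<^sup>2"] by simp
      ultimately have "\<kappa> / x * (1 / sqrt (1 + A\<^sup>2)) * exp (- (J + 2)\<^sup>2 * A\<^sup>2 / 2)
        \<le> \<kappa> / sqrt (\<kappa>\<^sup>2 + x\<^sup>2) * exp (- (J + 2)\<^sup>2 / (2 * x\<^sup>2))"
        using \<kappa> x1 by (intro mult_mono) auto
      moreover have "e / x \<le> \<kappa> / x * (e' / \<kappa>)" using ee x1 \<kappa> by (simp add: divide_right_mono)
      ultimately show ?thesis unfolding n_def by (simp add: right_diff_distrib mult.assoc)
    qed
    define D where "D = 1 / sqrt (1 + A\<^sup>2) * exp (- (J + 2)\<^sup>2 * A\<^sup>2 / 2) - e' / \<kappa>"
    have "m * exp (- h) * (exp (- sqrt \<kappa>) * (1 - exp (- J)) * D) = \<kappa> / x * D / (sqrt (2 * pi) * \<kappa>) * (exp (- (x\<^sup>2 / 2 + h + sqrt \<kappa>)) * (1 - exp (- J)))"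
    proof -
      have "exp (- (x\<^sup>2 / 2 + h + sqrt \<kappa>)) = exp (- x\<^sup>2 / 2) * exp (- h) * exp (- sqrt \<kappa>)" by (simp flip: exp_add)
      then show ?thesis using \<kappa> x1 unfolding m_def by (simp add: field_simps)
    qed
    also have "\<dots> \<le> n / (sqrt (2 * pi) * \<kappa>) * (exp (- (x\<^sup>2 / 2 + h + sqrt \<kappa>)) * (1 - exp (- J)))"
      using n_ge J0 \<kappa> unfolding D_def by (intro mult_right_mono divide_right_mono) auto
    also note main
    also have "\<kappa> * E * ((\<kappa> + e) / x) \<le> \<kappa> * E * ((\<kappa> + e') / x)"
      using \<kappa> ee x1 by (intro mult_left_mono divide_right_mono) (auto simp: E_def)
    also have "\<kappa> * E * ((\<kappa> + e') / x) = m * exp (- h) * (sqrt (2 * pi) * \<kappa> * (\<kappa> + e'))"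
      unfolding Em using x1 by simp
    finally have "m * exp (- h) * B \<le> exp (\<kappa>\<^sup>2 / 2) * P"
      unfolding B_def D_def by (simp add: right_diff_distrib)
    moreover have "normal_tail x * exp (- A) * B \<le> m * exp (- h) * B"
      using True tm h m0 normal_tail_nonneg by (intro mult_right_mono mult_mono) auto
    ultimately have "normal_tail x * exp (- A) * B \<le> exp (\<kappa>\<^sup>2 / 2) * P" by linarith
    then have "exp (- \<kappa>\<^sup>2 / 2) * (normal_tail x * exp (- A) * B) \<le> exp (- \<kappa>\<^sup>2 / 2) * (exp (\<kappa>\<^sup>2 / 2) * P)"
      by (intro mult_left_mono) auto
    also have "exp (- \<kappa>\<^sup>2 / 2) * (exp (\<kappa>\<^sup>2 / 2) * P) = P" by (simp add: exp_minus)
    finally show ?thesis unfolding lo by (simp add: mult_ac)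
  qed
qed

end

section \<open>Blocks of a mixing process as martingale differences\<close>

lemma powr_neg_le_diff:
  fixes \<beta> :: real
  assumes "1 < \<beta>" "2 \<le> d"
  shows "real d powr - \<beta> \<le> (real (d - 1) powr (1 - \<beta>) - real d powr (1 - \<beta>)) / (\<beta> - 1)"
proof -
  have "\<exists>z>real (d - 1). z < real d \<and> real d powr (1 - \<beta>) - real (d - 1) powr (1 - \<beta>) = (real d - real (d - 1)) * ((1 - \<beta>) * z powr (1 - \<beta> - 1))"
    by (rule MVT2) (use assms in \<open>auto intro!: derivative_eq_intros\<close>)
  then obtain z where z: "real (d - 1) < z" "z < real d"
    "real d powr (1 - \<beta>) - real (d - 1) powr (1 - \<beta>) = (1 - \<beta>) * z powr - \<beta>"
    using assms by auto
  have "real d powr - \<beta> \<le> z powr - \<beta>"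
    using z assms by (intro powr_mono2') auto
  also have "\<dots> = (real (d - 1) powr (1 - \<beta>) - real d powr (1 - \<beta>)) / (\<beta> - 1)"
    using z(3) assms by (simp add: field_simps)
  finally show ?thesis .
qed

text \<open>The telescoping bound holds from index 2 on, so the first term is split off. It is
  itself at most \<open>real (Suc m) powr (1 - \<beta>)\<close>.\<close>

lemma sum_powr_neg_le:
  fixes \<beta> :: real
  assumes "1 < \<beta>"
  shows "(\<Sum>d\<in>{Suc m..<b}. real d powr - \<beta>) \<le> (1 + 1 / (\<beta> - 1)) * real (Suc m) powr (1 - \<beta>)"
proof (cases "Suc m < b")
  case False
  then show ?thesis using assms by simp
next
  case True
  have "(\<Sum>d\<in>{Suc m..<b}. real d powr - \<beta>) = real (Suc m) powr - \<beta> + (\<Sum>d\<in>{Suc (Suc m)..<b}. real d powr - \<beta>)"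
    using True by (simp add: sum.atLeast_Suc_lessThan)
  also have "(\<Sum>d\<in>{Suc (Suc m)..<b}. real d powr - \<beta>)
     \<le> (\<Sum>d\<in>{Suc (Suc m)..<b}. (real (d - 1) powr (1 - \<beta>) - real d powr (1 - \<beta>)) / (\<beta> - 1))"
    using assms by (intro sum_mono powr_neg_le_diff) auto
  also have "\<dots> = (real (Suc m) powr (1 - \<beta>) - real (b - 1) powr (1 - \<beta>)) / (\<beta> - 1)"
  proof -
    have "(\<Sum>d\<in>{Suc (Suc m)..<Suc n}. (real (d - 1) powr (1 - \<beta>) - real d powr (1 - \<beta>)))
       = real (Suc m) powr (1 - \<beta>) - real n powr (1 - \<beta>)" if "Suc m \<le> n" for n
      using that
    proof (induction n rule: dec_induct)
      case (step n)
      then show ?case by (simp add: sum.atLeastLessThan_Suc)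
    qed simp
    from this[of "b - 1"] show ?thesis using True by (simp add: sum_divide_distrib[symmetric])
  qed
  also have "\<dots> \<le> real (Suc m) powr (1 - \<beta>) / (\<beta> - 1)"
    using assms by (intro divide_right_mono) auto
  also have "real (Suc m) powr - \<beta> \<le> real (Suc m) powr (1 - \<beta>)" by (intro powr_mono) auto
  finally show ?thesis by (simp add: algebra_simps)
qed

text \<open>With \<open>p = 2 - \<beta>\<close> this turns an error of order
  \<open>m powr (1 - \<beta>)\<close> per added variable into an increment of
  \<open>m powr (2 - \<beta>)\<close>, the form that the induction for the block variance can
  absorb.\<close>

lemma powr_diff_ge:
  fixes p :: real
  assumes "0 < p" "p < 1"
  shows "p * real (Suc m) powr (p - 1) \<le> real (Suc m) powr p - real m powr p"
proof (cases "m = 0")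
  case True
  then show ?thesis using assms by simp
next
  case False
  have "\<exists>z>real m. z < real (Suc m) \<and> real (Suc m) powr p - real m powr p = (real (Suc m) - real m) * (p * z powr (p - 1))"
    by (rule MVT2) (use assms False in \<open>auto intro!: derivative_eq_intros\<close>)
  then obtain z where z: "real m < z" "z < real (Suc m)" "real (Suc m) powr p - real m powr p = p * z powr (p - 1)"
    by auto
  have "real (Suc m) powr (p - 1) \<le> z powr (p - 1)"
    using z assms by (intro powr_mono2') auto
  then show ?thesis unfolding z(3) using assms by (intro mult_left_mono) auto
qed

lemma (in prob_space) integrable_AE_bound:
  fixes f :: "'a \<Rightarrow> real"
  assumes "f \<in> borel_measurable M" "AE \<omega> in M. \<bar>f \<omega>\<bar> \<le> c"
  shows "integrable M f"
  using assms by (intro integrable_const_bound[where B=c]) auto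

text \<open>The way back from the tested form to a pointwise bound: test with the indicator of the
  set where \<open>Z\<close> exceeds \<open>c\<close>.\<close>

lemma (in prob_space) AE_le_of_test:
  fixes Z :: "'a \<Rightarrow> real"
  assumes F: "subalgebra M F" and Z: "Z \<in> borel_measurable F" "integrable M Z"
    and test: "\<And>G. G \<in> borel_measurable F \<Longrightarrow> (\<And>\<omega>. \<bar>G \<omega>\<bar> \<le> 1) \<Longrightarrow> expectation (\<lambda>\<omega>. G \<omega> * Z \<omega>) \<le> c * expectation (\<lambda>\<omega>. \<bar>G \<omega>\<bar>)"
  shows "AE \<omega> in M. Z \<omega> \<le> c"
proof -
  define S where "S = {\<omega> \<in> space F. c < Z \<omega>}"
  have SF: "S \<in> sets F" unfolding S_def using Z(1) by measurable
  then have [measurable]: "S \<in> sets M" using F by (auto simp: subalgebra_def)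
  have [measurable]: "Z \<in> borel_measurable M" using Z by auto
  define G where "G = (indicator S :: 'a \<Rightarrow> real)"
  have GF: "G \<in> borel_measurable F" unfolding G_def using SF by simp
  have G1: "\<bar>G \<omega>\<bar> \<le> 1" for \<omega> by (simp add: G_def indicator_def)
  have iGZ: "integrable M (\<lambda>\<omega>. G \<omega> * Z \<omega>)"
    unfolding G_def using integrable_real_mult_indicator[OF _ Z(2), of S] by (simp add: mult.commute)
  have iG: "integrable M G"
    by (rule integrable_AE_bound[where c=1]) (use G1 in \<open>auto simp: G_def\<close>)
  define h where "h = (\<lambda>\<omega>. G \<omega> * (Z \<omega> - c))"
  have ih: "integrable M h" unfolding h_def right_diff_distrib using iGZ iG by simp
  have h0: "0 \<le> h \<omega>" for \<omega> by (simp add: h_def G_def S_def indicator_def)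
  have "expectation h = expectation (\<lambda>\<omega>. G \<omega> * Z \<omega>) - c * expectation (\<lambda>\<omega>. \<bar>G \<omega>\<bar>)"
    unfolding h_def right_diff_distrib using iGZ iG by (simp add: G_def)
  also have "\<dots> \<le> 0" using test[OF GF G1] by simp
  finally have "expectation h = 0" using h0 by (intro antisym integral_nonneg) auto
  then have "AE \<omega> in M. h \<omega> = 0" using integral_nonneg_eq_0_iff_AE[OF ih] h0 by simp
  then show ?thesis
  proof (rule AE_mp[OF _ AE_I2])
    fix \<omega> assume "\<omega> \<in> space M"
    then show "h \<omega> = 0 \<longrightarrow> Z \<omega> \<le> c"
      using F by (auto simp: h_def G_def S_def indicator_def subalgebra_def not_less split: if_splits)
  qed
qed

lemma (in prob_space) AE_abs_le_of_test:
  fixes Z :: "'a \<Rightarrow> real"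
  assumes F: "subalgebra M F" and Z: "Z \<in> borel_measurable F" "integrable M Z"
    and test: "\<And>G. G \<in> borel_measurable F \<Longrightarrow> (\<And>\<omega>. \<bar>G \<omega>\<bar> \<le> 1) \<Longrightarrow> \<bar>expectation (\<lambda>\<omega>. G \<omega> * Z \<omega>)\<bar> \<le> c * expectation (\<lambda>\<omega>. \<bar>G \<omega>\<bar>)"
  shows "AE \<omega> in M. \<bar>Z \<omega>\<bar> \<le> c"
proof -
  have "AE \<omega> in M. Z \<omega> \<le> c"
    by (rule AE_le_of_test[OF F Z]) (use test in \<open>auto dest: abs_le_D1\<close>)
  moreover have "AE \<omega> in M. - Z \<omega> \<le> c"
    by (rule AE_le_of_test[OF F]) (use Z test in \<open>auto dest: abs_le_D2\<close>)
  ultimately show ?thesis by eventually_elim auto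
qed

text \<open>The one-sided mixing conditions, with coefficients \<open>O(l\<^bsup>-\<beta>\<^esup>)\<close>, again in tested form. The condition
  on \<open>\<gamma>\<close> is \<open>\<sigma>\<^sup>2 = \<gamma> 0 + 2 (\<gamma> 1 + \<gamma> 2 + \<dots>)\<close> with \<open>\<sigma>\<^sup>2\<close> written as \<open>s2\<close>.\<close>

locale mixing_process = prob_space M for M :: "'a measure" +
  fixes F :: "nat \<Rightarrow> 'a measure" and X :: "nat \<Rightarrow> 'a \<Rightarrow> real" and \<gamma> :: "nat \<Rightarrow> real" and K \<beta> s2 :: real
  assumes subalg: "\<And>t. subalgebra M (F t)"
    and filtration: "\<And>s t. s \<le> t \<Longrightarrow> sets (F s) \<subseteq> sets (F t)"
    and adapted: "\<And>t. X t \<in> borel_measurable (F t)"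
    and K_ge: "1 \<le> K"
    and bounded: "\<And>t. AE \<omega> in M. \<bar>X t \<omega>\<bar> \<le> K"
    and \<beta>: "1 < \<beta>" "\<beta> \<le> 3 / 2"
    and mix1: "\<And>t l G c. 1 \<le> l \<Longrightarrow> G \<in> borel_measurable (F t) \<Longrightarrow> AE \<omega> in M. \<bar>G \<omega>\<bar> \<le> c \<Longrightarrow>
      \<bar>expectation (\<lambda>\<omega>. G \<omega> * X (t + l) \<omega>)\<bar> \<le> K * real l powr - \<beta> * expectation (\<lambda>\<omega>. \<bar>G \<omega>\<bar>)"
    and mix2: "\<And>t i l G c. 1 \<le> i \<Longrightarrow> i \<le> l \<Longrightarrow> G \<in> borel_measurable (F t) \<Longrightarrow> AE \<omega> in M. \<bar>G \<omega>\<bar> \<le> c \<Longrightarrow>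
      \<bar>expectation (\<lambda>\<omega>. G \<omega> * (X (t + i) \<omega> * X (t + l) \<omega> - \<gamma> (l - i)))\<bar> \<le> K * real i powr - \<beta> * expectation (\<lambda>\<omega>. \<bar>G \<omega>\<bar>)"
    and cov: "\<And>s d. expectation (\<lambda>\<omega>. X s \<omega> * X (s + d) \<omega>) = \<gamma> d"
    and sigma: "(\<lambda>d. \<gamma> (Suc d)) sums ((s2 - \<gamma> 0) / 2)" and s2_pos: "0 < s2"
begin

text \<open>\<open>Z\<close> bounds the sum of \<open>d powr - \<beta>\<close> over
  \<open>d \<ge> 1\<close>, so \<open>K * Z\<close> bounds the distance between martingale and
  partial sum. One martingale step meets this distance at both ends and one variable in between,
  whence \<open>L\<close>.\<close>

definition Z :: real where "Z = 1 + 1 / (\<beta> - 1)"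
definition L :: real where "L = K + 2 * K * Z"

lemma Z_ge: "1 \<le> Z" using \<beta> by (simp add: Z_def)

lemma L_ge: "1 \<le> L" "K \<le> L" "Z \<le> L" "K * Z \<le> L" "2 * (K * Z) \<le> L"
proof -
  have "1 * Z \<le> K * Z" using K_ge Z_ge by (intro mult_right_mono) auto
  then have "Z \<le> K * Z" by simp
  then show "1 \<le> L" "K \<le> L" "Z \<le> L" "K * Z \<le> L" "2 * (K * Z) \<le> L"
    using K_ge Z_ge unfolding L_def mult.assoc by linarith+
qed

lemma measurable_F_mono:
  assumes "f \<in> borel_measurable (F i)" "i \<le> j"
  shows "f \<in> borel_measurable (F j)"
proof -
  have "subalgebra (F j) (F i)"
    using subalg[of i] subalg[of j] filtration[OF assms(2)] unfolding subalgebra_def by simp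
  then show ?thesis using assms(1) measurable_from_subalg by blast
qed

lemma measurable_F_M: "f \<in> borel_measurable (F i) \<Longrightarrow> f \<in> borel_measurable M"
  using subalg measurable_from_subalg by blast

lemma X_measurable [measurable]: "X t \<in> borel_measurable M"
  using measurable_F_M[OF adapted] .

lemma X_measurable_F: "s \<le> t \<Longrightarrow> X s \<in> borel_measurable (F t)"
  using measurable_F_mono[OF adapted] .

lemma all_bounded: "AE \<omega> in M. \<forall>t. \<bar>X t \<omega>\<bar> \<le> K"
  using bounded by (simp add: AE_all_countable)

definition S :: "nat \<Rightarrow> 'a \<Rightarrow> real" where "S n \<omega> = (\<Sum>i\<in>{1..n}. X i \<omega>)"

lemma S_measurable_F: "n \<le> t \<Longrightarrow> S n \<in> borel_measurable (F t)"
  unfolding S_def by (intro borel_measurable_sum X_measurable_F) auto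

lemma S_measurable [measurable]: "S n \<in> borel_measurable M"
  using measurable_F_M[OF S_measurable_F[OF order.refl]] .

lemma S_bounded: "AE \<omega> in M. \<bar>S n \<omega>\<bar> \<le> n * K"
  using all_bounded
proof eventually_elim
  case (elim \<omega>)
  have "\<bar>S n \<omega>\<bar> \<le> (\<Sum>i\<in>{1..n}. K)"
    unfolding S_def by (intro order.trans[OF sum_abs] sum_mono) (use elim in auto)
  then show ?case by simp
qed

lemma integrable_S: "integrable M (S n)"
  by (rule integrable_AE_bound[OF _ S_bounded]) simp

definition mart :: "nat \<Rightarrow> nat \<Rightarrow> 'a \<Rightarrow> real" where
  "mart N t = real_cond_exp M (F t) (S N)"

lemma mart_measurable_F: "s \<le> t \<Longrightarrow> mart N s \<in> borel_measurable (F t)"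
  unfolding mart_def by (rule measurable_F_mono[of _ s]) auto

lemma mart_measurable [measurable]: "mart N t \<in> borel_measurable M"
  using measurable_F_M[OF mart_measurable_F[OF order.refl]] .

lemma mart_test:
  assumes G: "G \<in> borel_measurable (F t)" and Gc: "AE \<omega> in M. \<bar>G \<omega>\<bar> \<le> c"
  shows "integrable M (\<lambda>\<omega>. G \<omega> * mart N t \<omega>)"
    and "expectation (\<lambda>\<omega>. G \<omega> * mart N t \<omega>) = expectation (\<lambda>\<omega>. G \<omega> * S N \<omega>)"
proof -
  interpret finite_measure_subalgebra M "F t"
    by unfold_locales (rule subalg)
  have [measurable]: "G \<in> borel_measurable M" using G measurable_F_M by auto
  have i: "integrable M (\<lambda>\<omega>. G \<omega> * S N \<omega>)"
  proof (rule integrable_AE_bound)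
    show "AE \<omega> in M. \<bar>G \<omega> * S N \<omega>\<bar> \<le> c * (N * K)"
      using Gc S_bounded[of N] by eventually_elim (auto simp: abs_mult intro!: mult_mono intro: order.trans[OF abs_ge_zero])
  qed simp
  show "integrable M (\<lambda>\<omega>. G \<omega> * mart N t \<omega>)"
    unfolding mart_def by (rule real_cond_exp_intg(1)[OF i G]) simp
  show "expectation (\<lambda>\<omega>. G \<omega> * mart N t \<omega>) = expectation (\<lambda>\<omega>. G \<omega> * S N \<omega>)"
    unfolding mart_def by (rule real_cond_exp_intg(2)[OF i G]) simp
qed

text \<open>The difference is the conditional expectation of the variables after time
  \<open>t\<close>; tested against \<open>G\<close>, the first mixing condition applies to each of
  them.\<close>

lemma mart_approx:
  assumes "t \<le> N"
  shows "AE \<omega> in M. \<bar>mart N t \<omega> - S t \<omega>\<bar> \<le> K * (\<Sum>l\<in>{1..<Suc (N - t)}. real l powr - \<beta>)"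
proof (rule AE_abs_le_of_test[OF subalg])
  show "(\<lambda>\<omega>. mart N t \<omega> - S t \<omega>) \<in> borel_measurable (F t)"
    using mart_measurable_F S_measurable_F by (intro borel_measurable_diff) auto
  show "integrable M (\<lambda>\<omega>. mart N t \<omega> - S t \<omega>)"
    using mart_test(1)[of "\<lambda>_. 1" t 1 N] integrable_S by simp
  fix G :: "'a \<Rightarrow> real" assume G: "G \<in> borel_measurable (F t)" and G1: "\<And>\<omega>. \<bar>G \<omega>\<bar> \<le> 1"
  have [measurable]: "G \<in> borel_measurable M" using G measurable_F_M by auto
  have Gc: "AE \<omega> in M. \<bar>G \<omega>\<bar> \<le> 1" using G1 by simp
  have iGX: "integrable M (\<lambda>\<omega>. G \<omega> * X i \<omega>)" for i
  proof (rule integrable_AE_bound)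
    show "AE \<omega> in M. \<bar>G \<omega> * X i \<omega>\<bar> \<le> 1 * K"
      using bounded[of i]
    proof eventually_elim
      case (elim \<omega>)
      show ?case unfolding abs_mult by (intro mult_mono G1 elim) auto
    qed
  qed simp
  have iGS: "integrable M (\<lambda>\<omega>. G \<omega> * S i \<omega>)" for i
    unfolding S_def sum_distrib_left using iGX by simp
  have "expectation (\<lambda>\<omega>. G \<omega> * (mart N t \<omega> - S t \<omega>)) = expectation (\<lambda>\<omega>. G \<omega> * S N \<omega>) - expectation (\<lambda>\<omega>. G \<omega> * S t \<omega>)"
    using mart_test[OF G Gc] iGS by (simp add: right_diff_distrib)
  also have "\<dots> = expectation (\<lambda>\<omega>. G \<omega> * S N \<omega> - G \<omega> * S t \<omega>)" using iGS by simp
  also have "\<dots> = expectation (\<lambda>\<omega>. \<Sum>l\<in>{1..<Suc (N - t)}. G \<omega> * X (t + l) \<omega>)"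
  proof -
    have "S N \<omega> = S t \<omega> + (\<Sum>l\<in>{1..<Suc (N - t)}. X (t + l) \<omega>)" for \<omega>
    proof -
      have "S (t + d) \<omega> = S t \<omega> + (\<Sum>l\<in>{1..<Suc d}. X (t + l) \<omega>)" for d
        by (induction d) (auto simp: S_def)
      from this[of "N - t"] show ?thesis using assms by simp
    qed
    then have "G \<omega> * S N \<omega> - G \<omega> * S t \<omega> = (\<Sum>l\<in>{1..<Suc (N - t)}. G \<omega> * X (t + l) \<omega>)" for \<omega>
      unfolding sum_distrib_left[symmetric] right_diff_distrib[symmetric] by (metis add_diff_cancel_left')
    then show ?thesis by (simp only:)
  qed
  also have "\<dots> = (\<Sum>l\<in>{1..<Suc (N - t)}. expectation (\<lambda>\<omega>. G \<omega> * X (t + l) \<omega>))"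
    using iGX by simp
  finally have "\<bar>expectation (\<lambda>\<omega>. G \<omega> * (mart N t \<omega> - S t \<omega>))\<bar>
     \<le> (\<Sum>l\<in>{1..<Suc (N - t)}. \<bar>expectation (\<lambda>\<omega>. G \<omega> * X (t + l) \<omega>)\<bar>)" by (simp only: sum_abs)
  also have "\<dots> \<le> (\<Sum>l\<in>{1..<Suc (N - t)}. K * real l powr - \<beta> * expectation (\<lambda>\<omega>. \<bar>G \<omega>\<bar>))"
    by (intro sum_mono mix1[OF _ G Gc]) auto
  also have "\<dots> = K * (\<Sum>l\<in>{1..<Suc (N - t)}. real l powr - \<beta>) * expectation (\<lambda>\<omega>. \<bar>G \<omega>\<bar>)"
    by (simp only: sum_distrib_left sum_distrib_right mult.assoc)
  finally show "\<bar>expectation (\<lambda>\<omega>. G \<omega> * (mart N t \<omega> - S t \<omega>))\<bar>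
    \<le> K * (\<Sum>l\<in>{1..<Suc (N - t)}. real l powr - \<beta>) * expectation (\<lambda>\<omega>. \<bar>G \<omega>\<bar>)" .
qed

lemma mart_approx_const:
  assumes "t \<le> N"
  shows "AE \<omega> in M. \<bar>mart N t \<omega> - S t \<omega>\<bar> \<le> K * Z"
proof -
  have "(\<Sum>l\<in>{1..<Suc (N - t)}. real l powr - \<beta>) \<le> Z"
    using sum_powr_neg_le[OF \<beta>(1), of 0 "Suc (N - t)"] by (simp add: Z_def)
  then have "K * (\<Sum>l\<in>{1..<Suc (N - t)}. real l powr - \<beta>) \<le> K * Z" using K_ge by (intro mult_left_mono) auto
  then show ?thesis using mart_approx[OF assms] by (auto elim!: eventually_mono)
qed

lemma mart_final: "AE \<omega> in M. mart N N \<omega> = S N \<omega>"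
  using mart_approx[of N N] by (auto elim!: eventually_mono)

lemma mart_step_bounded:
  assumes "Suc t \<le> N"
  shows "AE \<omega> in M. \<bar>mart N (Suc t) \<omega> - mart N t \<omega>\<bar> \<le> L"
  using mart_approx_const[OF assms] mart_approx_const[of t N, OF Suc_leD[OF assms]] bounded[of "Suc t"]
proof eventually_elim
  case (elim \<omega>)
  have "S (Suc t) \<omega> = S t \<omega> + X (Suc t) \<omega>" by (simp add: S_def)
  then show ?case using elim unfolding L_def by linarith
qed

lemma mart_incr_bounded:
  assumes "t + s \<le> N"
  shows "AE \<omega> in M. \<bar>mart N (t + s) \<omega> - mart N t \<omega>\<bar> \<le> s * L"
  using assms
proof (induction s)
  case (Suc s)
  have "AE \<omega> in M. \<bar>mart N (Suc (t + s)) \<omega> - mart N (t + s) \<omega>\<bar> \<le> L"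
    using Suc by (intro mart_step_bounded) auto
  moreover have "AE \<omega> in M. \<bar>mart N (t + s) \<omega> - mart N t \<omega>\<bar> \<le> s * L" using Suc by auto
  ultimately show ?case
  proof eventually_elim
    case (elim \<omega>)
    then show ?case unfolding of_nat_Suc distrib_right add_Suc_right by linarith
  qed
qed simp

lemma mart_incr_centered:
  assumes G: "G \<in> borel_measurable (F t)" and Gc: "AE \<omega> in M. \<bar>G \<omega>\<bar> \<le> c" and "t \<le> u"
  shows "expectation (\<lambda>\<omega>. G \<omega> * (mart N u \<omega> - mart N t \<omega>)) = 0"
proof -
  have Gu: "G \<in> borel_measurable (F u)" using measurable_F_mono[OF G assms(3)] .
  show ?thesis using mart_test[OF G Gc] mart_test[OF Gu Gc] by (simp add: right_diff_distrib)
qed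

text \<open>Induction adding one step \<open>D\<close> to the increment \<open>W\<close>. Terms
  linear in \<open>D\<close> vanish by the martingale property. The fourth moment uses the second
  one, so both are carried along together; the correction in 4 s^2 - s makes the recursion close
  exactly, since going from s to s + 1 adds 8 s + 3.\<close>

lemma mart_incr_moments:
  assumes G: "G \<in> borel_measurable (F t)" and Gc: "AE \<omega> in M. \<bar>G \<omega>\<bar> \<le> c" and G0: "\<And>\<omega>. 0 \<le> G \<omega>" and ts: "t + s \<le> N"
  shows "expectation (\<lambda>\<omega>. G \<omega> * (mart N (t + s) \<omega> - mart N t \<omega>)\<^sup>2) \<le> L\<^sup>2 * s * expectation G
    \<and> expectation (\<lambda>\<omega>. G \<omega> * (mart N (t + s) \<omega> - mart N t \<omega>) ^ 4) \<le> L ^ 4 * (4 * (real s)\<^sup>2 - real s) * expectation G"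
  using ts
proof (induction s)
  case 0
  then show ?case by simp
next
  case (Suc s)
  define W where "W = (\<lambda>\<omega>. mart N (t + s) \<omega> - mart N t \<omega>)"
  define D where "D = (\<lambda>\<omega>. mart N (Suc (t + s)) \<omega> - mart N (t + s) \<omega>)"
  have [measurable]: "G \<in> borel_measurable M" using G measurable_F_M by auto
  have [measurable]: "W \<in> borel_measurable M" "D \<in> borel_measurable M" unfolding W_def D_def by measurable
  have WF: "W \<in> borel_measurable (F (t + s))"
    unfolding W_def using mart_measurable_F by (intro borel_measurable_diff) auto
  have GF: "G \<in> borel_measurable (F (t + s))" using measurable_F_mono[OF G] by simp
  have Wb: "AE \<omega> in M. \<bar>W \<omega>\<bar> \<le> s * L" unfolding W_def using Suc by (intro mart_incr_bounded) auto
  have Db: "AE \<omega> in M. \<bar>D \<omega>\<bar> \<le> L" unfolding D_def using Suc by (intro mart_step_bounded) auto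
  have GWc: "AE \<omega> in M. \<bar>G \<omega> * W \<omega> ^ p\<bar> \<le> c * (s * L) ^ p" for p
    using Gc Wb by eventually_elim (auto simp: abs_mult power_abs intro!: mult_mono power_mono intro: order.trans[OF abs_ge_zero])
  have int: "integrable M (\<lambda>\<omega>. G \<omega> * W \<omega> ^ p * D \<omega> ^ q)" for p q
  proof (rule integrable_AE_bound)
    show "AE \<omega> in M. \<bar>G \<omega> * W \<omega> ^ p * D \<omega> ^ q\<bar> \<le> c * (s * L) ^ p * L ^ q"
      using GWc[of p] Db
    proof eventually_elim
      case (elim \<omega>)
      have "\<bar>G \<omega> * W \<omega> ^ p\<bar> * \<bar>D \<omega> ^ q\<bar> \<le> c * (s * L) ^ p * L ^ q"
        using elim by (intro mult_mono) (auto simp: power_abs intro!: power_mono intro: order.trans[OF abs_ge_zero])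
      then show ?case by (simp add: abs_mult)
    qed
  qed simp
  have cent: "expectation (\<lambda>\<omega>. G \<omega> * W \<omega> ^ p * D \<omega> ^ 1) = 0" for p
    using mart_incr_centered[where G="\<lambda>\<omega>. G \<omega> * W \<omega> ^ p" and t="t + s" and u="Suc (t + s)" and N=N, OF _ GWc[of p]] GF WF
    by (simp add: D_def)
  have D2: "expectation (\<lambda>\<omega>. G \<omega> * W \<omega> ^ p * D \<omega> ^ q) \<le> L ^ q * expectation (\<lambda>\<omega>. G \<omega> * W \<omega> ^ p)" if "even p" "even q" for p q
  proof -
    have "expectation (\<lambda>\<omega>. G \<omega> * W \<omega> ^ p * D \<omega> ^ q) \<le> expectation (\<lambda>\<omega>. L ^ q * (G \<omega> * W \<omega> ^ p))"
    proof (rule integral_mono_AE[OF int])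
      show "integrable M (\<lambda>\<omega>. L ^ q * (G \<omega> * W \<omega> ^ p))" using int[of p 0] by simp
      show "AE \<omega> in M. G \<omega> * W \<omega> ^ p * D \<omega> ^ q \<le> L ^ q * (G \<omega> * W \<omega> ^ p)"
        using Db
      proof eventually_elim
        case (elim \<omega>)
        have "D \<omega> ^ q \<le> L ^ q" using elim power_mono[of "\<bar>D \<omega>\<bar>" L q] that by (simp add: power_even_abs)
        moreover have "0 \<le> G \<omega> * W \<omega> ^ p" using G0 that by (simp add: zero_le_even_power)
        ultimately show ?case by (subst mult.commute) (intro mult_right_mono)
      qed
    qed
    then show ?thesis by simp
  qed
  have IH: "expectation (\<lambda>\<omega>. G \<omega> * W \<omega> ^ 2) \<le> L\<^sup>2 * s * expectation G"
     "expectation (\<lambda>\<omega>. G \<omega> * W \<omega> ^ 4) \<le> L ^ 4 * (4 * (real s)\<^sup>2 - real s) * expectation G"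
    using Suc unfolding W_def by auto
  have incr: "mart N (t + Suc s) \<omega> - mart N t \<omega> = W \<omega> + D \<omega>" for \<omega> by (simp add: W_def D_def)
  have "expectation (\<lambda>\<omega>. G \<omega> * (W \<omega> + D \<omega>)\<^sup>2)
     = expectation (\<lambda>\<omega>. G \<omega> * W \<omega> ^ 2 * D \<omega> ^ 0 + 2 * (G \<omega> * W \<omega> ^ 1 * D \<omega> ^ 1) + G \<omega> * W \<omega> ^ 0 * D \<omega> ^ 2)"
    by (intro Bochner_Integration.integral_cong) (auto simp: power2_eq_square algebra_simps)
  also have "\<dots> = expectation (\<lambda>\<omega>. G \<omega> * W \<omega> ^ 2 * D \<omega> ^ 0) + 2 * expectation (\<lambda>\<omega>. G \<omega> * W \<omega> ^ 1 * D \<omega> ^ 1)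
     + expectation (\<lambda>\<omega>. G \<omega> * W \<omega> ^ 0 * D \<omega> ^ 2)"
    by (simp only: Bochner_Integration.integral_add Bochner_Integration.integrable_add integrable_mult_right int integral_mult_right_zero)
  also have "\<dots> \<le> L\<^sup>2 * s * expectation G + 2 * 0 + L\<^sup>2 * expectation G"
    using IH(1) cent[of 1] D2[of 0 2] by simp
  also have "\<dots> = L\<^sup>2 * Suc s * expectation G" by (simp add: algebra_simps)
  finally have second: "expectation (\<lambda>\<omega>. G \<omega> * (W \<omega> + D \<omega>)\<^sup>2) \<le> L\<^sup>2 * Suc s * expectation G" .
  \<comment> \<open>In the binomial expansion the term 4 w d^3 is replaced by 2 w^2 d^2 + 2 d^4, so
    that the only odd term left is linear in d.\<close>
  have pw: "(w + d) ^ 4 \<le> w ^ 4 + 4 * (w ^ 3 * d) + 8 * (w\<^sup>2 * d\<^sup>2) + 3 * d ^ 4" for w d :: real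
  proof -
    have "0 \<le> 2 * d\<^sup>2 * (w - d)\<^sup>2" by simp
    then show ?thesis by (simp add: power2_eq_square power3_eq_cube power4_eq_xxxx algebra_simps)
  qed
  have "expectation (\<lambda>\<omega>. G \<omega> * (W \<omega> + D \<omega>) ^ 4)
     \<le> expectation (\<lambda>\<omega>. G \<omega> * W \<omega> ^ 4 * D \<omega> ^ 0 + 4 * (G \<omega> * W \<omega> ^ 3 * D \<omega> ^ 1) + 8 * (G \<omega> * W \<omega> ^ 2 * D \<omega> ^ 2) + 3 * (G \<omega> * W \<omega> ^ 0 * D \<omega> ^ 4))"
  proof (rule integral_mono_AE)
    show "integrable M (\<lambda>\<omega>. G \<omega> * W \<omega> ^ 4 * D \<omega> ^ 0 + 4 * (G \<omega> * W \<omega> ^ 3 * D \<omega> ^ 1) + 8 * (G \<omega> * W \<omega> ^ 2 * D \<omega> ^ 2) + 3 * (G \<omega> * W \<omega> ^ 0 * D \<omega> ^ 4))"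
      by (intro Bochner_Integration.integrable_add integrable_mult_right int)
    show "integrable M (\<lambda>\<omega>. G \<omega> * (W \<omega> + D \<omega>) ^ 4)"
    proof (rule integrable_AE_bound)
      show "AE \<omega> in M. \<bar>G \<omega> * (W \<omega> + D \<omega>) ^ 4\<bar> \<le> c * (s * L + L) ^ 4"
        using Gc Wb Db
      proof eventually_elim
        case (elim \<omega>)
        have "\<bar>(W \<omega> + D \<omega>) ^ 4\<bar> \<le> (s * L + L) ^ 4"
          unfolding power_abs using elim by (intro power_mono) linarith+
        then show ?case unfolding abs_mult using elim by (intro mult_mono) (auto intro: order.trans[OF abs_ge_zero])
      qed
    qed simp
    show "AE \<omega> in M. G \<omega> * (W \<omega> + D \<omega>) ^ 4
      \<le> G \<omega> * W \<omega> ^ 4 * D \<omega> ^ 0 + 4 * (G \<omega> * W \<omega> ^ 3 * D \<omega> ^ 1) + 8 * (G \<omega> * W \<omega> ^ 2 * D \<omega> ^ 2) + 3 * (G \<omega> * W \<omega> ^ 0 * D \<omega> ^ 4)"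
    proof (rule AE_I2)
      fix \<omega>
      show "G \<omega> * (W \<omega> + D \<omega>) ^ 4
      \<le> G \<omega> * W \<omega> ^ 4 * D \<omega> ^ 0 + 4 * (G \<omega> * W \<omega> ^ 3 * D \<omega> ^ 1) + 8 * (G \<omega> * W \<omega> ^ 2 * D \<omega> ^ 2) + 3 * (G \<omega> * W \<omega> ^ 0 * D \<omega> ^ 4)"
        using mult_left_mono[OF pw[of "W \<omega>" "D \<omega>"] G0[of \<omega>]] by (simp add: distrib_left mult_ac)
    qed
  qed
  also have "\<dots> = expectation (\<lambda>\<omega>. G \<omega> * W \<omega> ^ 4 * D \<omega> ^ 0) + 4 * expectation (\<lambda>\<omega>. G \<omega> * W \<omega> ^ 3 * D \<omega> ^ 1)
     + 8 * expectation (\<lambda>\<omega>. G \<omega> * W \<omega> ^ 2 * D \<omega> ^ 2) + 3 * expectation (\<lambda>\<omega>. G \<omega> * W \<omega> ^ 0 * D \<omega> ^ 4)"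
    by (simp only: Bochner_Integration.integral_add Bochner_Integration.integrable_add integrable_mult_right int integral_mult_right_zero)
  also have "\<dots> \<le> L ^ 4 * (4 * (real s)\<^sup>2 - real s) * expectation G + 4 * 0 + 8 * (L\<^sup>2 * (L\<^sup>2 * s * expectation G)) + 3 * (L ^ 4 * expectation G)"
  proof (intro add_mono mult_left_mono)
    show "expectation (\<lambda>\<omega>. G \<omega> * W \<omega> ^ 4 * D \<omega> ^ 0) \<le> L ^ 4 * (4 * (real s)\<^sup>2 - real s) * expectation G" using IH(2) by simp
    show "expectation (\<lambda>\<omega>. G \<omega> * W \<omega> ^ 3 * D \<omega> ^ 1) \<le> 0" using cent[of 3] by simp
    show "expectation (\<lambda>\<omega>. G \<omega> * W \<omega> ^ 2 * D \<omega> ^ 2) \<le> L\<^sup>2 * (L\<^sup>2 * s * expectation G)"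
      by (rule order.trans[OF D2[of 2 2] mult_left_mono[OF IH(1)]]) auto
    show "expectation (\<lambda>\<omega>. G \<omega> * W \<omega> ^ 0 * D \<omega> ^ 4) \<le> L ^ 4 * expectation G" using D2[of 0 4] by simp
  qed auto
  also have "\<dots> = L ^ 4 * (4 * (real (Suc s))\<^sup>2 - real (Suc s)) * expectation G"
    by (simp add: power2_eq_square power4_eq_xxxx algebra_simps)
  finally have "expectation (\<lambda>\<omega>. G \<omega> * (W \<omega> + D \<omega>) ^ 4) \<le> L ^ 4 * (4 * (real (Suc s))\<^sup>2 - real (Suc s)) * expectation G" .
  with second show ?case unfolding incr by simp
qed

section \<open>Conditional variance of a block\<close>

lemma \<gamma>_bound:
  assumes "1 \<le> d"
  shows "\<bar>\<gamma> d\<bar> \<le> K\<^sup>2 * real d powr - \<beta>"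
proof -
  have "\<bar>\<gamma> d\<bar> \<le> K * real d powr - \<beta> * expectation (\<lambda>\<omega>. \<bar>X 0 \<omega>\<bar>)"
    using mix1[OF assms adapted[of 0] bounded[of 0]] cov[of 0 d] by simp
  also have "\<dots> \<le> K * real d powr - \<beta> * K"
  proof (rule mult_left_mono)
    have "expectation (\<lambda>\<omega>. \<bar>X 0 \<omega>\<bar>) \<le> expectation (\<lambda>\<omega>. K)"
      by (rule integral_mono_AE) (use bounded[of 0] in \<open>auto intro!: integrable_AE_bound[where c=K]\<close>)
    then show "expectation (\<lambda>\<omega>. \<bar>X 0 \<omega>\<bar>) \<le> K" by (simp add: prob_space)
  qed (use K_ge in auto)
  finally show ?thesis by (simp add: power2_eq_square mult_ac)
qed

text \<open>Twice the tail of the covariance series. Lengthening a block from \<open>m\<close> to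
  \<open>m + 1\<close> raises its variance by \<gamma> 0 plus twice the first \<open>m\<close>
  covariances, which misses \<open>s2\<close> by this amount.\<close>

lemma tail_\<gamma>:
  "\<bar>s2 - \<gamma> 0 - 2 * (\<Sum>d<m. \<gamma> (Suc d))\<bar> \<le> 2 * (K\<^sup>2 * (Z * real (Suc m) powr (1 - \<beta>)))"
proof -
  have t: "(\<lambda>n. (\<Sum>d<n. \<gamma> (Suc d)) - (\<Sum>d<m. \<gamma> (Suc d))) \<longlonglongrightarrow> (s2 - \<gamma> 0) / 2 - (\<Sum>d<m. \<gamma> (Suc d))"
    using sigma unfolding sums_def by (intro tendsto_intros)
  have b: "\<bar>(\<Sum>d<n. \<gamma> (Suc d)) - (\<Sum>d<m. \<gamma> (Suc d))\<bar> \<le> K\<^sup>2 * (Z * real (Suc m) powr (1 - \<beta>))" if "m \<le> n" for n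
  proof -
    have "(\<Sum>d<n. \<gamma> (Suc d)) - (\<Sum>d<m. \<gamma> (Suc d)) = (\<Sum>d\<in>{m..<n}. \<gamma> (Suc d))"
      using that sum_diff_nat_ivl[of 0 m n "\<lambda>d. \<gamma> (Suc d)"] by (simp add: atLeast0LessThan)
    also have "\<dots> = (\<Sum>d\<in>{Suc m..<Suc n}. \<gamma> d)" by (rule sum.shift_bounds_Suc_ivl[symmetric])
    finally have "\<bar>(\<Sum>d<n. \<gamma> (Suc d)) - (\<Sum>d<m. \<gamma> (Suc d))\<bar> \<le> (\<Sum>d\<in>{Suc m..<Suc n}. \<bar>\<gamma> d\<bar>)" by (simp only: sum_abs)
    also have "\<dots> \<le> (\<Sum>d\<in>{Suc m..<Suc n}. K\<^sup>2 * real d powr - \<beta>)"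
      by (intro sum_mono \<gamma>_bound) auto
    also have "\<dots> = K\<^sup>2 * (\<Sum>d\<in>{Suc m..<Suc n}. real d powr - \<beta>)" by (rule sum_distrib_left[symmetric])
    also have "\<dots> \<le> K\<^sup>2 * (Z * real (Suc m) powr (1 - \<beta>))"
      unfolding Z_def using \<beta> by (intro mult_left_mono sum_powr_neg_le) auto
    finally show ?thesis .
  qed
  have "\<bar>(s2 - \<gamma> 0) / 2 - (\<Sum>d<m. \<gamma> (Suc d))\<bar> \<le> K\<^sup>2 * (Z * real (Suc m) powr (1 - \<beta>))"
    by (rule tendsto_le[OF _ tendsto_const tendsto_rabs[OF t]])
      (use b in \<open>auto intro!: eventually_sequentiallyI[of m]\<close>)
  then show ?thesis by (simp add: abs_le_iff field_simps)
qed

definition block_part :: "nat \<Rightarrow> nat \<Rightarrow> 'a \<Rightarrow> real" where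
  "block_part t m \<omega> = (\<Sum>i\<in>{1..m}. X (t + i) \<omega>)"

lemma block_part_measurable [measurable]: "block_part t m \<in> borel_measurable M"
  unfolding block_part_def by measurable

lemma block_part_bounded: "AE \<omega> in M. \<bar>block_part t m \<omega>\<bar> \<le> m * K"
  using all_bounded
proof eventually_elim
  case (elim \<omega>)
  have "\<bar>block_part t m \<omega>\<bar> \<le> (\<Sum>i\<in>{1..m}. K)"
    unfolding block_part_def by (intro order.trans[OF sum_abs] sum_mono) (use elim in auto)
  then show ?case by simp
qed

lemma integrable_test_mult:
  assumes [measurable]: "G \<in> borel_measurable M" "f \<in> borel_measurable M"
    and "AE \<omega> in M. \<bar>G \<omega>\<bar> \<le> c" "AE \<omega> in M. \<bar>f \<omega>\<bar> \<le> b"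
  shows "integrable M (\<lambda>\<omega>. G \<omega> * f \<omega> :: real)"
proof (rule integrable_AE_bound)
  show "AE \<omega> in M. \<bar>G \<omega> * f \<omega>\<bar> \<le> c * b"
    using assms(3,4) by eventually_elim (auto simp: abs_mult intro!: mult_mono intro: order.trans[OF abs_ge_zero])
qed simp

text \<open>For the pair \<open>(i, m + 1)\<close> one of \<open>i\<close> and \<open>m + 1 - i\<close> is at least \<open>(m + 1) / 2\<close>: the former is
  used with the second mixing hypothesis, the latter with the first.\<close>

lemma pair_bound:
  assumes G: "G \<in> borel_measurable (F t)" and Gc: "AE \<omega> in M. \<bar>G \<omega>\<bar> \<le> c" and i: "1 \<le> i" "i \<le> m"
  shows "\<bar>expectation (\<lambda>\<omega>. G \<omega> * (X (t + i) \<omega> * X (t + Suc m) \<omega> - \<gamma> (Suc m - i)))\<bar>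
    \<le> 8 * K\<^sup>2 * real (Suc m) powr - \<beta> * expectation (\<lambda>\<omega>. \<bar>G \<omega>\<bar>)"
proof -
  have [measurable]: "G \<in> borel_measurable M" using G measurable_F_M by auto
  define g where "g = expectation (\<lambda>\<omega>. \<bar>G \<omega>\<bar>)"
  have g0: "0 \<le> g" by (simp add: g_def)
  have KK: "K \<le> K\<^sup>2" using K_ge by (simp add: power2_eq_square)
  \<comment> \<open>A distance of at least half of \<open>Suc m\<close> costs the factor
    \<open>2 powr \<beta>\<close>, which is at most 4 for these rates.\<close>
  have half: "real d powr - \<beta> \<le> 4 * real (Suc m) powr - \<beta>" if "Suc m \<le> 2 * d" for d
  proof -
    have "real (Suc m) \<le> 2 * real d" using of_nat_mono[OF that, where 'a=real] by simp
    then have "(real (Suc m) / 2) \<le> real d" by simp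
    then have "real d powr - \<beta> \<le> (real (Suc m) / 2) powr - \<beta>"
      using \<beta> by (intro powr_mono2') auto
    also have "\<dots> = 2 powr \<beta> * real (Suc m) powr - \<beta>"
      by (simp add: powr_divide powr_minus_divide)
    also have "\<dots> \<le> 2 powr 2 * real (Suc m) powr - \<beta>"
      using \<beta> by (intro mult_right_mono powr_mono) auto
    finally show ?thesis by simp
  qed
  show ?thesis
  proof (cases "Suc m \<le> 2 * i")
    case True
    have "\<bar>expectation (\<lambda>\<omega>. G \<omega> * (X (t + i) \<omega> * X (t + Suc m) \<omega> - \<gamma> (Suc m - i)))\<bar> \<le> K * real i powr - \<beta> * g"
      unfolding g_def by (rule mix2[OF _ _ G Gc]) (use i in auto)
    also have "\<dots> \<le> K\<^sup>2 * (4 * real (Suc m) powr - \<beta>) * g"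
      using half[OF True] KK g0 by (intro mult_right_mono mult_mono) auto
    also have "\<dots> \<le> 8 * K\<^sup>2 * real (Suc m) powr - \<beta> * g"
      using g0 by (intro mult_right_mono) auto
    finally show ?thesis by (simp add: g_def)
  next
    case False
    define d where "d = Suc m - i"
    have d: "Suc m \<le> 2 * d" "1 \<le> d" "t + Suc m = (t + i) + d" using False i by (auto simp: d_def)
    have GX: "(\<lambda>\<omega>. G \<omega> * X (t + i) \<omega>) \<in> borel_measurable (F (t + i))"
      using measurable_F_mono[OF G, of "t + i"] adapted[of "t + i"] by auto
    have GXc: "AE \<omega> in M. \<bar>G \<omega> * X (t + i) \<omega>\<bar> \<le> c * K"
      using Gc bounded[of "t + i"] by eventually_elim (auto simp: abs_mult intro!: mult_mono intro: order.trans[OF abs_ge_zero])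
    have GX1: "expectation (\<lambda>\<omega>. \<bar>G \<omega> * X (t + i) \<omega>\<bar>) \<le> K * g"
    proof -
      have "expectation (\<lambda>\<omega>. \<bar>G \<omega> * X (t + i) \<omega>\<bar>) \<le> expectation (\<lambda>\<omega>. K * \<bar>G \<omega>\<bar>)"
      proof (rule integral_mono_AE)
        show "AE \<omega> in M. \<bar>G \<omega> * X (t + i) \<omega>\<bar> \<le> K * \<bar>G \<omega>\<bar>"
          using bounded[of "t + i"] by eventually_elim (auto simp: abs_mult mult.commute[of K] intro!: mult_left_mono)
        show "integrable M (\<lambda>\<omega>. \<bar>G \<omega> * X (t + i) \<omega>\<bar>)"
          by (rule integrable_abs, rule integrable_AE_bound[OF _ GXc]) simp
        show "integrable M (\<lambda>\<omega>. K * \<bar>G \<omega>\<bar>)"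
          by (rule integrable_mult_right, rule integrable_abs, rule integrable_AE_bound[OF _ Gc]) simp
      qed
      then show ?thesis by (simp add: g_def)
    qed
    have iGXX: "integrable M (\<lambda>\<omega>. G \<omega> * X (t + i) \<omega> * X (t + i + d) \<omega>)"
      by (rule integrable_test_mult[OF _ _ GXc bounded]) auto
    have iG: "integrable M G" by (rule integrable_AE_bound[OF _ Gc]) simp
    have eG: "\<bar>expectation G\<bar> \<le> g" unfolding g_def by simp
    have "expectation (\<lambda>\<omega>. G \<omega> * (X (t + i) \<omega> * X (t + Suc m) \<omega> - \<gamma> d))
      = expectation (\<lambda>\<omega>. G \<omega> * X (t + i) \<omega> * X (t + i + d) \<omega>) - expectation G * \<gamma> d"
      using iGXX iG unfolding d(3) right_diff_distrib by (simp add: mult.assoc)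
    then have "\<bar>expectation (\<lambda>\<omega>. G \<omega> * (X (t + i) \<omega> * X (t + Suc m) \<omega> - \<gamma> d))\<bar>
      \<le> \<bar>expectation (\<lambda>\<omega>. G \<omega> * X (t + i) \<omega> * X (t + i + d) \<omega>)\<bar> + \<bar>expectation G\<bar> * \<bar>\<gamma> d\<bar>"
      unfolding abs_mult[of "expectation G", symmetric] by (simp only: abs_triangle_ineq4)
    also have "\<dots> \<le> K * real d powr - \<beta> * (K * g) + g * (K\<^sup>2 * real d powr - \<beta>)"
    proof (rule add_mono)
      have "\<bar>expectation (\<lambda>\<omega>. G \<omega> * X (t + i) \<omega> * X (t + i + d) \<omega>)\<bar>
         \<le> K * real d powr - \<beta> * expectation (\<lambda>\<omega>. \<bar>G \<omega> * X (t + i) \<omega>\<bar>)"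
        by (rule mix1[OF d(2) GX GXc])
      also have "\<dots> \<le> K * real d powr - \<beta> * (K * g)" using GX1 K_ge by (intro mult_left_mono) auto
      finally show "\<bar>expectation (\<lambda>\<omega>. G \<omega> * X (t + i) \<omega> * X (t + i + d) \<omega>)\<bar> \<le> K * real d powr - \<beta> * (K * g)" .
      show "\<bar>expectation G\<bar> * \<bar>\<gamma> d\<bar> \<le> g * (K\<^sup>2 * real d powr - \<beta>)"
        using eG \<gamma>_bound[OF d(2)] by (intro mult_mono) (auto intro: order.trans[OF abs_ge_zero])
    qed
    also have "\<dots> = 2 * K\<^sup>2 * g * real d powr - \<beta>" by (simp add: power2_eq_square)
    also have "\<dots> \<le> 2 * K\<^sup>2 * g * (4 * real (Suc m) powr - \<beta>)"
      using half[OF d(1)] g0 by (intro mult_left_mono) auto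
    finally show ?thesis by (simp add: g_def d_def mult_ac)
  qed
qed

text \<open>Induction on the length. A new variable forms \<open>m\<close> pairs, each with error of
  order m^(- \<beta>) by \<open>pair_bound\<close>, brings its own square and the tail of the
  covariance series; together they have order m^(1 - \<beta>). The constants 16, 1 and 2 of these
  three add up to 19, and 2 - \<beta> \<ge> 1/2 doubles this to 38.\<close>

lemma block_variance:
  assumes G: "G \<in> borel_measurable (F t)" and Gc: "AE \<omega> in M. \<bar>G \<omega>\<bar> \<le> c"
  shows "\<bar>expectation (\<lambda>\<omega>. G \<omega> * ((block_part t m \<omega>)\<^sup>2 - m * s2))\<bar>
    \<le> 38 * (K\<^sup>2 * Z) * real m powr (2 - \<beta>) * expectation (\<lambda>\<omega>. \<bar>G \<omega>\<bar>)"
proof (induction m)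
  case 0
  then show ?case by (simp add: block_part_def)
next
  case (Suc m)
  have [measurable]: "G \<in> borel_measurable M" using G measurable_F_M by auto
  define g where "g = expectation (\<lambda>\<omega>. \<bar>G \<omega>\<bar>)"
  have g0: "0 \<le> g" by (simp add: g_def)
  define P where "P = real (Suc m) powr (1 - \<beta>)"
  have P0: "0 \<le> P" by (simp add: P_def)
  have mP: "real (Suc m) * real (Suc m) powr - \<beta> = P"
  proof -
    have "real (Suc m) powr 1 * real (Suc m) powr - \<beta> = P" unfolding P_def by (simp only: powr_add[symmetric]) simp
    then show ?thesis by simp
  qed
  have bP: "real (Suc m) powr - \<beta> \<le> P" unfolding P_def by (intro powr_mono) auto
  have iG: "integrable M G" by (rule integrable_AE_bound[OF _ Gc]) simp
  have XX: "AE \<omega> in M. \<bar>X i \<omega> * X j \<omega> - v\<bar> \<le> K * K + \<bar>v\<bar>" for i j v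
    using bounded[of i] bounded[of j]
  proof eventually_elim
    case (elim \<omega>)
    have "\<bar>X i \<omega> * X j \<omega>\<bar> \<le> K * K" unfolding abs_mult using elim by (intro mult_mono) auto
    then show ?case by linarith
  qed
  have iXX: "integrable M (\<lambda>\<omega>. G \<omega> * (X i \<omega> * X j \<omega> - v))" for i j v
    by (rule integrable_test_mult[OF _ _ Gc XX]) auto
  define B where "B = block_part t m"
  have B2: "AE \<omega> in M. \<bar>(B \<omega>)\<^sup>2 - v\<bar> \<le> (m * K)\<^sup>2 + \<bar>v\<bar>" for v
    using block_part_bounded[of t m]
  proof eventually_elim
    case (elim \<omega>)
    have "(B \<omega>)\<^sup>2 \<le> (m * K)\<^sup>2" using power_mono[OF elim, of 2] by (simp add: B_def)
    then show ?case using zero_le_power2[of "B \<omega>"] by linarith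
  qed
  have [measurable]: "B \<in> borel_measurable M" by (simp add: B_def)
  have iB: "integrable M (\<lambda>\<omega>. G \<omega> * ((B \<omega>)\<^sup>2 - v))" for v
    by (rule integrable_test_mult[OF _ _ Gc B2]) auto
  \<comment> \<open>The deficit of one step: what the expected increase of the squared block sum
    lacks to \<open>s2\<close>.\<close>
  define T where "T = s2 - \<gamma> 0 - 2 * (\<Sum>d<m. \<gamma> (Suc d))"
  have dec: "G \<omega> * ((block_part t (Suc m) \<omega>)\<^sup>2 - Suc m * s2)
    = G \<omega> * ((B \<omega>)\<^sup>2 - m * s2) + 2 * (\<Sum>i\<in>{1..m}. G \<omega> * (X (t + i) \<omega> * X (t + Suc m) \<omega> - \<gamma> (Suc m - i)))
      + G \<omega> * (X (t + Suc m) \<omega> * X (t + Suc m) \<omega> - \<gamma> 0) - T * G \<omega>" for \<omega>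
  proof -
    have s: "(\<Sum>i\<in>{1..m}. \<gamma> (Suc m - i)) = (\<Sum>d<m. \<gamma> (Suc d))"
      by (rule sum.reindex_bij_witness[where i="\<lambda>d. m - d" and j="\<lambda>i. m - i"]) (auto intro: arg_cong[where f=\<gamma>])
    have b: "block_part t (Suc m) \<omega> = B \<omega> + X (t + Suc m) \<omega>" by (simp add: block_part_def B_def)
    have "(\<Sum>i\<in>{1..m}. G \<omega> * (X (t + i) \<omega> * X (t + Suc m) \<omega> - \<gamma> (Suc m - i)))
      = G \<omega> * (B \<omega> * X (t + Suc m) \<omega> - (\<Sum>d<m. \<gamma> (Suc d)))"
      unfolding s[symmetric] B_def block_part_def
      by (simp add: sum_distrib_left[symmetric] sum_distrib_right sum_subtractf)
    then show ?thesis unfolding b T_def by (simp add: power2_eq_square algebra_simps)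
  qed
  have "expectation (\<lambda>\<omega>. G \<omega> * ((block_part t (Suc m) \<omega>)\<^sup>2 - Suc m * s2))
    = expectation (\<lambda>\<omega>. G \<omega> * ((B \<omega>)\<^sup>2 - m * s2))
      + 2 * (\<Sum>i\<in>{1..m}. expectation (\<lambda>\<omega>. G \<omega> * (X (t + i) \<omega> * X (t + Suc m) \<omega> - \<gamma> (Suc m - i))))
      + expectation (\<lambda>\<omega>. G \<omega> * (X (t + Suc m) \<omega> * X (t + Suc m) \<omega> - \<gamma> 0)) - T * expectation G"
    unfolding dec
    by (simp only: Bochner_Integration.integral_add Bochner_Integration.integral_diff Bochner_Integration.integral_sum
        Bochner_Integration.integrable_add Bochner_Integration.integrable_diff Bochner_Integration.integrable_sum
        integrable_mult_right integral_mult_right_zero iXX iB iG)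
  then have "\<bar>expectation (\<lambda>\<omega>. G \<omega> * ((block_part t (Suc m) \<omega>)\<^sup>2 - Suc m * s2))\<bar>
    \<le> \<bar>expectation (\<lambda>\<omega>. G \<omega> * ((B \<omega>)\<^sup>2 - m * s2))\<bar>
      + 2 * (\<Sum>i\<in>{1..m}. \<bar>expectation (\<lambda>\<omega>. G \<omega> * (X (t + i) \<omega> * X (t + Suc m) \<omega> - \<gamma> (Suc m - i)))\<bar>)
      + \<bar>expectation (\<lambda>\<omega>. G \<omega> * (X (t + Suc m) \<omega> * X (t + Suc m) \<omega> - \<gamma> 0))\<bar> + \<bar>T\<bar> * \<bar>expectation G\<bar>"
    using sum_abs[of "\<lambda>i. expectation (\<lambda>\<omega>. G \<omega> * (X (t + i) \<omega> * X (t + Suc m) \<omega> - \<gamma> (Suc m - i)))" "{1..m}"]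
    by (simp only: abs_mult[symmetric])
  also have "\<dots> \<le> 38 * (K\<^sup>2 * Z) * real m powr (2 - \<beta>) * g + 2 * (8 * K\<^sup>2 * P * g) + K\<^sup>2 * P * g + 2 * (K\<^sup>2 * (Z * P)) * g"
  proof (intro add_mono)
    show "\<bar>expectation (\<lambda>\<omega>. G \<omega> * ((B \<omega>)\<^sup>2 - m * s2))\<bar> \<le> 38 * (K\<^sup>2 * Z) * real m powr (2 - \<beta>) * g"
      using Suc by (simp add: B_def g_def)
    have "(\<Sum>i\<in>{1..m}. \<bar>expectation (\<lambda>\<omega>. G \<omega> * (X (t + i) \<omega> * X (t + Suc m) \<omega> - \<gamma> (Suc m - i)))\<bar>)
      \<le> (\<Sum>i\<in>{1..m}. 8 * K\<^sup>2 * real (Suc m) powr - \<beta> * g)"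
      unfolding g_def by (intro sum_mono pair_bound[OF G Gc]) auto
    also have "\<dots> = 8 * K\<^sup>2 * (real m * real (Suc m) powr - \<beta>) * g" by simp
    also have "\<dots> \<le> 8 * K\<^sup>2 * (real (Suc m) * real (Suc m) powr - \<beta>) * g"
      using g0 by (intro mult_right_mono mult_left_mono) auto
    finally show "2 * (\<Sum>i\<in>{1..m}. \<bar>expectation (\<lambda>\<omega>. G \<omega> * (X (t + i) \<omega> * X (t + Suc m) \<omega> - \<gamma> (Suc m - i)))\<bar>)
       \<le> 2 * (8 * K\<^sup>2 * P * g)" unfolding mP by (rule mult_left_mono) simp
    have "\<bar>expectation (\<lambda>\<omega>. G \<omega> * (X (t + Suc m) \<omega> * X (t + Suc m) \<omega> - \<gamma> 0))\<bar> \<le> K * real (Suc m) powr - \<beta> * g"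
      using mix2[OF _ order.refl G Gc, of "Suc m"] by (simp add: g_def)
    also have "\<dots> \<le> K\<^sup>2 * P * g"
      using bP K_ge g0 by (intro mult_right_mono mult_mono) (auto simp: power2_eq_square)
    finally show "\<bar>expectation (\<lambda>\<omega>. G \<omega> * (X (t + Suc m) \<omega> * X (t + Suc m) \<omega> - \<gamma> 0))\<bar> \<le> K\<^sup>2 * P * g" .
    have "\<bar>expectation G\<bar> \<le> g" unfolding g_def by simp
    then show "\<bar>T\<bar> * \<bar>expectation G\<bar> \<le> 2 * (K\<^sup>2 * (Z * P)) * g"
      using tail_\<gamma>[of m] unfolding T_def P_def by (intro mult_mono) auto
  qed
  also have "\<dots> \<le> 38 * (K\<^sup>2 * Z) * real m powr (2 - \<beta>) * g + 19 * (K\<^sup>2 * Z) * P * g"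
  proof -
    have "17 * (K\<^sup>2 * 1 * P * g) \<le> 17 * (K\<^sup>2 * Z * P * g)"
      using Z_ge P0 g0 by (intro mult_left_mono mult_right_mono) auto
    then show ?thesis by (simp add: algebra_simps)
  qed
  also have "\<dots> \<le> 38 * (K\<^sup>2 * Z) * real m powr (2 - \<beta>) * g + 38 * (K\<^sup>2 * Z) * (real (Suc m) powr (2 - \<beta>) - real m powr (2 - \<beta>)) * g"
  proof -
    have "(2 - \<beta>) * P \<le> real (Suc m) powr (2 - \<beta>) - real m powr (2 - \<beta>)"
      using powr_diff_ge[of "2 - \<beta>" m] \<beta> by (simp add: P_def)
    moreover have "1/2 * P \<le> (2 - \<beta>) * P" using \<beta> P0 by (intro mult_right_mono) auto
    ultimately have "1/2 * P \<le> real (Suc m) powr (2 - \<beta>) - real m powr (2 - \<beta>)" by (rule order.trans[rotated])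
    then have "38 * (1/2 * P) \<le> 38 * (real (Suc m) powr (2 - \<beta>) - real m powr (2 - \<beta>))" by (rule mult_left_mono) simp
    then have "19 * P \<le> 38 * (real (Suc m) powr (2 - \<beta>) - real m powr (2 - \<beta>))" by simp
    then have "(K\<^sup>2 * Z * g) * (19 * P) \<le> (K\<^sup>2 * Z * g) * (38 * (real (Suc m) powr (2 - \<beta>) - real m powr (2 - \<beta>)))"
      using Z_ge g0 by (intro mult_left_mono) auto
    then show ?thesis by (simp add: mult_ac)
  qed
  also have "\<dots> = 38 * (K\<^sup>2 * Z) * real (Suc m) powr (2 - \<beta>) * g" by (simp add: algebra_simps)
  finally show ?case by (simp add: g_def)
qed

text \<open>Block sum and martingale increment differ by at most \<open>L\<close>, while the
  increment has conditional second moment of order m. Their squares therefore differ by order sqrt m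
  on average, and \<beta> \<le> 3/2 makes this at most m^(2 - \<beta>). The 41 is 38 from
  \<open>block_variance\<close> plus 3.\<close>

lemma block_mart_variance:
  assumes G: "G \<in> borel_measurable (F t)" and Gc: "AE \<omega> in M. \<bar>G \<omega>\<bar> \<le> c" and tm: "t + m \<le> N" and m: "1 \<le> m"
  shows "\<bar>expectation (\<lambda>\<omega>. G \<omega> * ((mart N (t + m) \<omega> - mart N t \<omega>)\<^sup>2 - m * s2))\<bar>
    \<le> 41 * L ^ 3 * real m powr (2 - \<beta>) * expectation (\<lambda>\<omega>. \<bar>G \<omega>\<bar>)"
proof -
  have [measurable]: "G \<in> borel_measurable M" using G measurable_F_M by auto
  define g where "g = expectation (\<lambda>\<omega>. \<bar>G \<omega>\<bar>)"
  have g0: "0 \<le> g" by (simp add: g_def)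
  define Y where "Y = (\<lambda>\<omega>. mart N (t + m) \<omega> - mart N t \<omega>)"
  define B where "B = block_part t m"
  have [measurable]: "Y \<in> borel_measurable M" "B \<in> borel_measurable M" by (simp_all add: Y_def B_def)
  have Yb: "AE \<omega> in M. \<bar>Y \<omega>\<bar> \<le> m * L" unfolding Y_def by (rule mart_incr_bounded[OF tm])
  have YB: "AE \<omega> in M. \<bar>Y \<omega> - B \<omega>\<bar> \<le> L"
    using mart_approx_const[OF tm] mart_approx_const[OF add_leD1[OF tm]]
  proof eventually_elim
    case (elim \<omega>)
    have "S (t + m) \<omega> = S t \<omega> + B \<omega>" unfolding B_def block_part_def by (induction m) (auto simp: S_def)
    then show ?case using elim L_ge(5) unfolding Y_def by linarith
  qed
  have Gc': "AE \<omega> in M. \<bar>\<bar>G \<omega>\<bar>\<bar> \<le> c" using Gc by simp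
  have iY2: "integrable M (\<lambda>\<omega>. \<bar>G \<omega>\<bar> * (Y \<omega>)\<^sup>2)"
    by (rule integrable_test_mult[OF _ _ Gc', where b="(m * L)\<^sup>2"])
      (use Yb in \<open>auto elim!: eventually_mono dest: power_mono[where n=2]\<close>)
  have iG: "integrable M (\<lambda>\<omega>. \<bar>G \<omega>\<bar>)" by (rule integrable_AE_bound[OF _ Gc']) simp
  have Y2: "expectation (\<lambda>\<omega>. \<bar>G \<omega>\<bar> * (Y \<omega>)\<^sup>2) \<le> L\<^sup>2 * m * g"
    using mart_incr_moments[of "\<lambda>\<omega>. \<bar>G \<omega>\<bar>" t c m N] G Gc tm by (simp add: Y_def g_def)
  define q where "q = sqrt (real m)"
  have q: "1 \<le> q" "q * q = m" using m by (auto simp: q_def)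
  have diff: "AE \<omega> in M. \<bar>G \<omega> * ((Y \<omega>)\<^sup>2 - (B \<omega>)\<^sup>2)\<bar> \<le> (L / q) * (\<bar>G \<omega>\<bar> * (Y \<omega>)\<^sup>2) + (L * q + L\<^sup>2) * \<bar>G \<omega>\<bar>"
    using YB
  proof eventually_elim
    case (elim \<omega>)
    \<comment> \<open>Only the conditional second moment of \<open>Y\<close> is at hand, so its
      absolute value is linearised by the inequality of arithmetic and geometric means; the scale
      \<open>q = sqrt m\<close> balances the two terms.\<close>
    have "2 * \<bar>Y \<omega>\<bar> \<le> (Y \<omega>)\<^sup>2 / q + q"
    proof -
      have "0 \<le> (\<bar>Y \<omega>\<bar> - q)\<^sup>2 / q" using q by simp
      also have "\<dots> = (Y \<omega>)\<^sup>2 / q + q - 2 * \<bar>Y \<omega>\<bar>" using q(1) by (simp add: power2_diff field_simps power2_eq_square)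
      finally show ?thesis by simp
    qed
    moreover have "\<bar>Y \<omega> + B \<omega>\<bar> \<le> 2 * \<bar>Y \<omega>\<bar> + L" using elim by linarith
    ultimately have "\<bar>Y \<omega> + B \<omega>\<bar> \<le> (Y \<omega>)\<^sup>2 / q + q + L" by linarith
    then have "\<bar>Y \<omega> - B \<omega>\<bar> * \<bar>Y \<omega> + B \<omega>\<bar> \<le> L * ((Y \<omega>)\<^sup>2 / q + q + L)"
      using elim by (intro mult_mono) (auto intro: order.trans[OF abs_ge_zero])
    moreover have "(Y \<omega>)\<^sup>2 - (B \<omega>)\<^sup>2 = (Y \<omega> - B \<omega>) * (Y \<omega> + B \<omega>)" by (simp add: power2_eq_square algebra_simps)
    ultimately have "\<bar>(Y \<omega>)\<^sup>2 - (B \<omega>)\<^sup>2\<bar> \<le> L * ((Y \<omega>)\<^sup>2 / q + q + L)" by (simp add: abs_mult)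
    then have "\<bar>G \<omega>\<bar> * \<bar>(Y \<omega>)\<^sup>2 - (B \<omega>)\<^sup>2\<bar> \<le> \<bar>G \<omega>\<bar> * (L * ((Y \<omega>)\<^sup>2 / q + q + L))" by (intro mult_left_mono) auto
    also have "\<dots> = (L / q) * (\<bar>G \<omega>\<bar> * (Y \<omega>)\<^sup>2) + (L * q + L\<^sup>2) * \<bar>G \<omega>\<bar>"
      by (simp add: power2_eq_square algebra_simps)
    finally show ?case by (simp add: abs_mult)
  qed
  have B2: "AE \<omega> in M. \<bar>(B \<omega>)\<^sup>2 - v\<bar> \<le> (m * K)\<^sup>2 + \<bar>v\<bar>" for v
    using block_part_bounded[of t m]
  proof eventually_elim
    case (elim \<omega>)
    have "(B \<omega>)\<^sup>2 \<le> (m * K)\<^sup>2" using power_mono[OF elim, of 2] by (simp add: B_def)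
    then show ?case using zero_le_power2[of "B \<omega>"] by linarith
  qed
  have Y2b: "AE \<omega> in M. \<bar>(Y \<omega>)\<^sup>2 - v\<bar> \<le> (m * L)\<^sup>2 + \<bar>v\<bar>" for v
    using Yb
  proof eventually_elim
    case (elim \<omega>)
    have "(Y \<omega>)\<^sup>2 \<le> (m * L)\<^sup>2" using power_mono[OF elim, of 2] by simp
    then show ?case using zero_le_power2[of "Y \<omega>"] by linarith
  qed
  have iB: "integrable M (\<lambda>\<omega>. G \<omega> * ((B \<omega>)\<^sup>2 - v))" for v by (rule integrable_test_mult[OF _ _ Gc B2]) auto
  have iYv: "integrable M (\<lambda>\<omega>. G \<omega> * ((Y \<omega>)\<^sup>2 - v))" for v by (rule integrable_test_mult[OF _ _ Gc Y2b]) auto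
  have iD: "integrable M (\<lambda>\<omega>. G \<omega> * ((Y \<omega>)\<^sup>2 - (B \<omega>)\<^sup>2))"
    using Bochner_Integration.integrable_diff[OF iYv[of 0] iB[of 0]] by (simp add: right_diff_distrib)
  have "\<bar>expectation (\<lambda>\<omega>. G \<omega> * ((Y \<omega>)\<^sup>2 - (B \<omega>)\<^sup>2))\<bar> \<le> expectation (\<lambda>\<omega>. \<bar>G \<omega> * ((Y \<omega>)\<^sup>2 - (B \<omega>)\<^sup>2)\<bar>)"
    by simp
  also have "\<dots> \<le> expectation (\<lambda>\<omega>. (L / q) * (\<bar>G \<omega>\<bar> * (Y \<omega>)\<^sup>2) + (L * q + L\<^sup>2) * \<bar>G \<omega>\<bar>)"
    by (rule integral_mono_AE[OF integrable_abs[OF iD] _ diff]) (use iY2 iG in auto)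
  also have "\<dots> = (L / q) * expectation (\<lambda>\<omega>. \<bar>G \<omega>\<bar> * (Y \<omega>)\<^sup>2) + (L * q + L\<^sup>2) * g"
    using iY2 iG by (simp add: g_def)
  also have "\<dots> \<le> (L / q) * (L\<^sup>2 * m * g) + (L * q + L\<^sup>2) * g"
    using Y2 L_ge q by (intro add_right_mono mult_left_mono) auto
  also have "(L / q) * (L\<^sup>2 * m * g) = L ^ 3 * q * g"
    using q(1) by (simp flip: q(2) add: power2_eq_square power3_eq_cube)
  also have "L ^ 3 * q * g + (L * q + L\<^sup>2) * g \<le> 3 * L ^ 3 * q * g"
  proof -
    have a: "L \<le> L ^ 3" "L\<^sup>2 \<le> L ^ 3"
      using L_ge(1) power_increasing[of 1 3 L] power_increasing[of 2 3 L] by auto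
    then have "L * q \<le> L ^ 3 * q" using q by (intro mult_right_mono) auto
    moreover have "L\<^sup>2 * 1 \<le> L ^ 3 * q" using a q L_ge(1) by (intro mult_mono) auto
    ultimately have "(L * q + L\<^sup>2) * g \<le> (2 * (L ^ 3 * q)) * g" using g0 by (intro mult_right_mono) auto
    then show ?thesis by (simp add: algebra_simps)
  qed
  also have "\<dots> \<le> 3 * L ^ 3 * real m powr (2 - \<beta>) * g"
  proof -
    have "q \<le> real m powr (2 - \<beta>)"
      unfolding q_def using \<beta> m by (simp add: powr_half_sqrt[symmetric] powr_mono)
    then show ?thesis using L_ge(1) g0 by (intro mult_right_mono mult_left_mono) auto
  qed
  finally have 1: "\<bar>expectation (\<lambda>\<omega>. G \<omega> * ((Y \<omega>)\<^sup>2 - (B \<omega>)\<^sup>2))\<bar> \<le> 3 * L ^ 3 * real m powr (2 - \<beta>) * g" .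
  have 2: "\<bar>expectation (\<lambda>\<omega>. G \<omega> * ((B \<omega>)\<^sup>2 - m * s2))\<bar> \<le> 38 * (K\<^sup>2 * Z) * real m powr (2 - \<beta>) * g"
    unfolding B_def g_def by (rule block_variance[OF G Gc])
  have K2Z: "K\<^sup>2 * Z \<le> L ^ 3"
  proof -
    have "K * (K * Z) \<le> L * L" using L_ge K_ge Z_ge by (intro mult_mono) auto
    also have "\<dots> \<le> L * L * L" using L_ge(1) mult_left_mono[of 1 L "L * L"] by simp
    finally show ?thesis by (simp add: power2_eq_square power3_eq_cube mult.assoc)
  qed
  have "expectation (\<lambda>\<omega>. G \<omega> * ((Y \<omega>)\<^sup>2 - m * s2))
     = expectation (\<lambda>\<omega>. G \<omega> * ((Y \<omega>)\<^sup>2 - (B \<omega>)\<^sup>2) + G \<omega> * ((B \<omega>)\<^sup>2 - m * s2))"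
    by (simp add: algebra_simps)
  also have "\<dots> = expectation (\<lambda>\<omega>. G \<omega> * ((Y \<omega>)\<^sup>2 - (B \<omega>)\<^sup>2)) + expectation (\<lambda>\<omega>. G \<omega> * ((B \<omega>)\<^sup>2 - m * s2))"
    by (rule Bochner_Integration.integral_add[OF iD iB])
  finally have "\<bar>expectation (\<lambda>\<omega>. G \<omega> * ((Y \<omega>)\<^sup>2 - m * s2))\<bar>
     \<le> 3 * L ^ 3 * real m powr (2 - \<beta>) * g + 38 * (K\<^sup>2 * Z) * real m powr (2 - \<beta>) * g"
    using 1 2 by linarith
  also have "\<dots> \<le> 3 * L ^ 3 * real m powr (2 - \<beta>) * g + 38 * L ^ 3 * real m powr (2 - \<beta>) * g"
    using K2Z g0 by (intro add_left_mono mult_right_mono mult_left_mono) auto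
  finally show ?thesis by (simp add: Y_def g_def algebra_simps)
qed

text \<open>The constants handed to \<open>bounded_mds\<close> after normalisation:
  \<open>Del * real m powr (1 - \<beta>)\<close> is the relative error of the conditional variance,
  and \<open>Cf\<close> governs the fourth moments.\<close>

definition Del :: real where "Del = 41 * L ^ 3 / s2"
definition Cf :: real where "Cf = max 1 (4 * L ^ 4 / s2\<^sup>2)"

definition \<xi> :: "nat \<Rightarrow> nat \<Rightarrow> nat \<Rightarrow> 'a \<Rightarrow> real" where
  "\<xi> m k j \<omega> = (mart (k * m) (m * j + m) \<omega> - mart (k * m) (m * j) \<omega>) / sqrt (s2 * (k * m))"

text \<open>Sampled at the block ends, the martingale stays a martingale. A block increment has
  conditional variance close to \<open>m * s2\<close>, hence close to \<open>1 / k\<close> after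
  division by \<open>sqrt (s2 * (k * m))\<close>.\<close>

lemma bounded_mds_blocks:
  assumes k: "1 \<le> k" and m: "1 \<le> m" and small: "Del * real m powr (1 - \<beta>) \<le> 1"
  shows "bounded_mds M (\<lambda>j. F (m * j)) (\<xi> m k) k (L * sqrt (m / (s2 * k))) (Del * real m powr (1 - \<beta>)) Cf"
proof
  define N where "N = k * m"
  have N: "0 < N" using k m by (simp add: N_def)
  define v where "v = sqrt (s2 * N)"
  have v: "0 < v" "v\<^sup>2 = s2 * N" using s2_pos N by (auto simp: v_def)
  have \<xi>: "\<xi> m k j \<omega> = (mart N (m * j + m) \<omega> - mart N (m * j) \<omega>) / v" for j \<omega>
    by (simp add: \<xi>_def N_def v_def)
  have le: "m * j + m \<le> N" if "j < k" for j
  proof -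
    have "m * Suc j \<le> m * k" using that by (intro mult_le_mono2) simp
    then show ?thesis by (simp add: N_def mult.commute)
  qed
  show "0 < k" using k by simp
  show "subalgebra M (F (m * j))" for j by (rule subalg)
  show "sets (F (m * i)) \<subseteq> sets (F (m * j))" if "i \<le> j" for i j using that by (intro filtration) simp
  show "\<xi> m k j \<in> borel_measurable (F (m * Suc j))" if "j < k" for j
    unfolding \<xi>[abs_def] using mart_measurable_F[of "m * j + m" "m * Suc j" N] mart_measurable_F[of "m * j" "m * Suc j" N]
    by (intro borel_measurable_divide borel_measurable_diff borel_measurable_const) auto
  show "AE \<omega> in M. \<bar>\<xi> m k j \<omega>\<bar> \<le> L * sqrt (m / (s2 * k))" if "j < k" for j
    using mart_incr_bounded[OF le[OF that]]
  proof eventually_elim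
    case (elim \<omega>)
    have "\<bar>\<xi> m k j \<omega>\<bar> \<le> m * L / v" unfolding \<xi> using elim v by (simp add: divide_right_mono)
    also have "m / v = sqrt (m / (s2 * k))"
    proof -
      have "m / v = sqrt (real m * real m) / sqrt (s2 * (k * m))" by (simp add: v_def N_def)
      also have "\<dots> = sqrt (real m * real m / (s2 * (k * m)))" by (rule real_sqrt_divide[symmetric])
      also have "real m * real m / (s2 * (k * m)) = m / (s2 * k)" using m by simp
      finally show ?thesis .
    qed
    then have "m * L / v = L * sqrt (m / (s2 * k))" by (metis mult.commute times_divide_eq_right)
    finally show ?case .
  qed
  show "0 \<le> Del * real m powr (1 - \<beta>)" using L_ge(1) s2_pos by (simp add: Del_def)
  show "Del * real m powr (1 - \<beta>) \<le> 1" by (rule small)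
  show "1 \<le> Cf" by (simp add: Cf_def)
  fix j G c
  assume j: "j < k" and G: "G \<in> borel_measurable (F (m * j))" and Gc: "AE \<omega> in M. \<bar>G \<omega>\<bar> \<le> (c :: real)"
  define Y where "Y = (\<lambda>\<omega>. mart N (m * j + m) \<omega> - mart N (m * j) \<omega>)"
  have \<xi>Y: "\<xi> m k j \<omega> = Y \<omega> / v" for \<omega> by (simp add: \<xi> Y_def)
  show "expectation (\<lambda>\<omega>. G \<omega> * \<xi> m k j \<omega>) = 0"
    using mart_incr_centered[OF G Gc, of "m * j + m" N] by (simp add: \<xi>Y Y_def)
  define g where "g = expectation (\<lambda>\<omega>. \<bar>G \<omega>\<bar>)"
  have g0: "0 \<le> g" by (simp add: g_def)
  have "G \<omega> * ((\<xi> m k j \<omega>)\<^sup>2 - 1 / k) = (1 / v\<^sup>2) * (G \<omega> * ((Y \<omega>)\<^sup>2 - m * s2))" for \<omega>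
  proof -
    have "1 / k = (m * s2) / v\<^sup>2" unfolding v N_def using m k s2_pos by simp
    then have "(\<xi> m k j \<omega>)\<^sup>2 - 1 / k = (1 / v\<^sup>2) * ((Y \<omega>)\<^sup>2 - m * s2)"
      by (simp add: \<xi>Y power_divide diff_divide_distrib)
    then show ?thesis by simp
  qed
  then have "\<bar>expectation (\<lambda>\<omega>. G \<omega> * ((\<xi> m k j \<omega>)\<^sup>2 - 1 / k))\<bar> = (1 / v\<^sup>2) * \<bar>expectation (\<lambda>\<omega>. G \<omega> * ((Y \<omega>)\<^sup>2 - m * s2))\<bar>"
    by (simp add: abs_mult)
  also have "\<dots> \<le> (1 / v\<^sup>2) * (41 * L ^ 3 * real m powr (2 - \<beta>) * g)"
    unfolding Y_def g_def using block_mart_variance[OF G Gc le[OF j] m] by (intro mult_left_mono) auto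
  also have "\<dots> = Del * real m powr (1 - \<beta>) / k * g"
  proof -
    have "real m powr (2 - \<beta>) = real m * real m powr (1 - \<beta>)"
      using m powr_add[of "real m" 1 "1 - \<beta>"] by simp
    then show ?thesis unfolding v N_def Del_def using m k s2_pos by (simp add: field_simps)
  qed
  finally show "\<bar>expectation (\<lambda>\<omega>. G \<omega> * ((\<xi> m k j \<omega>)\<^sup>2 - 1 / k))\<bar> \<le> Del * real m powr (1 - \<beta>) / k * expectation (\<lambda>\<omega>. \<bar>G \<omega>\<bar>)"
    by (simp add: g_def)
  have "expectation (\<lambda>\<omega>. \<bar>G \<omega>\<bar> * (\<xi> m k j \<omega>) ^ 4) = (1 / v ^ 4) * expectation (\<lambda>\<omega>. \<bar>G \<omega>\<bar> * (Y \<omega>) ^ 4)"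
    by (simp add: \<xi>Y power_divide)
  also have "\<dots> \<le> (1 / v ^ 4) * (L ^ 4 * (4 * (real m)\<^sup>2) * g)"
  proof (rule mult_left_mono)
    have "expectation (\<lambda>\<omega>. \<bar>G \<omega>\<bar> * (Y \<omega>) ^ 4) \<le> L ^ 4 * (4 * (real m)\<^sup>2 - m) * g"
      using mart_incr_moments[of "\<lambda>\<omega>. \<bar>G \<omega>\<bar>" "m * j" c m N] G Gc le[OF j] by (simp add: Y_def g_def)
    also have "\<dots> \<le> L ^ 4 * (4 * (real m)\<^sup>2) * g"
      using g0 by (intro mult_right_mono mult_left_mono) auto
    finally show "expectation (\<lambda>\<omega>. \<bar>G \<omega>\<bar> * (Y \<omega>) ^ 4) \<le> L ^ 4 * (4 * (real m)\<^sup>2) * g" .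
  qed simp
  also have "\<dots> = (4 * L ^ 4 / s2\<^sup>2) / (real k)\<^sup>2 * g"
  proof -
    have "v ^ 4 = (s2 * N)\<^sup>2" using v(2) by (metis mult_2_right numeral_Bit0 power2_eq_square power_add)
    then show ?thesis unfolding N_def using m k s2_pos by (simp add: power2_eq_square field_simps)
  qed
  also have "\<dots> \<le> Cf / (real k)\<^sup>2 * g"
    using g0 by (intro mult_right_mono divide_right_mono) (auto simp: Cf_def)
  finally show "expectation (\<lambda>\<omega>. \<bar>G \<omega>\<bar> * (\<xi> m k j \<omega>) ^ 4) \<le> Cf / (real k)\<^sup>2 * expectation (\<lambda>\<omega>. \<bar>G \<omega>\<bar>)"
    by (simp add: g_def)
qed

end

section \<open>Tails of the self-normalized sum\<close>

text \<open>This inclusion is free of loss: 2 sqrt q \<le> 1 + q turns a large exponent into a large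
  quotient. The assumption on \<open>q = 0\<close> matches the convention that a quotient with
  vanishing denominator is 0; such points cannot satisfy the last hypothesis.\<close>

lemma self_normalized_ge_of_exponent:
  fixes x s q :: real
  assumes "0 < x" "0 \<le> q" "q = 0 \<Longrightarrow> s = 0" "x\<^sup>2 / 2 \<le> x * s - x\<^sup>2 * q / 2"
  shows "x \<le> s / sqrt q"
proof -
  have x2: "0 < x\<^sup>2 / 2" using assms(1) by simp
  have "q \<noteq> 0" using assms(3,4) x2 by auto
  then have q: "0 < q" using assms(2) by simp
  have "0 \<le> x\<^sup>2 * (1 - sqrt q)\<^sup>2 / 2" by simp
  also have "\<dots> = x\<^sup>2 / 2 + x\<^sup>2 * q / 2 - x * (x * sqrt q)"
    using q by (simp add: power2_diff field_simps power2_eq_square)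
  finally have "x * (x * sqrt q) \<le> x * s" using assms(4) by linarith
  then have "x * sqrt q \<le> s" using assms(1) by simp
  then show ?thesis using q by (simp add: field_simps)
qed

text \<open>The converse loses x^2 (sqrt q - 1)^2 / 2, and q - 1 = (sqrt q - 1) (sqrt q + 1) bounds
  this by a quantity quadratic in q - 1.\<close>

lemma exponent_ge_of_self_normalized:
  fixes x s q :: real
  assumes "0 < x" "0 \<le> q" "x \<le> s / sqrt q"
  shows "x\<^sup>2 / 2 - x\<^sup>2 * (q - 1)\<^sup>2 / 2 \<le> x * s - x\<^sup>2 * q / 2"
proof -
  have "q \<noteq> 0" using assms by auto
  then have q: "0 < q" using assms(2) by simp
  then have "x * sqrt q \<le> s" using assms(3) by (simp add: field_simps)
  then have "x * (x * sqrt q) \<le> x * s" using assms(1) by (intro mult_left_mono) auto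
  moreover have "x\<^sup>2 / 2 - x\<^sup>2 * (q - 1)\<^sup>2 / 2 \<le> x * (x * sqrt q) - x\<^sup>2 * q / 2"
  proof -
    define r where "r = sqrt q"
    have r: "0 < r" "r * r = q" using q by (auto simp: r_def)
    have "q - 1 = (r - 1) * (r + 1)" by (simp flip: r(2) add: algebra_simps)
    then have "(q - 1)\<^sup>2 = (r - 1)\<^sup>2 * (r + 1)\<^sup>2" by (simp add: power_mult_distrib)
    moreover have "(r - 1)\<^sup>2 * 1 \<le> (r - 1)\<^sup>2 * (r + 1)\<^sup>2" using r by (intro mult_left_mono) auto
    ultimately have "x\<^sup>2 * (r - 1)\<^sup>2 \<le> x\<^sup>2 * (q - 1)\<^sup>2" by (intro mult_left_mono) auto
    moreover have "x\<^sup>2 * (r - 1)\<^sup>2 = x\<^sup>2 * q + x\<^sup>2 - 2 * (x * (x * r))"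
      by (simp flip: r(2) add: power2_eq_square algebra_simps)
    ultimately show ?thesis by (simp add: r_def)
  qed
  ultimately show ?thesis by linarith
qed

context mixing_process
begin

definition Vsq :: "nat \<Rightarrow> nat \<Rightarrow> 'a \<Rightarrow> real" where
  "Vsq m k \<omega> = (\<Sum>j<k. (block_part (m * j) m \<omega>)\<^sup>2)"

definition W :: "nat \<Rightarrow> nat \<Rightarrow> 'a \<Rightarrow> real" where
  "W m k \<omega> = S (k * m) \<omega> / sqrt (Vsq m k \<omega>)"

text \<open>Pathwise errors after normalisation. For sums the only gap is the one at time 0, since
  at the final time martingale and partial sum agree. For squares the comparison is made where the
  squared increments sum to at most 2, which is the origin of \<open>2 * L\<close>; the other two
  constants come from the part of the bound that does not involve the increments.\<close>

definition E0 :: real where "E0 = 2 * L + L / s2 + L\<^sup>2 / s2"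
definition err_sum :: "nat \<Rightarrow> nat \<Rightarrow> real" where "err_sum m k = K * Z / sqrt (s2 * (k * m))"
definition err_sq :: "nat \<Rightarrow> real" where "err_sq m = E0 / sqrt m"

lemma W_measurable [measurable]: "W m k \<in> borel_measurable M"
  unfolding W_def Vsq_def by measurable

lemma S_blocks: "S (k * m) \<omega> = (\<Sum>j<k. block_part (m * j) m \<omega>)"
proof (induction k)
  case 0
  then show ?case by (simp add: S_def)
next
  case (Suc k)
  have "S (t + n) \<omega> = S t \<omega> + block_part t n \<omega>" for t n
    unfolding block_part_def by (induction n) (auto simp: S_def)
  from this[of "k * m" m] Suc show ?case by (simp add: add.commute mult.commute)
qed

lemma E0_nonneg: "0 \<le> E0" using L_ge(1) s2_pos by (simp add: E0_def)

lemma err_nonneg: "0 \<le> err_sum m k" "0 \<le> err_sq m"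
  using K_ge Z_ge s2_pos E0_nonneg by (auto simp: err_sum_def err_sq_def)

lemma path_comparison:
  assumes k: "1 \<le> k" and m: "1 \<le> m"
  defines "v \<equiv> sqrt (s2 * (k * m))"
  shows "AE \<omega> in M. \<bar>S (k * m) \<omega> / v - (\<Sum>j<k. \<xi> m k j \<omega>)\<bar> \<le> err_sum m k \<and>
    ((\<Sum>j<k. (\<xi> m k j \<omega>)\<^sup>2) \<le> 2 \<longrightarrow> \<bar>Vsq m k \<omega> / v\<^sup>2 - (\<Sum>j<k. (\<xi> m k j \<omega>)\<^sup>2)\<bar> \<le> err_sq m)"
proof -
  define N where "N = k * m"
  have N: "0 < N" using k m by (simp add: N_def)
  have v: "0 < v" "v\<^sup>2 = s2 * N" using s2_pos N by (auto simp: v_def N_def)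
  have le: "m * j \<le> N" "m * j + m \<le> N" if "j < k" for j
  proof -
    have "m * Suc j \<le> m * k" using that by (intro mult_le_mono2) simp
    then show "m * j + m \<le> N" by (simp add: N_def mult.commute)
    then show "m * j \<le> N" by simp
  qed
  have "AE \<omega> in M. \<forall>j\<in>{..<k}. \<bar>mart N (m * j) \<omega> - S (m * j) \<omega>\<bar> \<le> K * Z \<and> \<bar>mart N (m * j + m) \<omega> - S (m * j + m) \<omega>\<bar> \<le> K * Z"
    using mart_approx_const[OF le(1)] mart_approx_const[OF le(2)] by (intro AE_finite_allI) auto
  with mart_final[of N] show ?thesis
  proof eventually_elim
    case (elim \<omega>)
    define Y where "Y = (\<lambda>j. mart N (m * j + m) \<omega> - mart N (m * j) \<omega>)"
    define B where "B = (\<lambda>j. block_part (m * j) m \<omega>)"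
    have \<xi>: "\<xi> m k j \<omega> = Y j / v" for j by (simp add: \<xi>_def Y_def v_def N_def)
    have YB: "\<bar>Y j - B j\<bar> \<le> L" if "j < k" for j
    proof -
      have "S (t + n) \<omega> = S t \<omega> + block_part t n \<omega>" for t n
        unfolding block_part_def by (induction n) (auto simp: S_def)
      then have "S (m * j + m) \<omega> = S (m * j) \<omega> + B j" by (simp add: B_def)
      moreover have "\<bar>mart N (m * j) \<omega> - S (m * j) \<omega>\<bar> \<le> K * Z" "\<bar>mart N (m * j + m) \<omega> - S (m * j + m) \<omega>\<bar> \<le> K * Z"
        using elim(2) that by auto
      ultimately show ?thesis using L_ge(5) unfolding Y_def by linarith
    qed
    have "(\<Sum>j<n. Y j) = mart N (m * n) \<omega> - mart N 0 \<omega>" for n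
      by (induction n) (auto simp: Y_def add.commute)
    then have "(\<Sum>j<k. Y j) = S N \<omega> - mart N 0 \<omega>" using elim(1) by (simp add: N_def mult.commute)
    moreover have "\<bar>mart N 0 \<omega>\<bar> \<le> K * Z" using elim(2) k by (auto simp: S_def dest!: bspec[of _ _ 0])
    ultimately have "\<bar>S N \<omega> - (\<Sum>j<k. Y j)\<bar> \<le> K * Z" by simp
    then have "\<bar>S N \<omega> - (\<Sum>j<k. Y j)\<bar> / v \<le> K * Z / v" using v by (intro divide_right_mono) auto
    then have 1: "\<bar>S (k * m) \<omega> / v - (\<Sum>j<k. \<xi> m k j \<omega>)\<bar> \<le> err_sum m k"
      using v by (simp add: \<xi> sum_divide_distrib[symmetric] diff_divide_distrib[symmetric] err_sum_def v_def N_def)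
    define Q where "Q = (\<Sum>j<k. (\<xi> m k j \<omega>)\<^sup>2)"
    have QY: "Q * v\<^sup>2 = (\<Sum>j<k. (Y j)\<^sup>2)" using v(1) by (simp add: Q_def \<xi> power_divide sum_divide_distrib[symmetric])
    have "\<bar>Vsq m k \<omega> / v\<^sup>2 - Q\<bar> \<le> err_sq m" if Q2: "Q \<le> 2"
    proof -
      define q where "q = sqrt (real m)"
      have q: "1 \<le> q" "q * q = m" using m by (auto simp: q_def)
      have "\<bar>(B j)\<^sup>2 - (Y j)\<^sup>2\<bar> \<le> L * ((Y j)\<^sup>2 / q + q + L)" if "j < k" for j
      proof -
        have "2 * \<bar>Y j\<bar> \<le> (Y j)\<^sup>2 / q + q"
        proof -
          have "0 \<le> (\<bar>Y j\<bar> - q)\<^sup>2 / q" using q by simp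
          also have "\<dots> = (Y j)\<^sup>2 / q + q - 2 * \<bar>Y j\<bar>" using q(1) by (simp add: power2_diff field_simps power2_eq_square)
          finally show ?thesis by simp
        qed
        moreover have "\<bar>Y j + B j\<bar> \<le> 2 * \<bar>Y j\<bar> + L" using YB[OF that] by linarith
        ultimately have "\<bar>Y j + B j\<bar> \<le> (Y j)\<^sup>2 / q + q + L" by linarith
        then have "\<bar>Y j - B j\<bar> * \<bar>Y j + B j\<bar> \<le> L * ((Y j)\<^sup>2 / q + q + L)"
          using YB[OF that] by (intro mult_mono) (auto intro: order.trans[OF abs_ge_zero])
        moreover have "(B j)\<^sup>2 - (Y j)\<^sup>2 = - ((Y j - B j) * (Y j + B j))" by (simp add: power2_eq_square algebra_simps)
        ultimately show ?thesis by (simp add: abs_mult)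
      qed
      then have "(\<Sum>j<k. \<bar>(B j)\<^sup>2 - (Y j)\<^sup>2\<bar>) \<le> (\<Sum>j<k. L * ((Y j)\<^sup>2 / q + q + L))" by (intro sum_mono) auto
      also have "\<dots> = L / q * (Q * v\<^sup>2) + k * (L * q + L\<^sup>2)"
        unfolding QY by (simp add: distrib_left sum.distrib sum_distrib_left power2_eq_square mult_ac)
      also have "\<dots> \<le> L / q * (2 * v\<^sup>2) + k * (L * q + L\<^sup>2 * q)"
        using Q2 q L_ge(1) by (intro add_mono mult_left_mono mult_right_mono) auto
      also have "\<dots> = err_sq m * v\<^sup>2"
      proof -
        have "k * (L * q + L\<^sup>2 * q) = (L / s2 + L\<^sup>2 / s2) / q * (s2 * (k * (q * q)))"
          using q(1) s2_pos by (simp add: field_simps)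
        then have "k * (L * q + L\<^sup>2 * q) = (L / s2 + L\<^sup>2 / s2) / q * v\<^sup>2" using v q by (simp add: N_def)
        then show ?thesis by (simp add: err_sq_def E0_def q_def add_divide_distrib distrib_right)
      qed
      finally have "(\<Sum>j<k. \<bar>(B j)\<^sup>2 - (Y j)\<^sup>2\<bar>) \<le> err_sq m * v\<^sup>2" .
      then have "\<bar>\<Sum>j<k. (B j)\<^sup>2 - (Y j)\<^sup>2\<bar> \<le> err_sq m * v\<^sup>2" by (rule order.trans[OF sum_abs])
      then have "\<bar>Vsq m k \<omega> - Q * v\<^sup>2\<bar> \<le> err_sq m * v\<^sup>2"
        unfolding QY Vsq_def B_def by (simp add: sum_subtractf)
      then have "\<bar>Vsq m k \<omega> - Q * v\<^sup>2\<bar> / v\<^sup>2 \<le> err_sq m" using v(1) by (simp add: divide_le_eq)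
      moreover have "Vsq m k \<omega> / v\<^sup>2 - Q = (Vsq m k \<omega> - Q * v\<^sup>2) / v\<^sup>2" using v(1) by (simp add: field_simps)
      ultimately show ?thesis by simp
    qed
    with 1 show ?case by (simp add: Q_def)
  qed
qed

definition T :: "nat \<Rightarrow> nat \<Rightarrow> 'a \<Rightarrow> real" where "T m k \<omega> = (\<Sum>j<k. \<xi> m k j \<omega>)"
definition Q :: "nat \<Rightarrow> nat \<Rightarrow> 'a \<Rightarrow> real" where "Q m k \<omega> = (\<Sum>j<k. (\<xi> m k j \<omega>)\<^sup>2)"

lemma TQ_measurable [measurable]: "T m k \<in> borel_measurable M" "Q m k \<in> borel_measurable M"
  unfolding T_def Q_def \<xi>_def by measurable

text \<open>The witnesses are the total block sum and the sum of squared block sums in normalised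
  form. A vanishing sum of squares forces every block sum to vanish, so the convention for a zero
  denominator agrees with the exponent inequalities.\<close>

lemma W_path:
  assumes k: "1 \<le> k" and m: "1 \<le> m"
  shows "AE \<omega> in M. \<exists>s q. W m k \<omega> = s / sqrt q \<and> 0 \<le> q \<and> (q = 0 \<longrightarrow> s = 0) \<and>
    \<bar>s - T m k \<omega>\<bar> \<le> err_sum m k \<and> (Q m k \<omega> \<le> 2 \<longrightarrow> \<bar>q - Q m k \<omega>\<bar> \<le> err_sq m)"
  using path_comparison[OF k m]
proof eventually_elim
  case (elim \<omega>)
  define v where "v = sqrt (s2 * (k * m))"
  have v: "0 < v" using s2_pos k m by (simp add: v_def)
  define s where "s = S (k * m) \<omega> / v"
  define q where "q = Vsq m k \<omega> / v\<^sup>2"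
  have V0: "0 \<le> Vsq m k \<omega>" unfolding Vsq_def by (intro sum_nonneg) auto
  have "sqrt q = sqrt (Vsq m k \<omega>) / v" using v by (simp add: q_def real_sqrt_divide)
  then have "W m k \<omega> = s / sqrt q" using v by (simp add: W_def s_def)
  moreover have "q = 0 \<longrightarrow> s = 0"
  proof
    assume "q = 0"
    then have "(\<Sum>j<k. (block_part (m * j) m \<omega>)\<^sup>2) = 0" using v by (simp add: q_def Vsq_def)
    then have "\<forall>j\<in>{..<k}. (block_part (m * j) m \<omega>)\<^sup>2 = 0" by (subst (asm) sum_nonneg_eq_0_iff) auto
    then show "s = 0" unfolding s_def S_blocks by simp
  qed
  moreover have "0 \<le> q" using V0 by (simp add: q_def)
  moreover have "\<bar>s - T m k \<omega>\<bar> \<le> err_sum m k \<and> (Q m k \<omega> \<le> 2 \<longrightarrow> \<bar>q - Q m k \<omega>\<bar> \<le> err_sq m)"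
    using elim by (simp add: s_def q_def v_def T_def Q_def)
  ultimately show ?case by blast
qed

text \<open>The event that \<open>Q\<close> is far from 1 is discarded at the price of its
  probability. Off this event \<open>Q\<close> is at most 2, so the pathwise comparison of squares
  applies and moves the exponent by at most
  \<open>x * err_sum m k + x\<^sup>2 * err_sq m / 2\<close>. The upper bound additionally pays the
  quadratic loss of \<open>exponent_ge_of_self_normalized\<close>.\<close>

lemma W_tail_compare:
  assumes k: "1 \<le> k" and m: "1 \<le> m" and x: "0 < x" and t: "t \<le> 1"
  shows "prob {\<omega> \<in> space M. x\<^sup>2 / 2 + (x * err_sum m k + x\<^sup>2 * err_sq m / 2) \<le> x * T m k \<omega> - x\<^sup>2 * Q m k \<omega> / 2}
      \<le> prob {\<omega> \<in> space M. x \<le> W m k \<omega>} + prob {\<omega> \<in> space M. t \<le> \<bar>Q m k \<omega> - 1\<bar>}"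
    and "prob {\<omega> \<in> space M. x \<le> W m k \<omega>}
      \<le> prob {\<omega> \<in> space M. x\<^sup>2 / 2 - (x * err_sum m k + x\<^sup>2 * err_sq m / 2 + x\<^sup>2 * (t + err_sq m)\<^sup>2 / 2) \<le> x * T m k \<omega> - x\<^sup>2 * Q m k \<omega> / 2}
       + prob {\<omega> \<in> space M. t \<le> \<bar>Q m k \<omega> - 1\<bar>}"
proof -
  define ee em where "ee = err_sum m k" and "em = err_sq m"
  define A where "A = {\<omega> \<in> space M. x \<le> W m k \<omega>}"
  define D where "D = {\<omega> \<in> space M. t \<le> \<bar>Q m k \<omega> - 1\<bar>}"
  define B1 where "B1 = {\<omega> \<in> space M. x\<^sup>2 / 2 + (x * ee + x\<^sup>2 * em / 2) \<le> x * T m k \<omega> - x\<^sup>2 * Q m k \<omega> / 2}"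
  define B2 where "B2 = {\<omega> \<in> space M. x\<^sup>2 / 2 - (x * ee + x\<^sup>2 * em / 2 + x\<^sup>2 * (t + em)\<^sup>2 / 2) \<le> x * T m k \<omega> - x\<^sup>2 * Q m k \<omega> / 2}"
  have [measurable]: "A \<in> sets M" "D \<in> sets M" "B1 \<in> sets M" "B2 \<in> sets M"
    unfolding A_def D_def B1_def B2_def by measurable
  have close: "\<bar>(x * s - x\<^sup>2 * q / 2) - (x * T m k \<omega> - x\<^sup>2 * Q m k \<omega> / 2)\<bar> \<le> x * ee + x\<^sup>2 * em / 2"
    if "\<bar>s - T m k \<omega>\<bar> \<le> ee" "\<bar>q - Q m k \<omega>\<bar> \<le> em" for s q \<omega>
  proof -
    have "(x * s - x\<^sup>2 * q / 2) - (x * T m k \<omega> - x\<^sup>2 * Q m k \<omega> / 2) = x * (s - T m k \<omega>) - (x\<^sup>2 / 2) * (q - Q m k \<omega>)"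
      by (simp add: algebra_simps)
    also have "\<bar>\<dots>\<bar> \<le> \<bar>x * (s - T m k \<omega>)\<bar> + \<bar>(x\<^sup>2 / 2) * (q - Q m k \<omega>)\<bar>" by (rule abs_triangle_ineq4)
    also have "\<dots> \<le> x * ee + (x\<^sup>2 / 2) * em"
      unfolding abs_mult using that x by (intro add_mono mult_mono) auto
    finally show ?thesis by simp
  qed
  have ae: "AE \<omega> in M. (\<omega> \<in> B1 \<longrightarrow> \<omega> \<in> A \<union> D) \<and> (\<omega> \<in> A \<longrightarrow> \<omega> \<in> B2 \<union> D)"
    using W_path[OF k m]
  proof (rule AE_mp[OF _ AE_I2], intro impI)
    fix \<omega> assume w: "\<omega> \<in> space M"
    assume "\<exists>s q. W m k \<omega> = s / sqrt q \<and> 0 \<le> q \<and> (q = 0 \<longrightarrow> s = 0) \<and>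
      \<bar>s - T m k \<omega>\<bar> \<le> err_sum m k \<and> (Q m k \<omega> \<le> 2 \<longrightarrow> \<bar>q - Q m k \<omega>\<bar> \<le> err_sq m)"
    then obtain s q where sq: "W m k \<omega> = s / sqrt q" "0 \<le> q" "q = 0 \<Longrightarrow> s = 0" "\<bar>s - T m k \<omega>\<bar> \<le> ee"
      "Q m k \<omega> \<le> 2 \<Longrightarrow> \<bar>q - Q m k \<omega>\<bar> \<le> em" by (auto simp: ee_def em_def)
    show "(\<omega> \<in> B1 \<longrightarrow> \<omega> \<in> A \<union> D) \<and> (\<omega> \<in> A \<longrightarrow> \<omega> \<in> B2 \<union> D)"
    proof (cases "\<omega> \<in> D")
      case False
      then have Qt: "\<bar>Q m k \<omega> - 1\<bar> < t" using w by (auto simp: D_def)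
      then have "Q m k \<omega> \<le> 2" using t by linarith
      then have qe: "\<bar>q - Q m k \<omega>\<bar> \<le> em" using sq by auto
      note cl = close[OF sq(4) qe]
      have "\<omega> \<in> A" if "\<omega> \<in> B1"
      proof -
        have "x\<^sup>2 / 2 \<le> x * s - x\<^sup>2 * q / 2" using that cl unfolding B1_def by simp linarith
        then show ?thesis
          using self_normalized_ge_of_exponent[OF x sq(2,3)] w by (simp add: A_def sq(1))
      qed
      moreover have "\<omega> \<in> B2" if "\<omega> \<in> A"
      proof -
        have "x \<le> s / sqrt q" using that by (simp add: A_def sq(1))
        then have "x\<^sup>2 / 2 - x\<^sup>2 * (q - 1)\<^sup>2 / 2 \<le> x * s - x\<^sup>2 * q / 2"
          by (rule exponent_ge_of_self_normalized[OF x sq(2)])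
        moreover have "x\<^sup>2 * (q - 1)\<^sup>2 / 2 \<le> x\<^sup>2 * (t + em)\<^sup>2 / 2"
        proof -
          have "\<bar>q - 1\<bar> \<le> t + em" using Qt qe by linarith
          then have "\<bar>q - 1\<bar>\<^sup>2 \<le> (t + em)\<^sup>2" by (intro power_mono) auto
          then show ?thesis by (intro divide_right_mono mult_left_mono) auto
        qed
        ultimately show ?thesis using cl w unfolding B2_def by simp
      qed
      ultimately show ?thesis by blast
    qed simp
  qed
  have "prob B1 \<le> prob (A \<union> D)" by (rule finite_measure_mono_AE) (use ae in \<open>auto elim!: eventually_mono\<close>)
  also have "\<dots> \<le> prob A + prob D" by (rule measure_Un_le) auto
  finally show "prob {\<omega> \<in> space M. x\<^sup>2 / 2 + (x * err_sum m k + x\<^sup>2 * err_sq m / 2) \<le> x * T m k \<omega> - x\<^sup>2 * Q m k \<omega> / 2}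
      \<le> prob {\<omega> \<in> space M. x \<le> W m k \<omega>} + prob {\<omega> \<in> space M. t \<le> \<bar>Q m k \<omega> - 1\<bar>}"
    unfolding A_def B1_def D_def ee_def em_def .
  have "prob A \<le> prob (B2 \<union> D)" by (rule finite_measure_mono_AE) (use ae in \<open>auto elim!: eventually_mono\<close>)
  also have "\<dots> \<le> prob B2 + prob D" by (rule measure_Un_le) auto
  finally show "prob {\<omega> \<in> space M. x \<le> W m k \<omega>}
      \<le> prob {\<omega> \<in> space M. x\<^sup>2 / 2 - (x * err_sum m k + x\<^sup>2 * err_sq m / 2 + x\<^sup>2 * (t + err_sq m)\<^sup>2 / 2) \<le> x * T m k \<omega> - x\<^sup>2 * Q m k \<omega> / 2}
       + prob {\<omega> \<in> space M. t \<le> \<bar>Q m k \<omega> - 1\<bar>}"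
    unfolding A_def B2_def D_def ee_def em_def .
qed

definition del :: "nat \<Rightarrow> real" where "del m = Del * real m powr (1 - \<beta>)"

lemma U_eq_TQ: "bounded_mds.U (\<xi> m k) x k \<omega> = x * T m k \<omega> - x\<^sup>2 * Q m k \<omega> / 2"
  if "1 \<le> k" "1 \<le> m" "del m \<le> 1"
proof -
  interpret A: bounded_mds M "\<lambda>j. F (m * j)" "\<xi> m k" k "L * sqrt (m / (s2 * k))" "Del * real m powr (1 - \<beta>)" Cf
    using that bounded_mds_blocks by (simp add: del_def)
  show ?thesis unfolding A.U_eq A.part_sum_def A.part_sq_def T_def Q_def ..
qed

text \<open>The exponent of the deviation bound is \<open>\<theta> t / 4\<close> for the largest \<open>\<theta>\<close> that
  the bound for a single block admits.\<close>

lemma Q_deviation: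
  assumes k: "1 \<le> k" and m: "1 \<le> m" and small: "del m \<le> 1" and t: "0 < t" "2 * del m \<le> t"
  shows "prob {\<omega> \<in> space M. t \<le> \<bar>Q m k \<omega> - 1\<bar>} \<le> 2 * exp (- min (t\<^sup>2 * k / (16 * Cf)) (t * s2 * k / (4 * L\<^sup>2 * m)))"
proof -
  interpret A: bounded_mds M "\<lambda>j. F (m * j)" "\<xi> m k" k "L * sqrt (m / (s2 * k))" "Del * real m powr (1 - \<beta>)" Cf
    using bounded_mds_blocks k m small by (simp add: del_def)
  have L: "0 < L" using L_ge(1) by simp
  have Cf: "0 < Cf" by (simp add: Cf_def max_def)
  define th where "th = min (t * k / (4 * Cf)) (s2 * k / (L\<^sup>2 * m))"
  have th0: "0 < th" unfolding th_def using t k m s2_pos L Cf by simp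
  have "th * (L * sqrt (m / (s2 * k)))\<^sup>2 \<le> s2 * k / (L\<^sup>2 * m) * (L\<^sup>2 * (m / (s2 * k)))"
  proof -
    have "(L * sqrt (m / (s2 * k)))\<^sup>2 = L\<^sup>2 * (m / (s2 * k))" using s2_pos by (simp add: power_mult_distrib)
    moreover have "th \<le> s2 * k / (L\<^sup>2 * m)" by (simp add: th_def)
    moreover have "0 \<le> L\<^sup>2 * (m / (s2 * k))" using s2_pos by simp
    ultimately show ?thesis using mult_right_mono by metis
  qed
  also have "\<dots> = 1" using L m k s2_pos by simp
  finally have th1: "th * (L * sqrt (m / (s2 * k)))\<^sup>2 \<le> 1" .
  have "4 * Cf * th \<le> 4 * Cf * (t * k / (4 * Cf))" using Cf by (intro mult_left_mono) (auto simp: th_def)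
  also have "\<dots> = t * k" using Cf by simp
  finally have th2: "4 * Cf * th \<le> t * k" .
  have "prob {\<omega> \<in> space M. t \<le> \<bar>Q m k \<omega> - 1\<bar>} \<le> 2 * exp (- (th * t / 4))"
    using A.part_sq_deviation[OF t(1) t(2)[unfolded del_def] th1 th0 th2]
    unfolding A.part_sq_def Q_def .
  also have "th * t / 4 = min (t\<^sup>2 * k / (16 * Cf)) (t * s2 * k / (4 * L\<^sup>2 * m))"
  proof -
    have "th * t / 4 = min (t * k / (4 * Cf)) (s2 * k / (L\<^sup>2 * m)) * (t / 4)" by (simp add: th_def)
    also have "\<dots> = min (t * k / (4 * Cf) * (t / 4)) (s2 * k / (L\<^sup>2 * m) * (t / 4))"
      using t(1) by (subst min_mult_distrib_right) simp
    also have "t * k / (4 * Cf) * (t / 4) = t\<^sup>2 * k / (16 * Cf)" by (simp add: power2_eq_square)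
    also have "s2 * k / (L\<^sup>2 * m) * (t / 4) = t * s2 * k / (4 * L\<^sup>2 * m)" by (simp add: mult_ac)
    finally show ?thesis .
  qed
  finally show ?thesis .
qed

text \<open>The admissible range of \<open>x\<close> is described by a single small parameter \<open>c\<close>, on which finitely
  many smallness conditions are imposed.\<close>

lemma tail_ratio:
  assumes \<eta>: "0 < \<eta>"
  shows "\<exists>c>0. \<forall>m k x. 1 \<le> m \<longrightarrow> 1 \<le> k \<longrightarrow> 1 / c \<le> x \<longrightarrow> x ^ 6 \<le> c * real k \<longrightarrow> x\<^sup>2 * real m powr (1 - \<beta>) \<le> c \<longrightarrow>
    x ^ 3 * real m \<le> c * real k \<longrightarrow> \<bar>prob {\<omega> \<in> space M. x \<le> W m k \<omega>} / normal_tail x - 1\<bar> \<le> \<eta>"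
proof -
  obtain \<kappa> A where \<kappa>: "0 < \<kappa>" "\<kappa> < 1" and A: "0 < A" "A \<le> 1" and up: "tail_up \<kappa> A < 1 + \<eta> / 2" and lo: "1 - \<eta> / 2 < tail_lo \<kappa> A"
    using ex_tail_constants[of "\<eta> / 2"] \<eta> by auto
  \<comment> \<open>The deviation level for \<open>Q\<close> will be \<open>a / x\<close>: the
    quadratic loss is then about a^2 / 2, which is below \<open>A\<close>, while the deviation
    probability still beats the normal tail.\<close>
  define a where "a = A / 4"
  define a0 where "a0 = min (a\<^sup>2 / (16 * Cf)) (a * s2 / (4 * L\<^sup>2))"
  have Cf1: "1 \<le> Cf" by (simp add: Cf_def)
  have L1: "1 \<le> L" by (rule L_ge)
  have a: "0 < a" "a \<le> 1" using A by (auto simp: a_def)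
  have a0: "0 < a0" using a Cf1 L1 s2_pos unfolding a0_def by simp
  have Del0: "0 \<le> Del" using L1 s2_pos by (simp add: Del_def)
  define e1 where "e1 = K * Z / sqrt s2"
  have e10: "0 \<le> e1" using K_ge Z_ge s2_pos by (simp add: e1_def)
  have ev: "\<forall>\<^sub>F c in at_right 0. f c < B" if "isCont f 0" "f 0 < B" for f :: "real \<Rightarrow> real" and B
  proof -
    have "(f \<longlongrightarrow> f 0) (at_right 0)"
      using that(1) by (simp add: isCont_def filterlim_at_split)
    then show ?thesis by (rule order_tendstoD) (rule that(2))
  qed
  have a2: "a\<^sup>2 / 2 < A"
  proof -
    have "a\<^sup>2 \<le> a * 1" using a unfolding power2_eq_square by (intro mult_left_mono) auto
    then show ?thesis using A by (simp add: a_def)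
  qed
  \<comment> \<open>Each condition is continuous in \<open>c\<close> and strict at
    \<open>c = 0\<close>, hence all of them hold for small positive \<open>c\<close>.\<close>
  have "\<forall>\<^sub>F c in at_right 0. c < A" "\<forall>\<^sub>F c in at_right 0. c < (1::real)"
    "\<forall>\<^sub>F c in at_right 0. e1 * sqrt c + E0 * c / 2 + (a + E0 * c)\<^sup>2 / 2 < A"
    "\<forall>\<^sub>F c in at_right 0. Del * c + 130 * Cf * sqrt c < A"
    "\<forall>\<^sub>F c in at_right 0. 2 * c < a0" "\<forall>\<^sub>F c in at_right 0. 24 * c\<^sup>2 < \<eta> / 2"
    "\<forall>\<^sub>F c in at_right 0. 2 * Del * c < a"
    using A a a2 a0 \<eta> by (auto intro!: ev continuous_intros)
  then have "\<forall>\<^sub>F c in at_right 0. c < A \<and> c < 1 \<and> e1 * sqrt c + E0 * c / 2 + (a + E0 * c)\<^sup>2 / 2 < A \<and>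
     Del * c + 130 * Cf * sqrt c < A \<and> 2 * c < a0 \<and> 24 * c\<^sup>2 < \<eta> / 2 \<and> 2 * Del * c < a"
    by eventually_elim auto
  moreover have "\<forall>\<^sub>F c in at_right 0. (0::real) < c" by (rule eventually_at_right_less)
  ultimately have "\<forall>\<^sub>F c in at_right 0. 0 < c \<and> c < A \<and> c < 1 \<and> e1 * sqrt c + E0 * c / 2 + (a + E0 * c)\<^sup>2 / 2 < A \<and>
     Del * c + 130 * Cf * sqrt c < A \<and> 2 * c < a0 \<and> 24 * c\<^sup>2 < \<eta> / 2 \<and> 2 * Del * c < a"
    by eventually_elim auto
  then obtain c where c: "0 < c" "c < A" "c < 1" "e1 * sqrt c + E0 * c / 2 + (a + E0 * c)\<^sup>2 / 2 < A"
     "Del * c + 130 * Cf * sqrt c < A" "2 * c < a0" "24 * c\<^sup>2 < \<eta> / 2" "2 * Del * c < a"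
    using eventually_happens[of _ "at_right (0::real)"] by auto
  have "\<bar>prob {\<omega> \<in> space M. x \<le> W m k \<omega>} / normal_tail x - 1\<bar> \<le> \<eta>"
    if m: "1 \<le> m" and k: "1 \<le> k" and x: "1 / c \<le> x" and x6: "x ^ 6 \<le> c * real k" and xm: "x\<^sup>2 * real m powr (1 - \<beta>) \<le> c"
      and x3m: "x ^ 3 * real m \<le> c * real k" for m k x
  proof -
    have "1 \<le> 1 / c" using c by simp
    then have x1: "1 \<le> x" using x by linarith
    define P where "P = real m powr (1 - \<beta>)"
    have P0: "0 \<le> P" by (simp add: P_def)
    have xP: "x * P \<le> c"
    proof -
      have "x * 1 \<le> x * x" using x1 by (intro mult_left_mono) auto
      then have "x * P \<le> x\<^sup>2 * P" using P0 by (intro mult_right_mono) (auto simp: power2_eq_square)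
      then show ?thesis using xm by (simp add: P_def)
    qed
    have Pc: "P \<le> c" using xP mult_right_mono[OF x1 P0] by simp
    \<comment> \<open>By \<beta> \<le> 3/2 the pathwise error of order 1 / sqrt m is dominated by
      the variance error, so no separate restriction on \<open>x\<close> arises from it.\<close>
    have mP: "1 / sqrt m \<le> P"
    proof -
      have "1 / sqrt m = real m powr (- 1/2)" using m by (simp add: powr_minus_divide powr_half_sqrt)
      also have "\<dots> \<le> P" unfolding P_def using m \<beta> by (intro powr_mono) auto
      finally show ?thesis .
    qed
    have small: "del m \<le> 1"
    proof -
      have "Del * P \<le> Del * c" using Pc Del0 by (intro mult_left_mono) auto
      then show ?thesis using c(8) a Del0 c(1) by (simp add: del_def P_def)
    qed
    interpret A: bounded_mds M "\<lambda>j. F (m * j)" "\<xi> m k" k "L * sqrt (m / (s2 * k))" "Del * real m powr (1 - \<beta>)" Cf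
      using bounded_mds_blocks k m small by (simp add: del_def)
    have "x\<^sup>2 \<le> c * k"
      using power_increasing[of 2 6 x] x1 x6 by linarith
    then have xk: "x \<le> sqrt c * sqrt k"
      using x1 real_le_rsqrt[of x "c * k"] by (simp add: real_sqrt_mult)
    have xk': "x \<le> sqrt k"
    proof -
      have "sqrt c * sqrt k \<le> 1 * sqrt k" using c by (intro mult_right_mono) auto
      then show ?thesis using xk by simp
    qed
    have x3k: "x ^ 3 \<le> sqrt c * sqrt k"
    proof -
      have "(x ^ 3)\<^sup>2 \<le> c * k" using x6 by (simp flip: power_mult)
      then show ?thesis using real_le_rsqrt[of "x ^ 3" "c * k"] by (simp add: real_sqrt_mult)
    qed
    have kpos: "0 < sqrt k" using k by simp
    have r0: "A.r0 x \<le> A"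
    proof -
      have "A.r0 x = Del * (x\<^sup>2 * P) + 130 * Cf * (x ^ 3 / sqrt k)" by (simp add: A.r0_def P_def)
      also have "\<dots> \<le> Del * c + 130 * Cf * sqrt c"
        using xm x3k Del0 Cf1 kpos by (intro add_mono mult_left_mono) (auto simp: P_def divide_le_eq)
      finally show ?thesis using c by linarith
    qed
    have xA: "1 / A \<le> x"
    proof -
      have "1 / A \<le> 1 / c" using c A by (intro divide_left_mono) auto
      then show ?thesis using x by linarith
    qed
    define h1 where "h1 = x * err_sum m k + x\<^sup>2 * err_sq m / 2"
    define t where "t = a / x"
    define h2 where "h2 = h1 + x\<^sup>2 * (t + err_sq m)\<^sup>2 / 2"
    have es: "x\<^sup>2 * err_sq m \<le> E0 * c" "x * err_sq m \<le> E0 * c"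
    proof -
      have "err_sq m = E0 * (1 / sqrt m)" by (simp add: err_sq_def)
      then have em: "err_sq m \<le> E0 * P" using mult_left_mono[OF mP E0_nonneg] by simp
      have 1: "y * err_sq m \<le> E0 * (y * P)" if "0 \<le> y" for y
        using mult_left_mono[OF em that] by (simp add: mult_ac)
      show "x\<^sup>2 * err_sq m \<le> E0 * c"
        using order.trans[OF 1[of "x\<^sup>2"] mult_left_mono[OF xm[folded P_def] E0_nonneg]] by simp
      show "x * err_sq m \<le> E0 * c"
        using order.trans[OF 1[of x] mult_left_mono[OF xP E0_nonneg]] x1 by simp
    qed
    have h1: "0 \<le> h1" "h1 \<le> e1 * sqrt c + E0 * c / 2"
    proof -
      show "0 \<le> h1" unfolding h1_def using x1 err_nonneg by simp
      have "x * err_sum m k \<le> e1 * sqrt c"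
      proof -
        have "err_sum m k = e1 / (sqrt k * sqrt m)" by (simp add: err_sum_def e1_def real_sqrt_mult)
        also have "\<dots> \<le> e1 / (sqrt k * 1)" using e10 kpos m by (intro divide_left_mono mult_left_mono) auto
        finally have "x * err_sum m k \<le> x * (e1 / sqrt k)" using x1 by (intro mult_left_mono) auto
        also have "\<dots> \<le> (sqrt c * sqrt k) * (e1 / sqrt k)" using xk e10 by (intro mult_right_mono) auto
        also have "\<dots> = e1 * sqrt c" using kpos by simp
        finally show ?thesis .
      qed
      then show "h1 \<le> e1 * sqrt c + E0 * c / 2" unfolding h1_def using es(1) by linarith
    qed
    have h2: "h1 \<le> h2" "h2 \<le> A"
    proof -
      show "h1 \<le> h2" by (simp add: h2_def)
      have "x\<^sup>2 * (t + err_sq m)\<^sup>2 = (a + x * err_sq m)\<^sup>2"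
        using x1 by (simp add: t_def power_mult_distrib[symmetric] distrib_left)
      also have "\<dots> \<le> (a + E0 * c)\<^sup>2" using es(2) a x1 err_nonneg by (intro power_mono) auto
      finally show "h2 \<le> A" unfolding h2_def using h1 c(4) by linarith
    qed
    have t: "0 < t" "t \<le> 1" using a x1 by (auto simp: t_def field_simps)
    have d2: "2 * del m \<le> t"
    proof -
      have "2 * (Del * (x * P)) \<le> 2 * (Del * c)" using xP Del0 by (intro mult_left_mono) auto
      then have "x * (2 * del m) \<le> a" using c(8) by (simp add: del_def P_def mult_ac)
      then show ?thesis using x1 by (simp add: t_def field_simps)
    qed
    define D where "D = prob {\<omega> \<in> space M. t \<le> \<bar>Q m k \<omega> - 1\<bar>}"
    have "D \<le> 2 * exp (- min (t\<^sup>2 * k / (16 * Cf)) (t * s2 * k / (4 * L\<^sup>2 * m)))"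
      unfolding D_def by (rule Q_deviation[OF k m small t(1) d2])
    \<comment> \<open>The two terms of the minimum correspond to two hypotheses. At level
      \<open>t = a / x\<close> the first has order k / x^2, which
      \<open>x ^ 6 \<le> c * real k\<close> makes at least of order x^4; the second has order k / (x
      m), at least of order x^2 by the bound on \<open>x ^ 3 * real m\<close>.\<close>
    also have "\<dots> \<le> 2 * exp (- (2 * x\<^sup>2))"
    proof -
      have i1: "2 * x\<^sup>2 \<le> t\<^sup>2 * k / (16 * Cf)"
      proof -
        have "2 * c * x ^ 4 \<le> a0 * x ^ 4" using c x1 by (intro mult_right_mono) auto
        also have "\<dots> \<le> a\<^sup>2 / (16 * Cf) * x ^ 4" using x1 by (intro mult_right_mono) (auto simp: a0_def)
        finally have "2 * c * x ^ 4 * (x\<^sup>2) \<le> a\<^sup>2 / (16 * Cf) * x ^ 4 * x\<^sup>2" by (rule mult_right_mono) simp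
        also have "a\<^sup>2 / (16 * Cf) * x ^ 4 * x\<^sup>2 = a\<^sup>2 / (16 * Cf) * x ^ 6"
          by (simp only: mult.assoc power_add[symmetric]) simp
        also have "\<dots> \<le> a\<^sup>2 / (16 * Cf) * (c * k)" using x6 Cf1 by (intro mult_left_mono) auto
        finally have "c * (2 * x\<^sup>2 * x ^ 4) \<le> c * (a\<^sup>2 / (16 * Cf) * k)" by (simp add: mult_ac)
        then have "2 * x\<^sup>2 * x ^ 4 \<le> a\<^sup>2 / (16 * Cf) * k" using c(1) by (simp only: mult_le_cancel_left_pos)
        moreover have "2 * x\<^sup>2 * x\<^sup>2 \<le> 2 * x\<^sup>2 * x ^ 4" using x1 by (intro mult_left_mono power_increasing) auto
        ultimately have "2 * x\<^sup>2 * x\<^sup>2 \<le> a\<^sup>2 / (16 * Cf) * k" by linarith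
        moreover have "t\<^sup>2 * k / (16 * Cf) = (a\<^sup>2 / (16 * Cf) * k) / x\<^sup>2" by (simp add: t_def power_divide)
        moreover have "0 < x\<^sup>2" using x1 by simp
        ultimately show ?thesis by (simp only: pos_le_divide_eq)
      qed
      have i2: "2 * x\<^sup>2 \<le> t * s2 * k / (4 * L\<^sup>2 * m)"
      proof -
        have "2 * c * (x ^ 3 * m) \<le> a * s2 / (4 * L\<^sup>2) * (x ^ 3 * m)"
          using c(6) x1 by (intro mult_right_mono) (auto simp: a0_def)
        also have "\<dots> \<le> a * s2 / (4 * L\<^sup>2) * (c * k)" using x3m a s2_pos by (intro mult_left_mono) auto
        finally have "c * (2 * (x ^ 3 * m)) \<le> c * (a * s2 / (4 * L\<^sup>2) * k)" by (simp add: mult_ac)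
        then have "2 * (x ^ 3 * m) \<le> a * s2 / (4 * L\<^sup>2) * k" using c(1) by (simp only: mult_le_cancel_left_pos)
        moreover have "2 * (x ^ 3 * m) = 2 * x\<^sup>2 * (x * m)" by (simp add: power2_eq_square power3_eq_cube)
        moreover have "t * s2 * k / (4 * L\<^sup>2 * m) = (a * s2 / (4 * L\<^sup>2) * k) / (x * m)" by (simp add: t_def mult_ac)
        moreover have "0 < x * m" using x1 m by simp
        ultimately show ?thesis by (simp only: pos_le_divide_eq)
      qed
      show ?thesis using i1 i2 by simp
    qed
    \<comment> \<open>The exponential splits into Mills' approximation, a factor exp (- x^2) that
      absorbs \<open>x\<close>, and a factor exp (- x^2 / 2) that is at most 2 c^2 because
      \<open>x\<close> is at least \<open>1 / c\<close>.\<close>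
    also have "\<dots> \<le> \<eta> / 2 * normal_tail x"
    proof -
      have nt: "exp (- x\<^sup>2 / 2) / (x * sqrt (2 * pi)) \<le> 2 * normal_tail x"
      proof -
        have "exp (- x\<^sup>2 / 2) / (x * sqrt (2 * pi)) \<le> (1 + 1 / x\<^sup>2) * normal_tail x" using x1 by (intro mills_ratio) auto
        also have "\<dots> \<le> 2 * normal_tail x" using x1 normal_tail_nonneg by (intro mult_right_mono) (auto simp: field_simps)
        finally show ?thesis .
      qed
      have s3: "sqrt (2 * pi) \<le> 3"
        using pi_less_4 by (intro real_le_lsqrt) auto
      have y: "y \<le> exp y" for y :: real using exp_ge_add_one_self[of y] by linarith
      have ex: "x * exp (- x\<^sup>2) \<le> 1"
      proof -
        have "x \<le> x\<^sup>2" using x1 by (simp add: power2_eq_square)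
        also have "\<dots> \<le> exp (x\<^sup>2)" by (rule y)
        finally show ?thesis by (simp add: exp_minus field_simps)
      qed
      have ex2: "exp (- x\<^sup>2 / 2) \<le> 2 * c\<^sup>2"
      proof -
        have "(1 / c)\<^sup>2 \<le> x\<^sup>2" using x c by (intro power_mono) auto
        then have "1 / c\<^sup>2 / 2 \<le> exp (x\<^sup>2 / 2)" using y[of "x\<^sup>2 / 2"] by (simp add: power_divide)
        then have "1 / exp (x\<^sup>2 / 2) \<le> 1 / (1 / c\<^sup>2 / 2)" using c by (intro divide_left_mono) auto
        then show ?thesis by (simp add: exp_minus inverse_eq_divide mult.commute)
      qed
      have "2 * exp (- (2 * x\<^sup>2)) = 2 * ((x * exp (- x\<^sup>2)) * exp (- x\<^sup>2 / 2) * sqrt (2 * pi)) * (exp (- x\<^sup>2 / 2) / (x * sqrt (2 * pi)))"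
      proof -
        have "exp (- (2 * x\<^sup>2)) = exp (- x\<^sup>2) * exp (- x\<^sup>2 / 2) * exp (- x\<^sup>2 / 2)" by (simp flip: exp_add)
        then show ?thesis using x1 by simp
      qed
      also have "\<dots> \<le> 2 * (1 * (2 * c\<^sup>2) * 3) * (2 * normal_tail x)"
        using ex ex2 s3 nt x1 by (intro mult_mono) auto
      also have "\<dots> = 24 * c\<^sup>2 * normal_tail x" by simp
      also have "\<dots> \<le> \<eta> / 2 * normal_tail x" using c(7) normal_tail_nonneg by (intro mult_right_mono) auto
      finally show ?thesis .
    qed
    finally have D: "D \<le> \<eta> / 2 * normal_tail x" .
    have U: "x * T m k \<omega> - x\<^sup>2 * Q m k \<omega> / 2 = A.U x k \<omega>" for \<omega>
      using U_eq_TQ[OF k m small] by simp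
    define Pr where "Pr = prob {\<omega> \<in> space M. x \<le> W m k \<omega>}"
    have "normal_tail x * tail_lo \<kappa> A \<le> prob {\<omega> \<in> space M. x\<^sup>2 / 2 + h1 \<le> A.U x k \<omega>}"
      using A.tail_U_bounds(2)[OF \<kappa> A xA xk' r0, of h1] h1 h2 by simp
    also have "\<dots> \<le> Pr + D"
      using W_tail_compare(1)[OF k m _ t(2), of x] x1 unfolding U h1_def Pr_def D_def by simp
    finally have l: "normal_tail x * tail_lo \<kappa> A \<le> Pr + D" .
    have "Pr \<le> prob {\<omega> \<in> space M. x\<^sup>2 / 2 + (- h2) \<le> A.U x k \<omega>} + D"
      using W_tail_compare(2)[OF k m less_le_trans[OF zero_less_one x1] t(2)]
      unfolding U h1_def h2_def Pr_def D_def add_uminus_conv_diff .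
    also have "prob {\<omega> \<in> space M. x\<^sup>2 / 2 + (- h2) \<le> A.U x k \<omega>} \<le> normal_tail x * tail_up \<kappa> A"
      using A.tail_U_bounds(1)[OF \<kappa> A xA xk' r0, of "- h2"] h1 h2 by simp
    finally have u: "Pr \<le> normal_tail x * tail_up \<kappa> A + D" by simp
    have np: "0 < normal_tail x" by (rule normal_tail_pos)
    have "Pr \<le> normal_tail x * (1 + \<eta>)"
      using u D mult_left_mono[OF less_imp_le[OF up], of "normal_tail x"] np by (simp add: algebra_simps)
    moreover have "normal_tail x * (1 - \<eta>) \<le> Pr"
      using l D mult_left_mono[OF less_imp_le[OF lo], of "normal_tail x"] np by (simp add: algebra_simps)
    ultimately have "Pr / normal_tail x \<le> 1 + \<eta>" "1 - \<eta> \<le> Pr / normal_tail x"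
      using np by (auto simp: field_simps)
    then show ?thesis unfolding Pr_def by (simp add: abs_le_iff)
  qed
  then show ?thesis using c(1) by (intro exI[of _ c] conjI allI impI)
qed

end

section \<open>Moderate deviations\<close>

lemma isCont_normal_cdf: "isCont (cdf std_normal_distribution) x"
proof -
  interpret N: real_distribution std_normal_distribution by (rule real_dist_normal_dist)
  have "emeasure std_normal_distribution {x} = (\<integral>\<^sup>+t. ennreal (std_normal_density t) * indicator {x} t \<partial>lborel)"
    by (simp add: emeasure_density)
  also have "\<dots> = (\<integral>\<^sup>+t. 0 \<partial>(lborel :: real measure))"
    by (rule nn_integral_cong_AE) (use AE_lborel_singleton[of x] in \<open>auto elim!: eventually_mono\<close>)
  finally show ?thesis by (simp add: N.isCont_cdf measure_def)
qed

lemma isCont_normal_tail: "isCont normal_tail x"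
  unfolding normal_tail_def using isCont_normal_cdf by (intro continuous_intros) auto

lemma normal_tail_antimono: "x \<le> y \<Longrightarrow> normal_tail y \<le> normal_tail x"
proof -
  interpret N: real_distribution std_normal_distribution by (rule real_dist_normal_dist)
  show "x \<le> y \<Longrightarrow> normal_tail y \<le> normal_tail x"
    unfolding normal_tail_def using N.cdf_nondecreasing[of x y] by simp
qed

text \<open>Polya's argument: on a grid finer than the modulus of continuity of the limit,
  convergence is uniform, and monotonicity traps the values between neighbouring grid points.
  Uniform continuity is taken on \<open>{0..B+1}\<close> because the right neighbour of a point may
  exceed \<open>B\<close>.\<close>

lemma antimono_uniform_convergence:
  fixes f :: "nat \<Rightarrow> real \<Rightarrow> real" and g :: "real \<Rightarrow> real"
  assumes f: "\<And>n x y. 0 \<le> x \<Longrightarrow> x \<le> y \<Longrightarrow> f n y \<le> f n x" and g: "\<And>x y. 0 \<le> x \<Longrightarrow> x \<le> y \<Longrightarrow> g y \<le> g x"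
    and cont: "\<And>x. isCont g x" and lim: "\<And>x. 0 \<le> x \<Longrightarrow> (\<lambda>n. f n x) \<longlonglongrightarrow> g x" and e: "0 < e" and B: "0 \<le> B"
  shows "\<forall>\<^sub>F n in sequentially. \<forall>x\<in>{0..B}. \<bar>f n x - g x\<bar> < e"
proof -
  have "uniformly_continuous_on {0..B+1} g"
    by (intro compact_uniformly_continuous continuous_at_imp_continuous_on) (use cont in auto)
  then obtain d where d: "0 < d" "\<And>x y. x \<in> {0..B+1} \<Longrightarrow> y \<in> {0..B+1} \<Longrightarrow> \<bar>x - y\<bar> < d \<Longrightarrow> \<bar>g x - g y\<bar> < e / 2"
    using e unfolding uniformly_continuous_on_def dist_real_def by (metis half_gt_zero)
  define h where "h = min (d / 2) 1"
  have h: "0 < h" "h < d" "h \<le> 1" using d(1) by (auto simp: h_def)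
  obtain r where r: "B / h < real r" using reals_Archimedean2 by blast
  have "\<forall>\<^sub>F n in sequentially. \<forall>i\<in>{..Suc r}. \<bar>f n (i * h) - g (i * h)\<bar> < e / 2"
  proof (subst eventually_ball_finite_distrib, simp, intro ballI)
    fix i
    have "(\<lambda>n. f n (real i * h)) \<longlonglongrightarrow> g (real i * h)" using h by (intro lim) auto
    then show "\<forall>\<^sub>F n in sequentially. \<bar>f n (i * h) - g (i * h)\<bar> < e / 2"
      using e tendstoD[of _ "g (real i * h)" sequentially "e / 2"] by (simp add: dist_real_def)
  qed
  then show ?thesis
  proof eventually_elim
    case (elim n)
    show ?case
    proof
      fix x assume x: "x \<in> {0..B}"
      define i where "i = nat \<lfloor>x / h\<rfloor>"
      have xh: "0 \<le> x / h" using x h by auto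
      have i1: "real i * h \<le> x"
      proof -
        have "real i \<le> x / h" using xh by (simp add: i_def)
        then show ?thesis using h by (simp add: field_simps)
      qed
      have i2: "x \<le> real (Suc i) * h"
      proof -
        have "x / h \<le> real i + 1" using xh unfolding i_def by linarith
        then show ?thesis using h by (simp add: field_simps)
      qed
      have "real i < real r"
      proof -
        have "real i \<le> x / h" using xh by (simp add: i_def)
        also have "\<dots> \<le> B / h" using x h by (intro divide_right_mono) auto
        finally show ?thesis using r by linarith
      qed
      then have ir: "i \<le> r" by simp
      have ih0: "0 \<le> real i * h" using h by simp
      have ih1: "real (Suc i) * h \<le> B + 1"
        using i1 x h by (simp add: distrib_right)
      have "f n x \<le> f n (i * h)" using f[OF ih0 i1] .
      moreover have "f n (Suc i * h) \<le> f n x" using f[OF _ i2] x by simp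
      moreover have "\<bar>f n (i * h) - g (i * h)\<bar> < e / 2" "\<bar>f n (Suc i * h) - g (Suc i * h)\<bar> < e / 2"
        using elim ir by (auto simp del: of_nat_Suc)
      moreover have "\<bar>g (i * h) - g x\<bar> < e / 2"
        using i1 i2 h x ih0 ih1 order.trans[OF ih0 i1] by (intro d(2)) (auto simp: distrib_right)
      moreover have "\<bar>g (Suc i * h) - g x\<bar> < e / 2"
        using i1 i2 h x ih0 ih1 order.trans[OF ih0 i1] by (intro d(2)) (auto simp: distrib_right)
      ultimately show "\<bar>f n x - g x\<bar> < e" by linarith
    qed
  qed
qed

section \<open>Central limit theorem for bounded arguments, and its union with the large
  ones\<close>

context mixing_process
begin

text \<open>The exponent at x = 1 has limiting characteristic function exp ((- t^2 - i t) / 2), that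
  of a normal law with mean -1/2 and variance 1; adding 1/2 centers it. Since \<open>Q\<close>
  concentrates at 1, the centered variable is close to \<open>T\<close> itself.\<close>

lemma clt_T:
  fixes m k :: "nat \<Rightarrow> nat"
  assumes m: "filterlim m at_top sequentially" and k: "filterlim k at_top sequentially"
  shows "(\<lambda>n. prob {\<omega> \<in> space M. y < T (m n) (k n) \<omega> - Q (m n) (k n) \<omega> / 2 + 1 / 2}) \<longlonglongrightarrow> normal_tail y"
proof -
  define V where "V = (\<lambda>n \<omega>. T (m n) (k n) \<omega> - Q (m n) (k n) \<omega> / 2 + 1 / 2)"
  have [measurable]: "V n \<in> borel_measurable M" for n unfolding V_def by measurable
  define \<mu> where "\<mu> = (\<lambda>n. distr M borel (V n))"
  have rd: "real_distribution (\<mu> n)" for n unfolding \<mu>_def by (rule real_distribution_distr) simp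
  have m1: "\<forall>\<^sub>F n in sequentially. 1 \<le> m n" using m by (simp add: filterlim_at_top)
  have k1: "\<forall>\<^sub>F n in sequentially. 1 \<le> k n" using k by (simp add: filterlim_at_top)
  have mr: "filterlim (\<lambda>n. real (m n)) at_top sequentially"
    by (rule filterlim_compose[OF filterlim_real_sequentially m])
  have kr: "filterlim (\<lambda>n. real (k n)) at_top sequentially"
    by (rule filterlim_compose[OF filterlim_real_sequentially k])
  have dl: "(\<lambda>n. del (m n)) \<longlonglongrightarrow> 0"
  proof -
    have "(\<lambda>n. real (m n) powr (1 - \<beta>)) \<longlonglongrightarrow> 0"
      by (rule tendsto_neg_powr[OF _ mr]) (use \<beta> in auto)
    then show ?thesis unfolding del_def by (rule tendsto_mult_right_zero)
  qed
  then have d1: "\<forall>\<^sub>F n in sequentially. del (m n) \<le> 1"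
    using order_tendstoD(2)[OF dl, of 1] by (auto elim!: eventually_mono)
  have chars: "(\<lambda>n. char (\<mu> n) t) \<longlonglongrightarrow> char std_normal_distribution t" for t
  proof -
    define r where "r = (\<lambda>n. del (m n) + 130 * Cf / sqrt (k n))"
    have "(\<lambda>n. 130 * Cf / sqrt (k n)) \<longlonglongrightarrow> 0"
      by (intro tendsto_divide_0[OF tendsto_const] filterlim_at_top_imp_at_infinity filterlim_compose[OF sqrt_at_top kr])
    from tendsto_add[OF dl this] have "r \<longlonglongrightarrow> 0" by (simp add: r_def)
    then have r0: "(\<lambda>n. (1 + \<bar>t\<bar>) ^ 4 * r n) \<longlonglongrightarrow> 0" by (rule tendsto_mult_right_zero)
    have "\<forall>\<^sub>F n in sequentially. norm (char (\<mu> n) t - char std_normal_distribution t) \<le> (1 + \<bar>t\<bar>) ^ 4 * r n"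
      using m1 k1 d1
    proof eventually_elim
      case (elim n)
      interpret A: bounded_mds M "\<lambda>j. F (m n * j)" "\<xi> (m n) (k n)" "k n" "L * sqrt (m n / (s2 * k n))" "Del * real (m n) powr (1 - \<beta>)" Cf
        using bounded_mds_blocks elim by (simp add: del_def)
      have VU: "V n \<omega> = A.U 1 (k n) \<omega> + 1 / 2" for \<omega>
        using U_eq_TQ[of "k n" "m n" 1 \<omega>] elim by (simp add: V_def)
      have [measurable]: "A.U 1 (k n) \<in> borel_measurable M" by simp
      define h where "h = exp (\<i> * complex_of_real (t / 2))"
      have nh: "norm h = 1" by (simp add: h_def norm_exp_eq_Re)
      have "char (\<mu> n) t = (\<integral>\<omega>. exp (\<i> * complex_of_real (t * V n \<omega>)) \<partial>M)"
        unfolding char_def \<mu>_def by (subst integral_distr) auto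
      also have "\<dots> = (\<integral>\<omega>. h * exp (\<i> * of_real t * of_real (A.U 1 (k n) \<omega>)) \<partial>M)"
        unfolding VU h_def by (intro Bochner_Integration.integral_cong) (auto simp: exp_add[symmetric] algebra_simps)
      also have "\<dots> = h * (\<integral>\<omega>. exp (\<i> * of_real t * of_real (A.U 1 (k n) \<omega>)) \<partial>M)" by simp
      finally have c1: "char (\<mu> n) t = h * (\<integral>\<omega>. exp (\<i> * of_real t * of_real (A.U 1 (k n) \<omega>)) \<partial>M)" .
      have c2: "char std_normal_distribution t = h * exp ((- of_real (t\<^sup>2) - \<i> * of_real t) / 2 * of_real (1\<^sup>2))"
      proof -
        have "h * exp ((- of_real (t\<^sup>2) - \<i> * of_real t) / 2 * of_real (1\<^sup>2)) = exp (complex_of_real (- t\<^sup>2 / 2))"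
          unfolding h_def exp_add[symmetric] by (simp add: field_simps)
        then show ?thesis unfolding char_std_normal_distribution exp_of_real by simp
      qed
      have "char (\<mu> n) t - char std_normal_distribution t = h * ((\<integral>\<omega>. exp (\<i> * of_real t * of_real (A.U 1 (k n) \<omega>)) \<partial>M) - exp ((- of_real (t\<^sup>2) - \<i> * of_real t) / 2 * of_real (1\<^sup>2)))"
        unfolding c1 c2 by (rule right_diff_distrib[symmetric])
      then have "norm (char (\<mu> n) t - char std_normal_distribution t) = norm ((\<integral>\<omega>. exp (\<i> * of_real t * of_real (A.U 1 (k n) \<omega>)) \<partial>M) - exp ((- of_real (t\<^sup>2) - \<i> * of_real t) / 2 * of_real (1\<^sup>2)))"
        by (simp only: norm_mult nh mult_1)
      also have "\<dots> \<le> (1 + \<bar>t\<bar>) ^ 4 * A.r0 1" by (rule A.char_U_bound) (use elim in auto)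
      also have "A.r0 1 = r n" by (simp add: A.r0_def r_def del_def)
      finally show ?case .
    qed
    then have "(\<lambda>n. char (\<mu> n) t - char std_normal_distribution t) \<longlonglongrightarrow> 0"
      by (rule Lim_null_comparison[OF _ r0])
    then show ?thesis by (simp add: LIM_zero_iff)
  qed
  have "weak_conv_m \<mu> std_normal_distribution"
    by (rule levy_continuity[OF rd real_dist_normal_dist chars])
  then have "(\<lambda>n. cdf (\<mu> n) y) \<longlonglongrightarrow> cdf std_normal_distribution y"
    unfolding weak_conv_m_def weak_conv_def using isCont_normal_cdf by blast
  then have "(\<lambda>n. 1 - cdf (\<mu> n) y) \<longlonglongrightarrow> normal_tail y"
    unfolding normal_tail_def by (intro tendsto_intros)
  moreover have "1 - cdf (\<mu> n) y = prob {\<omega> \<in> space M. y < V n \<omega>}" for n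
  proof -
    have "cdf (\<mu> n) y = prob (V n -` {..y} \<inter> space M)" unfolding cdf_def \<mu>_def by (rule measure_distr) auto
    also have "1 - \<dots> = prob (space M - (V n -` {..y} \<inter> space M))" by (rule prob_compl[symmetric]) simp
    also have "space M - (V n -` {..y} \<inter> space M) = {\<omega> \<in> space M. y < V n \<omega>}" by auto
    finally show ?thesis .
  qed
  ultimately show ?thesis by (simp add: V_def)
qed

text \<open>At a fixed level \<open>t\<close> both terms of the minimum in
  \<open>Q_deviation\<close> diverge, one like k and the other like k / m.\<close>

lemma Q_concentrates:
  fixes m k :: "nat \<Rightarrow> nat"
  assumes m: "filterlim m at_top sequentially" and k: "filterlim k at_top sequentially"
    and mk: "(\<lambda>n. real (m n) / real (k n)) \<longlonglongrightarrow> 0" and t: "0 < t"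
  shows "(\<lambda>n. prob {\<omega> \<in> space M. t \<le> \<bar>Q (m n) (k n) \<omega> - 1\<bar>}) \<longlonglongrightarrow> 0"
proof -
  have m1: "\<forall>\<^sub>F n in sequentially. 1 \<le> m n" using m by (simp add: filterlim_at_top)
  have k1: "\<forall>\<^sub>F n in sequentially. 1 \<le> k n" using k by (simp add: filterlim_at_top)
  have mr: "filterlim (\<lambda>n. real (m n)) at_top sequentially"
    by (rule filterlim_compose[OF filterlim_real_sequentially m])
  have kr: "filterlim (\<lambda>n. real (k n)) at_top sequentially"
    by (rule filterlim_compose[OF filterlim_real_sequentially k])
  have dl: "(\<lambda>n. del (m n)) \<longlonglongrightarrow> 0"
  proof -
    have "(\<lambda>n. real (m n) powr (1 - \<beta>)) \<longlonglongrightarrow> 0"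
      by (rule tendsto_neg_powr[OF _ mr]) (use \<beta> in auto)
    then show ?thesis unfolding del_def by (rule tendsto_mult_right_zero)
  qed
  have d: "\<forall>\<^sub>F n in sequentially. del (m n) < min 1 (t / 2)"
    by (rule order_tendstoD(2)[OF dl]) (use t in simp)
  have Cf1: "1 \<le> Cf" by (simp add: Cf_def)
  have km: "filterlim (\<lambda>n. real (k n) / real (m n)) at_top sequentially"
  proof -
    have "\<forall>\<^sub>F n in sequentially. 0 < real (m n) / real (k n)" using m1 k1 by eventually_elim simp
    from filterlim_inverse_at_top[OF mk this] show ?thesis by (simp add: inverse_eq_divide)
  qed
  define E where "E = (\<lambda>n. min (t\<^sup>2 / (16 * Cf) * real (k n)) (t * s2 / (4 * L\<^sup>2) * (real (k n) / real (m n))))"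
  have "filterlim E at_top sequentially"
  proof -
    have "filterlim (\<lambda>n. t\<^sup>2 / (16 * Cf) * real (k n)) at_top sequentially"
      by (rule filterlim_tendsto_pos_mult_at_top[OF tendsto_const _ kr]) (use t Cf1 in simp)
    moreover have "filterlim (\<lambda>n. t * s2 / (4 * L\<^sup>2) * (real (k n) / real (m n))) at_top sequentially"
      by (rule filterlim_tendsto_pos_mult_at_top[OF tendsto_const _ km]) (use t s2_pos L_ge(1) in simp)
    ultimately show ?thesis unfolding E_def filterlim_at_top by (auto intro: eventually_conj)
  qed
  then have "((\<lambda>n. exp (- E n)) \<longlongrightarrow> 0) sequentially"
    by (intro filterlim_compose[OF exp_at_bot] filterlim_compose[OF filterlim_uminus_at_bot_at_top])
  then have "((\<lambda>n. 2 * exp (- E n)) \<longlongrightarrow> 0) sequentially" by (rule tendsto_mult_right_zero)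
  moreover have "\<forall>\<^sub>F n in sequentially. norm (prob {\<omega> \<in> space M. t \<le> \<bar>Q (m n) (k n) \<omega> - 1\<bar>}) \<le> 2 * exp (- E n)"
    using m1 k1 d
  proof eventually_elim
    case (elim n)
    have "prob {\<omega> \<in> space M. t \<le> \<bar>Q (m n) (k n) \<omega> - 1\<bar>} \<le> 2 * exp (- E n)"
      using Q_deviation[of "k n" "m n" t] elim t by (simp add: E_def)
    then show ?case by simp
  qed
  ultimately show ?thesis by (rule Lim_null_comparison[rotated])
qed

text \<open>A Slutsky argument: off an event of small probability the denominator is close to 1, and
  the event for \<open>W\<close> is squeezed between those where the variable of
  \<open>clt_T\<close> exceeds x + d and x - d. Continuity of the normal tail closes the
  gap.\<close>

lemma clt_W:
  fixes m k :: "nat \<Rightarrow> nat"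
  assumes m: "filterlim m at_top sequentially" and k: "filterlim k at_top sequentially"
    and mk: "(\<lambda>n. real (m n) / real (k n)) \<longlonglongrightarrow> 0" and x: "0 \<le> x"
  shows "(\<lambda>n. prob {\<omega> \<in> space M. x \<le> W (m n) (k n) \<omega>}) \<longlonglongrightarrow> normal_tail x"
proof (rule tendstoI)
  fix e :: real assume e: "0 < e"
  have m1: "\<forall>\<^sub>F n in sequentially. 1 \<le> m n" using m by (simp add: filterlim_at_top)
  have k1: "\<forall>\<^sub>F n in sequentially. 1 \<le> k n" using k by (simp add: filterlim_at_top)
  have mr: "filterlim (\<lambda>n. real (m n)) at_top sequentially"
    by (rule filterlim_compose[OF filterlim_real_sequentially m])
  have kr: "filterlim (\<lambda>n. real (k n)) at_top sequentially"
    by (rule filterlim_compose[OF filterlim_real_sequentially k])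
  obtain d where d: "0 < d" "\<And>y. \<bar>y - x\<bar> \<le> d \<Longrightarrow> \<bar>normal_tail y - normal_tail x\<bar> < e / 4"
  proof -
    have "\<exists>d>0. \<forall>y. norm (y - x) < d \<longrightarrow> norm (normal_tail y - normal_tail x) < e / 4"
      using isCont_normal_tail[of x] e unfolding isCont_def LIM_eq
      by (metis diff_self half_gt_zero norm_zero zero_less_divide_iff zero_less_numeral)
    then obtain d where "0 < d" "\<And>y. \<bar>y - x\<bar> < d \<Longrightarrow> \<bar>normal_tail y - normal_tail x\<bar> < e / 4" by auto
    then show thesis by (intro that[of "d / 2"]) auto
  qed
  \<comment> \<open>Dividing by \<open>x + 1\<close> rather than by \<open>x\<close> covers
    \<open>x = 0\<close> and makes both \<open>x * t\<close> and \<open>t\<close> itself at most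
    \<open>d / 4\<close>.\<close>
  define t where "t = min (1/4) (d / (4 * (x + 1)))"
  have t: "0 < t" using d x by (simp add: t_def)
  moreover have "t \<le> 1 / 4" unfolding t_def by (rule min.cobounded1)
  ultimately have t: "0 < t" "t \<le> 1 / 4" by auto
  have xt: "(x + 1) * t \<le> d / 4"
  proof -
    have "(x + 1) * t \<le> (x + 1) * (d / (4 * (x + 1)))" using x by (intro mult_left_mono) (auto simp: t_def)
    moreover have "y * (d / (4 * y)) = d / 4" if "y \<noteq> 0" for y using that by simp
    from this[of "x + 1"] have "(x + 1) * (d / (4 * (x + 1))) = d / 4" using x by linarith
    ultimately show ?thesis by (simp only:)
  qed
  have em: "(\<lambda>n. err_sq (m n)) \<longlonglongrightarrow> 0"
    unfolding err_sq_def
    by (intro tendsto_divide_0[OF tendsto_const] filterlim_at_top_imp_at_infinity filterlim_compose[OF sqrt_at_top mr])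
  have ee: "(\<lambda>n. err_sum (m n) (k n)) \<longlonglongrightarrow> 0"
  proof (rule Lim_null_comparison)
    show "(\<lambda>n. K * Z / sqrt s2 / sqrt (k n)) \<longlonglongrightarrow> 0"
      by (intro tendsto_divide_0[OF tendsto_const] filterlim_at_top_imp_at_infinity filterlim_compose[OF sqrt_at_top kr])
    show "\<forall>\<^sub>F n in sequentially. norm (err_sum (m n) (k n)) \<le> K * Z / sqrt s2 / sqrt (k n)"
      using m1 k1
    proof eventually_elim
      case (elim n)
      have "sqrt (s2 * k n) * 1 \<le> sqrt (s2 * k n) * sqrt (m n)" using elim s2_pos by (intro mult_left_mono) auto
      then have "sqrt (s2 * k n) \<le> sqrt (s2 * (k n * m n))" by (simp add: real_sqrt_mult)
      then have "err_sum (m n) (k n) \<le> K * Z / sqrt (s2 * k n)"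
        unfolding err_sum_def using K_ge Z_ge s2_pos elim by (intro divide_left_mono mult_nonneg_nonneg mult_pos_pos) auto
      then show ?case using err_nonneg by (simp add: real_sqrt_mult)
    qed
  qed
  define D where "D = (\<lambda>n. prob {\<omega> \<in> space M. t \<le> \<bar>Q (m n) (k n) \<omega> - 1\<bar>})"
  define Y where "Y = (\<lambda>n \<omega>. T (m n) (k n) \<omega> - Q (m n) (k n) \<omega> / 2 + 1 / 2)"
  define p where "p = (\<lambda>y n. prob {\<omega> \<in> space M. y < Y n \<omega>})"
  have [measurable]: "Y n \<in> borel_measurable M" for n unfolding Y_def by measurable
  have p: "p y \<longlonglongrightarrow> normal_tail y" for y unfolding p_def Y_def using clt_T[OF m k] .
  have D0: "D \<longlonglongrightarrow> 0" unfolding D_def by (rule Q_concentrates[OF m k mk t(1)])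
  have "\<forall>\<^sub>F n in sequentially. err_sq (m n) < t" by (rule order_tendstoD(2)[OF em t(1)])
  moreover have "\<forall>\<^sub>F n in sequentially. err_sum (m n) (k n) < d / 8" by (rule order_tendstoD(2)[OF ee]) (use d in simp)
  moreover have "\<forall>\<^sub>F n in sequentially. D n < e / 4" by (rule order_tendstoD(2)[OF D0]) (use e in simp)
  moreover have "\<forall>\<^sub>F n in sequentially. \<bar>p (x - d) n - normal_tail (x - d)\<bar> < e / 4"
    using tendstoD[OF p[of "x - d"], of "e / 4"] e by (simp add: dist_real_def)
  moreover have "\<forall>\<^sub>F n in sequentially. \<bar>p (x + d) n - normal_tail (x + d)\<bar> < e / 4"
    using tendstoD[OF p[of "x + d"], of "e / 4"] e by (simp add: dist_real_def)
  ultimately show "\<forall>\<^sub>F n in sequentially. dist (prob {\<omega> \<in> space M. x \<le> W (m n) (k n) \<omega>}) (normal_tail x) < e"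
    using m1 k1
  proof eventually_elim
    case (elim n)
    define A where "A = {\<omega> \<in> space M. x \<le> W (m n) (k n) \<omega>}"
    define Dn where "Dn = {\<omega> \<in> space M. t \<le> \<bar>Q (m n) (k n) \<omega> - 1\<bar>}"
    define L1 where "L1 = {\<omega> \<in> space M. x - d < Y n \<omega>}"
    define L2 where "L2 = {\<omega> \<in> space M. x + d < Y n \<omega>}"
    have [measurable]: "A \<in> sets M" "Dn \<in> sets M" "L1 \<in> sets M" "L2 \<in> sets M"
      unfolding A_def Dn_def L1_def L2_def by measurable
    have ae: "AE \<omega> in M. (\<omega> \<in> A \<longrightarrow> \<omega> \<in> L1 \<union> Dn) \<and> (\<omega> \<in> L2 \<longrightarrow> \<omega> \<in> A \<union> Dn)"
      using W_path[OF elim(7,6)]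
    proof (rule AE_mp[OF _ AE_I2], intro impI)
      fix \<omega> assume w: "\<omega> \<in> space M"
      assume "\<exists>s q. W (m n) (k n) \<omega> = s / sqrt q \<and> 0 \<le> q \<and> (q = 0 \<longrightarrow> s = 0) \<and>
        \<bar>s - T (m n) (k n) \<omega>\<bar> \<le> err_sum (m n) (k n) \<and> (Q (m n) (k n) \<omega> \<le> 2 \<longrightarrow> \<bar>q - Q (m n) (k n) \<omega>\<bar> \<le> err_sq (m n))"
      then obtain s q where sq0: "W (m n) (k n) \<omega> = s / sqrt q" "\<bar>s - T (m n) (k n) \<omega>\<bar> \<le> err_sum (m n) (k n)"
        "Q (m n) (k n) \<omega> \<le> 2 \<longrightarrow> \<bar>q - Q (m n) (k n) \<omega>\<bar> \<le> err_sq (m n)" by blast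
      have sq: "W (m n) (k n) \<omega> = s / sqrt q" "\<bar>s - T (m n) (k n) \<omega>\<bar> \<le> d / 8"
        "Q (m n) (k n) \<omega> \<le> 2 \<Longrightarrow> \<bar>q - Q (m n) (k n) \<omega>\<bar> \<le> t"
        using sq0 elim(1,2) by linarith+
      show "(\<omega> \<in> A \<longrightarrow> \<omega> \<in> L1 \<union> Dn) \<and> (\<omega> \<in> L2 \<longrightarrow> \<omega> \<in> A \<union> Dn)"
      proof (cases "\<omega> \<in> Dn")
        case False
        then have Qt: "\<bar>Q (m n) (k n) \<omega> - 1\<bar> < t" using w by (auto simp: Dn_def)
        then have "\<bar>q - Q (m n) (k n) \<omega>\<bar> \<le> t" using sq(3) t by linarith
        then have q: "1 - 2 * t \<le> q" "q \<le> 1 + 2 * t" "0 < q" using Qt t by linarith+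
        have sl: "1 - 2 * t \<le> sqrt q"
        proof (rule real_le_rsqrt)
          have "(1 - 2 * t)\<^sup>2 \<le> (1 - 2 * t) * 1" unfolding power2_eq_square using t by (intro mult_left_mono) auto
          then show "(1 - 2 * t)\<^sup>2 \<le> q" using q by simp
        qed
        have su: "sqrt q \<le> 1 + 2 * t"
        proof (rule real_le_lsqrt)
          have "(1 + 2 * t) * 1 \<le> (1 + 2 * t)\<^sup>2" unfolding power2_eq_square using t by (intro mult_left_mono) auto
          then show "q \<le> (1 + 2 * t)\<^sup>2" using q by simp
        qed (use t in auto)
        have "x * t + t \<le> d / 4" using xt by (simp add: distrib_right)
        moreover have "0 \<le> x * t" using x t by simp
        ultimately have xt2: "2 * (x * t) \<le> d / 2" "t \<le> d / 4" using t(1) by linarith+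
        have sqp: "0 < sqrt q" using q by simp
        have WA: "\<omega> \<in> A \<longleftrightarrow> x * sqrt q \<le> s" using w sqp by (simp add: A_def sq(1) field_simps)
        have "\<omega> \<in> L1" if "\<omega> \<in> A"
        proof -
          have "x * (1 - 2 * t) \<le> x * sqrt q" using sl x by (intro mult_left_mono) auto
          then have "x - 2 * (x * t) \<le> s" using that WA by (simp add: algebra_simps)
          then have "x - d < Y n \<omega>" using xt2 sq(2) Qt d(1) unfolding Y_def by linarith
          then show ?thesis using w by (simp add: L1_def)
        qed
        moreover have "\<omega> \<in> A" if "\<omega> \<in> L2"
        proof -
          have "x + d < Y n \<omega>" using that by (simp add: L2_def)
          then have "x + 2 * (x * t) \<le> s" using xt2 sq(2) Qt d(1) unfolding Y_def by linarith
          moreover have "x * sqrt q \<le> x * (1 + 2 * t)" using su x by (intro mult_left_mono) auto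
          ultimately show ?thesis unfolding WA by (simp add: algebra_simps)
        qed
        ultimately show ?thesis by blast
      qed simp
    qed
    have "prob A \<le> prob (L1 \<union> Dn)" by (rule finite_measure_mono_AE) (use ae in \<open>auto elim!: eventually_mono\<close>)
    also have "\<dots> \<le> prob L1 + prob Dn" by (rule measure_Un_le) auto
    finally have u: "prob A \<le> p (x - d) n + D n" by (simp add: p_def D_def L1_def Dn_def)
    have "prob L2 \<le> prob (A \<union> Dn)" by (rule finite_measure_mono_AE) (use ae in \<open>auto elim!: eventually_mono\<close>)
    also have "\<dots> \<le> prob A + prob Dn" by (rule measure_Un_le) auto
    finally have l: "p (x + d) n \<le> prob A + D n" by (simp add: p_def D_def L2_def Dn_def)
    have "\<bar>normal_tail (x - d) - normal_tail x\<bar> < e / 4" "\<bar>normal_tail (x + d) - normal_tail x\<bar> < e / 4"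
      using d by auto
    then have "\<bar>prob A - normal_tail x\<bar> < e" using u l elim by linarith
    then show ?case by (simp add: dist_real_def A_def)
  qed
qed

text \<open>\<open>tail_ratio\<close> fixes a threshold \<open>B = 1 / c\<close>. Above it the ratio
  is controlled directly; below it the central limit theorem is uniform, and dividing by the normal
  tail is harmless because that tail is at least its value at \<open>B\<close>.\<close>

lemma uniform_tail:
  fixes m k :: "nat \<Rightarrow> nat"
  assumes m: "filterlim m at_top sequentially" and k: "filterlim k at_top sequentially"
    and mk: "(\<lambda>n. real (m n) / real (k n)) \<longlonglongrightarrow> 0"
    and c1: "(\<lambda>n. xs n ^ 6 / real (k n)) \<longlonglongrightarrow> 0" and c2: "(\<lambda>n. (xs n)\<^sup>2 * real (m n) powr (1 - \<beta>)) \<longlonglongrightarrow> 0"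
    and c3: "(\<lambda>n. xs n ^ 3 * real (m n) / real (k n)) \<longlonglongrightarrow> 0" and e: "0 < e"
  shows "\<forall>\<^sub>F n in sequentially. \<forall>x\<in>{0..xs n}. \<bar>prob {\<omega> \<in> space M. x \<le> W (m n) (k n) \<omega>} / normal_tail x - 1\<bar> < e"
proof -
  obtain c where c: "0 < c" and big: "\<And>m k x. 1 \<le> m \<Longrightarrow> 1 \<le> k \<Longrightarrow> 1 / c \<le> x \<Longrightarrow> x ^ 6 \<le> c * real k \<Longrightarrow>
    x\<^sup>2 * real m powr (1 - \<beta>) \<le> c \<Longrightarrow> x ^ 3 * real m \<le> c * real k \<Longrightarrow> \<bar>prob {\<omega> \<in> space M. x \<le> W m k \<omega>} / normal_tail x - 1\<bar> \<le> e / 2"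
    using tail_ratio[of "e / 2"] e by auto
  have m1: "\<forall>\<^sub>F n in sequentially. 1 \<le> m n" using m by (simp add: filterlim_at_top)
  have k1: "\<forall>\<^sub>F n in sequentially. 1 \<le> k n" using k by (simp add: filterlim_at_top)
  define B where "B = 1 / c"
  have B: "0 \<le> B" using c by (simp add: B_def)
  define e' where "e' = e * normal_tail B"
  have e': "0 < e'" using e normal_tail_pos by (simp add: e'_def)
  have "\<forall>\<^sub>F n in sequentially. \<forall>x\<in>{0..B}. \<bar>prob {\<omega> \<in> space M. x \<le> W (m n) (k n) \<omega>} - normal_tail x\<bar> < e'"
  proof (rule antimono_uniform_convergence)
    show "prob {\<omega> \<in> space M. y \<le> W (m n) (k n) \<omega>} \<le> prob {\<omega> \<in> space M. x \<le> W (m n) (k n) \<omega>}" if "x \<le> y" for n x y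
      by (rule finite_measure_mono) (use that in auto)
  qed (use normal_tail_antimono isCont_normal_tail clt_W[OF m k mk] e' B in auto)
  moreover have "\<forall>\<^sub>F n in sequentially. xs n ^ 6 / real (k n) < c" by (rule order_tendstoD(2)[OF c1 c])
  moreover have "\<forall>\<^sub>F n in sequentially. (xs n)\<^sup>2 * real (m n) powr (1 - \<beta>) < c" by (rule order_tendstoD(2)[OF c2 c])
  moreover have "\<forall>\<^sub>F n in sequentially. xs n ^ 3 * real (m n) / real (k n) < c" by (rule order_tendstoD(2)[OF c3 c])
  ultimately show ?thesis using m1 k1
  proof eventually_elim
    case (elim n)
    show ?case
    proof
      fix x assume x: "x \<in> {0..xs n}"
      show "\<bar>prob {\<omega> \<in> space M. x \<le> W (m n) (k n) \<omega>} / normal_tail x - 1\<bar> < e"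
      proof (cases "x \<le> B")
        case True
        then have "\<bar>prob {\<omega> \<in> space M. x \<le> W (m n) (k n) \<omega>} - normal_tail x\<bar> < e'" using elim(1) x by auto
        also have "e' \<le> e * normal_tail x" unfolding e'_def using e normal_tail_antimono[OF True] by (intro mult_left_mono) auto
        finally have "\<bar>prob {\<omega> \<in> space M. x \<le> W (m n) (k n) \<omega>} - normal_tail x\<bar> / normal_tail x < e"
          using normal_tail_pos[of x] by (simp add: divide_less_eq)
        moreover have "prob {\<omega> \<in> space M. x \<le> W (m n) (k n) \<omega>} / normal_tail x - 1 = (prob {\<omega> \<in> space M. x \<le> W (m n) (k n) \<omega>} - normal_tail x) / normal_tail x"
          using normal_tail_pos[of x] by (simp add: field_simps)
        ultimately show ?thesis using normal_tail_pos[of x] by simp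
      next
        case False
        have "\<bar>prob {\<omega> \<in> space M. x \<le> W (m n) (k n) \<omega>} / normal_tail x - 1\<bar> \<le> e / 2"
        proof (rule big)
          show "1 \<le> m n" "1 \<le> k n" "1 / c \<le> x" using elim False by (auto simp: B_def)
          have kp: "0 < real (k n)" using elim by simp
          have "x ^ 6 \<le> xs n ^ 6" using x by (intro power_mono) auto
          also have "\<dots> \<le> c * k n" using elim(2) kp by (simp add: divide_less_eq)
          finally show "x ^ 6 \<le> c * k n" .
          have "x\<^sup>2 * real (m n) powr (1 - \<beta>) \<le> (xs n)\<^sup>2 * real (m n) powr (1 - \<beta>)"
            using x by (intro mult_right_mono power_mono) auto
          then show "x\<^sup>2 * real (m n) powr (1 - \<beta>) \<le> c" using elim(3) by linarith
          have "x ^ 3 * m n \<le> xs n ^ 3 * m n" using x by (intro mult_right_mono power_mono) auto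
          also have "\<dots> \<le> c * k n" using elim(4) kp by (simp add: divide_less_eq)
          finally show "x ^ 3 * m n \<le> c * k n" .
        qed
        then show ?thesis using e by linarith
      qed
    qed
  qed
qed

end

section \<open>The block lengths of the moderate deviation statements\<close>

lemma div_lower_bound:
  assumes "1 \<le> m" "m \<le> n"
  shows "1 \<le> n div m" "real n / (2 * real m) \<le> real (n div m)"
proof -
  show 1: "1 \<le> n div m" using assms by (simp add: div_greater_zero_iff Suc_le_eq)
  have "n = m * (n div m) + n mod m" by simp
  also have "\<dots> \<le> m * (n div m) + m * (n div m)"
  proof -
    have "n mod m \<le> m * 1" using assms by simp
    also have "\<dots> \<le> m * (n div m)" using 1 by (intro mult_le_mono2)
    finally show ?thesis by (rule add_left_mono)
  qed
  finally have "real n \<le> real (2 * m * (n div m))" by (intro of_nat_mono) simp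
  then show "real n / (2 * real m) \<le> real (n div m)" using assms by (simp add: divide_le_eq mult_ac)
qed

context mixing_process
begin

text \<open>Write n^\<alpha> for the block length and n^b for the range of x. The relation 2 b =
  \<alpha> (\<beta> - 1) makes the variance term x^2 m^(1 - \<beta>) exactly critical, so it
  vanishes by the little-o alone. The other two terms carry the additional powers n^(- \<alpha>) and
  n^(- 3 \<alpha> (\<beta> - 1) / 2).\<close>

lemma moderate_deviations:
  fixes xs :: "nat \<Rightarrow> real"
  assumes x0: "\<And>n. 0 \<le> xs n" and xs: "xs \<in> o(\<lambda>n. real n powr ((\<beta> - 1) / (6 * \<beta> - 2)))" and e: "0 < e"
  defines "m \<equiv> \<lambda>n. nat \<lfloor>real n powr (1 / (3 * \<beta> - 1))\<rfloor>"
  shows "\<forall>\<^sub>F n in sequentially. \<forall>x\<in>{0..xs n}. \<bar>prob {\<omega> \<in> space M. x \<le> W (m n) (n div m n) \<omega>} / normal_tail x - 1\<bar> < e"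
proof -
  define \<alpha> where "\<alpha> = 1 / (3 * \<beta> - 1)"
  define b where "b = (\<beta> - 1) / (6 * \<beta> - 2)"
  have \<alpha>: "0 < \<alpha>" "\<alpha> < 1/2" using \<beta> by (auto simp: \<alpha>_def field_simps)
  have ba: "2 * b = \<alpha> * (\<beta> - 1)"
  proof -
    have h: "6 * \<beta> - 2 = 2 * (3 * \<beta> - 1)" by simp
    have "2 * (p / (2 * q)) = 1 / q * p" for p q :: real by simp
    then show ?thesis unfolding b_def \<alpha>_def h .
  qed
  have \<alpha>1: "\<alpha> * (3 * \<beta> - 1) = 1" using \<beta> by (simp add: \<alpha>_def)
  have b: "0 < b" using \<beta> by (simp add: b_def)
  define u where "u = (\<lambda>n. xs n / real n powr b)"
  have u: "u \<longlonglongrightarrow> 0" unfolding u_def b_def using xs by (rule smalloD_tendsto)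
  have u0: "0 \<le> u n" for n using x0 by (simp add: u_def)
  have nr: "filterlim (\<lambda>n. real n) at_top sequentially" by (rule filterlim_real_sequentially)
  have npow: "(\<lambda>n. real n powr - c) \<longlonglongrightarrow> 0" if "0 < c" for c
    by (rule tendsto_neg_powr[OF _ nr]) (use that in auto)
  have n1: "\<forall>\<^sub>F n in sequentially. 1 \<le> n" by (rule eventually_ge_at_top)
  have na: "filterlim (\<lambda>n. real n powr \<alpha>) at_top sequentially"
  proof -
    have "\<forall>\<^sub>F n in sequentially. 0 < real n powr - \<alpha>" using n1 by eventually_elim simp
    from filterlim_inverse_at_top[OF npow[OF \<alpha>(1)] this] show ?thesis by (simp add: powr_minus)
  qed
  have mdef: "m n = nat \<lfloor>real n powr \<alpha>\<rfloor>" for n by (simp add: m_def \<alpha>_def)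
  have mb: "real (m n) \<le> real n powr \<alpha>" "real n powr \<alpha> - 1 \<le> real (m n)" for n
    unfolding mdef by (auto simp: of_nat_floor)
  have big: "\<forall>\<^sub>F n in sequentially. 2 \<le> real n powr \<alpha>" using na by (simp add: filterlim_at_top)
  have mh: "\<forall>\<^sub>F n in sequentially. real n powr \<alpha> / 2 \<le> real (m n) \<and> 1 \<le> m n \<and> m n \<le> n"
    using big n1
  proof eventually_elim
    case (elim n)
    have "real n powr \<alpha> / 2 \<le> real (m n)" using mb(2)[of n] elim by linarith
    moreover have "1 \<le> real (m n)" using mb(2)[of n] elim by linarith
    moreover have "real n powr \<alpha> \<le> real n powr 1" using \<alpha> elim by (intro powr_mono) auto
    then have "real (m n) \<le> real n" using mb(1)[of n] elim by simp
    ultimately show ?case by auto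
  qed
  have kb: "\<forall>\<^sub>F n in sequentially. 1 / real (n div m n) \<le> 2 * real n powr (\<alpha> - 1)"
    using mh n1
  proof eventually_elim
    case (elim n)
    have n0: "0 < real n" using elim by simp
    have "real n / (2 * real n powr \<alpha>) \<le> real n / (2 * real (m n))"
      using mb(1)[of n] elim by (intro divide_left_mono) auto
    also have "\<dots> \<le> real (n div m n)" using elim by (intro div_lower_bound) auto
    finally have "1 / real (n div m n) \<le> 1 / (real n / (2 * real n powr \<alpha>))"
      using n0 div_lower_bound(1)[of "m n" n] elim by (intro divide_left_mono mult_pos_pos) auto
    also have "\<dots> = 2 * real n powr (\<alpha> - 1)" using n0 by (simp add: powr_diff)
    finally show ?case .
  qed
  have m: "filterlim m at_top sequentially"
  proof -
    have "filterlim (\<lambda>n. real n powr \<alpha> * (1/2)) at_top sequentially"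
      by (rule filterlim_at_top_mult_tendsto_pos[OF tendsto_const _ na]) simp
    then have "filterlim (\<lambda>n. real (m n)) at_top sequentially"
      by (rule filterlim_at_top_mono) (use mh in \<open>auto elim!: eventually_mono\<close>)
    then show ?thesis by (rule filterlim_sequentially_iff_filterlim_real[THEN iffD2])
  qed
  have k: "filterlim (\<lambda>n. n div m n) at_top sequentially"
  proof -
    have t: "(\<lambda>n. 1 / real (n div m n)) \<longlonglongrightarrow> 0"
    proof (rule Lim_null_comparison)
      have "(\<lambda>n. real n powr (\<alpha> - 1)) \<longlonglongrightarrow> 0" using npow[of "1 - \<alpha>"] \<alpha> by simp
      then show "(\<lambda>n. 2 * real n powr (\<alpha> - 1)) \<longlonglongrightarrow> 0" by (rule tendsto_mult_right_zero)
    qed (use kb in \<open>auto elim!: eventually_mono\<close>)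
    have p: "\<forall>\<^sub>F n in sequentially. 0 < 1 / real (n div m n)"
      using mh
    proof eventually_elim
      case (elim n)
      then show ?case using div_lower_bound(1)[of "m n" n] by simp
    qed
    have "filterlim (\<lambda>n. real (n div m n)) at_top sequentially"
      using filterlim_inverse_at_top[OF t p] by simp
    then show ?thesis by (rule filterlim_sequentially_iff_filterlim_real[THEN iffD2])
  qed
  have mk: "(\<lambda>n. real (m n) / real (n div m n)) \<longlonglongrightarrow> 0"
  proof (rule Lim_null_comparison)
    have "(\<lambda>n. real n powr - (1 - 2 * \<alpha>)) \<longlonglongrightarrow> 0" by (rule npow) (use \<alpha> in simp)
    then show "(\<lambda>n. 2 * real n powr - (1 - 2 * \<alpha>)) \<longlonglongrightarrow> 0" by (rule tendsto_mult_right_zero)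
    show "\<forall>\<^sub>F n in sequentially. norm (real (m n) / real (n div m n)) \<le> 2 * real n powr - (1 - 2 * \<alpha>)"
      using kb
    proof eventually_elim
      case (elim n)
      have "real (m n) * (1 / real (n div m n)) \<le> real n powr \<alpha> * (2 * real n powr (\<alpha> - 1))"
        using mb(1) elim by (intro mult_mono) auto
      also have "\<dots> = 2 * real n powr - (1 - 2 * \<alpha>)" by (simp add: powr_add[symmetric])
      finally show ?case by simp
    qed
  qed
  have up: "(\<lambda>n. u n ^ p) \<longlonglongrightarrow> 0" if "0 < p" for p
    using tendsto_power[OF u, of p] that by (simp add: zero_power)
  have xu: "xs n = u n * real n powr b" if "1 \<le> n" for n using that by (simp add: u_def)
  have xp: "xs n ^ p = u n ^ p * real n powr (p * b)" if "1 \<le> n" for n p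
    unfolding xu[OF that] power_mult_distrib using that by (simp add: powr_realpow[symmetric] powr_powr mult.commute)
  have le1: "real n powr c \<le> 1" if "1 \<le> n" "c \<le> 0" for n c
    using powr_mono[of c 0 "real n"] that by simp
  show ?thesis
  proof (rule uniform_tail[OF m k mk _ _ _ e])
    show "(\<lambda>n. xs n ^ 6 / real (n div m n)) \<longlonglongrightarrow> 0"
    proof (rule Lim_null_comparison)
      show "(\<lambda>n. 2 * u n ^ 6) \<longlonglongrightarrow> 0" by (intro tendsto_mult_right_zero up) simp
      show "\<forall>\<^sub>F n in sequentially. norm (xs n ^ 6 / real (n div m n)) \<le> 2 * u n ^ 6"
        using kb n1
      proof eventually_elim
        case (elim n)
        have "xs n ^ 6 * (1 / real (n div m n)) \<le> xs n ^ 6 * (2 * real n powr (\<alpha> - 1))"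
          using elim x0 by (intro mult_left_mono) auto
        also have "\<dots> = 2 * u n ^ 6 * real n powr (6 * b + (\<alpha> - 1))"
          unfolding xp[OF elim(2)] by (simp add: powr_add[symmetric])
        also have "\<dots> \<le> 2 * u n ^ 6 * 1"
        proof (intro mult_left_mono le1[OF elim(2)])
          have "6 * b + (\<alpha> - 1) = - \<alpha>" using ba \<alpha>1 by (simp add: algebra_simps)
          then show "6 * b + (\<alpha> - 1) \<le> 0" using \<alpha> by simp
        qed (use u0 in auto)
        finally show ?case using x0 by simp
      qed
    qed
    show "(\<lambda>n. (xs n)\<^sup>2 * real (m n) powr (1 - \<beta>)) \<longlonglongrightarrow> 0"
    proof (rule Lim_null_comparison)
      show "(\<lambda>n. 2 powr (\<beta> - 1) * u n ^ 2) \<longlonglongrightarrow> 0" by (intro tendsto_mult_right_zero up) simp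
      show "\<forall>\<^sub>F n in sequentially. norm ((xs n)\<^sup>2 * real (m n) powr (1 - \<beta>)) \<le> 2 powr (\<beta> - 1) * u n ^ 2"
        using mh n1
      proof eventually_elim
        case (elim n)
        have "real (m n) powr (1 - \<beta>) \<le> (real n powr \<alpha> / 2) powr (1 - \<beta>)"
          using elim \<beta> by (intro powr_mono2') auto
        also have "\<dots> = real n powr (\<alpha> * (1 - \<beta>)) * 2 powr (\<beta> - 1)"
        proof -
          have "(2::real) powr (1 - \<beta>) = 1 / 2 powr (\<beta> - 1)"
            using powr_minus_divide[of 2 "\<beta> - 1"] by simp
          then show ?thesis by (simp add: powr_divide powr_powr)
        qed
        finally have "(xs n)\<^sup>2 * real (m n) powr (1 - \<beta>) \<le> (xs n)\<^sup>2 * (real n powr (\<alpha> * (1 - \<beta>)) * 2 powr (\<beta> - 1))"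
          by (intro mult_left_mono) auto
        also have "\<dots> = 2 powr (\<beta> - 1) * u n ^ 2 * real n powr (2 * b + \<alpha> * (1 - \<beta>))"
          unfolding xp[OF elim(2)] by (simp add: powr_add[symmetric])
        also have "2 * b + \<alpha> * (1 - \<beta>) = 0" using ba by (simp add: algebra_simps)
        finally show ?case using elim by simp
      qed
    qed
    show "(\<lambda>n. xs n ^ 3 * real (m n) / real (n div m n)) \<longlonglongrightarrow> 0"
    proof (rule Lim_null_comparison)
      show "(\<lambda>n. 2 * u n ^ 3) \<longlonglongrightarrow> 0" by (intro tendsto_mult_right_zero up) simp
      show "\<forall>\<^sub>F n in sequentially. norm (xs n ^ 3 * real (m n) / real (n div m n)) \<le> 2 * u n ^ 3"
        using kb n1
      proof eventually_elim
        case (elim n)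
        have "xs n ^ 3 * (real (m n) * (1 / real (n div m n))) \<le> xs n ^ 3 * (real n powr \<alpha> * (2 * real n powr (\<alpha> - 1)))"
          using elim mb(1) x0 by (intro mult_left_mono mult_mono) auto
        also have "\<dots> = 2 * u n ^ 3 * real n powr (3 * b + (\<alpha> + (\<alpha> - 1)))"
          unfolding xp[OF elim(2)] by (simp add: powr_add[symmetric])
        also have "\<dots> \<le> 2 * u n ^ 3 * 1"
        proof (intro mult_left_mono le1[OF elim(2)])
          have "3 * b + (\<alpha> + (\<alpha> - 1)) = 3/2 * (\<alpha> * (1 - \<beta>))" using ba \<alpha>1 by (simp add: algebra_simps)
          moreover have "\<alpha> * (1 - \<beta>) \<le> 0" using \<alpha> \<beta> by (intro mult_nonneg_nonpos) auto
          ultimately show "3 * b + (\<alpha> + (\<alpha> - 1)) \<le> 0" by simp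
        qed (use u0 in auto)
        finally show ?case using x0 by simp
      qed
    qed
  qed
qed

text \<open>The upper bound is Markov's inequality for exp U. The lower bound is Cramer's change of
  measure, carried out through moments alone: the moment at a tilt \<open>l\<close> above 1 is shown
  to come mainly from a bounded range of U, so that range must have the expected
  probability.\<close>

lemma mdp_tails:
  fixes m k :: "nat \<Rightarrow> nat" and x :: "nat \<Rightarrow> real"
  assumes m: "filterlim m at_top sequentially" and k1: "\<forall>\<^sub>F n in sequentially. 1 \<le> k n"
    and x: "filterlim x at_top sequentially" and xmk: "(\<lambda>n. (x n)\<^sup>2 * real (m n) / real (k n)) \<longlonglongrightarrow> 0" and e: "0 < e"
  shows "\<forall>\<^sub>F n in sequentially. prob {\<omega> \<in> space M. x n \<le> W (m n) (k n) \<omega>} \<le> exp (- (1/2 - e) * (x n)\<^sup>2) \<and>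
    exp (- (1/2 + e) * (x n)\<^sup>2) \<le> prob {\<omega> \<in> space M. x n \<le> W (m n) (k n) \<omega>}"
proof -
  \<comment> \<open>At most \<open>6 * \<epsilon>\<close> is lost in the exponents below, and
    \<open>\<epsilon> \<le> 1/4\<close> keeps the tilt \<open>l + \<epsilon>\<close> below
    2.\<close>
  define \<epsilon> where "\<epsilon> = min (e / 8) (1 / 4)"
  have \<epsilon>: "0 < \<epsilon>" "8 * \<epsilon> \<le> e" "\<epsilon> \<le> 1 / 4" using e unfolding \<epsilon>_def by (auto simp: min_def)
  have \<epsilon>2: "\<epsilon>\<^sup>2 \<le> \<epsilon> / 4" using mult_left_mono[OF \<epsilon>(3), of \<epsilon>] \<epsilon>(1) by (simp add: power2_eq_square)
  have Cf1: "1 \<le> Cf" by (simp add: Cf_def)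
  have L1: "1 \<le> L" by (rule L_ge)
  have m1: "\<forall>\<^sub>F n in sequentially. 1 \<le> m n" using m by (simp add: filterlim_at_top)
  have x1: "\<forall>\<^sub>F n in sequentially. 1 \<le> x n" using x by (simp add: filterlim_at_top)
  have mr: "filterlim (\<lambda>n. real (m n)) at_top sequentially"
    by (rule filterlim_compose[OF filterlim_real_sequentially m])
  have dl: "(\<lambda>n. del (m n)) \<longlonglongrightarrow> 0"
  proof -
    have "(\<lambda>n. real (m n) powr (1 - \<beta>)) \<longlonglongrightarrow> 0"
      by (rule tendsto_neg_powr[OF _ mr]) (use \<beta> in auto)
    then show ?thesis unfolding del_def by (rule tendsto_mult_right_zero)
  qed
  have em: "(\<lambda>n. err_sq (m n)) \<longlonglongrightarrow> 0"
    unfolding err_sq_def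
    by (intro tendsto_divide_0[OF tendsto_const] filterlim_at_top_imp_at_infinity filterlim_compose[OF sqrt_at_top mr])
  have x2k: "(\<lambda>n. (x n)\<^sup>2 / real (k n)) \<longlonglongrightarrow> 0"
  proof (rule Lim_null_comparison[OF _ xmk])
    show "\<forall>\<^sub>F n in sequentially. norm ((x n)\<^sup>2 / real (k n)) \<le> (x n)\<^sup>2 * real (m n) / real (k n)"
      using m1
    proof eventually_elim
      case (elim n)
      have "(x n)\<^sup>2 * 1 \<le> (x n)\<^sup>2 * real (m n)" using elim by (intro mult_left_mono) auto
      then show ?case by (simp add: divide_right_mono)
    qed
  qed
  have xk: "(\<lambda>n. x n / sqrt (k n)) \<longlonglongrightarrow> 0"
  proof -
    have "(\<lambda>n. sqrt ((x n)\<^sup>2 / real (k n))) \<longlonglongrightarrow> sqrt 0" by (rule tendsto_real_sqrt[OF x2k])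
    then have "(\<lambda>n. \<bar>x n / sqrt (k n)\<bar>) \<longlonglongrightarrow> 0" by (simp add: real_sqrt_divide)
    then show ?thesis by (rule tendsto_rabs_zero_cancel)
  qed
  have ee: "(\<lambda>n. err_sum (m n) (k n)) \<longlonglongrightarrow> 0"
  proof (rule Lim_null_comparison)
    show "(\<lambda>n. K * Z / sqrt s2 / sqrt (m n)) \<longlonglongrightarrow> 0"
      by (intro tendsto_divide_0[OF tendsto_const] filterlim_at_top_imp_at_infinity filterlim_compose[OF sqrt_at_top mr])
    show "\<forall>\<^sub>F n in sequentially. norm (err_sum (m n) (k n)) \<le> K * Z / sqrt s2 / sqrt (m n)"
      using m1 k1
    proof eventually_elim
      case (elim n)
      have "sqrt (s2 * m n) * 1 \<le> sqrt (s2 * m n) * sqrt (k n)" using elim s2_pos by (intro mult_left_mono) auto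
      then have "sqrt (s2 * m n) \<le> sqrt (s2 * (k n * m n))" by (simp add: real_sqrt_mult mult_ac)
      then have "err_sum (m n) (k n) \<le> K * Z / sqrt (s2 * m n)"
        unfolding err_sum_def using K_ge Z_ge s2_pos elim by (intro divide_left_mono mult_nonneg_nonneg mult_pos_pos) auto
      then show ?case using err_nonneg by (simp add: real_sqrt_mult)
    qed
  qed
  \<comment> \<open>Multiplied by \<open>(x n)\<^sup>2\<close>, this is the error
    \<open>400 * r0\<close> in the exponent of \<open>exp_mult_U_bounds\<close>; its convergence to
    0 makes that error negligible on the scale x^2.\<close>
  define q where "q = (\<lambda>n. 400 * (del (m n) + 130 * Cf * (x n / sqrt (k n))))"
  have q: "q \<longlonglongrightarrow> 0"
  proof -
    have "q \<longlonglongrightarrow> 400 * (0 + 130 * Cf * 0)" unfolding q_def by (intro tendsto_intros dl xk)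
    then show ?thesis by simp
  qed
  \<comment> \<open>The denominators are 9 times those in \<open>Q_deviation\<close>, so that the
    deviation probability becomes at most 2 exp (- 9 x^2), far below either bound to be
    proved.\<close>
  define B where "B = min (\<epsilon>\<^sup>2 / (144 * Cf)) (\<epsilon> * s2 / (36 * L\<^sup>2))"
  have B: "0 < B" unfolding B_def using \<epsilon> Cf1 L1 s2_pos by simp
  have xx: "filterlim (\<lambda>n. (x n)\<^sup>2) at_top sequentially" by (intro filterlim_pow_at_top x) simp
  have exlim: "\<forall>\<^sub>F n in sequentially. 4 \<le> exp (c * (x n)\<^sup>2)" if "0 < c" for c
  proof -
    have "filterlim (\<lambda>n. c * (x n)\<^sup>2) at_top sequentially"
      by (rule filterlim_tendsto_pos_mult_at_top[OF tendsto_const that xx])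
    from filterlim_compose[OF exp_at_top this] show ?thesis by (simp add: filterlim_at_top)
  qed
  have "\<forall>\<^sub>F n in sequentially. err_sum (m n) (k n) < \<epsilon> / 4" "\<forall>\<^sub>F n in sequentially. err_sq (m n) < \<epsilon> / 4"
    "\<forall>\<^sub>F n in sequentially. q n < \<epsilon>\<^sup>2 / 8" "\<forall>\<^sub>F n in sequentially. del (m n) < \<epsilon> / 2"
    "\<forall>\<^sub>F n in sequentially. (x n)\<^sup>2 * real (m n) / real (k n) < B" "\<forall>\<^sub>F n in sequentially. (x n)\<^sup>2 / real (k n) < 1"
    using order_tendstoD(2)[OF ee, of "\<epsilon> / 4"] order_tendstoD(2)[OF em, of "\<epsilon> / 4"] order_tendstoD(2)[OF q, of "\<epsilon>\<^sup>2 / 8"]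
      order_tendstoD(2)[OF dl, of "\<epsilon> / 2"] order_tendstoD(2)[OF xmk B] order_tendstoD(2)[OF x2k, of 1] \<epsilon> by auto
  then show ?thesis using m1 k1 x1 exlim[OF \<epsilon>(1)] exlim[of "\<epsilon>\<^sup>2 / 4", OF divide_pos_pos[OF zero_less_power[OF \<epsilon>(1)] zero_less_numeral]]
  proof eventually_elim
    case (elim n)
    define y where "y = x n"
    define X where "X = y\<^sup>2"
    define mm where "mm = m n"
    define kk where "kk = k n"
    have mk: "1 \<le> mm" "1 \<le> kk" using elim by (auto simp: mm_def kk_def)
    have y1: "1 \<le> y" using elim by (simp add: y_def)
    have X1: "1 \<le> X" using y1 by (simp add: X_def)
    have yX: "y \<le> X" using y1 by (simp add: X_def power2_eq_square)
    have small: "del mm \<le> 1" using elim(4) \<epsilon> by (simp add: mm_def)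
    interpret A: bounded_mds M "\<lambda>j. F (mm * j)" "\<xi> mm kk" kk "L * sqrt (mm / (s2 * kk))" "Del * real mm powr (1 - \<beta>)" Cf
      using bounded_mds_blocks mk small by (simp add: del_def)
    have [measurable]: "A.U y kk \<in> borel_measurable M" by simp
    have Xk: "X \<le> kk"
      using elim(6) mk by (simp add: X_def y_def kk_def divide_less_eq)
    have yk: "0 \<le> y" "y \<le> sqrt kk" using y1 Xk by (auto simp: X_def real_le_rsqrt)
    define R where "R = 400 * A.r0 y"
    have R: "0 \<le> R" "R \<le> \<epsilon>\<^sup>2 / 8 * X"
    proof -
      show "0 \<le> R" using A.r0_nonneg[OF yk(1)] by (simp add: R_def)
      have "R = q n * X"
        unfolding R_def A.r0_def
        by (simp add: q_def del_def X_def y_def mm_def kk_def power2_eq_square power3_eq_cube algebra_simps)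
      also have "\<dots> \<le> \<epsilon>\<^sup>2 / 8 * X" using elim(3) X1 by (intro mult_right_mono) auto
      finally show "R \<le> \<epsilon>\<^sup>2 / 8 * X" .
    qed
    have RX: "R \<le> \<epsilon> * X"
    proof -
      have "\<epsilon>\<^sup>2 / 8 * X \<le> \<epsilon> * X" using \<epsilon> \<epsilon>2 X1 by (intro mult_right_mono) auto
      then show ?thesis using R by linarith
    qed
    have Rk: "400 * A.r0 y \<le> kk"
    proof -
      have "\<epsilon> * X \<le> 1 * X" using \<epsilon> X1 by (intro mult_right_mono) auto
      then show ?thesis using RX Xk unfolding R_def by linarith
    qed
    define D where "D = prob {\<omega> \<in> space M. \<epsilon> \<le> \<bar>Q mm kk \<omega> - 1\<bar>}"
    have D: "D \<le> 2 * exp (- (9 * X))"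
    proof -
      have "D \<le> 2 * exp (- min (\<epsilon>\<^sup>2 * kk / (16 * Cf)) (\<epsilon> * s2 * kk / (4 * L\<^sup>2 * mm)))"
        unfolding D_def by (rule Q_deviation[OF mk(2,1) small \<epsilon>(1)]) (use elim(4) in \<open>simp add: mm_def\<close>)
      also have "\<dots> \<le> 2 * exp (- (9 * X))"
      proof -
        have Bk: "X * mm \<le> B * kk" using elim(5) mk by (simp add: X_def y_def mm_def kk_def divide_less_eq)
        have "X * 1 \<le> X * mm" using X1 mk by (intro mult_left_mono) auto
        also have "\<dots> \<le> B * kk" by (rule Bk)
        also have "\<dots> \<le> \<epsilon>\<^sup>2 / (144 * Cf) * kk" by (intro mult_right_mono) (auto simp: B_def)
        finally have "9 * X \<le> \<epsilon>\<^sup>2 * kk / (16 * Cf)" by simp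
        moreover have "9 * X \<le> \<epsilon> * s2 * kk / (4 * L\<^sup>2 * mm)"
        proof -
          have "X * mm \<le> \<epsilon> * s2 / (36 * L\<^sup>2) * kk"
            by (rule order.trans[OF Bk]) (intro mult_right_mono, auto simp: B_def)
          then have "9 * X * mm \<le> \<epsilon> * s2 * kk / (4 * L\<^sup>2)" by simp
          moreover have "0 < real mm" using mk by simp
          ultimately have "9 * X \<le> \<epsilon> * s2 * kk / (4 * L\<^sup>2) / mm" by (simp only: pos_le_divide_eq)
          then show ?thesis by (simp only: divide_divide_eq_left)
        qed
        ultimately show ?thesis by simp
      qed
      finally show ?thesis .
    qed
    define h1 where "h1 = y * err_sum mm kk + y\<^sup>2 * err_sq mm / 2"
    define h2 where "h2 = h1 + y\<^sup>2 * (\<epsilon> + err_sq mm)\<^sup>2 / 2"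
    have h: "h1 \<le> \<epsilon> * X" "h2 \<le> \<epsilon> * X"
    proof -
      have "y * err_sum mm kk \<le> X * (\<epsilon> / 4)" using yX y1 elim(1) err_nonneg by (intro mult_mono) (auto simp: mm_def kk_def)
      moreover have "y\<^sup>2 * err_sq mm \<le> X * (\<epsilon> / 4)" unfolding X_def using elim(2) by (intro mult_left_mono) (auto simp: mm_def)
      ultimately have h1: "h1 \<le> X * (3 * \<epsilon> / 8)" unfolding h1_def by (simp add: algebra_simps)
      have "(\<epsilon> + err_sq mm)\<^sup>2 \<le> (5/4 * \<epsilon>)\<^sup>2" using elim(2) \<epsilon> err_nonneg by (intro power_mono) (auto simp: mm_def)
      also have "\<dots> \<le> \<epsilon>" using \<epsilon>2 \<epsilon>(1) by (simp add: power2_eq_square)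
      finally have "X * (\<epsilon> + err_sq mm)\<^sup>2 \<le> X * \<epsilon>" using X1 by (intro mult_left_mono) auto
      then have "h2 \<le> X * (3 * \<epsilon> / 8) + X * \<epsilon> / 2" unfolding h2_def X_def[symmetric] using h1 by linarith
      then have h2: "h2 \<le> X * (7 / 8 * \<epsilon>)" by (simp add: algebra_simps)
      have "0 \<le> X * \<epsilon>" using X1 \<epsilon> by simp
      then show "h1 \<le> \<epsilon> * X" "h2 \<le> \<epsilon> * X" using h1 h2 by (simp_all add: algebra_simps)
    qed
    have U: "y * T mm kk \<omega> - y\<^sup>2 * Q mm kk \<omega> / 2 = A.U y kk \<omega>" for \<omega>
      using U_eq_TQ[OF mk(2,1) small] by simp
    define P where "P = prob {\<omega> \<in> space M. y \<le> W mm kk \<omega>}"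
    have "P \<le> exp (- (1/2 - e) * X)"
    proof -
      have "P \<le> prob {\<omega> \<in> space M. y\<^sup>2 / 2 - h2 \<le> A.U y kk \<omega>} + D"
        using W_tail_compare(2)[OF mk(2,1), of y \<epsilon>] y1 \<epsilon> unfolding U P_def D_def h1_def h2_def by simp
      also have "prob {\<omega> \<in> space M. y\<^sup>2 / 2 - h2 \<le> A.U y kk \<omega>} \<le> prob {\<omega> \<in> space M. exp ((1/2 - \<epsilon>) * X) \<le> exp (A.U y kk \<omega>)}"
      proof (rule finite_measure_mono)
        have "(1/2 - \<epsilon>) * X \<le> y\<^sup>2 / 2 - h2" using h(2) by (simp add: X_def algebra_simps)
        then show "{\<omega> \<in> space M. y\<^sup>2 / 2 - h2 \<le> A.U y kk \<omega>} \<subseteq> {\<omega> \<in> space M. exp ((1/2 - \<epsilon>) * X) \<le> exp (A.U y kk \<omega>)}"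
          by auto
      qed simp
      also have "\<dots> \<le> expectation (\<lambda>\<omega>. exp (A.U y kk \<omega>)) / exp ((1/2 - \<epsilon>) * X)"
      proof (rule integral_Markov_inequality_measure[where A="{}"])
        show "integrable M (\<lambda>\<omega>. exp (A.U y kk \<omega>))"
          by (rule integrable_AE_bound[where c="exp (kk / 2)"]) (use A.U_le[of y kk] in auto)
      qed auto
      also have "\<dots> \<le> exp (16 * A.r0 y) / exp ((1/2 - \<epsilon>) * X)"
        using A.exp_U_le[OF order.refl yk] by (intro divide_right_mono) auto
      also have "\<dots> \<le> exp (- (1/2 - 2 * \<epsilon>) * X)"
      proof -
        have "16 * A.r0 y \<le> \<epsilon> * X" using RX R(1) unfolding R_def by linarith
        then have "16 * A.r0 y - (1/2 - \<epsilon>) * X \<le> - (1/2 - 2 * \<epsilon>) * X" by (simp add: algebra_simps)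
        then show ?thesis by (simp flip: exp_diff)
      qed
      also have "D \<le> 2 * exp (- (1/2 - 2 * \<epsilon>) * X)"
      proof -
        have "(1/2 - 2 * \<epsilon>) * X \<le> 9 * X" using X1 \<epsilon> by (intro mult_right_mono) auto
        then have "exp (- (9 * X)) \<le> exp (- (1/2 - 2 * \<epsilon>) * X)" unfolding exp_le_cancel_iff by linarith
        then show ?thesis using D by linarith
      qed
      finally have "P \<le> 3 * exp (- (1/2 - 2 * \<epsilon>) * X)" by simp
      also have "\<dots> \<le> exp (\<epsilon> * X) * exp (- (1/2 - 2 * \<epsilon>) * X)"
        using elim(10) by (intro mult_right_mono) (auto simp: X_def y_def)
      also have "\<dots> = exp (- (1/2 - 3 * \<epsilon>) * X)" by (simp add: exp_add[symmetric] algebra_simps)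
      also have "\<dots> \<le> exp (- (1/2 - e) * X)"
      proof -
        have "3 * \<epsilon> * X \<le> e * X" using \<epsilon> X1 by (intro mult_right_mono) auto
        then show ?thesis by (simp add: algebra_simps)
      qed
      finally show ?thesis .
    qed
    moreover have "exp (- (1/2 + e) * X) \<le> P"
    proof -
      \<comment> \<open>With the moment exponent (l^2 - l) X / 2, tilting by \<open>l\<close> moves
        the mean of U to (l - 1/2) X = (1/2 + 2 \<epsilon>) X, the midpoint of \<open>c1\<close> and
        \<open>c3\<close>. Contributions outside these cutoffs are bounded by the moments at the
        neighbouring tilts.\<close>
      define l where "l = 1 + 2 * \<epsilon>"
      define c1 where "c1 = (1/2 + \<epsilon>) * X"
      define c3 where "c3 = (1/2 + 3 * \<epsilon>) * X"
      define G where "G = (l\<^sup>2 - l) / 2 * X"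
      define p where "p = prob {\<omega> \<in> space M. c1 \<le> A.U y kk \<omega>}"
      define S1 where "S1 = {\<omega> \<in> space M. c1 \<le> A.U y kk \<omega>}"
      have [measurable]: "S1 \<in> sets M" unfolding S1_def by measurable
      have int: "integrable M (\<lambda>\<omega>. exp (c * A.U y kk \<omega>))" if "0 \<le> c" for c
      proof (rule integrable_AE_bound)
        show "AE \<omega> in M. \<bar>exp (c * A.U y kk \<omega>)\<bar> \<le> exp (c * (kk / 2))"
          using mult_left_mono[OF A.U_le[of y kk] that] by auto
      qed simp
      have l: "0 \<le> l" "l \<le> 2" "0 \<le> l + \<epsilon>" "l + \<epsilon> \<le> 2" "0 \<le> l - \<epsilon>" "l - \<epsilon> \<le> 2" using \<epsilon> by (auto simp: l_def)
      have bounds: "exp (G - R) \<le> expectation (\<lambda>\<omega>. exp (l * A.U y kk \<omega>))"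
        "expectation (\<lambda>\<omega>. exp ((l + \<epsilon>) * A.U y kk \<omega>)) \<le> exp (((l + \<epsilon>)\<^sup>2 - (l + \<epsilon>)) / 2 * X + R)"
        "expectation (\<lambda>\<omega>. exp ((l - \<epsilon>) * A.U y kk \<omega>)) \<le> exp (((l - \<epsilon>)\<^sup>2 - (l - \<epsilon>)) / 2 * X + R)"
        using A.exp_mult_U_bounds(2)[OF l(1,2) yk Rk] A.exp_mult_U_bounds(1)[OF l(3,4) yk Rk] A.exp_mult_U_bounds(1)[OF l(5,6) yk Rk]
        by (simp_all add: G_def R_def X_def)
      have "expectation (\<lambda>\<omega>. exp (l * A.U y kk \<omega>))
        \<le> expectation (\<lambda>\<omega>. exp (l * c3) * indicator S1 \<omega> + exp (- \<epsilon> * c3) * exp ((l + \<epsilon>) * A.U y kk \<omega>) + exp (\<epsilon> * c1) * exp ((l - \<epsilon>) * A.U y kk \<omega>))"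
      proof (rule integral_mono[OF int[OF l(1)]])
        show "integrable M (\<lambda>\<omega>. exp (l * c3) * indicator S1 \<omega> + exp (- \<epsilon> * c3) * exp ((l + \<epsilon>) * A.U y kk \<omega>) + exp (\<epsilon> * c1) * exp ((l - \<epsilon>) * A.U y kk \<omega>))"
          by (intro Bochner_Integration.integrable_add integrable_mult_right int l integrable_real_indicator) (auto simp: emeasure_eq_measure)
        fix \<omega> assume w: "\<omega> \<in> space M"
        define u where "u = A.U y kk \<omega>"
        have pos: "0 \<le> exp (l * c3) * indicator S1 \<omega>" "0 \<le> exp (- \<epsilon> * c3) * exp ((l + \<epsilon>) * u)" "0 \<le> exp (\<epsilon> * c1) * exp ((l - \<epsilon>) * u)" by auto
        consider "u < c1" | "c1 \<le> u" "u \<le> c3" | "c3 < u" by linarith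
        then have "exp (l * u) \<le> exp (l * c3) * indicator S1 \<omega> + exp (- \<epsilon> * c3) * exp ((l + \<epsilon>) * u) + exp (\<epsilon> * c1) * exp ((l - \<epsilon>) * u)"
        proof cases
          case 1
          have "\<epsilon> * u \<le> \<epsilon> * c1" using 1 \<epsilon> by (intro mult_left_mono) auto
          then have "exp (l * u) \<le> exp (\<epsilon> * c1 + (l - \<epsilon>) * u)" by (simp add: algebra_simps)
          then show ?thesis using pos unfolding exp_add by linarith
        next
          case 2
          have "\<omega> \<in> S1" using 2 w by (simp add: S1_def u_def)
          moreover have "exp (l * u) \<le> exp (l * c3)" using 2 l by (simp add: mult_left_mono)
          ultimately have "exp (l * u) \<le> exp (l * c3) * indicator S1 \<omega>" by simp
          then show ?thesis using pos by linarith
        next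
          case 3
          have "\<epsilon> * c3 \<le> \<epsilon> * u" using 3 \<epsilon> by (intro mult_left_mono) auto
          then have "exp (l * u) \<le> exp (- \<epsilon> * c3 + (l + \<epsilon>) * u)" by (simp add: algebra_simps)
          then show ?thesis using pos unfolding exp_add by linarith
        qed
        then show "exp (l * A.U y kk \<omega>) \<le> exp (l * c3) * indicator S1 \<omega> + exp (- \<epsilon> * c3) * exp ((l + \<epsilon>) * A.U y kk \<omega>) + exp (\<epsilon> * c1) * exp ((l - \<epsilon>) * A.U y kk \<omega>)"
          by (simp add: u_def)
      qed
      also have "\<dots> = exp (l * c3) * p + exp (- \<epsilon> * c3) * expectation (\<lambda>\<omega>. exp ((l + \<epsilon>) * A.U y kk \<omega>)) + exp (\<epsilon> * c1) * expectation (\<lambda>\<omega>. exp ((l - \<epsilon>) * A.U y kk \<omega>))"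
      proof -
        have iS: "integrable M (indicator S1 :: 'a \<Rightarrow> real)"
          by (intro integrable_real_indicator) (auto simp: emeasure_eq_measure)
        have "expectation (indicator S1) = p" by (simp add: p_def S1_def)
        then show ?thesis
          by (simp only: Bochner_Integration.integral_add Bochner_Integration.integrable_add integrable_mult_right
              integral_mult_right_zero iS int[OF l(3)] int[OF l(5)])
      qed
      also have "\<dots> \<le> exp (l * c3) * p + exp (- \<epsilon> * c3) * exp (((l + \<epsilon>)\<^sup>2 - (l + \<epsilon>)) / 2 * X + R) + exp (\<epsilon> * c1) * exp (((l - \<epsilon>)\<^sup>2 - (l - \<epsilon>)) / 2 * X + R)"
        using bounds by (intro add_mono mult_left_mono) auto
      \<comment> \<open>A cutoff at distance \<epsilon> X from the tilted mean, met by a shift of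
        the tilt by \<epsilon>, gains \<open>\<epsilon>\<^sup>2 / 2 * X\<close>. This outweighs the
        two errors \<open>R\<close>, which together are at most
        \<open>\<epsilon>\<^sup>2 / 4 * X\<close>.\<close>
      also have "exp (- \<epsilon> * c3) * exp (((l + \<epsilon>)\<^sup>2 - (l + \<epsilon>)) / 2 * X + R) = exp (G + R - \<epsilon>\<^sup>2 / 2 * X)"
      proof -
        have "- \<epsilon> * c3 + (((l + \<epsilon>)\<^sup>2 - (l + \<epsilon>)) / 2 * X + R) = G + R - \<epsilon>\<^sup>2 / 2 * X"
          unfolding c3_def G_def l_def by (simp add: power2_eq_square field_simps)
        then show ?thesis by (simp only: exp_add[symmetric])
      qed
      also have "exp (\<epsilon> * c1) * exp (((l - \<epsilon>)\<^sup>2 - (l - \<epsilon>)) / 2 * X + R) = exp (G + R - \<epsilon>\<^sup>2 / 2 * X)"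
      proof -
        have "\<epsilon> * c1 + (((l - \<epsilon>)\<^sup>2 - (l - \<epsilon>)) / 2 * X + R) = G + R - \<epsilon>\<^sup>2 / 2 * X"
          unfolding c1_def G_def l_def by (simp add: power2_eq_square field_simps)
        then show ?thesis by (simp only: exp_add[symmetric])
      qed
      finally have main: "exp (G - R) \<le> exp (l * c3) * p + 2 * exp (G + R - \<epsilon>\<^sup>2 / 2 * X)" using bounds(1) by linarith
      define H where "H = exp (G - \<epsilon>\<^sup>2 / 8 * X)"
      have "H \<le> exp (G - R)" unfolding H_def using R by simp
      moreover have "4 * exp (G + R - \<epsilon>\<^sup>2 / 2 * X) \<le> H"
      proof -
        have "4 * exp (G + R - \<epsilon>\<^sup>2 / 2 * X) \<le> exp (\<epsilon>\<^sup>2 / 4 * X) * exp (G + R - \<epsilon>\<^sup>2 / 2 * X)"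
          using elim(11) by (intro mult_right_mono) (auto simp: X_def y_def)
        also have "\<dots> = exp (G + R - \<epsilon>\<^sup>2 / 4 * X)" by (simp add: exp_add[symmetric] field_simps)
        also have "\<dots> \<le> H" unfolding H_def using R(2) by (simp add: field_simps)
        finally show ?thesis .
      qed
      ultimately have "H / 2 \<le> exp (l * c3) * p" using main by linarith
      then have "exp (- (l * c3)) * (H / 2) \<le> exp (- (l * c3)) * (exp (l * c3) * p)" by (intro mult_left_mono) auto
      also have "exp (- (l * c3)) * (exp (l * c3) * p) = p" by (simp add: exp_minus)
      finally have "exp (- (l * c3)) * (H / 2) \<le> p" .
      moreover have "exp (- (1/2 + 5 * \<epsilon>) * X) \<le> exp (- (l * c3)) * H"
      proof -
        have "- (l * c3) + (G - \<epsilon>\<^sup>2 / 8 * X) = - (1/2 + 3 * \<epsilon> + 4 * \<epsilon>\<^sup>2 + \<epsilon>\<^sup>2 / 8) * X"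
          unfolding c3_def G_def l_def by (simp add: power2_eq_square field_simps)
        moreover have "(1/2 + 3 * \<epsilon> + 4 * \<epsilon>\<^sup>2 + \<epsilon>\<^sup>2 / 8) * X \<le> (1/2 + 5 * \<epsilon>) * X"
          using \<epsilon>2 \<epsilon> X1 by (intro mult_right_mono) auto
        ultimately have "- (1/2 + 5 * \<epsilon>) * X \<le> - (l * c3) + (G - \<epsilon>\<^sup>2 / 8 * X)" by linarith
        then show ?thesis unfolding H_def by (simp flip: exp_add)
      qed
      ultimately have p: "exp (- (1/2 + 5 * \<epsilon>) * X) / 2 \<le> p" by simp
      have "prob {\<omega> \<in> space M. y\<^sup>2 / 2 + h1 \<le> A.U y kk \<omega>} \<le> P + D"
        using W_tail_compare(1)[OF mk(2,1), of y \<epsilon>] y1 \<epsilon> unfolding U P_def D_def h1_def by simp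
      moreover have "p \<le> prob {\<omega> \<in> space M. y\<^sup>2 / 2 + h1 \<le> A.U y kk \<omega>}"
        unfolding p_def
      proof (rule finite_measure_mono)
        have "y\<^sup>2 / 2 + h1 \<le> c1" using h(1) by (simp add: c1_def X_def algebra_simps)
        then show "{\<omega> \<in> space M. c1 \<le> A.U y kk \<omega>} \<subseteq> {\<omega> \<in> space M. y\<^sup>2 / 2 + h1 \<le> A.U y kk \<omega>}" by auto
      qed simp
      moreover have "D \<le> exp (- (1/2 + 5 * \<epsilon>) * X) / 4"
      proof -
        have e7: "8 \<le> exp (7 * X)"
        proof -
          have "8 \<le> 1 + 7 * X" using X1 by simp
          also have "\<dots> \<le> exp (7 * X)" by (rule exp_ge_add_one_self)
          finally show ?thesis .
        qed
        have "8 * exp (- (9 * X)) \<le> exp (7 * X) * exp (- (9 * X))" using e7 by (intro mult_right_mono) auto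
        also have "\<dots> = exp (- 2 * X)" by (simp flip: exp_add)
        also have "\<dots> \<le> exp (- (1/2 + 5 * \<epsilon>) * X)"
        proof -
          have "(1/2 + 5 * \<epsilon>) * X \<le> 2 * X" using \<epsilon> X1 by (intro mult_right_mono) auto
          then show ?thesis unfolding exp_le_cancel_iff by linarith
        qed
        finally show ?thesis using D by linarith
      qed
      ultimately have "exp (- (1/2 + 5 * \<epsilon>) * X) / 4 \<le> P" using p by linarith
      moreover have "exp (- (1/2 + e) * X) \<le> exp (- (1/2 + 5 * \<epsilon>) * X) / 4"
      proof -
        have "4 * exp (- (1/2 + e) * X) \<le> exp (\<epsilon> * X) * exp (- (1/2 + e) * X)"
          using elim(10) by (intro mult_right_mono) (auto simp: X_def y_def)
        also have "\<dots> = exp (\<epsilon> * X - (1/2 + e) * X)" by (simp flip: exp_add add: algebra_simps)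
        also have "\<dots> \<le> exp (- (1/2 + 5 * \<epsilon>) * X)"
        proof -
          have "6 * \<epsilon> * X \<le> e * X" using \<epsilon> X1 by (intro mult_right_mono) auto
          then show ?thesis by (simp add: algebra_simps)
        qed
        finally show ?thesis by simp
      qed
      ultimately show ?thesis by linarith
    qed
    ultimately show ?case by (simp add: P_def X_def y_def mm_def kk_def)
  qed
qed

end

section \<open>From tail asymptotics to arbitrary Borel sets\<close>

lemma scaled_ext_ln_le:
  assumes "0 < a" "0 \<le> p" "p \<le> exp (c / a\<^sup>2)"
  shows "ereal (a\<^sup>2) * ext_ln p \<le> ereal c"
proof (cases "p = 0")
  case True
  then show ?thesis using assms by (simp add: ext_ln_def)
next
  case False
  then have p: "0 < p" using assms by simp
  have "ln p \<le> c / a\<^sup>2" using assms(3) p by (metis ln_exp ln_mono)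
  then have "a\<^sup>2 * ln p \<le> c" using assms(1) by (simp add: field_simps)
  then show ?thesis using p by (simp add: ext_ln_def)
qed

lemma scaled_ext_ln_ge:
  assumes "0 < a" "exp (c / a\<^sup>2) \<le> p"
  shows "ereal c \<le> ereal (a\<^sup>2) * ext_ln p"
proof -
  have p: "0 < p" using assms(2) exp_gt_zero less_le_trans by blast
  have "c / a\<^sup>2 \<le> ln p" using assms(2) p by (simp add: ln_ge_iff)
  then have "c \<le> a\<^sup>2 * ln p" using assms(1) by (simp add: field_simps)
  then show ?thesis using p by (simp add: ext_ln_def)
qed

text \<open>On the line, one-sided tails suffice because the rate grows with the distance from 0.
  Near an interior point x there is an interval on the side of x away from 0; its probability is a
  difference of two tails, the farther of which is exponentially smaller. For the upper bound the
  set lies outside a symmetric interval whose end points have the infimal rate, or a slightly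
  smaller one.\<close>

lemma (in prob_space) mdp_of_tails:
  fixes V :: "nat \<Rightarrow> 'a \<Rightarrow> real" and a :: "nat \<Rightarrow> real" and B :: "real set"
  assumes V [measurable]: "\<And>n. V n \<in> borel_measurable M" and a: "a \<longlonglongrightarrow> 0" and apos: "\<forall>\<^sub>F n in sequentially. 0 < a n"
    and tails: "\<And>sg y e. sg \<in> {1, -1} \<Longrightarrow> 0 < y \<Longrightarrow> 0 < e \<Longrightarrow> \<forall>\<^sub>F n in sequentially.
      prob {\<omega> \<in> space M. y \<le> sg * V n \<omega>} \<le> exp (- (y\<^sup>2 / 2 - e) / (a n)\<^sup>2) \<and>
      exp (- (y\<^sup>2 / 2 + e) / (a n)\<^sup>2) \<le> prob {\<omega> \<in> space M. y \<le> sg * V n \<omega>}"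
    and B [measurable]: "B \<in> sets borel"
  defines "Ls \<equiv> \<lambda>n. ereal ((a n)\<^sup>2) * ext_ln (prob {\<omega> \<in> space M. V n \<omega> \<in> B})"
  shows "- (INF x\<in>interior B. ereal (x\<^sup>2 / 2)) \<le> liminf Ls"
    and "limsup Ls \<le> - (INF x\<in>closure B. ereal (x\<^sup>2 / 2))"
proof -
  have exlim: "\<forall>\<^sub>F n in sequentially. 2 \<le> exp (c / (a n)\<^sup>2)" if "0 < c" for c
  proof -
    have "(\<lambda>n. (a n)\<^sup>2) \<longlonglongrightarrow> 0" using tendsto_power[OF a, of 2] by simp
    moreover have "\<forall>\<^sub>F n in sequentially. 0 < (a n)\<^sup>2" using apos by eventually_elim simp
    ultimately have "filterlim (\<lambda>n. inverse ((a n)\<^sup>2)) at_top sequentially" by (rule filterlim_inverse_at_top)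
    from filterlim_compose[OF exp_at_top filterlim_tendsto_pos_mult_at_top[OF tendsto_const that this]]
    show ?thesis by (simp add: filterlim_at_top divide_inverse)
  qed
  show "- (INF x\<in>interior B. ereal (x\<^sup>2 / 2)) \<le> liminf Ls"
  proof -
    have "- liminf Ls \<le> (INF x\<in>interior B. ereal (x\<^sup>2 / 2))"
    proof (rule INF_greatest)
      fix x assume "x \<in> interior B"
      then obtain d where d: "0 < d" "ball x d \<subseteq> B" by (auto simp: mem_interior)
      define sg where "sg = (if 0 \<le> x then 1 else -1 :: real)"
      have sg: "sg \<in> {1, -1}" "sg * sg = 1" "x = sg * \<bar>x\<bar>" by (auto simp: sg_def)
      have "ereal (- (x\<^sup>2 / 2)) \<le> liminf Ls"
      proof (rule ereal_le_epsilon2)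
        fix e :: real assume e: "0 < e"
        define \<eta> where "\<eta> = min (d / 2) (min 1 (e / (4 * (\<bar>x\<bar> + 1))))"
        have \<eta>: "0 < \<eta>" "\<eta> \<le> d / 2" "\<eta> \<le> 1" "\<eta> * (4 * (\<bar>x\<bar> + 1)) \<le> e"
        proof -
          have x1: "0 < 4 * (\<bar>x\<bar> + 1)" by (simp add: add_nonneg_pos)
          have "\<eta> \<le> e / (4 * (\<bar>x\<bar> + 1))" unfolding \<eta>_def by linarith
          then show "\<eta> * (4 * (\<bar>x\<bar> + 1)) \<le> e" using x1 by (simp only: pos_le_divide_eq)
          have "0 < e / (4 * (\<bar>x\<bar> + 1))" using e x1 by (rule divide_pos_pos)
          then show "0 < \<eta>" unfolding \<eta>_def using d by simp
          show "\<eta> \<le> d / 2" "\<eta> \<le> 1" unfolding \<eta>_def by linarith+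
        qed
        \<comment> \<open>The offset keeps the level positive even at \<open>x = 0\<close>, as the
          tail hypothesis demands, and raises the rate by at most \<open>e / 4\<close>.\<close>
        define y where "y = \<bar>x\<bar> + \<eta>"
        define z where "z = y + d / 4"
        have y: "0 < y" "y < z" using \<eta> d by (auto simp: y_def z_def)
        have y2: "y\<^sup>2 / 2 \<le> x\<^sup>2 / 2 + e / 4"
        proof -
          have "\<eta> * \<eta> \<le> \<eta> * 1" using \<eta> by (intro mult_left_mono) auto
          moreover have "y\<^sup>2 = x\<^sup>2 + 2 * (\<eta> * \<bar>x\<bar>) + \<eta> * \<eta>" by (simp add: y_def power2_eq_square algebra_simps)
          moreover have "\<eta> * (4 * (\<bar>x\<bar> + 1)) = 4 * (\<eta> * \<bar>x\<bar>) + 4 * \<eta>" by (simp add: algebra_simps)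
          ultimately show ?thesis using \<eta>(1,4) by linarith
        qed
        define g where "g = z\<^sup>2 / 2 - y\<^sup>2 / 2"
        have g: "0 < g" using y by (simp add: g_def power_strict_mono)
        define e1 where "e1 = min (e / 4) (g / 4)"
        have e1: "0 < e1" "e1 \<le> e / 4" "4 * e1 \<le> g" using e g by (auto simp: e1_def)
        have "\<forall>\<^sub>F n in sequentially. ereal (- (x\<^sup>2 / 2) - e) \<le> Ls n"
          using apos tails[OF sg(1) y(1) e1(1)] tails[OF sg(1) less_trans[OF y] e1(1)] exlim[OF e1(1)]
        proof eventually_elim
          case (elim n)
          define E where "E = exp (- (y\<^sup>2 / 2 + e1) / (a n)\<^sup>2)"
          have a2: "0 < (a n)\<^sup>2" using elim(1) by simp
          define Py where "Py = prob {\<omega> \<in> space M. y \<le> sg * V n \<omega>}"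
          define Pz where "Pz = prob {\<omega> \<in> space M. z \<le> sg * V n \<omega>}"
          define PB where "PB = prob {\<omega> \<in> space M. V n \<omega> \<in> B}"
          have "Py \<le> prob ({\<omega> \<in> space M. V n \<omega> \<in> B} \<union> {\<omega> \<in> space M. z \<le> sg * V n \<omega>})"
            unfolding Py_def
          proof (rule finite_measure_mono)
            show "{\<omega> \<in> space M. y \<le> sg * V n \<omega>} \<subseteq> {\<omega> \<in> space M. V n \<omega> \<in> B} \<union> {\<omega> \<in> space M. z \<le> sg * V n \<omega>}"
            proof
              fix \<omega> assume w: "\<omega> \<in> {\<omega> \<in> space M. y \<le> sg * V n \<omega>}"
              show "\<omega> \<in> {\<omega> \<in> space M. V n \<omega> \<in> B} \<union> {\<omega> \<in> space M. z \<le> sg * V n \<omega>}"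
              proof (cases "z \<le> sg * V n \<omega>")
                case False
                have "sg * (sg * V n \<omega>) = V n \<omega>" using sg(2) by (simp only: mult.assoc[symmetric] mult_1)
                then have "V n \<omega> - x = sg * (sg * V n \<omega> - \<bar>x\<bar>)" using sg(3) by (simp add: right_diff_distrib)
                then have "\<bar>V n \<omega> - x\<bar> = \<bar>sg * V n \<omega> - \<bar>x\<bar>\<bar>" using sg(1) by (auto simp: abs_mult)
                also have "\<dots> < d" using w False \<eta>(1,2) d(1) unfolding z_def y_def by auto
                finally have "V n \<omega> \<in> ball x d" by (simp add: dist_real_def abs_minus_commute)
                then show ?thesis using d(2) w by auto
              qed (use w in auto)
            qed
          qed simp
          also have "\<dots> \<le> PB + Pz" unfolding PB_def Pz_def by (rule measure_Un_le) auto
          finally have "Py - Pz \<le> PB" by simp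
          moreover have "E \<le> Py" using elim(2) by (simp add: E_def Py_def)
          moreover have "Pz \<le> E / 2"
          proof -
            have "2 * exp (- (z\<^sup>2 / 2 - e1) / (a n)\<^sup>2) \<le> exp (e1 / (a n)\<^sup>2) * exp (- (z\<^sup>2 / 2 - e1) / (a n)\<^sup>2)"
              using elim(4) by (intro mult_right_mono) auto
            also have "\<dots> = exp ((e1 - (z\<^sup>2 / 2 - e1)) / (a n)\<^sup>2)" by (simp add: exp_add[symmetric] diff_divide_distrib add_divide_distrib)
            also have "\<dots> \<le> E"
              unfolding E_def exp_le_cancel_iff using a2 e1 by (intro divide_right_mono) (auto simp: g_def)
            finally show ?thesis using elim(3) by (simp add: Pz_def)
          qed
          ultimately have "E / 2 \<le> PB" by linarith
          moreover have "exp ((- (x\<^sup>2 / 2) - e) / (a n)\<^sup>2) \<le> E / 2"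
          proof -
            have "2 * exp ((- (x\<^sup>2 / 2) - e) / (a n)\<^sup>2) \<le> exp (e1 / (a n)\<^sup>2) * exp ((- (x\<^sup>2 / 2) - e) / (a n)\<^sup>2)"
              using elim(4) by (intro mult_right_mono) auto
            also have "\<dots> = exp ((e1 + (- (x\<^sup>2 / 2) - e)) / (a n)\<^sup>2)" by (simp add: exp_add[symmetric] diff_divide_distrib add_divide_distrib)
            also have "\<dots> \<le> E"
              unfolding E_def exp_le_cancel_iff using a2 e1 e y2 by (intro divide_right_mono) auto
            finally show ?thesis by simp
          qed
          ultimately show ?case unfolding Ls_def PB_def using elim(1) by (intro scaled_ext_ln_ge) auto
        qed
        then have "ereal (- (x\<^sup>2 / 2) - e) \<le> liminf Ls" by (rule Liminf_bounded)
        then have "ereal (- (x\<^sup>2 / 2) - e) + ereal e \<le> liminf Ls + ereal e" by (rule add_right_mono)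
        then show "ereal (- (x\<^sup>2 / 2)) \<le> liminf Ls + ereal e" by simp
      qed
      then have "- ereal (x\<^sup>2 / 2) \<le> liminf Ls" by simp
      then show "- liminf Ls \<le> ereal (x\<^sup>2 / 2)" by (subst ereal_uminus_le_reorder)
    qed
    then show ?thesis by (subst ereal_uminus_le_reorder)
  qed
  show "limsup Ls \<le> - (INF x\<in>closure B. ereal (x\<^sup>2 / 2))"
  \<comment> \<open>Comparing with every real upper bound also covers the infinite infimum over an
    empty closure. For nonnegative \<open>r\<close> it is enough that logarithms of probabilities
    are at most 0.\<close>
  proof (rule ereal_le_real)
    fix r assume r: "- (INF x\<in>closure B. ereal (x\<^sup>2 / 2)) \<le> ereal r"
    show "limsup Ls \<le> ereal r"
    proof (cases "0 \<le> r")
      case True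
      have "\<forall>\<^sub>F n in sequentially. Ls n \<le> ereal 0"
        using apos by eventually_elim (auto simp: Ls_def intro!: scaled_ext_ln_le[of _ _ 0, simplified])
      then have "limsup Ls \<le> ereal 0" by (rule Limsup_bounded)
      also have "ereal 0 \<le> ereal r" using True by simp
      finally show ?thesis .
    next
      case False
      define y where "y = sqrt (- 2 * r)"
      have y: "0 < y" "y\<^sup>2 / 2 = - r" using False by (auto simp: y_def)
      have Bsub: "y \<le> v \<or> y \<le> - v" if "v \<in> B" for v
      proof -
        have "(INF x\<in>closure B. ereal (x\<^sup>2 / 2)) \<le> ereal (v\<^sup>2 / 2)"
          using that closure_subset by (intro INF_lower) auto
        moreover have "- ereal r \<le> (INF x\<in>closure B. ereal (x\<^sup>2 / 2))"
          using r by (subst ereal_uminus_le_reorder)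
        ultimately have "- ereal r \<le> ereal (v\<^sup>2 / 2)" by (rule order.trans[rotated])
        then have "y\<^sup>2 \<le> \<bar>v\<bar>\<^sup>2" using y(2) by simp
        then have "y \<le> \<bar>v\<bar>" by (rule power2_le_imp_le) simp
        then show ?thesis by auto
      qed
      show ?thesis
      proof (rule ereal_le_epsilon2)
        fix e :: real assume e: "0 < e"
        then have e2: "0 < e / 2" by simp
        have "\<forall>\<^sub>F n in sequentially. Ls n \<le> ereal (r + e)"
          using apos tails[of 1, OF _ y(1) e2, simplified] tails[of "-1", OF _ y(1) e2, simplified] exlim[OF e2]
        proof eventually_elim
          case (elim n)
          have "prob {\<omega> \<in> space M. V n \<omega> \<in> B} \<le> prob ({\<omega> \<in> space M. y \<le> V n \<omega>} \<union> {\<omega> \<in> space M. y \<le> - V n \<omega>})"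
            by (rule finite_measure_mono) (use Bsub in auto)
          also have "\<dots> \<le> prob {\<omega> \<in> space M. y \<le> V n \<omega>} + prob {\<omega> \<in> space M. y \<le> - V n \<omega>}"
            by (rule measure_Un_le) auto
          also have "\<dots> \<le> 2 * exp ((r + e / 2) / (a n)\<^sup>2)"
          proof -
            have eq: "- (y\<^sup>2 / 2 - e / 2) = r + e / 2" using y(2) by simp
            have "prob {\<omega> \<in> space M. y \<le> V n \<omega>} \<le> exp (- (y\<^sup>2 / 2 - e / 2) / (a n)\<^sup>2)"
              "prob {\<omega> \<in> space M. y \<le> - V n \<omega>} \<le> exp (- (y\<^sup>2 / 2 - e / 2) / (a n)\<^sup>2)"
              using elim(2,3) by auto
            then show ?thesis unfolding eq by linarith
          qed
          also have "\<dots> \<le> exp (e / 2 / (a n)\<^sup>2) * exp ((r + e / 2) / (a n)\<^sup>2)"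
            using elim(4) by (intro mult_right_mono) auto
          also have "\<dots> = exp ((r + e) / (a n)\<^sup>2)" by (simp add: exp_add[symmetric] add_divide_distrib)
          finally show ?case unfolding Ls_def using elim(1) by (intro scaled_ext_ln_le) auto
        qed
        then have "limsup Ls \<le> ereal (r + e)" by (rule Limsup_bounded)
        then show "limsup Ls \<le> ereal r + ereal e" by simp
      qed
    qed
  qed
qed

context mixing_process
begin

text \<open>The tail estimates are applied at level \<open>y / a n\<close>. As the number of blocks
  is at least n / (2 m), their smallness condition is bounded by a multiple of the inverse square of
  the sequence assumed to diverge. That divergence also makes \<open>a n\<close> eventually
  positive.\<close>

lemma mdp_W:
  fixes m :: "nat \<Rightarrow> nat" and a :: "nat \<Rightarrow> real"
  assumes mn: "\<And>n. 1 \<le> n \<Longrightarrow> 1 \<le> m n \<and> m n \<le> n" and m: "filterlim m at_top sequentially"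
    and a: "a \<longlonglongrightarrow> 0" and am: "filterlim (\<lambda>n. a n * sqrt (real n) / real (m n)) at_top sequentially"
  shows "\<forall>\<^sub>F n in sequentially. 0 < a n"
    and "0 < y \<Longrightarrow> 0 < e \<Longrightarrow> \<forall>\<^sub>F n in sequentially.
      prob {\<omega> \<in> space M. y \<le> a n * W (m n) (n div m n) \<omega>} \<le> exp (- (y\<^sup>2 / 2 - e) / (a n)\<^sup>2) \<and>
      exp (- (y\<^sup>2 / 2 + e) / (a n)\<^sup>2) \<le> prob {\<omega> \<in> space M. y \<le> a n * W (m n) (n div m n) \<omega>}"
proof -
  have n1: "\<forall>\<^sub>F n in sequentially. 1 \<le> n" by (rule eventually_ge_at_top)
  have "\<forall>\<^sub>F n in sequentially. 0 < a n * sqrt (real n) / real (m n)"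
    using am by (simp add: filterlim_at_top_dense)
  then show apos: "\<forall>\<^sub>F n in sequentially. 0 < a n"
    using n1
  proof eventually_elim
    case (elim n)
    then show ?case using mn[of n] by (simp add: zero_less_divide_iff zero_less_mult_iff)
  qed
  assume y: "0 < y" and e: "0 < e"
  define x where "x = (\<lambda>n. y / a n)"
  have xlim: "filterlim x at_top sequentially"
    using filterlim_tendsto_pos_mult_at_top[OF tendsto_const y filterlim_inverse_at_top[OF a apos]]
    by (simp add: x_def divide_inverse)
  have k1: "\<forall>\<^sub>F n in sequentially. 1 \<le> n div m n"
    using n1
  proof eventually_elim
    case (elim n)
    then show ?case using mn[OF elim] by (intro div_lower_bound) auto
  qed
  have inv: "(\<lambda>n. inverse (a n * sqrt (real n) / real (m n))) \<longlonglongrightarrow> 0"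
    by (rule tendsto_inverse_0_at_top[OF am])
  have "(\<lambda>n. 2 * y\<^sup>2 * (inverse (a n * sqrt (real n) / real (m n)))\<^sup>2) \<longlonglongrightarrow> 2 * y\<^sup>2 * 0\<^sup>2"
    by (intro tendsto_intros inv)
  then have lim: "(\<lambda>n. 2 * y\<^sup>2 * (inverse (a n * sqrt (real n) / real (m n)))\<^sup>2) \<longlonglongrightarrow> 0" by simp
  have xmk: "(\<lambda>n. (x n)\<^sup>2 * real (m n) / real (n div m n)) \<longlonglongrightarrow> 0"
  proof (rule Lim_null_comparison[OF _ lim])
    show "\<forall>\<^sub>F n in sequentially. norm ((x n)\<^sup>2 * real (m n) / real (n div m n)) \<le> 2 * y\<^sup>2 * (inverse (a n * sqrt (real n) / real (m n)))\<^sup>2"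
      using n1 apos
    proof eventually_elim
      case (elim n)
      have mm: "1 \<le> m n" "m n \<le> n" using mn[OF elim(1)] by auto
      have n0: "0 < real n" "0 < real (m n)" using mm elim by auto
      have "(x n)\<^sup>2 * real (m n) / real (n div m n) \<le> (x n)\<^sup>2 * real (m n) / (real n / (2 * real (m n)))"
        using div_lower_bound[OF mm] n0 by (intro divide_left_mono mult_pos_pos) auto
      also have "\<dots> = 2 * y\<^sup>2 * (inverse (a n * sqrt (real n) / real (m n)))\<^sup>2"
      proof -
        have s: "(sqrt (real n))\<^sup>2 = real n" by simp
        have eq: "(inverse (a n * sqrt (real n) / real (m n)))\<^sup>2 = (real (m n))\<^sup>2 / ((a n)\<^sup>2 * real n)"
          by (simp add: power_mult_distrib power_divide power_inverse s)
        show ?thesis unfolding eq using n0 by (simp add: x_def power_divide power2_eq_square)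
      qed
      finally show ?case by simp
    qed
  qed
  have e': "0 < e / y\<^sup>2" using e y by simp
  show "\<forall>\<^sub>F n in sequentially.
      prob {\<omega> \<in> space M. y \<le> a n * W (m n) (n div m n) \<omega>} \<le> exp (- (y\<^sup>2 / 2 - e) / (a n)\<^sup>2) \<and>
      exp (- (y\<^sup>2 / 2 + e) / (a n)\<^sup>2) \<le> prob {\<omega> \<in> space M. y \<le> a n * W (m n) (n div m n) \<omega>}"
    using mdp_tails[OF m k1 xlim xmk e'] apos
  proof eventually_elim
    case (elim n)
    have "y \<le> a n * w \<longleftrightarrow> x n \<le> w" for w using elim(2) by (simp add: x_def pos_divide_le_eq mult.commute)
    moreover have "- (1/2 - e / y\<^sup>2) * (x n)\<^sup>2 = - (y\<^sup>2 / 2 - e) / (a n)\<^sup>2" "- (1/2 + e / y\<^sup>2) * (x n)\<^sup>2 = - (y\<^sup>2 / 2 + e) / (a n)\<^sup>2"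
      using y elim(2) by (auto simp: x_def power_divide field_simps)
    ultimately show ?case using elim(1) by (simp only:)
  qed
qed

text \<open>Changing the sign of the variables changes the sign of the self-normalised sum, so lower
  tails follow from upper tails.\<close>

lemma mixing_process_uminus: "mixing_process M F (\<lambda>t \<omega>. - X t \<omega>) \<gamma> K \<beta> s2"
proof
  show "subalgebra M (F t)" for t by (rule subalg)
  show "s \<le> t \<Longrightarrow> sets (F s) \<subseteq> sets (F t)" for s t by (rule filtration)
  show "(\<lambda>\<omega>. - X t \<omega>) \<in> borel_measurable (F t)" for t using adapted[of t] by simp
  show "1 \<le> K" by (rule K_ge)
  show "AE \<omega> in M. \<bar>- X t \<omega>\<bar> \<le> K" for t using bounded[of t] by simp
  show "1 < \<beta>" "\<beta> \<le> 3 / 2" by (rule \<beta>)+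
  show "\<bar>expectation (\<lambda>\<omega>. G \<omega> * - X (t + l) \<omega>)\<bar> \<le> K * real l powr - \<beta> * expectation (\<lambda>\<omega>. \<bar>G \<omega>\<bar>)"
    if "1 \<le> l" "G \<in> borel_measurable (F t)" "AE \<omega> in M. \<bar>G \<omega>\<bar> \<le> c" for t l G c
    using mix1[OF that] by simp
  show "\<bar>expectation (\<lambda>\<omega>. G \<omega> * (- X (t + i) \<omega> * - X (t + l) \<omega> - \<gamma> (l - i)))\<bar> \<le> K * real i powr - \<beta> * expectation (\<lambda>\<omega>. \<bar>G \<omega>\<bar>)"
    if "1 \<le> i" "i \<le> l" "G \<in> borel_measurable (F t)" "AE \<omega> in M. \<bar>G \<omega>\<bar> \<le> c" for t i l G c
    using mix2[OF that] by simp
  show "expectation (\<lambda>\<omega>. - X s \<omega> * - X (s + d) \<omega>) = \<gamma> d" for s d using cov[of s d] by simp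
  show "(\<lambda>d. \<gamma> (Suc d)) sums ((s2 - \<gamma> 0) / 2)" by (rule sigma)
  show "0 < s2" by (rule s2_pos)
qed

lemma mdp_W_set:
  fixes m :: "nat \<Rightarrow> nat" and a :: "nat \<Rightarrow> real" and B :: "real set"
  assumes mn: "\<And>n. 1 \<le> n \<Longrightarrow> 1 \<le> m n \<and> m n \<le> n" and m: "filterlim m at_top sequentially"
    and a: "a \<longlonglongrightarrow> 0" and am: "filterlim (\<lambda>n. a n * sqrt (real n) / real (m n)) at_top sequentially"
    and B: "B \<in> sets borel"
  defines "Ls \<equiv> \<lambda>n. ereal ((a n)\<^sup>2) * ext_ln (prob {\<omega> \<in> space M. a n * W (m n) (n div m n) \<omega> \<in> B})"
  shows "- (INF x\<in>interior B. ereal (x\<^sup>2 / 2)) \<le> liminf Ls"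
    and "limsup Ls \<le> - (INF x\<in>closure B. ereal (x\<^sup>2 / 2))"
proof -
  interpret N: mixing_process M F "\<lambda>t \<omega>. - X t \<omega>" \<gamma> K \<beta> s2 by (rule mixing_process_uminus)
  have NW: "N.W p q \<omega> = - W p q \<omega>" for p q \<omega>
    by (simp add: N.W_def W_def N.S_def S_def N.Vsq_def Vsq_def N.block_part_def block_part_def sum_negf)
  have tails: "\<forall>\<^sub>F n in sequentially.
      prob {\<omega> \<in> space M. y \<le> sg * (a n * W (m n) (n div m n) \<omega>)} \<le> exp (- (y\<^sup>2 / 2 - e) / (a n)\<^sup>2) \<and>
      exp (- (y\<^sup>2 / 2 + e) / (a n)\<^sup>2) \<le> prob {\<omega> \<in> space M. y \<le> sg * (a n * W (m n) (n div m n) \<omega>)}"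
    if "sg \<in> {1, -1}" "0 < y" "0 < e" for sg y e :: real
    using mdp_W(2)[OF mn m a am that(2,3)] N.mdp_W(2)[OF mn m a am that(2,3)] that(1) by (auto simp: NW)
  have V: "(\<lambda>\<omega>. a n * W (m n) (n div m n) \<omega>) \<in> borel_measurable M" for n by measurable
  show "- (INF x\<in>interior B. ereal (x\<^sup>2 / 2)) \<le> liminf Ls" "limsup Ls \<le> - (INF x\<in>closure B. ereal (x\<^sup>2 / 2))"
    unfolding Ls_def using mdp_of_tails[OF V a mdp_W(1)[OF mn m a am] tails B] by auto
qed

end

section \<open>Stationary sequences\<close>

locale adapted_stationary = prob_space M for M :: "'a measure" +
  fixes F0 :: "'a measure" and T :: "'a \<Rightarrow> 'a" and X0 :: "'a \<Rightarrow> real"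
  assumes aut: "automorphism M T" and sub: "subalgebra M F0"
    and incr: "sets F0 \<subseteq> sets (shifted_field M T F0 1)"
    and X0_measurable: "X0 \<in> borel_measurable F0"
begin

lemma iterate_nat: "iterate M T (int t) = T ^^ t"
  by (simp add: iterate_def)

lemma space_F0: "space F0 = space M" using sub by (simp add: subalgebra_def)

lemma pow_measurable [measurable]: "T ^^ t \<in> measurable M M"
  using aut unfolding automorphism_def by (intro measurable_compose_n) auto

lemma pow_distr: "distr M M (T ^^ t) = M"
proof (induction t)
  case 0
  then show ?case by (simp add: distr_id2 id_def)
next
  case (Suc t)
  have T: "T \<in> measurable M M" "distr M M T = M" using aut by (auto simp: automorphism_def)
  have "distr M M (T ^^ Suc t) = distr (distr M M (T ^^ t)) M T"
    unfolding distr_distr[OF T(1) pow_measurable] by simp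
  then show ?case unfolding Suc T(2) .
qed

lemma pow_bij: "bij_betw (T ^^ t) (space M) (space M)"
  using aut unfolding automorphism_def by (intro bij_betw_funpow) auto

lemma pow_space: "\<omega> \<in> space M \<Longrightarrow> (T ^^ t) \<omega> \<in> space M"
  using pow_bij bij_betwE by blast

lemma integral_shift:
  fixes h :: "'a \<Rightarrow> real"
  assumes "h \<in> borel_measurable M"
  shows "expectation (\<lambda>\<omega>. h ((T ^^ t) \<omega>)) = expectation h"
  using integral_distr[OF pow_measurable assms, of t] by (simp add: pow_distr)

lemma AE_shift:
  assumes "AE \<omega> in M. P \<omega>"
  shows "AE \<omega> in M. P ((T ^^ t) \<omega>)"
proof -
  have "AE \<omega> in distr M M (T ^^ t). P \<omega>" unfolding pow_distr by (rule assms)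
  then show ?thesis by (rule AE_distrD[OF pow_measurable])
qed

lemma sets_shifted: "sets (shifted_field M T F0 (int t)) = {(T ^^ t) -` A \<inter> space M | A. A \<in> sets F0}"
  unfolding shifted_field_def iterate_nat by (rule sets_vimage_algebra2) (auto simp: space_F0 pow_space)

lemma shifted_subalgebra: "subalgebra M (shifted_field M T F0 (int t))"
proof -
  have "(T ^^ t) -` A \<inter> space M \<in> sets M" if "A \<in> sets F0" for A
    using that sub by (intro measurable_sets[OF pow_measurable]) (auto simp: subalgebra_def)
  moreover have "space (shifted_field M T F0 (int t)) = space M" by (simp add: shifted_field_def)
  ultimately show ?thesis unfolding subalgebra_def sets_shifted by auto
qed

lemma shifted_mono:
  assumes "s \<le> t"
  shows "sets (shifted_field M T F0 (int s)) \<subseteq> sets (shifted_field M T F0 (int t))"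
proof -
  have "sets (shifted_field M T F0 (int n)) \<subseteq> sets (shifted_field M T F0 (int (Suc n)))" for n
  proof
    fix S assume "S \<in> sets (shifted_field M T F0 (int n))"
    then obtain A where A: "A \<in> sets F0" "S = (T ^^ n) -` A \<inter> space M" by (auto simp: sets_shifted)
    have "A \<in> sets (shifted_field M T F0 (int 1))" using incr A by auto
    then obtain A' where A': "A' \<in> sets F0" "A = (T ^^ 1) -` A' \<inter> space M" unfolding sets_shifted by auto
    have "S = (T ^^ Suc n) -` A' \<inter> space M" using A'(2) A(2) pow_space by auto
    then show "S \<in> sets (shifted_field M T F0 (int (Suc n)))" unfolding sets_shifted using A' by blast
  qed
  then show ?thesis using assms by (rule lift_Suc_mono_le)
qed

text \<open>The t-th power of \<open>T\<close> is a bijection of the space, so \<open>G\<close> can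
  be composed with its inverse. The result is measurable because each preimage under
  \<open>G\<close> is the preimage of some set of \<open>F0\<close> under that power, and this set
  is recovered exactly by bijectivity.\<close>

lemma shifted_factor:
  fixes G :: "'a \<Rightarrow> real"
  assumes G: "G \<in> borel_measurable (shifted_field M T F0 (int t))"
  obtains G' where "G' \<in> borel_measurable F0" "\<And>\<omega>. \<omega> \<in> space M \<Longrightarrow> G \<omega> = G' ((T ^^ t) \<omega>)"
proof
  define g where "g = the_inv_into (space M) (T ^^ t)"
  have inj: "inj_on (T ^^ t) (space M)" and im: "(T ^^ t) ` space M = space M"
    using pow_bij[of t] by (auto simp: bij_betw_def)
  have gT: "g ((T ^^ t) \<omega>) = \<omega>" if "\<omega> \<in> space M" for \<omega>
    unfolding g_def by (rule the_inv_into_f_f[OF inj that])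
  have Tg: "(T ^^ t) (g \<omega>) = \<omega>" "g \<omega> \<in> space M" if "\<omega> \<in> space M" for \<omega>
    unfolding g_def using f_the_inv_into_f[OF inj, of \<omega>] the_inv_into_into[OF inj, of \<omega> "space M"] that im by auto
  show "G \<omega> = G (g ((T ^^ t) \<omega>))" if "\<omega> \<in> space M" for \<omega> using gT[OF that] by simp
  show "(\<lambda>\<omega>. G (g \<omega>)) \<in> borel_measurable F0"
  proof (rule measurableI)
    fix A :: "real set" assume A: "A \<in> sets borel"
    have "G -` A \<inter> space M \<in> sets (shifted_field M T F0 (int t))"
      using measurable_sets[OF G A] by (simp add: shifted_field_def)
    then obtain B where B: "B \<in> sets F0" "G -` A \<inter> space M = (T ^^ t) -` B \<inter> space M" by (auto simp: sets_shifted)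
    have "(\<lambda>\<omega>. G (g \<omega>)) -` A \<inter> space F0 = B"
    proof (intro equalityI subsetI)
      fix \<omega> assume "\<omega> \<in> (\<lambda>\<omega>. G (g \<omega>)) -` A \<inter> space F0"
      then have w: "\<omega> \<in> space M" "G (g \<omega>) \<in> A" by (auto simp: space_F0)
      then have "g \<omega> \<in> G -` A \<inter> space M" using Tg by auto
      then have "(T ^^ t) (g \<omega>) \<in> B" using B(2) by auto
      then show "\<omega> \<in> B" using Tg w by simp
    next
      fix \<omega> assume wB: "\<omega> \<in> B"
      then have w: "\<omega> \<in> space M" using sets.sets_into_space[OF B(1)] space_F0 by auto
      then have "g \<omega> \<in> (T ^^ t) -` B \<inter> space M" using Tg[OF w] wB by auto
      then have "G (g \<omega>) \<in> A" using B(2) by auto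
      then show "\<omega> \<in> (\<lambda>\<omega>. G (g \<omega>)) -` A \<inter> space F0" using w by (simp add: space_F0)
    qed
    then show "(\<lambda>\<omega>. G (g \<omega>)) -` A \<inter> space F0 \<in> sets F0" using B(1) by simp
  qed simp
qed

abbreviation Xs :: "int \<Rightarrow> 'a \<Rightarrow> real" where "Xs \<equiv> shifted_var M T X0"

lemma Xs_nat: "Xs (int t) \<omega> = X0 ((T ^^ t) \<omega>)"
  by (simp add: shifted_var_def iterate_nat)

lemma Xs_shift: "Xs (int (t + l)) \<omega> = Xs (int l) ((T ^^ t) \<omega>)"
  unfolding Xs_nat by (simp add: add.commute[of t] funpow_add)

lemma X0_M [measurable]: "X0 \<in> borel_measurable M"
  using X0_measurable sub measurable_from_subalg by blast

lemma Xs_measurable [measurable]: "Xs (int t) \<in> borel_measurable M"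
  unfolding shifted_var_def iterate_nat comp_def by measurable

lemma Xs_adapted: "Xs (int t) \<in> borel_measurable (shifted_field M T F0 (int t))"
  unfolding shifted_var_def shifted_field_def iterate_nat comp_def
  by (rule measurable_compose[OF measurable_vimage_algebra1 X0_measurable]) (auto simp: space_F0 pow_space)

lemma cond_exp_bounded:
  assumes Y: "Y \<in> borel_measurable M" "AE \<omega> in M. \<bar>Y \<omega>\<bar> \<le> c"
  shows "AE \<omega> in M. \<bar>real_cond_exp M F0 Y \<omega>\<bar> \<le> c"
proof -
  interpret finite_measure_subalgebra M F0 by unfold_locales (rule sub)
  have iY: "integrable M Y" by (rule integrable_AE_bound[OF Y])
  show ?thesis
  proof (rule AE_abs_le_of_test[OF sub])
    show "real_cond_exp M F0 Y \<in> borel_measurable F0" by simp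
    show "integrable M (real_cond_exp M F0 Y)" by (rule real_cond_exp_int(1)[OF iY])
    fix G :: "'a \<Rightarrow> real" assume G: "G \<in> borel_measurable F0" and G1: "\<And>\<omega>. \<bar>G \<omega>\<bar> \<le> 1"
    have [measurable]: "G \<in> borel_measurable M" "Y \<in> borel_measurable M" using G sub measurable_from_subalg Y by blast+
    have GY: "AE \<omega> in M. \<bar>G \<omega> * Y \<omega>\<bar> \<le> c * \<bar>G \<omega>\<bar>"
      using Y(2) by eventually_elim (auto simp: abs_mult mult.commute[of c] intro!: mult_left_mono)
    have iG: "integrable M (\<lambda>\<omega>. c * \<bar>G \<omega>\<bar>)"
      by (intro integrable_mult_right integrable_abs integrable_AE_bound[where c=1]) (use G1 in auto)
    have iGY: "integrable M (\<lambda>\<omega>. G \<omega> * Y \<omega>)"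
      by (rule Bochner_Integration.integrable_bound[OF iG]) (use GY in \<open>auto elim!: eventually_mono intro: order.trans\<close>)
    have "\<bar>expectation (\<lambda>\<omega>. G \<omega> * real_cond_exp M F0 Y \<omega>)\<bar> = \<bar>expectation (\<lambda>\<omega>. G \<omega> * Y \<omega>)\<bar>"
      using real_cond_exp_intg(2)[OF iGY G] by simp
    also have "\<dots> \<le> expectation (\<lambda>\<omega>. \<bar>G \<omega> * Y \<omega>\<bar>)" by simp
    also have "\<dots> \<le> expectation (\<lambda>\<omega>. c * \<bar>G \<omega>\<bar>)" by (rule integral_mono_AE[OF integrable_abs[OF iGY] iG GY])
    finally show "\<bar>expectation (\<lambda>\<omega>. G \<omega> * real_cond_exp M F0 Y \<omega>)\<bar> \<le> c * expectation (\<lambda>\<omega>. \<bar>G \<omega>\<bar>)" by simp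
  qed
qed

text \<open>From an almost sure bound on a conditional expectation to the tested form: a bounded
  \<open>F0\<close>-measurable \<open>G\<close> does not distinguish \<open>Y\<close> from its
  conditional expectation.\<close>

lemma test_cond_exp:
  assumes Y: "Y \<in> borel_measurable M" "AE \<omega> in M. \<bar>Y \<omega>\<bar> \<le> b"
    and G: "G \<in> borel_measurable F0" "AE \<omega> in M. \<bar>G \<omega>\<bar> \<le> c"
    and d: "AE \<omega> in M. \<bar>real_cond_exp M F0 Y \<omega> - v\<bar> \<le> d"
  shows "\<bar>expectation (\<lambda>\<omega>. G \<omega> * (Y \<omega> - v))\<bar> \<le> d * expectation (\<lambda>\<omega>. \<bar>G \<omega>\<bar>)"
proof -
  interpret finite_measure_subalgebra M F0 by unfold_locales (rule sub)
  have [measurable]: "G \<in> borel_measurable M" "Y \<in> borel_measurable M" using G sub measurable_from_subalg Y by blast+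
  have iGY: "integrable M (\<lambda>\<omega>. G \<omega> * Y \<omega>)"
  proof (rule integrable_AE_bound)
    show "AE \<omega> in M. \<bar>G \<omega> * Y \<omega>\<bar> \<le> c * b"
      using Y(2) G(2) by eventually_elim (auto simp: abs_mult intro!: mult_mono intro: order.trans[OF abs_ge_zero])
  qed simp
  have iG: "integrable M G" by (rule integrable_AE_bound[OF _ G(2)]) simp
  define R where "R = real_cond_exp M F0 Y"
  have [measurable]: "R \<in> borel_measurable M" unfolding R_def using borel_measurable_cond_exp2 by simp
  have iGR: "integrable M (\<lambda>\<omega>. G \<omega> * R \<omega>)" unfolding R_def by (rule real_cond_exp_intg(1)[OF iGY G(1)]) simp
  have eq: "expectation (\<lambda>\<omega>. G \<omega> * R \<omega>) = expectation (\<lambda>\<omega>. G \<omega> * Y \<omega>)"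
    unfolding R_def by (rule real_cond_exp_intg(2)[OF iGY G(1)]) simp
  have "expectation (\<lambda>\<omega>. G \<omega> * (Y \<omega> - v)) = expectation (\<lambda>\<omega>. G \<omega> * (R \<omega> - v))"
    using iGY iGR iG eq by (simp add: right_diff_distrib)
  also have "\<bar>\<dots>\<bar> \<le> expectation (\<lambda>\<omega>. \<bar>G \<omega> * (R \<omega> - v)\<bar>)" by simp
  also have "\<dots> \<le> expectation (\<lambda>\<omega>. d * \<bar>G \<omega>\<bar>)"
  proof (rule integral_mono_AE)
    show "integrable M (\<lambda>\<omega>. \<bar>G \<omega> * (R \<omega> - v)\<bar>)" using iGR iG by (simp add: right_diff_distrib)
    show "integrable M (\<lambda>\<omega>. d * \<bar>G \<omega>\<bar>)" using iG by simp
    show "AE \<omega> in M. \<bar>G \<omega> * (R \<omega> - v)\<bar> \<le> d * \<bar>G \<omega>\<bar>"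
      using d unfolding R_def by eventually_elim (auto simp: abs_mult mult.commute[of d] intro!: mult_left_mono)
  qed
  finally show ?thesis by simp
qed

lemma AE_le_of_Linf_norm: "AE \<omega> in M. ereal \<bar>f \<omega>\<bar> \<le> Linf_norm M f"
  unfolding Linf_norm_def by (rule esssup_AE)

lemma X_bounded:
  assumes "Linf_norm M X0 < \<infinity>"
  shows "\<exists>B\<ge>1. \<forall>t. AE \<omega> in M. \<bar>Xs (int t) \<omega>\<bar> \<le> B"
proof -
  define B where "B = max 1 (real_of_ereal (Linf_norm M X0))"
  have le: "Linf_norm M X0 \<le> ereal B"
  proof (cases "Linf_norm M X0")
    case (real r)
    then show ?thesis by (simp add: B_def)
  qed (use assms in auto)
  have "AE \<omega> in M. \<bar>X0 \<omega>\<bar> \<le> B"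
    using AE_le_of_Linf_norm[of X0]
  proof eventually_elim
    case (elim \<omega>)
    then have "ereal \<bar>X0 \<omega>\<bar> \<le> ereal B" using le by (rule order.trans)
    then show ?case by simp
  qed
  then have "AE \<omega> in M. \<bar>Xs (int t) \<omega>\<bar> \<le> B" for t
    unfolding Xs_nat by (rule AE_shift)
  then show ?thesis by (intro exI[of _ B]) (simp add: B_def)
qed

text \<open>For the finitely many \<open>l\<close> below the threshold the trivial bound is absorbed into the constant.\<close>

lemma decay_all:
  assumes N: "\<And>l. N \<le> l \<Longrightarrow> AE \<omega> in M. \<bar>f l \<omega>\<bar> \<le> C * real l powr - \<beta>" and b: "\<And>l. AE \<omega> in M. \<bar>f l \<omega>\<bar> \<le> b"
    and \<beta>: "0 < \<beta>'" "\<beta>' \<le> \<beta>" and l: "1 \<le> l" and b0: "0 \<le> b"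
  shows "AE \<omega> in M. \<bar>f l \<omega>\<bar> \<le> (\<bar>C\<bar> + b * real (Suc N) powr \<beta>') * real l powr - \<beta>'"
proof (cases "N \<le> l")
  case True
  have "C * real l powr - \<beta> \<le> \<bar>C\<bar> * real l powr - \<beta>'"
    using l \<beta> by (intro mult_mono powr_mono) auto
  also have "\<dots> \<le> (\<bar>C\<bar> + b * real (Suc N) powr \<beta>') * real l powr - \<beta>'"
    using b0 by (intro mult_right_mono) auto
  finally show ?thesis using N[OF True] by (auto elim!: eventually_mono)
next
  case False
  have "1 \<le> real (Suc N) powr \<beta>' * real l powr - \<beta>'"
  proof -
    have "real l powr \<beta>' \<le> real (Suc N) powr \<beta>'" using False \<beta> by (intro powr_mono2) auto
    then have "real l powr \<beta>' * real l powr - \<beta>' \<le> real (Suc N) powr \<beta>' * real l powr - \<beta>'" by (intro mult_right_mono) auto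
    moreover have "real l powr \<beta>' * real l powr - \<beta>' = 1" using l by (simp add: powr_minus)
    ultimately show ?thesis by simp
  qed
  then have "b * 1 \<le> b * (real (Suc N) powr \<beta>' * real l powr - \<beta>')" using b0 by (rule mult_left_mono)
  also have "\<dots> \<le> (\<bar>C\<bar> + b * real (Suc N) powr \<beta>') * real l powr - \<beta>'" by (simp add: distrib_right)
  finally show ?thesis using b[of l] by (auto elim!: eventually_mono)
qed

text \<open>Stationarity makes the covariance even in the lag, so the two-sided sum is the value at
  lag 0 plus twice the sum over positive lags.\<close>

lemma covariance_series:
  assumes pos: "0 < (\<Sum>\<^sub>\<infinity>k\<in>UNIV. expectation (\<lambda>\<omega>. Xs 0 \<omega> * Xs k \<omega>))"
  defines "f \<equiv> \<lambda>k. expectation (\<lambda>\<omega>. Xs 0 \<omega> * Xs k \<omega>)"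
  shows "(\<lambda>d. f (int (Suc d))) sums ((infsum f UNIV - f 0) / 2)"
proof -
  \<comment> \<open>An unconditional sum that does not exist has the default value 0; positivity
    therefore implies summability.\<close>
  have sm: "f summable_on UNIV" using pos infsum_not_exists[of f UNIV] unfolding f_def by fastforce
  \<comment> \<open>The negative lag is removed by composing the product with the t-th power of
    \<open>T\<close>, which leaves the expectation unchanged.\<close>
  have sym: "f (- int t) = f (int t)" for t
  proof -
    have inj: "inj_on (T ^^ t) (space M)" using pow_bij[of t] by (auto simp: bij_betw_def)
    define S where "S = the_inv_into (space M) T"
    have Tinj: "inj_on T (space M)"
      using aut by (auto simp: automorphism_def bij_betw_def)
    have S1: "S (T \<omega>) = \<omega>" if "\<omega> \<in> space M" for \<omega> unfolding S_def by (rule the_inv_into_f_f[OF Tinj that])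
    have ST: "(S ^^ n) ((T ^^ n) \<omega>) = \<omega>" if "\<omega> \<in> space M" for n \<omega>
    proof (induction n)
      case (Suc n)
      have "(S ^^ Suc n) ((T ^^ Suc n) \<omega>) = (S ^^ n) (S (T ((T ^^ n) \<omega>)))" by (simp add: funpow_swap1)
      also have "\<dots> = (S ^^ n) ((T ^^ n) \<omega>)" using S1[OF pow_space[OF that]] by simp
      finally show ?case using Suc by simp
    qed simp
    have Sm: "S ^^ n \<in> measurable M M" for n
      using aut unfolding automorphism_def S_def by (intro measurable_compose_n) auto
    have it: "iterate M T (- int t) = S ^^ t"
      by (cases "t = 0") (auto simp: iterate_def S_def)
    have Xm: "Xs (- int t) = (\<lambda>\<omega>. X0 ((S ^^ t) \<omega>))" unfolding shifted_var_def it by (simp add: comp_def)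
    have X0e: "Xs 0 = X0" using Xs_nat[of 0] by (auto simp: fun_eq_iff)
    have hm: "(\<lambda>\<omega>. Xs 0 \<omega> * Xs (- int t) \<omega>) \<in> borel_measurable M"
      unfolding Xm X0e using Sm[of t] by measurable
    have "f (- int t) = expectation (\<lambda>\<omega>. Xs 0 ((T ^^ t) \<omega>) * Xs (- int t) ((T ^^ t) \<omega>))"
      unfolding f_def using integral_shift[OF hm, of t] by simp
    also have "\<dots> = expectation (\<lambda>\<omega>. Xs (int t) \<omega> * Xs 0 \<omega>)"
      by (intro Bochner_Integration.integral_cong) (auto simp: Xm X0e ST Xs_nat)
    finally show ?thesis by (simp add: f_def mult.commute)
  qed
  define P where "P = (\<lambda>d. int (Suc d)) ` (UNIV :: nat set)"
  define Q where "Q = (\<lambda>d. - int (Suc d)) ` (UNIV :: nat set)"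
  have inj: "inj (\<lambda>d. int (Suc d))" "inj (\<lambda>d. - int (Suc d))" by (auto simp: inj_on_def)
  have U: "UNIV = insert 0 (P \<union> Q)"
  proof -
    have "k \<in> insert 0 (P \<union> Q)" for k :: int
    proof (cases k rule: int_cases3)
      case (pos n)
      then have "k = int (Suc (n - 1))" by simp
      then show ?thesis unfolding P_def by blast
    next
      case (neg n)
      then have "k = - int (Suc (n - 1))" by simp
      then show ?thesis unfolding Q_def by blast
    qed auto
    then show ?thesis by auto
  qed
  have disj: "P \<inter> Q = {}" "0 \<notin> P \<union> Q" by (auto simp: P_def Q_def)
  define p where "p = infsum f P"
  have hp: "(f has_sum p) P" unfolding p_def using summable_on_subset_banach[OF sm] by (intro has_sum_infsum) auto
  then have hp': "((\<lambda>d. f (int (Suc d))) has_sum p) UNIV" 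
    unfolding P_def by (simp only: has_sum_reindex[OF inj(1)] comp_def)
  have hq: "(f has_sum p) Q"
    unfolding Q_def
  proof (subst has_sum_reindex)
    have "f \<circ> (\<lambda>d. - int (Suc d)) = (\<lambda>d. f (int (Suc d)))" by (rule ext) (simp only: comp_def sym)
    then show "((f \<circ> (\<lambda>d. - int (Suc d))) has_sum p) UNIV" using hp' by simp
  qed (rule inj)
  have "(f has_sum (f 0 + (p + p))) (insert 0 (P \<union> Q))"
    using disj by (intro has_sum_insert has_sum_Un_disjoint hp hq) auto
  then have "infsum f UNIV = f 0 + (p + p)" unfolding U[symmetric] by (rule infsumI)
  then have "(infsum f UNIV - f 0) / 2 = p" by simp
  then show ?thesis using has_sum_imp_sums[OF hp'] by simp
qed

text \<open>The mixing coefficients speak of conditioning at time 0 and of large lags. Stationarity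
  carries them to every time, \<open>decay_all\<close> to every lag from 1 on, and the rate may be
  lowered to any smaller \<open>\<beta>'\<close> in the range of the locale.\<close>

lemma mixing_process_of_eta:
  assumes bdd: "Linf_norm M X0 < \<infinity>"
    and pos: "0 < (\<Sum>\<^sub>\<infinity>k\<in>UNIV. expectation (\<lambda>\<omega>. Xs 0 \<omega> * Xs k \<omega>))"
    and eta: "\<exists>C::real. \<forall>\<^sub>F n in sequentially. max (eta1 M F0 Xs n) (eta2 M F0 Xs n) \<le> ereal (C * real n powr (- \<beta>))"
    and \<beta>': "1 < \<beta>'" "\<beta>' \<le> 3 / 2" "\<beta>' \<le> \<beta>"
  shows "\<exists>K. mixing_process M (\<lambda>t. shifted_field M T F0 (int t)) (\<lambda>t. Xs (int t)) (\<lambda>d. expectation (\<lambda>\<omega>. Xs 0 \<omega> * Xs (int d) \<omega>))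
     K \<beta>' (\<Sum>\<^sub>\<infinity>k\<in>UNIV. expectation (\<lambda>\<omega>. Xs 0 \<omega> * Xs k \<omega>))"
proof -
  obtain B where B: "1 \<le> B" "\<And>t. AE \<omega> in M. \<bar>Xs (int t) \<omega>\<bar> \<le> B" 
    using X_bounded[OF bdd] by blast
  obtain C N where C: "\<And>n. N \<le> n \<Longrightarrow> max (eta1 M F0 Xs n) (eta2 M F0 Xs n) \<le> ereal (C * real n powr (- \<beta>))"
    using eta by (auto simp: eventually_sequentially)
  define \<gamma> where "\<gamma> = (\<lambda>d. expectation (\<lambda>\<omega>. Xs 0 \<omega> * Xs (int d) \<omega>))"
  have cov: "expectation (\<lambda>\<omega>. Xs (int s) \<omega> * Xs (int (s + d)) \<omega>) = \<gamma> d" for s d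
  proof -
    have "expectation (\<lambda>\<omega>. Xs (int s) \<omega> * Xs (int (s + d)) \<omega>) = expectation (\<lambda>\<omega>. Xs (int 0) ((T ^^ s) \<omega>) * Xs (int d) ((T ^^ s) \<omega>))"
      using Xs_shift[of s 0] Xs_shift[of s d] by simp
    also have "\<dots> = expectation (\<lambda>\<omega>. Xs (int 0) \<omega> * Xs (int d) \<omega>)"
      by (rule integral_shift[where h="\<lambda>\<omega>. Xs (int 0) \<omega> * Xs (int d) \<omega>"]) measurable
    finally show ?thesis by (simp add: \<gamma>_def)
  qed
  have XX: "AE \<omega> in M. \<bar>Xs (int i) \<omega> * Xs (int l) \<omega>\<bar> \<le> B * B" for i l
    using B(2)[of i] B(2)[of l] by eventually_elim (use B(1) in \<open>auto simp: abs_mult intro!: mult_mono\<close>)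
  have \<gamma>B: "\<bar>\<gamma> d\<bar> \<le> B * B" for d
  proof -
    have i: "integrable M (\<lambda>\<omega>. Xs (int 0) \<omega> * Xs (int d) \<omega>)" by (rule integrable_AE_bound[OF _ XX]) measurable
    have "\<bar>\<gamma> d\<bar> \<le> expectation (\<lambda>\<omega>. \<bar>Xs (int 0) \<omega> * Xs (int d) \<omega>\<bar>)" unfolding \<gamma>_def by simp
    also have "\<dots> \<le> expectation (\<lambda>\<omega>. B * B)" by (rule integral_mono_AE[OF integrable_abs[OF i] _ XX]) simp
    finally show ?thesis by (simp add: prob_space)
  qed
  define K1 where "K1 = \<bar>C\<bar> + B * real (Suc N) powr \<beta>'"
  define K2 where "K2 = \<bar>C\<bar> + (2 * (B * B)) * real (Suc N) powr \<beta>'"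
  define K where "K = B + K1 + K2"
  have K12: "0 \<le> K1" "0 \<le> K2" using B(1) by (auto simp: K1_def K2_def)
  have cond1: "AE \<omega> in M. \<bar>real_cond_exp M F0 (Xs (int l)) \<omega> - 0\<bar> \<le> K1 * real l powr - \<beta>'" if l: "1 \<le> l" for l
    unfolding K1_def
  proof (rule decay_all[where \<beta>=\<beta> and \<beta>'=\<beta>' and f="\<lambda>l \<omega>. real_cond_exp M F0 (Xs (int l)) \<omega> - 0"])
    show "AE \<omega> in M. \<bar>real_cond_exp M F0 (Xs (int l)) \<omega> - 0\<bar> \<le> B" for l
      using cond_exp_bounded[OF _ B(2)[of l]] by simp
    show "AE \<omega> in M. \<bar>real_cond_exp M F0 (Xs (int l)) \<omega> - 0\<bar> \<le> C * real l powr - \<beta>" if "N \<le> l" for l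
      using AE_le_of_Linf_norm[of "real_cond_exp M F0 (Xs (int l))"]
    proof eventually_elim
      case (elim \<omega>)
      have "Linf_norm M (real_cond_exp M F0 (Xs (int l))) \<le> eta1 M F0 Xs l" unfolding eta1_def by (rule SUP_upper) simp
      also have "\<dots> \<le> ereal (C * real l powr - \<beta>)" using C[OF that] by simp
      finally have "ereal \<bar>real_cond_exp M F0 (Xs (int l)) \<omega>\<bar> \<le> ereal (C * real l powr - \<beta>)" using elim by (rule order.trans[rotated])
      then show ?case by simp
    qed
  qed (use \<beta>' l B(1) in auto)
  have cond2: "AE \<omega> in M. \<bar>real_cond_exp M F0 (\<lambda>\<omega>. Xs (int i) \<omega> * Xs (int (i + d)) \<omega>) \<omega> - \<gamma> d\<bar> \<le> K2 * real i powr - \<beta>'" if i: "1 \<le> i" for i d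
    unfolding K2_def
  proof (rule decay_all[where \<beta>=\<beta> and \<beta>'=\<beta>' and f="\<lambda>i \<omega>. real_cond_exp M F0 (\<lambda>\<omega>. Xs (int i) \<omega> * Xs (int (i + d)) \<omega>) \<omega> - \<gamma> d"])
    show "AE \<omega> in M. \<bar>real_cond_exp M F0 (\<lambda>\<omega>. Xs (int i) \<omega> * Xs (int (i + d)) \<omega>) \<omega> - \<gamma> d\<bar> \<le> 2 * (B * B)" for i
    proof -
      have "AE \<omega> in M. \<bar>real_cond_exp M F0 (\<lambda>\<omega>. Xs (int i) \<omega> * Xs (int (i + d)) \<omega>) \<omega>\<bar> \<le> B * B"
        by (rule cond_exp_bounded[OF _ XX]) measurable
      then show ?thesis
      proof eventually_elim
        case (elim \<omega>)
        then show ?case using \<gamma>B[of d] by linarith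
      qed
    qed
    show "AE \<omega> in M. \<bar>real_cond_exp M F0 (\<lambda>\<omega>. Xs (int i) \<omega> * Xs (int (i + d)) \<omega>) \<omega> - \<gamma> d\<bar> \<le> C * real i powr - \<beta>" if "N \<le> i" for i
      using AE_le_of_Linf_norm[of "\<lambda>\<omega>. real_cond_exp M F0 (\<lambda>\<omega>. Xs (int i) \<omega> * Xs (int (i + d)) \<omega>) \<omega> - \<gamma> d"]
    proof eventually_elim
      case (elim \<omega>)
      have "Linf_norm M (\<lambda>\<omega>. real_cond_exp M F0 (\<lambda>\<omega>. Xs (int i) \<omega> * Xs (int (i + d)) \<omega>) \<omega> - \<gamma> d) \<le> eta2 M F0 Xs i"
        unfolding eta2_def cov[of i d, symmetric]
        by (rule SUP_upper2[of "int i"], simp, rule SUP_upper2[of "int (i + d)"]) auto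
      also have "\<dots> \<le> ereal (C * real i powr - \<beta>)" using C[OF that] by simp
      finally have "ereal \<bar>real_cond_exp M F0 (\<lambda>\<omega>. Xs (int i) \<omega> * Xs (int (i + d)) \<omega>) \<omega> - \<gamma> d\<bar> \<le> ereal (C * real i powr - \<beta>)"
        using elim by (rule order.trans[rotated])
      then show ?case by simp
    qed
  qed (use \<beta>' i B(1) in auto)
  \<comment> \<open>A test function at time \<open>t\<close> is a function of time 0 composed with
    the t-th power of \<open>T\<close>. Invariance of the measure then moves the whole inequality to
    time 0.\<close>
  have transfer: "\<bar>expectation (\<lambda>\<omega>. G \<omega> * (Y ((T ^^ t) \<omega>) - v))\<bar> \<le> D * expectation (\<lambda>\<omega>. \<bar>G \<omega>\<bar>)"
    if Y: "Y \<in> borel_measurable M" "AE \<omega> in M. \<bar>Y \<omega>\<bar> \<le> b" and G: "G \<in> borel_measurable (shifted_field M T F0 (int t))"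
      and Gc: "AE \<omega> in M. \<bar>G \<omega>\<bar> \<le> c" and ce: "AE \<omega> in M. \<bar>real_cond_exp M F0 Y \<omega> - v\<bar> \<le> D" for Y b G t c v D
  proof -
    obtain G' where G': "G' \<in> borel_measurable F0" "\<And>\<omega>. \<omega> \<in> space M \<Longrightarrow> G \<omega> = G' ((T ^^ t) \<omega>)"
      using shifted_factor[OF G] by blast
    have G'M [measurable]: "G' \<in> borel_measurable M" using G'(1) sub measurable_from_subalg by blast
    note Y(1)[measurable]
    have "AE \<omega> in M. \<bar>G' ((T ^^ t) \<omega>)\<bar> \<le> c" using Gc G'(2) by (auto elim!: AE_mp intro!: AE_I2)
    then have "AE \<omega> in distr M M (T ^^ t). \<bar>G' \<omega>\<bar> \<le> c" by (subst AE_distr_iff) auto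
    then have G'c: "AE \<omega> in M. \<bar>G' \<omega>\<bar> \<le> c" unfolding pow_distr .
    have "expectation (\<lambda>\<omega>. G \<omega> * (Y ((T ^^ t) \<omega>) - v)) = expectation (\<lambda>\<omega>. G' ((T ^^ t) \<omega>) * (Y ((T ^^ t) \<omega>) - v))"
      by (intro Bochner_Integration.integral_cong) (auto simp: G'(2))
    also have "\<dots> = expectation (\<lambda>\<omega>. G' \<omega> * (Y \<omega> - v))"
      by (rule integral_shift[where h="\<lambda>\<omega>. G' \<omega> * (Y \<omega> - v)"]) measurable
    finally have 1: "expectation (\<lambda>\<omega>. G \<omega> * (Y ((T ^^ t) \<omega>) - v)) = expectation (\<lambda>\<omega>. G' \<omega> * (Y \<omega> - v))" .
    have "expectation (\<lambda>\<omega>. \<bar>G \<omega>\<bar>) = expectation (\<lambda>\<omega>. \<bar>G' ((T ^^ t) \<omega>)\<bar>)"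
      by (intro Bochner_Integration.integral_cong) (auto simp: G'(2))
    also have "\<dots> = expectation (\<lambda>\<omega>. \<bar>G' \<omega>\<bar>)" by (rule integral_shift[where h="\<lambda>\<omega>. \<bar>G' \<omega>\<bar>"]) measurable
    finally have 2: "expectation (\<lambda>\<omega>. \<bar>G \<omega>\<bar>) = expectation (\<lambda>\<omega>. \<bar>G' \<omega>\<bar>)" .
    show ?thesis unfolding 1 2 by (rule test_cond_exp[OF Y G'(1) G'c ce])
  qed
  have "mixing_process M (\<lambda>t. shifted_field M T F0 (int t)) (\<lambda>t. Xs (int t)) \<gamma> K \<beta>' (\<Sum>\<^sub>\<infinity>k\<in>UNIV. expectation (\<lambda>\<omega>. Xs 0 \<omega> * Xs k \<omega>))"
  proof
    show "subalgebra M (shifted_field M T F0 (int t))" for t by (rule shifted_subalgebra)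
    show "sets (shifted_field M T F0 (int s)) \<subseteq> sets (shifted_field M T F0 (int t))" if "s \<le> t" for s t using that by (rule shifted_mono)
    show "Xs (int t) \<in> borel_measurable (shifted_field M T F0 (int t))" for t by (rule Xs_adapted)
    show "1 \<le> K" using B K12 by (simp add: K_def)
    show "AE \<omega> in M. \<bar>Xs (int t) \<omega>\<bar> \<le> K" for t
      using B(2)[of t] by eventually_elim (use K12 in \<open>auto simp: K_def\<close>)
    show "1 < \<beta>'" "\<beta>' \<le> 3 / 2" by (rule \<beta>')+
    show "\<bar>expectation (\<lambda>\<omega>. G \<omega> * Xs (int (t + l)) \<omega>)\<bar> \<le> K * real l powr - \<beta>' * expectation (\<lambda>\<omega>. \<bar>G \<omega>\<bar>)"
      if "1 \<le> l" "G \<in> borel_measurable (shifted_field M T F0 (int t))" "AE \<omega> in M. \<bar>G \<omega>\<bar> \<le> c" for t l G c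
    proof -
      have "\<bar>expectation (\<lambda>\<omega>. G \<omega> * (Xs (int l) ((T ^^ t) \<omega>) - 0))\<bar> \<le> K1 * real l powr - \<beta>' * expectation (\<lambda>\<omega>. \<bar>G \<omega>\<bar>)"
        by (rule transfer[OF _ B(2) that(2,3) cond1[OF that(1)]]) measurable
      also have "\<dots> \<le> K * real l powr - \<beta>' * expectation (\<lambda>\<omega>. \<bar>G \<omega>\<bar>)"
        using K12 B(1) by (intro mult_right_mono) (auto simp: K_def)
      finally show ?thesis unfolding Xs_shift by simp
    qed
    show "\<bar>expectation (\<lambda>\<omega>. G \<omega> * (Xs (int (t + i)) \<omega> * Xs (int (t + l)) \<omega> - \<gamma> (l - i)))\<bar> \<le> K * real i powr - \<beta>' * expectation (\<lambda>\<omega>. \<bar>G \<omega>\<bar>)"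
      if "1 \<le> i" "i \<le> l" "G \<in> borel_measurable (shifted_field M T F0 (int t))" "AE \<omega> in M. \<bar>G \<omega>\<bar> \<le> c" for t i l G c
    proof -
      have l: "i + (l - i) = l" using that by simp
      have "\<bar>expectation (\<lambda>\<omega>. G \<omega> * ((\<lambda>\<omega>. Xs (int i) \<omega> * Xs (int l) \<omega>) ((T ^^ t) \<omega>) - \<gamma> (l - i)))\<bar>
         \<le> K2 * real i powr - \<beta>' * expectation (\<lambda>\<omega>. \<bar>G \<omega>\<bar>)"
        by (rule transfer[OF _ XX that(3,4) cond2[OF that(1), of "l - i", unfolded l]]) measurable
      also have "\<dots> \<le> K * real i powr - \<beta>' * expectation (\<lambda>\<omega>. \<bar>G \<omega>\<bar>)"
        using K12 B(1) by (intro mult_right_mono) (auto simp: K_def)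
      finally show ?thesis unfolding Xs_shift by simp
    qed
    show "expectation (\<lambda>\<omega>. Xs (int s) \<omega> * Xs (int (s + d)) \<omega>) = \<gamma> d" for s d by (rule cov)
    show "(\<lambda>d. \<gamma> (Suc d)) sums (((\<Sum>\<^sub>\<infinity>k\<in>UNIV. expectation (\<lambda>\<omega>. Xs 0 \<omega> * Xs k \<omega>)) - \<gamma> 0) / 2)"
      using covariance_series[OF pos] by (simp add: \<gamma>_def)
    show "0 < (\<Sum>\<^sub>\<infinity>k\<in>UNIV. expectation (\<lambda>\<omega>. Xs 0 \<omega> * Xs k \<omega>))" by (rule pos)
  qed
  then show ?thesis unfolding \<gamma>_def by blast
qed

end

context mixing_process
begin

text \<open>Blocks are numbered from 1 in the statement and from 0 for the martingale; the variables
  keep their indices.\<close>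

lemma self_norm_sum_eq:
  assumes Y: "\<And>t. Y (int t) = X t"
  shows "self_norm_sum Y m n = W m (n div m)"
proof
  fix \<omega>
  have bs: "block_sum Y m (Suc j) \<omega> = block_part (m * j) m \<omega>" for j
    unfolding block_sum_def block_def block_part_def Y
    using sum.shift_bounds_cl_nat_ivl[of "\<lambda>i. X i \<omega>" 1 "m * j" m] by (simp add: add.commute)
  have re: "(\<Sum>j=1..k. g j) = (\<Sum>j<k. g (Suc j))" for g :: "nat \<Rightarrow> real" and k
    using sum.shift_bounds_Suc_ivl[of g 0 k] by (simp add: atLeastLessThanSuc_atLeastAtMost lessThan_atLeast0)
  show "self_norm_sum Y m n \<omega> = W m (n div m) \<omega>"
    unfolding self_norm_sum_def block_norm_def W_def Vsq_def S_blocks re bs by (simp add: mult.commute)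
qed

end

theorem proposition3p1:
  fixes M F0 :: "'a measure" and T :: "'a \<Rightarrow> 'a" and X0 :: "'a \<Rightarrow> real"
    and X :: "int \<Rightarrow> 'a \<Rightarrow> real" and \<beta> :: real
  assumes "prob_space M"
    and "automorphism M T"
    and "subalgebra M F0"
    and "sets F0 \<subseteq> sets (shifted_field M T F0 1)"
    and "X0 \<in> borel_measurable F0"
    and "(\<integral>\<omega>. X0 \<omega> \<partial>M) = 0"
    and X_def: "X = shifted_var M T X0"
    and "Linf_norm M X0 < \<infinity>"
    and "(\<Sum>\<^sub>\<infinity>k\<in>UNIV. \<integral>\<omega>. X 0 \<omega> * X k \<omega> \<partial>M) > 0"
    and "\<beta> > 1"
    and "\<exists>C::real. \<forall>\<^sub>F n in sequentially.
           max (eta1 M F0 X n) (eta2 M F0 X n) \<le> ereal (C * real n powr (- \<beta>))"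
  shows
    "(\<beta> \<ge> 3/2 \<longrightarrow>
        normal_tail_uniformly M
          (\<lambda>n. self_norm_sum X (nat \<lfloor>real n powr (2/7)\<rfloor>) n)
          (\<lambda>n. real n powr (1/14) / sqrt (ln (real n)))) \<and>
     (\<beta> < 3/2 \<longrightarrow>
        normal_tail_uniformly M
          (\<lambda>n. self_norm_sum X (nat \<lfloor>real n powr (1 / (3 * \<beta> - 1))\<rfloor>) n)
          (\<lambda>n. real n powr ((\<beta> - 1) / (6 * \<beta> - 2)))) \<and>
     (\<forall>(m :: nat \<Rightarrow> nat) (a :: nat \<Rightarrow> real) (B :: real set).
        (\<forall>n\<ge>1. 1 \<le> m n \<and> m n \<le> n) \<longrightarrow>
        filterlim m at_top sequentially \<longrightarrow>
        filterlim (\<lambda>n. sqrt (real n) / real (m n)) at_top sequentially \<longrightarrow>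
        a \<longlonglongrightarrow> 0 \<longrightarrow>
        filterlim (\<lambda>n. a n * sqrt (real n) / real (m n)) at_top sequentially \<longrightarrow>
        B \<in> sets borel \<longrightarrow>
        (let L = (\<lambda>n. ereal ((a n)\<^sup>2) *
                   ext_ln (\<P>(\<omega> in M. a n * self_norm_sum X (m n) n \<omega> \<in> B)))
         in - (INF x\<in>interior B. ereal (x\<^sup>2 / 2)) \<le> liminf L \<and>
            liminf L \<le> limsup L \<and>
            limsup L \<le> - (INF x\<in>closure B. ereal (x\<^sup>2 / 2))))"
proof -
  interpret adapted_stationary M F0 T X0
    using assms(1-5) by (simp add: adapted_stationary_def adapted_stationary_axioms_def)
  \<comment> \<open>Lowering the rate to at most 3/2 reduces the first statement to the second one
    at the boundary: there the exponents of the block length and of the range are 2/7 and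
    1/14.\<close>
  define \<beta>' where "\<beta>' = min \<beta> (3 / 2)"
  define \<sigma>2 where "\<sigma>2 = (\<Sum>\<^sub>\<infinity>k\<in>UNIV. expectation (\<lambda>\<omega>. X 0 \<omega> * X k \<omega>))"
  have "\<exists>K. mixing_process M (\<lambda>t. shifted_field M T F0 (int t)) (\<lambda>t. X (int t))
      (\<lambda>d. expectation (\<lambda>\<omega>. X 0 \<omega> * X (int d) \<omega>)) K \<beta>' \<sigma>2"
    unfolding \<sigma>2_def X_def
  proof (rule mixing_process_of_eta)
    show "1 < \<beta>'" "\<beta>' \<le> 3 / 2" "\<beta>' \<le> \<beta>" using \<open>\<beta> > 1\<close> by (auto simp: \<beta>'_def)
  qed (use assms in \<open>simp_all only: X_def\<close>)
  then obtain K where "mixing_process M (\<lambda>t. shifted_field M T F0 (int t)) (\<lambda>t. X (int t))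
      (\<lambda>d. expectation (\<lambda>\<omega>. X 0 \<omega> * X (int d) \<omega>)) K \<beta>' \<sigma>2" ..
  then interpret P: mixing_process M "\<lambda>t. shifted_field M T F0 (int t)" "\<lambda>t. X (int t)"
      "\<lambda>d. expectation (\<lambda>\<omega>. X 0 \<omega> * X (int d) \<omega>)" K \<beta>' \<sigma>2 .
  have W: "self_norm_sum X m n = P.W m (n div m)" for m n by (rule P.self_norm_sum_eq) simp
  have md: "normal_tail_uniformly M (\<lambda>n. self_norm_sum X (nat \<lfloor>real n powr (1 / (3 * \<beta>' - 1))\<rfloor>) n)
      (\<lambda>n. real n powr ((\<beta>' - 1) / (6 * \<beta>' - 2)))"
    unfolding normal_tail_uniformly_def W using P.moderate_deviations by (simp add: normal_tail_def)
  have i: "normal_tail_uniformly M (\<lambda>n. self_norm_sum X (nat \<lfloor>real n powr (2/7)\<rfloor>) n)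
      (\<lambda>n. real n powr (1/14) / sqrt (ln (real n)))" if "\<beta> \<ge> 3/2"
  proof -
    have eq: "\<beta>' = 3 / 2" using that by (simp add: \<beta>'_def)
    have "1 / (3 * \<beta>' - 1) = 2/7" "(\<beta>' - 1) / (6 * \<beta>' - 2) = 1/14" by (simp_all add: eq)
    note md' = md[unfolded this]
    \<comment> \<open>For \<open>n \<ge> 3\<close> the logarithm is at least 1, so the range with
      the logarithm lies inside the range o(n^(1/14)) already obtained.\<close>
    have "(\<lambda>n. real n powr (1/14) / sqrt (ln (real n))) \<in> O(\<lambda>n. real n powr (1/14))"
    proof (rule bigoI[where c=1])
      show "\<forall>\<^sub>F n in sequentially. norm (real n powr (1/14) / sqrt (ln (real n))) \<le> 1 * norm (real n powr (1/14))"
        using eventually_ge_at_top[of 3]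
      proof eventually_elim
        case (elim n)
        have "exp 1 \<le> real n" using elim exp_le by linarith
        then have "1 \<le> ln (real n)" using elim ln_ge_iff[of "real n" 1] by simp
        then have "1 \<le> sqrt (ln (real n))" by simp
        then show ?case by (simp add: divide_le_eq mult_le_cancel_left1)
      qed
    qed
    then have "xs \<in> o(\<lambda>n. real n powr (1/14))" if "xs \<in> o(\<lambda>n. real n powr (1/14) / sqrt (ln (real n)))" for xs
      using that by (rule landau_o.small_big_trans[rotated])
    then show ?thesis using md' unfolding normal_tail_uniformly_def by blast
  qed
  have ii: "normal_tail_uniformly M (\<lambda>n. self_norm_sum X (nat \<lfloor>real n powr (1 / (3 * \<beta> - 1))\<rfloor>) n)
      (\<lambda>n. real n powr ((\<beta> - 1) / (6 * \<beta> - 2)))" if "\<beta> < 3/2"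
  proof -
    have "\<beta>' = \<beta>" using that by (simp add: \<beta>'_def)
    then show ?thesis using md by simp
  qed
  have iii: "let L = (\<lambda>n. ereal ((a n)\<^sup>2) * ext_ln (\<P>(\<omega> in M. a n * self_norm_sum X (m n) n \<omega> \<in> B)))
      in - (INF x\<in>interior B. ereal (x\<^sup>2 / 2)) \<le> liminf L \<and> liminf L \<le> limsup L \<and>
         limsup L \<le> - (INF x\<in>closure B. ereal (x\<^sup>2 / 2))"
    if "\<forall>n\<ge>1. 1 \<le> m n \<and> m n \<le> n" "filterlim m at_top sequentially" "a \<longlonglongrightarrow> 0"
      "filterlim (\<lambda>n. a n * sqrt (real n) / real (m n)) at_top sequentially" "B \<in> sets borel"
    for m :: "nat \<Rightarrow> nat" and a :: "nat \<Rightarrow> real" and B :: "real set"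
  proof -
    have mn: "1 \<le> m n \<and> m n \<le> n" if "1 \<le> n" for n using \<open>\<forall>n\<ge>1. _ n\<close> that by blast
    show ?thesis unfolding Let_def W
      using P.mdp_W_set[OF mn that(2-5)] by (intro conjI Liminf_le_Limsup) auto
  qed
  show ?thesis
    by (intro conjI[OF _ conjI] impI allI; (rule i ii iii; assumption)?)
qed

end
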